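(* The sequence $\mathcal{IA}$ of integrated algebraic power series is a convergent Analysis system, and $\mathcal{IA}_n\subset\mathcal{S}_n$ for all $n$ whenever $\mathcal{S}$ is a convergent Analysis system with $\mathcal{A}_n\subset\mathcal{S}_n$ for all $n$. That is, $\mathcal{IA}$ is the smallest convergent Analysis system containing $\mathcal{A}$.
   Context: For $n\ge0$ let $\mathcal{O}_n$ be the ring of real power series in $X=(X_1,\dots,X_n)$ converging near $0$ ($\mathcal{O}_0=\mathbb{R}$), identified with a subring of $\mathcal{O}_{n+1}$. For $f=\sum_\alpha a_\alpha X^\alpha\in\mathcal{O}_n$ let $\mathcal{D}(f)$ be the union of all boxes $\prod_i]-R_i,R_i[$ ($R_i\in(0,\infty]$) on which $f$ converges absolutely; for $a\in\mathcal{D}(f)$, $f_a$ is the expansion at $0$ of $x\mapsto f(a+x)$; $\int f\,dX_n:=\sum_\alpha\frac{a_\alpha}{\alpha_n+1}X^{\alpha+e_n}$; for a subfield $k\subset\mathbb{R}$, $k\{X\}$ is the set of elements of $\mathcal{O}_n$ with coefficients in $k$. A system is a sequence $\mathcal{S}=(\mathcal{S}_n)_{n\ge0}$, $\mathcal{S}_n\subset\mathcal{O}_n$, such that each $\mathcal{S}_n$ is a subring of $\mathcal{O}_n$, $\mathcal{S}_n=\mathcal{S}_{n+1}\cap\mathcal{O}_n$, $\mathcal{S}_n$ is closed under permuting variables, $k:=\mathcal{S}_0$ is a subfield of $\mathbb{R}$, and $k[X]\subset\mathcal{S}_n\subset k\{X\}$ for $n\ge1$. It is convergent if $f_a\in\mathcal{S}_n$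 for all $f\in\mathcal{S}_n$, $a\in\mathcal{D}(f)\cap k^n$. A convergent system is a convergent Analysis system if for all $n\ge1$, $f\in\mathcal{S}_n$: $1/f\in\mathcal{S}_n$ if $f(0)\ne0$; $f(X_1,\dots,X_{n-1},0)\in\mathcal{S}_{n-1}$; $\partial f/\partial X_n\in\mathcal{S}_n$; $\mathrm{Re}\,f_{\mathbb{C}},\mathrm{Im}\,f_{\mathbb{C}}\in\mathcal{S}_{2n}$, these being the power series at $0\in\mathbb{R}^{2n}$ of $(x_1,y_1,\dots,x_n,y_n)\mapsto\mathrm{Re}$ resp. $\mathrm{Im}$ of $\sum_\alpha a_\alpha(x+iy)^\alpha$; and $\int f\,dX_n\in\mathcal{S}_n$. Let $\mathcal{A}_n$ be the series in $\mathcal{O}_n$ algebraic over $\mathbb{Q}[X]$. $\mathcal{IA}=(\mathcal{IA}_n)_n$ is the smallest sequence with $\mathcal{IA}_n\subset\mathcal{O}_n$ such that: $\mathcal{IA}_n$ is a subring; $\mathcal{IA}_n=\mathcal{IA}_{n+1}\cap\mathcal{O}_n$; closed under permuting variables; $\mathcal{A}_n\subset\mathcal{IA}_n$; and for $f\in\mathcal{IA}_n$: $1/f\in\mathcal{IA}_n$ if $f(0)\ne0$; $f(h(X))\in\mathcal{IA}_n$ for $h\in\mathbb{Q}[X]^n$ with $h(0)=0$; $f_a\in\mathcal{IA}_n$ for $a\in\mathcal{D}(f)\cap\mathbb{Q}^n$; $\int f\,dX_n\in\mathcal{IA}_n$. *)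

theory Defs
  imports
    "HOL-Analysis.Infinite_Sum"
    "HOL-Library.Poly_Mapping"
    "HOL-Library.Extended_Real"
    "HOL-Combinatorics.Permutations"
    "HOL-Computational_Algebra.Polynomial"
begin

section \<open>Formal power series in the variables indexed by the natural numbers\<close>

text \<open>
  All rings of power series live in one type: real formal power series in variables indexed by
  \<open>nat\<close>, a multi-index being a finitely supported function. The variable \<open>X\<^sub>i\<close> of the
  mathematical text has index \<open>i - 1\<close>, so a series in \<open>n\<close> variables only involves the indices
  below \<open>n\<close>, and the inclusion of the series in \<open>n\<close> variables into those in \<open>n + 1\<close> variables
  is literally an inclusion of sets.
\<close>

datatype mps = MPS (mcoeff: "(nat \<Rightarrow>\<^sub>0 nat) \<Rightarrow> real")

lemma mps_eqI: "(\<And>\<alpha>. mcoeff f \<alpha> = mcoeff g \<alpha>) \<Longrightarrow> f = g"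
  by (cases f; cases g) auto

definition splits :: "(nat \<Rightarrow>\<^sub>0 nat) \<Rightarrow> ((nat \<Rightarrow>\<^sub>0 nat) \<times> (nat \<Rightarrow>\<^sub>0 nat)) set" where
  "splits \<gamma> = {(\<alpha>, \<beta>). \<alpha> + \<beta> = \<gamma>}"

lemma finite_splits [simp, intro]: "finite (splits \<gamma>)"
proof -
  let ?F = "{u. \<forall>i. (i \<in> Poly_Mapping.keys \<gamma> \<longrightarrow> u i \<in> (\<Union>j\<in>Poly_Mapping.keys \<gamma>. {..Poly_Mapping.lookup \<gamma> j}))
                 \<and> (i \<notin> Poly_Mapping.keys \<gamma> \<longrightarrow> u i = (0::nat))}"
  have F: "finite ?F"
    by (rule finite_set_of_finite_funs) auto
  have "fst ` splits \<gamma> \<subseteq> Poly_Mapping.lookup -` ?F"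
  proof
    fix \<alpha> assume "\<alpha> \<in> fst ` splits \<gamma>"
    then obtain \<beta> where \<beta>: "\<gamma> = \<alpha> + \<beta>" by (auto simp: splits_def)
    have le: "Poly_Mapping.lookup \<alpha> i \<le> Poly_Mapping.lookup \<gamma> i" for i
      by (simp add: \<beta> lookup_add)
    moreover have "Poly_Mapping.lookup \<alpha> i = 0" if "i \<notin> Poly_Mapping.keys \<gamma>" for i
      using le[of i] that by (simp add: in_keys_iff)
    ultimately show "\<alpha> \<in> Poly_Mapping.lookup -` ?F" by auto
  qed
  moreover have "finite (Poly_Mapping.lookup -` ?F)"
    by (rule finite_vimageI[OF F]) (simp add: inj_on_def lookup_inject)
  ultimately have "finite (fst ` splits \<gamma>)"
    by (rule finite_subset)
  moreover have "inj_on fst (splits \<gamma>)"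
    by (auto simp: inj_on_def splits_def)
  ultimately show ?thesis
    by (rule finite_imageD)
qed

instantiation mps :: comm_ring_1
begin

definition "0 = MPS (\<lambda>_. 0)"
definition "1 = MPS (\<lambda>\<alpha>. if \<alpha> = 0 then 1 else 0)"
definition "f + g = MPS (\<lambda>\<alpha>. mcoeff f \<alpha> + mcoeff g \<alpha>)"
definition "f - g = MPS (\<lambda>\<alpha>. mcoeff f \<alpha> - mcoeff g \<alpha>)"
definition "- f = MPS (\<lambda>\<alpha>. - mcoeff f \<alpha>)"
definition "f * g = MPS (\<lambda>\<gamma>. \<Sum>(\<alpha>, \<beta>)\<in>splits \<gamma>. mcoeff f \<alpha> * mcoeff g \<beta>)"

instance
proof
  fix f g h :: mps
  note defs = zero_mps_def one_mps_def plus_mps_def minus_mps_def uminus_mps_def times_mps_def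
  show "f * g * h = f * (g * h)"
  proof (rule mps_eqI)
    fix \<gamma>
    have "mcoeff (f * g * h) \<gamma> =
        (\<Sum>p\<in>splits \<gamma>. \<Sum>q\<in>splits (fst p). mcoeff f (fst q) * mcoeff g (snd q) * mcoeff h (snd p))"
      by (simp add: defs sum_distrib_right case_prod_beta)
    also have "\<dots> = (\<Sum>(p, q)\<in>(SIGMA p:splits \<gamma>. splits (fst p)).
        mcoeff f (fst q) * mcoeff g (snd q) * mcoeff h (snd p))"
      by (rule sum.Sigma) auto
    also have "\<dots> = (\<Sum>(p, q)\<in>(SIGMA p:splits \<gamma>. splits (snd p)).
        mcoeff f (fst p) * (mcoeff g (fst q) * mcoeff h (snd q)))"
      by (rule sum.reindex_bij_witness[where
            i = "\<lambda>(p, q). ((fst p + fst q, snd q), (fst p, fst q))" and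
            j = "\<lambda>(p, q). ((fst q, snd q + snd p), (snd q, snd p))"])
        (auto simp: splits_def add.assoc)
    also have "\<dots> = (\<Sum>p\<in>splits \<gamma>. \<Sum>q\<in>splits (snd p).
        mcoeff f (fst p) * (mcoeff g (fst q) * mcoeff h (snd q)))"
      by (rule sum.Sigma[symmetric]) auto
    also have "\<dots> = mcoeff (f * (g * h)) \<gamma>"
      by (simp add: defs sum_distrib_left case_prod_beta)
    finally show "mcoeff (f * g * h) \<gamma> = mcoeff (f * (g * h)) \<gamma>" .
  qed
  show "f * g = g * f"
  proof (rule mps_eqI)
    fix \<gamma>
    show "mcoeff (f * g) \<gamma> = mcoeff (g * f) \<gamma>"
      unfolding defs mps.sel
      by (rule sum.reindex_bij_witness[where i = prod.swap and j = prod.swap])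
        (auto simp: splits_def add.commute)
  qed
  show "1 * f = f"
  proof (rule mps_eqI)
    fix \<gamma>
    have "mcoeff (1 * f) \<gamma> = (\<Sum>p\<in>splits \<gamma>. if p = (0, \<gamma>) then mcoeff f \<gamma> else 0)"
      unfolding defs mps.sel by (rule sum.cong) (auto simp: splits_def split: if_splits)
    also have "\<dots> = mcoeff f \<gamma>"
      by (simp add: sum.delta) (simp add: splits_def)
    finally show "mcoeff (1 * f) \<gamma> = mcoeff f \<gamma>" .
  qed
  show "(f + g) * h = f * h + g * h"
    by (rule mps_eqI) (simp add: defs case_prod_beta distrib_right sum.distrib)
  show "(0::mps) \<noteq> 1"
    by (auto simp: defs fun_eq_iff)
qed (auto simp: zero_mps_def plus_mps_def minus_mps_def uminus_mps_def intro: mps_eqI)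

end

text \<open>Evaluation is used at real and at complex points.\<close>

definition monom_at :: "(nat \<Rightarrow> 'a::real_normed_field) \<Rightarrow> (nat \<Rightarrow>\<^sub>0 nat) \<Rightarrow> 'a" where
  "monom_at x \<alpha> = (\<Prod>i\<in>Poly_Mapping.keys \<alpha>. x i ^ Poly_Mapping.lookup \<alpha> i)"

definition mps_eval :: "mps \<Rightarrow> (nat \<Rightarrow> 'a::real_normed_field) \<Rightarrow> 'a" where
  "mps_eval f x = (\<Sum>\<^sub>\<infinity>\<alpha>. of_real (mcoeff f \<alpha>) * monom_at x \<alpha>)"

definition abs_conv_at :: "mps \<Rightarrow> (nat \<Rightarrow> real) \<Rightarrow> bool" where
  "abs_conv_at f x \<longleftrightarrow> (\<lambda>\<alpha>. \<bar>mcoeff f \<alpha> * monom_at x \<alpha>\<bar>) summable_on UNIV"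


section \<open>Convergent power series in n variables\<close>

text \<open>Points of n-space are sequences that vanish from index \<open>n\<close> on.\<close>

definition space_n :: "nat \<Rightarrow> (nat \<Rightarrow> real) set" where
  "space_n n = {x. \<forall>i\<ge>n. x i = 0}"

definition vars_below :: "nat \<Rightarrow> mps \<Rightarrow> bool" where
  "vars_below n f \<longleftrightarrow> (\<forall>\<alpha>. mcoeff f \<alpha> \<noteq> 0 \<longrightarrow> Poly_Mapping.keys \<alpha> \<subseteq> {..<n})"

definition conv_series :: "nat \<Rightarrow> mps set" where
  "conv_series n = {f. vars_below n f \<and>
     (\<exists>r>0. \<forall>x\<in>space_n n. (\<forall>i<n. \<bar>x i\<bar> < r) \<longrightarrow> abs_conv_at f x)}"

definition open_box :: "nat \<Rightarrow> (nat \<Rightarrow> ereal) \<Rightarrow> (nat \<Rightarrow> real) set" where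
  "open_box n R = {x \<in> space_n n. \<forall>i<n. ereal \<bar>x i\<bar> < R i}"

definition conv_domain :: "nat \<Rightarrow> mps \<Rightarrow> (nat \<Rightarrow> real) set" where
  "conv_domain n f =
     \<Union>{open_box n R | R. (\<forall>i<n. 0 < R i) \<and> (\<forall>x\<in>open_box n R. abs_conv_at f x)}"

definition represents :: "nat \<Rightarrow> mps \<Rightarrow> ((nat \<Rightarrow> real) \<Rightarrow> real) \<Rightarrow> bool" where
  "represents n g F \<longleftrightarrow> g \<in> conv_series n \<and>
     (\<exists>r>0. \<forall>x\<in>space_n n. (\<forall>i<n. \<bar>x i\<bar> < r) \<longrightarrow> F x = mps_eval g x)"

text \<open>
  The power series at 0 of a function of \<open>n\<close> real variables that is analytic at 0. It is
  unspecified for other functions.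
\<close>

definition expansion :: "nat \<Rightarrow> ((nat \<Rightarrow> real) \<Rightarrow> real) \<Rightarrow> mps" where
  "expansion n F = (THE g. represents n g F)"


section \<open>Operations on power series\<close>

definition mps_translate :: "nat \<Rightarrow> mps \<Rightarrow> (nat \<Rightarrow> real) \<Rightarrow> mps" where
  "mps_translate n f a = expansion n (\<lambda>x. mps_eval f (\<lambda>i. a i + x i))"

text \<open>The coordinates of real \<open>2n\<close>-space are ordered as \<open>x\<^sub>1, y\<^sub>1, \<dots>, x\<^sub>n, y\<^sub>n\<close>.\<close>

definition cpoint :: "(nat \<Rightarrow> real) \<Rightarrow> nat \<Rightarrow> complex" where
  "cpoint w j = Complex (w (2 * j)) (w (2 * j + 1))"

definition mps_Re :: "nat \<Rightarrow> mps \<Rightarrow> mps" where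
  "mps_Re n f = expansion (2 * n) (\<lambda>w. Re (mps_eval f (cpoint w)))"

definition mps_Im :: "nat \<Rightarrow> mps \<Rightarrow> mps" where
  "mps_Im n f = expansion (2 * n) (\<lambda>w. Im (mps_eval f (cpoint w)))"

text \<open>Meaningful if the constant coefficient is nonzero.\<close>

definition mps_inverse :: "mps \<Rightarrow> mps" where
  "mps_inverse f = (THE g. f * g = 1)"

text \<open>Renaming every variable \<open>X\<^sub>i\<close> to \<open>X\<^bsub>\<sigma> i\<^esub>\<close>, for a bijection \<open>\<sigma>\<close>.\<close>

definition mps_permute :: "(nat \<Rightarrow> nat) \<Rightarrow> mps \<Rightarrow> mps" where
  "mps_permute \<sigma> f = MPS (\<lambda>\<alpha>. mcoeff f (Poly_Mapping.map_key \<sigma> \<alpha>))"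

definition mps_set_zero :: "nat \<Rightarrow> mps \<Rightarrow> mps" where
  "mps_set_zero i f = MPS (\<lambda>\<alpha>. if Poly_Mapping.lookup \<alpha> i = 0 then mcoeff f \<alpha> else 0)"

definition mps_deriv :: "nat \<Rightarrow> mps \<Rightarrow> mps" where
  "mps_deriv i f = MPS (\<lambda>\<alpha>.
     real (Poly_Mapping.lookup \<alpha> i + 1) * mcoeff f (\<alpha> + Poly_Mapping.single i 1))"

definition mps_integral :: "nat \<Rightarrow> mps \<Rightarrow> mps" where
  "mps_integral i f = MPS (\<lambda>\<beta>. if Poly_Mapping.lookup \<beta> i = 0 then 0
     else mcoeff f (\<beta> - Poly_Mapping.single i 1) / real (Poly_Mapping.lookup \<beta> i))"

text \<open>
  Formal substitution \<open>f(h)\<close>. If \<open>f\<close> involves only finitely many variables and the series \<open>h i\<close>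
  for these variables have constant coefficient 0, then only finitely many summands are nonzero.
\<close>

definition mps_subst :: "mps \<Rightarrow> (nat \<Rightarrow> mps) \<Rightarrow> mps" where
  "mps_subst f h = MPS (\<lambda>\<beta>. Sum_any (\<lambda>\<alpha>.
     mcoeff f \<alpha> * mcoeff (\<Prod>i\<in>Poly_Mapping.keys \<alpha>. h i ^ Poly_Mapping.lookup \<alpha> i) \<beta>))"


section \<open>Systems\<close>

definition is_subring :: "'a::comm_ring_1 set \<Rightarrow> bool" where
  "is_subring A \<longleftrightarrow> 1 \<in> A \<and> (\<forall>x\<in>A. \<forall>y\<in>A. x - y \<in> A \<and> x * y \<in> A)"

definition is_subfield :: "real set \<Rightarrow> bool" where
  "is_subfield k \<longleftrightarrow> is_subring k \<and> (\<forall>x\<in>k. x \<noteq> 0 \<longrightarrow> inverse x \<in> k)"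

definition polynomials :: "real set \<Rightarrow> nat \<Rightarrow> mps set" where
  "polynomials k n = {f. vars_below n f \<and> finite {\<alpha>. mcoeff f \<alpha> \<noteq> 0} \<and> range (mcoeff f) \<subseteq> k}"

definition series_over :: "real set \<Rightarrow> nat \<Rightarrow> mps set" where
  "series_over k n = {f \<in> conv_series n. range (mcoeff f) \<subseteq> k}"

definition points_over :: "real set \<Rightarrow> nat \<Rightarrow> (nat \<Rightarrow> real) set" where
  "points_over k n = {a \<in> space_n n. \<forall>i<n. a i \<in> k}"

text \<open>\<open>S 0\<close> viewed as a set of reals, through the identification of constant series with numbers.\<close>

definition base_field :: "(nat \<Rightarrow> mps set) \<Rightarrow> real set" where
  "base_field S = (\<lambda>f. mcoeff f 0) ` S 0"

definition perm_closed :: "(nat \<Rightarrow> mps set) \<Rightarrow> bool" where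
  "perm_closed S \<longleftrightarrow> (\<forall>n. \<forall>f\<in>S n. \<forall>\<sigma>. \<sigma> permutes {..<n} \<longrightarrow> mps_permute \<sigma> f \<in> S n)"

definition is_system :: "(nat \<Rightarrow> mps set) \<Rightarrow> bool" where
  "is_system S \<longleftrightarrow>
     (\<forall>n. S n \<subseteq> conv_series n \<and> is_subring (S n)) \<and>
     (\<forall>n. S n = S (n + 1) \<inter> conv_series n) \<and>
     perm_closed S \<and>
     is_subfield (base_field S) \<and>
     (\<forall>n\<ge>1. polynomials (base_field S) n \<subseteq> S n \<and> S n \<subseteq> series_over (base_field S) n)"

definition convergent_system :: "(nat \<Rightarrow> mps set) \<Rightarrow> bool" where
  "convergent_system S \<longleftrightarrow> is_system S \<and>
     (\<forall>n. \<forall>f\<in>S n. \<forall>a\<in>conv_domain n f \<inter> points_over (base_field S) n. mps_translate n f a \<in> S n)"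

definition convergent_analysis_system :: "(nat \<Rightarrow> mps set) \<Rightarrow> bool" where
  "convergent_analysis_system S \<longleftrightarrow> convergent_system S \<and>
     (\<forall>n\<ge>1. \<forall>f\<in>S n.
        (mcoeff f 0 \<noteq> 0 \<longrightarrow> mps_inverse f \<in> S n) \<and>
        mps_set_zero (n - 1) f \<in> S (n - 1) \<and>
        mps_deriv (n - 1) f \<in> S n \<and>
        mps_Re n f \<in> S (2 * n) \<and> mps_Im n f \<in> S (2 * n) \<and>
        mps_integral (n - 1) f \<in> S n)"


section \<open>Algebraic and integrated algebraic power series\<close>

definition algebraic_series :: "nat \<Rightarrow> mps set" where
  "algebraic_series n = {f \<in> conv_series n.
     \<exists>p :: mps poly. p \<noteq> 0 \<and> (\<forall>i. coeff p i \<in> polynomials \<rat> n) \<and> poly p f = 0}"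

definition ia_closed :: "(nat \<Rightarrow> mps set) \<Rightarrow> bool" where
  "ia_closed S \<longleftrightarrow>
     (\<forall>n. S n \<subseteq> conv_series n \<and> is_subring (S n)) \<and>
     (\<forall>n. S n = S (n + 1) \<inter> conv_series n) \<and>
     perm_closed S \<and>
     (\<forall>n. algebraic_series n \<subseteq> S n) \<and>
     (\<forall>n. \<forall>f\<in>S n.
        (mcoeff f 0 \<noteq> 0 \<longrightarrow> mps_inverse f \<in> S n) \<and>
        (\<forall>h. (\<forall>i<n. h i \<in> polynomials \<rat> n \<and> mcoeff (h i) 0 = 0) \<longrightarrow> mps_subst f h \<in> S n) \<and>
        (\<forall>a\<in>conv_domain n f \<inter> points_over \<rat> n. mps_translate n f a \<in> S n) \<and>
        (n \<ge> 1 \<longrightarrow> mps_integral (n - 1) f \<in> S n))"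

text \<open>The smallest sequence with these closure properties, as the intersection of all of them.\<close>

definition IA :: "nat \<Rightarrow> mps set" where
  "IA n = \<Inter>{S n | S. ia_closed S}"

end

theory Submission
  imports Defs "HOL-Complex_Analysis.Complex_Analysis"
begin

text \<open>
  The core is closure under composition, which comes from Cauchy's formula:
  \<open>f(X, g(X))\<close> is \<open>1 / (2 \<pi> i)\<close> times the integral of \<open>f(X, z) / (z - g(X))\<close> over the boundary of a
  small square with rational corners. Cut into half sides, this is a sum of definite integrals whose
  real and imaginary parts are available from \<open>Re f\<close>, \<open>Im f\<close>, inversion, formal integration,
  translation by rational points and setting variables to zero. The kernel \<open>1 / (z - g(X))\<^sup>2\<close> yields
  derivatives in the same way, hence also that the coefficients lie in the base field.
  Composition shows that Analysis systems admit the polynomial substitutions in the definition of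
  \<open>IA\<close>, and that \<open>IA\<close> admits translation by a
  point \<open>a\<close> over the base field: substitute \<open>X + a T\<close>, a polynomial without constant term, and then
  translate \<open>T\<close> by the rational number 1.

  Closure of \<open>IA\<close> under real and imaginary parts follows from minimality. For algebraic series it says
  that the sum of two algebraic elements is algebraic; for integrals one uses that the
  differential form \<open>f dz\<close> is closed.
\<close>

text \<open>The obstacle is that a value at a rational point other than 0 is reached only by
  translating one power series, and the point must lie in a polydisc on which that series converges
  absolutely. An integral along a segment can therefore be formed only if the integrand has a single
  expansion about one end whose radius exceeds the length of the segment; knowing the integrand as a
  germ is not enough. This is why functions are carried along with a polyradius and a bound for a
  weighted l1 norm of their coefficients, a Banach algebra norm that survives sums, products,
  geometric series and composition with explicit radii. The same obstacle dictates the half sides.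
  Let the sides have distance r from 0; the kernel is singular close to 0. The midpoint of a side is
  only r away, so an expansion about it cannot reach the corners, while a corner is sqrt 2 r away
  and an expansion about it reaches beyond both adjacent midpoints. Membership in a system is always
  decided through functions: closure properties produce a germ at 0, an estimate produces a
  convergent series with a known radius, and the identity theorem says that the two agree.\<close>

type_synonym multi_index = "nat \<Rightarrow>\<^sub>0 nat"
abbreviation lookup where "lookup \<equiv> Poly_Mapping.lookup"
abbreviation keys where "keys \<equiv> Poly_Mapping.keys"
abbreviation single where "single \<equiv> Poly_Mapping.single"

section \<open>Monomials and their values\<close>

lemma monom_at_superset:
  assumes "finite A" "keys \<alpha> \<subseteq> A"
  shows "monom_at x \<alpha> = (\<Prod>i\<in>A. x i ^ lookup \<alpha> i)"
  unfolding monom_at_def by (rule prod.mono_neutral_left) (use assms in \<open>auto simp: in_keys_iff\<close>)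

lemma monom_at_0 [simp]: "monom_at x 0 = 1"
  by (simp add: monom_at_def)

lemma monom_at_add: "monom_at x (\<alpha> + \<beta>) = monom_at x \<alpha> * monom_at x \<beta>"
proof -
  let ?A = "keys \<alpha> \<union> keys \<beta>"
  have "keys (\<alpha> + \<beta>) \<subseteq> ?A" by (rule keys_add)
  then show ?thesis
    by (simp add: monom_at_superset[of ?A] lookup_add power_add prod.distrib)
qed

lemma monom_at_single [simp]: "monom_at x (single i j) = x i ^ j"
  by (cases "j = 0") (simp_all add: monom_at_def)

lemma monom_at_cong:
  "(\<And>i. i \<in> keys \<alpha> \<Longrightarrow> x i = y i) \<Longrightarrow> monom_at x \<alpha> = monom_at y \<alpha>"
  by (simp add: monom_at_def)

lemma norm_monom_at: "norm (monom_at x \<alpha>) = monom_at (\<lambda>i. norm (x i)) \<alpha>"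
  by (simp add: monom_at_def prod_norm[symmetric] norm_power)

lemma monom_at_of_real: "monom_at (\<lambda>i. of_real (x i)) \<alpha> = of_real (monom_at x \<alpha>)"
  by (simp add: monom_at_def)

lemma monom_at_nonneg:
  fixes x :: "nat \<Rightarrow> real"
  shows "(\<And>i. i \<in> keys \<alpha> \<Longrightarrow> 0 \<le> x i) \<Longrightarrow> 0 \<le> monom_at x \<alpha>"
  by (auto simp: monom_at_def intro!: prod_nonneg)

lemma monom_at_pos:
  fixes x :: "nat \<Rightarrow> real"
  shows "(\<And>i. i \<in> keys \<alpha> \<Longrightarrow> 0 < x i) \<Longrightarrow> 0 < monom_at x \<alpha>"
  by (auto simp: monom_at_def intro!: prod_pos)

lemma monom_at_mono:
  fixes x y :: "nat \<Rightarrow> real"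
  shows "(\<And>i. i \<in> keys \<alpha> \<Longrightarrow> 0 \<le> x i \<and> x i \<le> y i) \<Longrightarrow> monom_at x \<alpha> \<le> monom_at y \<alpha>"
  by (auto simp: monom_at_def intro!: prod_mono power_mono)

lemma norm_monom_at_le:
  "(\<And>i. i \<in> keys \<alpha> \<Longrightarrow> norm (x i) \<le> \<rho> i) \<Longrightarrow> norm (monom_at x \<alpha>) \<le> monom_at \<rho> \<alpha>"
  by (simp add: norm_monom_at monom_at_mono)

section \<open>Absolutely convergent expansions on polydiscs\<close>

definition supp_below :: "nat \<Rightarrow> (multi_index \<Rightarrow> complex) \<Rightarrow> bool" where
  "supp_below n c \<longleftrightarrow> (\<forall>\<alpha>. c \<alpha> \<noteq> 0 \<longrightarrow> keys \<alpha> \<subseteq> {..<n})"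

text \<open>An l1 norm of coefficients instead of a supremum over the polydisc: it is
  submultiplicative and complete for one fixed \<open>\<rho>\<close>, so that no estimate has to
  give up a part of the radius.\<close>

definition weighted_norm :: "(nat \<Rightarrow> real) \<Rightarrow> (multi_index \<Rightarrow> complex) \<Rightarrow> real" where
  "weighted_norm \<rho> c = (\<Sum>\<^sub>\<infinity>\<alpha>. norm (c \<alpha>) * monom_at \<rho> \<alpha>)"

text \<open>Coordinates of \<open>z\<close> from \<open>n\<close> on are unrestricted, which forces
  \<open>F\<close> to ignore them; independence of further variables needs no separate condition.
  The polydisc is closed, so that the bound of one function can serve exactly as the radius for the
  next one.\<close>

definition has_expansion :: "nat \<Rightarrow> (nat \<Rightarrow> real) \<Rightarrow> (multi_index \<Rightarrow> complex) \<Rightarrow>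
    ((nat \<Rightarrow> complex) \<Rightarrow> complex) \<Rightarrow> bool" where
  "has_expansion n \<rho> c F \<longleftrightarrow> supp_below n c \<and> (\<lambda>\<alpha>. norm (c \<alpha>) * monom_at \<rho> \<alpha>) summable_on UNIV \<and>
     (\<forall>z. (\<forall>i<n. norm (z i) \<le> \<rho> i) \<longrightarrow> ((\<lambda>\<alpha>. c \<alpha> * monom_at z \<alpha>) has_sum F z) UNIV)"

text \<open>Keeps the radius and the bound and forgets the coefficients, so that estimates for
  composite functions are assembled by introduction rules.\<close>

definition exp_bounded :: "nat \<Rightarrow> (nat \<Rightarrow> real) \<Rightarrow> real \<Rightarrow> ((nat \<Rightarrow> complex) \<Rightarrow> complex) \<Rightarrow> bool" where
  "exp_bounded n \<rho> M F \<longleftrightarrow> (\<exists>c. has_expansion n \<rho> c F \<and> weighted_norm \<rho> c \<le> M)"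

lemma supp_belowD: "supp_below n c \<Longrightarrow> c \<alpha> \<noteq> 0 \<Longrightarrow> i \<in> keys \<alpha> \<Longrightarrow> i < n"
  by (auto simp: supp_below_def)

lemma term_norm_le:
  assumes "supp_below n c" "\<forall>i<n. norm (z i) \<le> \<rho> i"
  shows "norm (c \<alpha> * monom_at z \<alpha>) \<le> norm (c \<alpha>) * monom_at \<rho> \<alpha>"
proof (cases "c \<alpha> = 0")
  case False
  then show ?thesis using assms supp_belowD[OF assms(1) False]
    by (auto simp: norm_mult intro!: mult_left_mono norm_monom_at_le)
qed auto

lemma expansion_summable:
  assumes "supp_below n c" "(\<lambda>\<alpha>. norm (c \<alpha>) * monom_at \<rho> \<alpha>) summable_on UNIV"
    "\<forall>i<n. norm (z i) \<le> \<rho> i"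
  shows "(\<lambda>\<alpha>. norm (c \<alpha> * monom_at z \<alpha>)) summable_on UNIV"
  by (rule Infinite_Sum.abs_summable_on_comparison_test'[OF assms(2)]) (use term_norm_le assms in blast)

lemma has_expI:
  assumes "supp_below n c" "(\<lambda>\<alpha>. norm (c \<alpha>) * monom_at \<rho> \<alpha>) summable_on UNIV"
    and "\<And>z. \<forall>i<n. norm (z i) \<le> \<rho> i \<Longrightarrow> F z = (\<Sum>\<^sub>\<infinity>\<alpha>. c \<alpha> * monom_at z \<alpha>)"
  shows "has_expansion n \<rho> c F"
  unfolding has_expansion_def
proof (intro conjI allI impI)
  fix z :: "nat \<Rightarrow> complex" assume z: "\<forall>i<n. norm (z i) \<le> \<rho> i"
  show "((\<lambda>\<alpha>. c \<alpha> * monom_at z \<alpha>) has_sum F z) UNIV"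
    unfolding assms(3)[OF z] by (rule has_sum_infsum[OF abs_summable_summable[OF expansion_summable[OF assms(1,2) z]]])
qed (use assms in auto)

lemma has_expansion_infsum: "has_expansion n \<rho> c F \<Longrightarrow> \<forall>i<n. norm (z i) \<le> \<rho> i \<Longrightarrow> F z = (\<Sum>\<^sub>\<infinity>\<alpha>. c \<alpha> * monom_at z \<alpha>)"
  unfolding has_expansion_def by (blast intro: infsumI[symmetric])

lemma wterm_nonneg: "supp_below n c \<Longrightarrow> \<forall>i<n. 0 \<le> \<rho> i \<Longrightarrow> 0 \<le> norm (c \<alpha>) * monom_at \<rho> \<alpha>"
  by (cases "c \<alpha> = 0") (auto intro!: mult_nonneg_nonneg monom_at_nonneg dest: supp_belowD)

lemma weighted_norm_nonneg: "supp_below n c \<Longrightarrow> \<forall>i<n. 0 \<le> \<rho> i \<Longrightarrow> 0 \<le> weighted_norm \<rho> c"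
  unfolding weighted_norm_def by (rule infsum_nonneg) (rule wterm_nonneg)

lemma exp_bounded_nonneg: "exp_bounded n \<rho> M F \<Longrightarrow> \<forall>i<n. 0 \<le> \<rho> i \<Longrightarrow> 0 \<le> M"
  unfolding exp_bounded_def has_expansion_def using weighted_norm_nonneg order_trans by blast

lemma exp_bounded_mono: "exp_bounded n \<rho> M F \<Longrightarrow> M \<le> M' \<Longrightarrow> exp_bounded n \<rho> M' F"
  unfolding exp_bounded_def by force

lemma exp_bounded_cong:
  "exp_bounded n \<rho> M F \<Longrightarrow> (\<And>z. \<forall>i<n. norm (z i) \<le> \<rho> i \<Longrightarrow> F z = G z) \<Longrightarrow> exp_bounded n \<rho> M G"
  unfolding exp_bounded_def has_expansion_def by auto

lemma has_expansion_norm_le: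
  assumes "has_expansion n \<rho> c F" "\<forall>i<n. norm (z i) \<le> \<rho> i"
  shows "norm (F z) \<le> weighted_norm \<rho> c"
  unfolding weighted_norm_def
  by (rule Infinite_Sum.norm_infsum_le[where f = "\<lambda>\<alpha>. c \<alpha> * monom_at z \<alpha>" and X = UNIV
        and g = "\<lambda>\<alpha>. norm (c \<alpha>) * monom_at \<rho> \<alpha>"])
    (use assms term_norm_le in \<open>auto simp: has_expansion_def\<close>)

lemma exp_bounded_norm_le: "exp_bounded n \<rho> M F \<Longrightarrow> \<forall>i<n. norm (z i) \<le> \<rho> i \<Longrightarrow> norm (F z) \<le> M"
  unfolding exp_bounded_def using has_expansion_norm_le by force

lemma exp_bounded_const: "exp_bounded n \<rho> (norm a) (\<lambda>_. a)"
proof -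
  define c :: "multi_index \<Rightarrow> complex" where "c = (\<lambda>\<alpha>. if \<alpha> = 0 then a else 0)"
  have 1: "((\<lambda>\<alpha>. c \<alpha> * monom_at z \<alpha>) has_sum a) UNIV" for z
    by (rule has_sum_finite_neutralI[of "{0}"]) (auto simp: c_def)
  have 2: "((\<lambda>\<alpha>. norm (c \<alpha>) * monom_at \<rho> \<alpha>) has_sum norm a) UNIV"
    by (rule has_sum_finite_neutralI[of "{0}"]) (auto simp: c_def)
  have "has_expansion n \<rho> c (\<lambda>_. a)" unfolding has_expansion_def
    using 1 2 by (auto simp: summable_on_def supp_below_def c_def)
  moreover have "weighted_norm \<rho> c = norm a" unfolding weighted_norm_def using 2 by (rule infsumI)
  ultimately show ?thesis unfolding exp_bounded_def by auto
qed

lemma exp_bounded_var: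
  assumes "i < n"
  shows "exp_bounded n \<rho> (\<rho> i) (\<lambda>z. z i)"
proof -
  define e where "e = single i (1::nat)"
  define c :: "multi_index \<Rightarrow> complex" where "c = (\<lambda>\<alpha>. if \<alpha> = e then 1 else 0)"
  have 1: "((\<lambda>\<alpha>. c \<alpha> * monom_at z \<alpha>) has_sum z i) UNIV" for z
    by (rule has_sum_finite_neutralI[of "{e}"]) (auto simp: c_def e_def)
  have 2: "((\<lambda>\<alpha>. norm (c \<alpha>) * monom_at \<rho> \<alpha>) has_sum \<rho> i) UNIV"
    by (rule has_sum_finite_neutralI[of "{e}"]) (auto simp: c_def e_def)
  have "has_expansion n \<rho> c (\<lambda>z. z i)" unfolding has_expansion_def
    using 1 2 assms by (auto simp: summable_on_def supp_below_def c_def e_def split: if_splits)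
  moreover have "weighted_norm \<rho> c = \<rho> i" unfolding weighted_norm_def using 2 by (rule infsumI)
  ultimately show ?thesis unfolding exp_bounded_def by auto
qed

lemma exp_bounded_shrink:
  assumes "exp_bounded n \<rho> M F" "\<forall>i<n. 0 \<le> \<rho>' i \<and> \<rho>' i \<le> \<rho> i"
  shows "exp_bounded n \<rho>' M F"
proof -
  obtain c where c: "has_expansion n \<rho> c F" "weighted_norm \<rho> c \<le> M" using assms(1) by (auto simp: exp_bounded_def)
  have sb: "supp_below n c" using c by (simp add: has_expansion_def)
  have S: "(\<lambda>\<alpha>. norm (c \<alpha>) * monom_at \<rho> \<alpha>) summable_on UNIV" using c by (simp add: has_expansion_def)
  have le: "norm (c \<alpha>) * monom_at \<rho>' \<alpha> \<le> norm (c \<alpha>) * monom_at \<rho> \<alpha>" for \<alpha>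
    using supp_belowD[OF sb] assms(2)
    by (cases "c \<alpha> = 0") (auto intro!: mult_left_mono monom_at_mono)
  have S': "(\<lambda>\<alpha>. norm (c \<alpha>) * monom_at \<rho>' \<alpha>) summable_on UNIV"
    by (rule summable_on_comparison_test[OF S le]) (use wterm_nonneg[OF sb] assms(2) in auto)
  have "weighted_norm \<rho>' c \<le> weighted_norm \<rho> c"
    unfolding weighted_norm_def by (rule infsum_mono[OF S' S le])
  moreover have "has_expansion n \<rho>' c F" unfolding has_expansion_def
  proof (intro conjI allI impI sb S')
    fix z :: "nat \<Rightarrow> complex" assume "\<forall>i<n. norm (z i) \<le> \<rho>' i"
    then have "\<forall>i<n. norm (z i) \<le> \<rho> i" using assms(2) by (meson order_trans)
    then show "((\<lambda>\<alpha>. c \<alpha> * monom_at z \<alpha>) has_sum F z) UNIV" using c(1) by (simp add: has_expansion_def)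
  qed
  ultimately show ?thesis using c unfolding exp_bounded_def by auto
qed

lemma splits_Sigma_bij: "bij_betw (\<lambda>(\<alpha>, \<beta>). (\<alpha> + \<beta>, (\<alpha>, \<beta>))) UNIV (SIGMA \<gamma>:UNIV. splits \<gamma>)"
  by (rule bij_betwI[where g = snd]) (auto simp: splits_def)

text \<open>An unconditional sum over pairs may be regrouped by the value of the sum of the pair;
  every group is finite. This is the Cauchy product before the terms are named.\<close>

lemma has_sum_splits:
  fixes f :: "multi_index \<times> multi_index \<Rightarrow> 'a::banach"
  assumes "(f has_sum s) UNIV"
  shows "((\<lambda>\<gamma>. \<Sum>p\<in>splits \<gamma>. f p) has_sum s) UNIV"
proof -
  have "((\<lambda>(\<gamma>, p). f p) has_sum s) (SIGMA \<gamma>:UNIV. splits \<gamma>)"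
    using assms has_sum_reindex_bij_betw[OF splits_Sigma_bij, of "\<lambda>(\<gamma>, p). f p" s]
    by (simp add: case_prod_unfold)
  then show ?thesis
    by (rule has_sum_SigmaD) (auto simp: has_sum_finite_iff)
qed

lemma has_sum_times:
  fixes f :: "'i \<Rightarrow> 'a::{real_normed_field,banach}" and g :: "'j \<Rightarrow> 'a"
  assumes "(\<lambda>x. norm (f x)) summable_on UNIV" "(\<lambda>x. norm (g x)) summable_on UNIV"
  shows "((\<lambda>(x, y). f x * g y) has_sum (infsum f UNIV * infsum g UNIV)) UNIV"
    "(\<lambda>(x, y). norm (f x * g y)) summable_on UNIV"
proof -
  have "(\<lambda>p. norm (f (fst p)) * norm (g (snd p))) summable_on (SIGMA x:UNIV. UNIV)"
  proof (rule summable_on_SigmaI[where g = "\<lambda>x. norm (f x) * infsum (\<lambda>y. norm (g y)) UNIV"])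
    show "((\<lambda>y. norm (f (fst (x, y))) * norm (g (snd (x, y)))) has_sum
        norm (f x) * infsum (\<lambda>y. norm (g y)) UNIV) UNIV" for x
      using has_sum_cmult_right[OF has_sum_infsum[OF assms(2)]] by simp
    show "(\<lambda>x. norm (f x) * infsum (\<lambda>y. norm (g y)) UNIV) summable_on UNIV"
      by (rule summable_on_cmult_left[OF assms(1)])
  qed auto
  then show S: "(\<lambda>(x, y). norm (f x * g y)) summable_on UNIV"
    by (simp add: norm_mult case_prod_unfold)
  then have S': "(\<lambda>(x, y). f x * g y) summable_on UNIV"
    by (simp add: case_prod_unfold abs_summable_summable)
  then have "(\<lambda>(x, y). f x * g y) summable_on (UNIV \<times> UNIV)" by simp
  then have "infsum (\<lambda>x. infsum (\<lambda>y. f x * g y) UNIV) UNIV = infsum (\<lambda>(x, y). f x * g y) (UNIV \<times> UNIV)"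
    by (rule infsum_Sigma'_banach)
  moreover have "infsum (\<lambda>x. infsum (\<lambda>y. f x * g y) UNIV) UNIV = infsum f UNIV * infsum g UNIV"
    by (simp only: infsum_cmult_right[OF abs_summable_summable[OF assms(2)]]
        infsum_cmult_left[OF abs_summable_summable[OF assms(1)]])
  ultimately show "((\<lambda>(x, y). f x * g y) has_sum (infsum f UNIV * infsum g UNIV)) UNIV"
    using has_sum_infsum[OF S'] by simp
qed

lemma has_sum_cauchy_product:
  fixes a b :: "multi_index \<Rightarrow> 'a::{real_normed_field,banach}"
  assumes "(\<lambda>\<alpha>. norm (a \<alpha> * monom_at x \<alpha>)) summable_on UNIV"
    "(\<lambda>\<alpha>. norm (b \<alpha> * monom_at x \<alpha>)) summable_on UNIV"
  shows "((\<lambda>\<gamma>. (\<Sum>(\<alpha>, \<beta>)\<in>splits \<gamma>. a \<alpha> * b \<beta>) * monom_at x \<gamma>) has_sum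
     ((\<Sum>\<^sub>\<infinity>\<alpha>. a \<alpha> * monom_at x \<alpha>) * (\<Sum>\<^sub>\<infinity>\<alpha>. b \<alpha> * monom_at x \<alpha>))) UNIV"
    (is "(?f has_sum ?s) UNIV")
    "(\<lambda>\<gamma>. norm ((\<Sum>(\<alpha>, \<beta>)\<in>splits \<gamma>. a \<alpha> * b \<beta>) * monom_at x \<gamma>)) summable_on UNIV"
proof -
  note H = has_sum_times[OF assms]
  have eq: "?f \<gamma> = (\<Sum>p\<in>splits \<gamma>. case p of (\<alpha>, \<beta>) \<Rightarrow> a \<alpha> * monom_at x \<alpha> * (b \<beta> * monom_at x \<beta>))" for \<gamma>
    unfolding sum_distrib_right
    by (rule sum.cong) (auto simp: splits_def monom_at_add)
  show "(?f has_sum ?s) UNIV" unfolding eq by (rule has_sum_splits[OF H(1)])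
  have S: "(\<lambda>\<gamma>. \<Sum>p\<in>splits \<gamma>. case p of (\<alpha>, \<beta>) \<Rightarrow> norm (a \<alpha> * monom_at x \<alpha> * (b \<beta> * monom_at x \<beta>)))
      summable_on UNIV"
    using has_sum_splits[OF has_sum_infsum[OF H(2)]] by (auto simp: summable_on_def)
  show "(\<lambda>\<gamma>. norm (?f \<gamma>)) summable_on UNIV"
    by (rule Infinite_Sum.abs_summable_on_comparison_test'[OF S])
      (unfold eq, auto simp: case_prod_unfold intro!: norm_sum)
qed

lemma has_expansion_add:
  assumes "has_expansion n \<rho> c F" "has_expansion n \<rho> d G" "\<forall>i<n. 0 \<le> \<rho> i"
  shows "has_expansion n \<rho> (\<lambda>\<alpha>. c \<alpha> + d \<alpha>) (\<lambda>z. F z + G z)" "weighted_norm \<rho> (\<lambda>\<alpha>. c \<alpha> + d \<alpha>) \<le> weighted_norm \<rho> c + weighted_norm \<rho> d"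
proof -
  have sb: "supp_below n (\<lambda>\<alpha>. c \<alpha> + d \<alpha>)"
    using assms(1,2) unfolding has_expansion_def supp_below_def by (metis add_0)
  have S: "(\<lambda>\<alpha>. norm (c \<alpha>) * monom_at \<rho> \<alpha> + norm (d \<alpha>) * monom_at \<rho> \<alpha>) summable_on UNIV"
    using assms(1,2) by (auto simp: has_expansion_def intro: summable_on_add)
  have le: "norm (c \<alpha> + d \<alpha>) * monom_at \<rho> \<alpha> \<le> norm (c \<alpha>) * monom_at \<rho> \<alpha> + norm (d \<alpha>) * monom_at \<rho> \<alpha>" for \<alpha>
  proof (cases "keys \<alpha> \<subseteq> {..<n}")
    case True
    then have "0 \<le> monom_at \<rho> \<alpha>" using assms(3) by (intro monom_at_nonneg) auto
    then show ?thesis using norm_triangle_ineq[of "c \<alpha>" "d \<alpha>"]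
      by (metis distrib_right mult_right_mono)
  next
    case False
    then have "c \<alpha> = 0" "d \<alpha> = 0" using assms(1,2) by (auto simp: has_expansion_def supp_below_def)
    then show ?thesis by simp
  qed
  have S': "(\<lambda>\<alpha>. norm (c \<alpha> + d \<alpha>) * monom_at \<rho> \<alpha>) summable_on UNIV"
    by (rule summable_on_comparison_test[OF S le]) (use wterm_nonneg[OF sb assms(3)] in auto)
  show "has_expansion n \<rho> (\<lambda>\<alpha>. c \<alpha> + d \<alpha>) (\<lambda>z. F z + G z)"
    unfolding has_expansion_def using sb S' assms(1,2)
    by (auto simp: has_expansion_def distrib_right intro: has_sum_add)
  have "weighted_norm \<rho> (\<lambda>\<alpha>. c \<alpha> + d \<alpha>) \<le> infsum (\<lambda>\<alpha>. norm (c \<alpha>) * monom_at \<rho> \<alpha> + norm (d \<alpha>) * monom_at \<rho> \<alpha>) UNIV"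
    unfolding weighted_norm_def by (rule infsum_mono[OF S' S le])
  also have "\<dots> = weighted_norm \<rho> c + weighted_norm \<rho> d" unfolding weighted_norm_def
    by (rule infsum_add) (use assms in \<open>auto simp: has_expansion_def\<close>)
  finally show "weighted_norm \<rho> (\<lambda>\<alpha>. c \<alpha> + d \<alpha>) \<le> weighted_norm \<rho> c + weighted_norm \<rho> d" .
qed

lemma exp_bounded_add:
  assumes "exp_bounded n \<rho> M F" "exp_bounded n \<rho> N G" "\<forall>i<n. 0 \<le> \<rho> i"
  shows "exp_bounded n \<rho> (M + N) (\<lambda>z. F z + G z)"
proof -
  obtain c d where c: "has_expansion n \<rho> c F" "weighted_norm \<rho> c \<le> M" and d: "has_expansion n \<rho> d G" "weighted_norm \<rho> d \<le> N"
    using assms by (auto simp: exp_bounded_def)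
  show ?thesis unfolding exp_bounded_def
    by (rule exI[of _ "\<lambda>\<alpha>. c \<alpha> + d \<alpha>"]) (use has_expansion_add[OF c(1) d(1) assms(3)] c d in auto)
qed

lemma has_expansion_mult:
  assumes F: "has_expansion n \<rho> c F" and G: "has_expansion n \<rho> d G" and \<rho>: "\<forall>i<n. 0 \<le> \<rho> i"
  defines "e \<equiv> \<lambda>\<gamma>. \<Sum>(\<alpha>, \<beta>)\<in>splits \<gamma>. c \<alpha> * d \<beta>"
  shows "has_expansion n \<rho> e (\<lambda>z. F z * G z)" "weighted_norm \<rho> e \<le> weighted_norm \<rho> c * weighted_norm \<rho> d"
proof -
  have sc: "supp_below n c" and sd: "supp_below n d" using F G by (auto simp: has_expansion_def)
  have sb: "supp_below n e"
    unfolding supp_below_def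
  proof safe
    fix \<gamma> i assume "e \<gamma> \<noteq> 0" and i: "i \<in> keys \<gamma>"
    then obtain p where "p \<in> splits \<gamma>" "(\<lambda>(\<alpha>, \<beta>). c \<alpha> * d \<beta>) p \<noteq> 0" unfolding e_def
      using sum.not_neutral_contains_not_neutral by blast
    then obtain \<alpha> \<beta> where "\<gamma> = \<alpha> + \<beta>" "c \<alpha> \<noteq> 0" "d \<beta> \<noteq> 0" by (auto simp: splits_def)
    then show "i < n" using i keys_add[of \<alpha> \<beta>] supp_belowD[OF sc] supp_belowD[OF sd] by blast
  qed
  \<comment> \<open>From index \<open>n\<close> on, \<open>\<rho>\<close> may be negative. Resetting
    it to 0 there makes all weights nonnegative and changes no term with a nonzero
    coefficient.\<close>
  define \<rho>' where "\<rho>' = (\<lambda>i. if i < n then \<rho> i else 0)"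
  have mon: "keys \<alpha> \<subseteq> {..<n} \<Longrightarrow> monom_at \<rho>' \<alpha> = monom_at \<rho> \<alpha>" for \<alpha>
    by (rule monom_at_cong) (auto simp: \<rho>'_def)
  have pos: "0 \<le> monom_at \<rho>' \<alpha>" for \<alpha> by (rule monom_at_nonneg) (use \<rho> in \<open>auto simp: \<rho>'_def\<close>)
  have eqc: "norm (c \<alpha>) * monom_at \<rho>' \<alpha> = norm (c \<alpha>) * monom_at \<rho> \<alpha>" for \<alpha>
    using sc mon by (cases "c \<alpha> = 0") (auto simp: supp_below_def)
  have eqd: "norm (d \<alpha>) * monom_at \<rho>' \<alpha> = norm (d \<alpha>) * monom_at \<rho> \<alpha>" for \<alpha>
    using sd mon by (cases "d \<alpha> = 0") (auto simp: supp_below_def)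
  have eqe: "norm (e \<alpha>) * monom_at \<rho>' \<alpha> = norm (e \<alpha>) * monom_at \<rho> \<alpha>" for \<alpha>
    using sb mon by (cases "e \<alpha> = 0") (auto simp: supp_below_def)
  have H: "((\<lambda>\<gamma>. (\<Sum>(\<alpha>, \<beta>)\<in>splits \<gamma>. norm (c \<alpha>) * norm (d \<beta>)) * monom_at \<rho>' \<gamma>) has_sum
     ((\<Sum>\<^sub>\<infinity>\<alpha>. norm (c \<alpha>) * monom_at \<rho>' \<alpha>) * (\<Sum>\<^sub>\<infinity>\<alpha>. norm (d \<alpha>) * monom_at \<rho>' \<alpha>))) UNIV"
    by (rule has_sum_cauchy_product)
      (use F G pos in \<open>simp_all add: eqc[symmetric] eqd[symmetric] has_expansion_def norm_mult\<close>)
  have le: "norm (e \<gamma>) * monom_at \<rho>' \<gamma> \<le> (\<Sum>(\<alpha>, \<beta>)\<in>splits \<gamma>. norm (c \<alpha>) * norm (d \<beta>)) * monom_at \<rho>' \<gamma>" for \<gamma>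
    unfolding e_def by (rule mult_right_mono[OF _ pos])
      (auto simp: case_prod_unfold norm_mult[symmetric] intro!: norm_sum)
  have S': "(\<lambda>\<gamma>. norm (e \<gamma>) * monom_at \<rho>' \<gamma>) summable_on UNIV"
    by (rule summable_on_comparison_test[OF has_sum_imp_summable[OF H] le]) (use pos in auto)
  have "infsum (\<lambda>\<gamma>. norm (e \<gamma>) * monom_at \<rho>' \<gamma>) UNIV \<le>
      infsum (\<lambda>\<gamma>. (\<Sum>(\<alpha>, \<beta>)\<in>splits \<gamma>. norm (c \<alpha>) * norm (d \<beta>)) * monom_at \<rho>' \<gamma>) UNIV"
    by (rule infsum_mono[OF S' has_sum_imp_summable[OF H] le])
  then show "weighted_norm \<rho> e \<le> weighted_norm \<rho> c * weighted_norm \<rho> d"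
    unfolding infsumI[OF H] eqc eqd eqe weighted_norm_def .
  show "has_expansion n \<rho> e (\<lambda>z. F z * G z)"
  proof (rule has_expI[OF sb])
    show "(\<lambda>\<alpha>. norm (e \<alpha>) * monom_at \<rho> \<alpha>) summable_on UNIV" using S' unfolding eqe .
  next
    fix z :: "nat \<Rightarrow> complex" assume z: "\<forall>i<n. norm (z i) \<le> \<rho> i"
    have "((\<lambda>\<gamma>. e \<gamma> * monom_at z \<gamma>) has_sum
     ((\<Sum>\<^sub>\<infinity>\<alpha>. c \<alpha> * monom_at z \<alpha>) * (\<Sum>\<^sub>\<infinity>\<alpha>. d \<alpha> * monom_at z \<alpha>))) UNIV"
      unfolding e_def
      by (rule has_sum_cauchy_product) (use F G z in \<open>auto simp: has_expansion_def intro: expansion_summable\<close>)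
    then show "F z * G z = (\<Sum>\<^sub>\<infinity>\<gamma>. e \<gamma> * monom_at z \<gamma>)"
      using has_expansion_infsum[OF F z] has_expansion_infsum[OF G z] by (simp add: infsumI)
  qed
qed

lemma exp_bounded_mult:
  assumes "exp_bounded n \<rho> M F" "exp_bounded n \<rho> N G" "\<forall>i<n. 0 \<le> \<rho> i"
  shows "exp_bounded n \<rho> (M * N) (\<lambda>z. F z * G z)"
proof -
  obtain c d where c: "has_expansion n \<rho> c F" "weighted_norm \<rho> c \<le> M" and d: "has_expansion n \<rho> d G" "weighted_norm \<rho> d \<le> N"
    using assms by (auto simp: exp_bounded_def)
  have "weighted_norm \<rho> c * weighted_norm \<rho> d \<le> M * N"
    using c d assms(3) weighted_norm_nonneg[of n d \<rho>] weighted_norm_nonneg[of n c \<rho>] by (intro mult_mono) (auto simp: has_expansion_def)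
  then show ?thesis unfolding exp_bounded_def using has_expansion_mult[OF c(1) d(1) assms(3)] order_trans by blast
qed

lemma exp_bounded_cmult: "exp_bounded n \<rho> M F \<Longrightarrow> \<forall>i<n. 0 \<le> \<rho> i \<Longrightarrow> exp_bounded n \<rho> (norm a * M) (\<lambda>z. a * F z)"
  by (rule exp_bounded_mult[OF exp_bounded_const])

lemma exp_bounded_diff: "exp_bounded n \<rho> M F \<Longrightarrow> exp_bounded n \<rho> N G \<Longrightarrow> \<forall>i<n. 0 \<le> \<rho> i \<Longrightarrow> exp_bounded n \<rho> (M + N) (\<lambda>z. F z - G z)"
  using exp_bounded_add[of n \<rho> M F N "\<lambda>z. -1 * G z"] exp_bounded_cmult[of n \<rho> N G "-1"] by simp

lemma exp_bounded_power: "exp_bounded n \<rho> M F \<Longrightarrow> \<forall>i<n. 0 \<le> \<rho> i \<Longrightarrow> exp_bounded n \<rho> (M ^ k) (\<lambda>z. F z ^ k)"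
proof (induction k)
  case 0
  then show ?case using exp_bounded_const[of n \<rho> 1] by simp
next
  case (Suc k)
  then show ?case using exp_bounded_mult by simp
qed

lemma exp_bounded_prod:
  assumes "finite A" "\<And>i. i \<in> A \<Longrightarrow> exp_bounded n \<rho> (M i) (F i)" "\<forall>i<n. 0 \<le> \<rho> i"
  shows "exp_bounded n \<rho> (\<Prod>i\<in>A. M i) (\<lambda>z. \<Prod>i\<in>A. F i z)"
  using assms
proof (induction A rule: finite_induct)
  case empty
  then show ?case using exp_bounded_const[of n \<rho> 1] by simp
next
  case (insert x A)
  then show ?case using exp_bounded_mult[of n \<rho> "M x" "F x"] by simp
qed

text \<open>Completeness of the weighted l1 space. Strict positivity of \<open>\<rho>\<close> allows
  division by the weight, which turns summability of the weighted terms into convergence of each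
  single coefficient; Fubini then exchanges the sum over \<open>k\<close> with the sum over
  multi-indices.\<close>

lemma has_expansion_infinite_sum:
  fixes c :: "'k \<Rightarrow> multi_index \<Rightarrow> complex"
  assumes F: "\<And>k. has_expansion n \<rho> (c k) (F k)" and M: "\<And>k. weighted_norm \<rho> (c k) \<le> M k"
    and SM: "M summable_on UNIV" and \<rho>: "\<forall>i<n. 0 < \<rho> i"
  shows "has_expansion n \<rho> (\<lambda>\<beta>. \<Sum>\<^sub>\<infinity>k. c k \<beta>) (\<lambda>z. \<Sum>\<^sub>\<infinity>k. F k z)"
    "weighted_norm \<rho> (\<lambda>\<beta>. \<Sum>\<^sub>\<infinity>k. c k \<beta>) \<le> infsum M UNIV"
proof -
  have \<rho>0: "\<forall>i<n. 0 \<le> \<rho> i" using \<rho> by (simp add: less_imp_le)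
  have sbk: "supp_below n (c k)" for k using F by (auto simp: has_expansion_def)
  have sb: "supp_below n (\<lambda>\<beta>. \<Sum>\<^sub>\<infinity>k. c k \<beta>)"
    unfolding supp_below_def
  proof (intro allI impI)
    fix \<beta> assume "(\<Sum>\<^sub>\<infinity>k. c k \<beta>) \<noteq> 0"
    then obtain k where "c k \<beta> \<noteq> 0" by (metis infsum_0)
    then show "keys \<beta> \<subseteq> {..<n}" using sbk by (auto simp: supp_below_def)
  qed
  have wn: "0 \<le> norm (c k \<alpha>) * monom_at \<rho> \<alpha>" for k \<alpha> by (rule wterm_nonneg[OF sbk \<rho>0])
  have Sw: "(\<lambda>k. weighted_norm \<rho> (c k)) summable_on UNIV"
    by (rule summable_on_comparison_test[OF SM M]) (use weighted_norm_nonneg[OF sbk \<rho>0] in auto)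
  have "(\<lambda>p. norm (c (fst p) (snd p)) * monom_at \<rho> (snd p)) summable_on (SIGMA k:UNIV. UNIV)"
    by (rule summable_on_SigmaI[where g = "\<lambda>k. weighted_norm \<rho> (c k)"])
      (use F Sw wn in \<open>auto simp: has_expansion_def weighted_norm_def\<close>)
  then have SS: "(\<lambda>p. norm (c (fst p) (snd p)) * monom_at \<rho> (snd p)) summable_on (UNIV \<times> UNIV)" by simp
  have SS2: "(\<lambda>p. norm (c (snd p) (fst p)) * monom_at \<rho> (fst p)) summable_on (UNIV \<times> UNIV)"
    using SS by (subst (asm) summable_on_swap) (simp add: case_prod_unfold)
  have row: "(\<lambda>k. norm (c k \<beta>) * monom_at \<rho> \<beta>) summable_on UNIV" for \<beta>
    using summable_on_SigmaD1[of "\<lambda>\<beta> k. norm (c k \<beta>) * monom_at \<rho> \<beta>" UNIV "\<lambda>_. UNIV" \<beta>] SS2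
    by (simp add: case_prod_unfold)
  have Sk: "(\<lambda>k. norm (c k \<beta>)) summable_on UNIV" for \<beta>
  proof (cases "keys \<beta> \<subseteq> {..<n}")
    case True
    then have "monom_at \<rho> \<beta> > 0" using \<rho> by (intro monom_at_pos) auto
    then show ?thesis using summable_on_cmult_left[OF row[of \<beta>], of "1 / monom_at \<rho> \<beta>"] by simp
  next
    case False
    then have "c k \<beta> = 0" for k using sbk by (auto simp: supp_below_def)
    then show ?thesis by simp
  qed
  have Ssum: "(\<lambda>\<beta>. infsum (\<lambda>k. norm (c k \<beta>) * monom_at \<rho> \<beta>) UNIV) summable_on UNIV"
    using summable_on_Sigma_banach[of "\<lambda>\<beta> k. norm (c k \<beta>) * monom_at \<rho> \<beta>" UNIV "\<lambda>_. UNIV"] SS2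
    by (simp add: case_prod_unfold)
  have le: "norm (\<Sum>\<^sub>\<infinity>k. c k \<beta>) * monom_at \<rho> \<beta> \<le> infsum (\<lambda>k. norm (c k \<beta>) * monom_at \<rho> \<beta>) UNIV" for \<beta>
  proof (cases "keys \<beta> \<subseteq> {..<n}")
    case True
    then have "monom_at \<rho> \<beta> > 0" using \<rho> by (intro monom_at_pos) auto
    moreover have "norm (\<Sum>\<^sub>\<infinity>k. c k \<beta>) \<le> infsum (\<lambda>k. norm (c k \<beta>)) UNIV"
      by (rule norm_infsum_bound[OF Sk])
    ultimately show ?thesis using Sk by (simp add: infsum_cmult_left mult_right_mono)
  next
    case False
    then have "c k \<beta> = 0" for k using sbk by (auto simp: supp_below_def)
    then show ?thesis by simp
  qed
  have S': "(\<lambda>\<beta>. norm (\<Sum>\<^sub>\<infinity>k. c k \<beta>) * monom_at \<rho> \<beta>) summable_on UNIV"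
    by (rule summable_on_comparison_test[OF Ssum le]) (rule wterm_nonneg[OF sb \<rho>0])
  have "weighted_norm \<rho> (\<lambda>\<beta>. \<Sum>\<^sub>\<infinity>k. c k \<beta>) \<le> infsum (\<lambda>\<beta>. infsum (\<lambda>k. norm (c k \<beta>) * monom_at \<rho> \<beta>) UNIV) UNIV"
    unfolding weighted_norm_def by (rule infsum_mono[OF S' Ssum le])
  also have "\<dots> = infsum (\<lambda>k. weighted_norm \<rho> (c k)) UNIV"
    unfolding weighted_norm_def by (rule infsum_swap_banach) (use SS2 in \<open>simp add: case_prod_unfold\<close>)
  also have "\<dots> \<le> infsum M UNIV" by (rule infsum_mono[OF Sw SM M])
  finally show "weighted_norm \<rho> (\<lambda>\<beta>. \<Sum>\<^sub>\<infinity>k. c k \<beta>) \<le> infsum M UNIV" .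
  show "has_expansion n \<rho> (\<lambda>\<beta>. \<Sum>\<^sub>\<infinity>k. c k \<beta>) (\<lambda>z. \<Sum>\<^sub>\<infinity>k. F k z)"
  proof (rule has_expI[OF sb S'])
    fix z :: "nat \<Rightarrow> complex" assume z: "\<forall>i<n. norm (z i) \<le> \<rho> i"
    have "(\<lambda>p. norm (c (fst p) (snd p) * monom_at z (snd p))) summable_on (UNIV \<times> UNIV)"
      by (rule Infinite_Sum.abs_summable_on_comparison_test'[OF SS]) (use term_norm_le[OF sbk z] in auto)
    then have "(\<lambda>(k, \<beta>). c k \<beta> * monom_at z \<beta>) summable_on (UNIV \<times> UNIV)"
      by (simp add: case_prod_unfold abs_summable_summable)
    from infsum_swap_banach[OF this]
    have "(\<Sum>\<^sub>\<infinity>k. F k z) = (\<Sum>\<^sub>\<infinity>\<beta>. \<Sum>\<^sub>\<infinity>k. c k \<beta> * monom_at z \<beta>)"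
      using has_expansion_infsum[OF F z] by simp
    also have "\<dots> = (\<Sum>\<^sub>\<infinity>\<beta>. (\<Sum>\<^sub>\<infinity>k. c k \<beta>) * monom_at z \<beta>)"
      using Sk by (simp add: infsum_cmult_left abs_summable_summable)
    finally show "(\<Sum>\<^sub>\<infinity>k. F k z) = (\<Sum>\<^sub>\<infinity>\<beta>. (\<Sum>\<^sub>\<infinity>k. c k \<beta>) * monom_at z \<beta>)" .
  qed
qed

lemma exp_bounded_infinite_sum:
  fixes F :: "'k \<Rightarrow> (nat \<Rightarrow> complex) \<Rightarrow> complex"
  assumes F: "\<And>k. exp_bounded n \<rho> (M k) (F k)"
    and SM: "M summable_on UNIV" and \<rho>: "\<forall>i<n. 0 < \<rho> i"
  shows "exp_bounded n \<rho> (infsum M UNIV) (\<lambda>z. \<Sum>\<^sub>\<infinity>k. F k z)"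
proof -
  obtain c where "\<And>k. has_expansion n \<rho> (c k) (F k)" "\<And>k. weighted_norm \<rho> (c k) \<le> M k"
    using F unfolding exp_bounded_def by metis
  then show ?thesis unfolding exp_bounded_def using has_expansion_infinite_sum[of n \<rho> c F M] SM \<rho> by blast
qed

section \<open>Evaluation of convergent power series\<close>

lemma abs_conv_at_iff:
  "abs_conv_at f (\<lambda>i. norm (x i)) \<longleftrightarrow> (\<lambda>\<alpha>. norm (of_real (mcoeff f \<alpha>) * monom_at x \<alpha>)) summable_on UNIV"
  unfolding abs_conv_at_def by (simp add: norm_mult norm_monom_at abs_mult monom_at_nonneg)

lemma vars_belowD: "vars_below n f \<Longrightarrow> mcoeff f \<alpha> \<noteq> 0 \<Longrightarrow> i \<in> keys \<alpha> \<Longrightarrow> i < n"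
  by (auto simp: vars_below_def)

lemma vars_below_mono: "vars_below n f \<Longrightarrow> n \<le> m \<Longrightarrow> vars_below m f"
  by (auto simp: vars_below_def) force

lemma abs_conv_at_mono:
  assumes "vars_below n f" "abs_conv_at f y" "\<And>i. i < n \<Longrightarrow> \<bar>x i\<bar> \<le> \<bar>y i\<bar>"
  shows "abs_conv_at f x"
proof -
  have *: "\<bar>mcoeff f \<alpha> * monom_at x \<alpha>\<bar> \<le> \<bar>mcoeff f \<alpha> * monom_at y \<alpha>\<bar>" for \<alpha>
  proof (cases "mcoeff f \<alpha> = 0")
    case False
    have "\<bar>monom_at x \<alpha>\<bar> \<le> \<bar>monom_at y \<alpha>\<bar>"
      using norm_monom_at[of x \<alpha>] norm_monom_at[of y \<alpha>] vars_belowD[OF assms(1) False] assms(3)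
      by (simp add: monom_at_mono)
    then show ?thesis by (simp add: abs_mult mult_left_mono)
  qed auto
  show ?thesis unfolding abs_conv_at_def
    by (rule summable_on_comparison_test[OF assms(2)[unfolded abs_conv_at_def] *]) auto
qed

lemma mps_eval_cong:
  assumes "vars_below n f" "\<And>i. i < n \<Longrightarrow> x i = y i"
  shows "mps_eval f x = mps_eval f y"
  unfolding mps_eval_def
proof (rule infsum_cong)
  fix \<alpha>
  show "of_real (mcoeff f \<alpha>) * monom_at x \<alpha> = of_real (mcoeff f \<alpha>) * monom_at y \<alpha>"
    using vars_belowD[OF assms(1)] assms(2) by (cases "mcoeff f \<alpha> = 0") (auto intro: monom_at_cong)
qed

text \<open>By monotonicity in the absolute values of the coordinates, one diagonal point with
  positive coordinates controls a whole box around 0. The entries from \<open>n\<close> on do not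
  matter because the series does not involve them.\<close>

lemma conv_series_iff: "f \<in> conv_series n \<longleftrightarrow> vars_below n f \<and> (\<exists>r>0. abs_conv_at f (\<lambda>_. r))"
proof (intro iffI conjI)
  assume "f \<in> conv_series n"
  then obtain r where r: "r > 0" "vars_below n f"
    "\<And>x. x \<in> space_n n \<Longrightarrow> (\<forall>i<n. \<bar>x i\<bar> < r) \<Longrightarrow> abs_conv_at f x"
    by (auto simp: conv_series_def)
  then have "abs_conv_at f (\<lambda>i. if i < n then r / 2 else 0)"
    by (intro r(3)) (auto simp: space_n_def)
  then have "abs_conv_at f (\<lambda>_. r / 2)"
    by (rule abs_conv_at_mono[OF r(2)]) auto
  then show "\<exists>r>0. abs_conv_at f (\<lambda>_. r)" using r(1) by (meson half_gt_zero)
  show "vars_below n f" by fact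
next
  assume "vars_below n f \<and> (\<exists>r>0. abs_conv_at f (\<lambda>_. r))"
  then show "f \<in> conv_series n"
    unfolding conv_series_def by (fastforce elim: abs_conv_at_mono)
qed

lemma conv_series_mono: "n \<le> m \<Longrightarrow> conv_series n \<subseteq> conv_series m"
  using vars_below_mono by (auto simp: conv_series_iff)

text \<open>Holds without any convergence hypothesis: \<open>Re\<close> inverts the embedding, so
  both sums converge together, and otherwise both are 0 by convention.\<close>

lemma mps_eval_of_real: "mps_eval f (\<lambda>i. of_real (x i) :: complex) = of_real (mps_eval f x)"
proof -
  let ?g = "\<lambda>\<alpha>. mcoeff f \<alpha> * monom_at x \<alpha>"
  have "(\<lambda>\<alpha>. complex_of_real (?g \<alpha>)) summable_on UNIV \<longleftrightarrow> ?g summable_on UNIV"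
    by (rule summable_on_bounded_linear_iff[where h' = Re]) (auto intro: bounded_linear_of_real bounded_linear_Re)
  from infsum_bounded_linear_strong[OF this bounded_linear_of_real]
  show ?thesis by (simp add: mps_eval_def monom_at_of_real)
qed

lemma mps_has_exp:
  assumes "vars_below n f" "abs_conv_at f \<rho>" "\<forall>i<n. 0 \<le> \<rho> i"
  shows "has_expansion n \<rho> (\<lambda>\<alpha>. of_real (mcoeff f \<alpha>)) (mps_eval f)"
proof (rule has_expI)
  show "supp_below n (\<lambda>\<alpha>. complex_of_real (mcoeff f \<alpha>))"
    using assms(1) by (auto simp: supp_below_def vars_below_def)
  have "norm (complex_of_real (mcoeff f \<alpha>)) * monom_at \<rho> \<alpha> = \<bar>mcoeff f \<alpha> * monom_at \<rho> \<alpha>\<bar>" for \<alpha>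
  proof (cases "mcoeff f \<alpha> = 0")
    case False
    then have "0 \<le> monom_at \<rho> \<alpha>" using vars_belowD[OF assms(1)] assms(3) by (intro monom_at_nonneg) auto
    then show ?thesis by (simp add: abs_mult)
  qed auto
  then show "(\<lambda>\<alpha>. cmod (complex_of_real (mcoeff f \<alpha>)) * monom_at \<rho> \<alpha>) summable_on UNIV"
    using assms(2) by (simp add: abs_conv_at_def)
qed (simp add: mps_eval_def)

lemma mps_exp_bounded:
  assumes "vars_below n f" "abs_conv_at f \<rho>" "\<forall>i<n. 0 \<le> \<rho> i"
  obtains M where "exp_bounded n \<rho> M (mps_eval f)"
  using mps_has_exp[OF assms] unfolding exp_bounded_def by blast

text \<open>\<open>p\<close> stands for \<open>Re\<close> or \<open>Im\<close>. Being real-linear,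
  it passes through the values of monomials at real points, and it does not increase the norm of a
  coefficient, so the real series keeps the whole radius.\<close>

lemma expansion_part_mps:
  assumes F: "has_expansion n \<rho> c F" and \<rho>: "\<forall>i<n. 0 \<le> \<rho> i"
    and p: "bounded_linear p" "\<And>a r. p (a * of_real r) = p a * r" "\<And>a. \<bar>p a\<bar> \<le> cmod a"
  shows "vars_below n (MPS (p \<circ> c))" "abs_conv_at (MPS (p \<circ> c)) \<rho>"
    "\<And>x. \<forall>i<n. \<bar>x i\<bar> \<le> \<rho> i \<Longrightarrow> mps_eval (MPS (p \<circ> c)) x = p (F (\<lambda>i. of_real (x i)))"
proof -
  interpret bounded_linear p by fact
  have sb: "supp_below n c" using F by (simp add: has_expansion_def)
  show "vars_below n (MPS (p \<circ> c))" using sb zero unfolding vars_below_def supp_below_def by (metis mps.sel o_apply)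
  have le: "\<bar>p (c \<alpha>) * monom_at \<rho> \<alpha>\<bar> \<le> norm (c \<alpha>) * monom_at \<rho> \<alpha>" for \<alpha>
  proof (cases "c \<alpha> = 0")
    case False
    then have "0 \<le> monom_at \<rho> \<alpha>" using supp_belowD[OF sb] \<rho> by (intro monom_at_nonneg) auto
    then show ?thesis using p(3) by (simp add: abs_mult mult_right_mono)
  qed (auto simp: zero)
  show "abs_conv_at (MPS (p \<circ> c)) \<rho>" unfolding abs_conv_at_def
    by (rule summable_on_comparison_test[of "\<lambda>\<alpha>. norm (c \<alpha>) * monom_at \<rho> \<alpha>"])
      (use F le in \<open>auto simp: has_expansion_def\<close>)
  fix x assume "\<forall>i<n. \<bar>x i\<bar> \<le> \<rho> i"
  then have "((\<lambda>\<alpha>. c \<alpha> * monom_at (\<lambda>i. of_real (x i)) \<alpha>) has_sum F (\<lambda>i. of_real (x i))) UNIV"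
    using F by (auto simp: has_expansion_def)
  from has_sum_bounded_linear[OF p(1) this]
  have "((\<lambda>\<alpha>. p (c \<alpha>) * monom_at x \<alpha>) has_sum p (F (\<lambda>i. of_real (x i)))) UNIV"
    by (simp add: monom_at_of_real p(2))
  then show "mps_eval (MPS (p \<circ> c)) x = p (F (\<lambda>i. of_real (x i)))"
    by (simp add: mps_eval_def infsumI)
qed

lemmas expansion_Re_mps = expansion_part_mps[OF _ _ bounded_linear_Re, simplified abs_Re_le_cmod, simplified]
lemmas expansion_Im_mps = expansion_part_mps[OF _ _ bounded_linear_Im, simplified abs_Im_le_cmod, simplified]

section \<open>Slices in one variable and the identity theorem\<close>

lemma monom_at_fun_upd:
  "monom_at (x(i := t)) (\<beta> + single i j) = monom_at x \<beta> * t ^ j" if "lookup \<beta> i = 0"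
proof -
  have "monom_at (x(i := t)) \<beta> = monom_at x \<beta>" using that by (intro monom_at_cong) (auto simp: in_keys_iff)
  then show ?thesis by (simp add: monom_at_add)
qed

lemma slice_bij:
  "bij_betw (\<lambda>(j, \<beta>). \<beta> + single i j) (SIGMA j:UNIV. {\<beta>. lookup \<beta> i = 0}) (UNIV :: multi_index set)"
  by (rule bij_betwI[where g = "\<lambda>\<alpha>. (lookup \<alpha> i, \<alpha> - single i (lookup \<alpha> i))"])
    (auto simp: lookup_add lookup_minus lookup_single when_def intro!: poly_mapping_eqI)

text \<open>The coefficient of the \<open>j\<close>-th power of variable \<open>i\<close> when
  \<open>f\<close> is read as a power series in that variable alone.\<close>

definition mps_slice :: "nat \<Rightarrow> nat \<Rightarrow> mps \<Rightarrow> mps" where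
  "mps_slice i j f = MPS (\<lambda>\<beta>. if lookup \<beta> i = 0 then mcoeff f (\<beta> + single i j) else 0)"

lemma abs_conv_at_slice:
  assumes "abs_conv_at f \<rho>" "\<rho> i \<noteq> 0"
  shows "abs_conv_at (mps_slice i j f) \<rho>"
proof -
  let ?h = "\<lambda>\<alpha>. \<bar>mcoeff f \<alpha> * monom_at \<rho> \<alpha>\<bar>"
  have "?h summable_on (\<lambda>\<beta>. \<beta> + single i j) ` {\<beta>. lookup \<beta> i = 0}"
    using assms(1) unfolding abs_conv_at_def by (rule summable_on_subset_banach) auto
  then have "(?h \<circ> (\<lambda>\<beta>. \<beta> + single i j)) summable_on {\<beta>. lookup \<beta> i = 0}"
    by (subst (asm) summable_on_reindex) (auto simp: inj_on_def)
  then have "(\<lambda>\<beta>. \<bar>mcoeff f (\<beta> + single i j) * monom_at \<rho> (\<beta> + single i j)\<bar> * (1 / \<bar>\<rho> i ^ j\<bar>))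
      summable_on {\<beta>. lookup \<beta> i = 0}"
    by (intro summable_on_cmult_left) (simp add: o_def)
  also have "(\<lambda>\<beta>. \<bar>mcoeff f (\<beta> + single i j) * monom_at \<rho> (\<beta> + single i j)\<bar> * (1 / \<bar>\<rho> i ^ j\<bar>))
    = (\<lambda>\<beta>. \<bar>mcoeff f (\<beta> + single i j) * monom_at \<rho> \<beta>\<bar>)"
    using assms(2) by (auto simp: monom_at_add abs_mult)
  finally show ?thesis unfolding abs_conv_at_def
    by (subst (asm) summable_on_cong_neutral[where T = UNIV and g = "\<lambda>\<beta>. \<bar>mcoeff (mps_slice i j f) \<beta> * monom_at \<rho> \<beta>\<bar>"])
      (auto simp: mps_slice_def)
qed

lemma vars_below_slice: "vars_below (Suc n) f \<Longrightarrow> vars_below n (mps_slice n j f)"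
  unfolding vars_below_def mps_slice_def
proof (intro allI impI subsetI)
  fix \<alpha> i assume f: "\<forall>\<alpha>. mcoeff f \<alpha> \<noteq> 0 \<longrightarrow> keys \<alpha> \<subseteq> {..<Suc n}"
    and a: "mcoeff (MPS (\<lambda>\<beta>. if lookup \<beta> n = 0 then mcoeff f (\<beta> + single n j) else 0)) \<alpha> \<noteq> 0"
    and i: "i \<in> keys \<alpha>"
  from a have 1: "lookup \<alpha> n = 0" "mcoeff f (\<alpha> + single n j) \<noteq> 0" by (auto split: if_splits)
  from i have "i \<in> keys (\<alpha> + single n j)" by (auto simp: in_keys_iff lookup_add)
  then have "i < Suc n" using f 1 by blast
  moreover have "i \<noteq> n" using i 1 by (auto simp: in_keys_iff)
  ultimately show "i \<in> {..<n}" by simp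
qed

lemma mps_eval_slice_upd [simp]: "mps_eval (mps_slice i j f) (x(i := t)) = mps_eval (mps_slice i j f) x"
  unfolding mps_eval_def
proof (rule infsum_cong)
  fix \<alpha>
  show "of_real (mcoeff (mps_slice i j f) \<alpha>) * monom_at (x(i := t)) \<alpha> = of_real (mcoeff (mps_slice i j f) \<alpha>) * monom_at x \<alpha>"
    using monom_at_fun_upd[of \<alpha> i x t 0] by (auto simp: mps_slice_def)
qed

lemma slice_sums:
  fixes x :: "nat \<Rightarrow> 'a::{real_normed_field,banach}"
  assumes "abs_conv_at f (\<lambda>i. norm (x i))"
  shows "(\<lambda>j. mps_eval (mps_slice i j f) x * x i ^ j) sums mps_eval f x"
proof -
  let ?h = "\<lambda>\<alpha>. of_real (mcoeff f \<alpha>) * monom_at x \<alpha>"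
  have "?h abs_summable_on UNIV" using assms by (simp add: abs_conv_at_iff)
  then have S: "(?h has_sum mps_eval f x) UNIV" unfolding mps_eval_def
    by (intro has_sum_infsum) (rule abs_summable_summable)
  have "((\<lambda>(j, \<beta>). ?h (\<beta> + single i j)) has_sum mps_eval f x)
     (SIGMA j:UNIV. {\<beta>. lookup \<beta> i = 0})"
    using has_sum_reindex_bij_betw[OF slice_bij[of i], of ?h "mps_eval f x"] S by (simp add: case_prod_unfold)
  then have "((\<lambda>j. mps_eval (mps_slice i j f) x * x i ^ j) has_sum mps_eval f x) UNIV"
  proof (rule has_sum_SigmaD)
    fix j :: nat
    let ?B = "{\<beta>. lookup \<beta> i = 0}" and ?g = "\<lambda>\<beta>. of_real (mcoeff f (\<beta> + single i j)) * monom_at x \<beta>"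
    have "?h summable_on (\<lambda>\<beta>. \<beta> + single i j) ` ?B"
      using has_sum_imp_summable[OF S] by (rule summable_on_subset_banach) auto
    then have "(?h \<circ> (\<lambda>\<beta>. \<beta> + single i j)) summable_on ?B"
      by (subst (asm) summable_on_reindex) (auto simp: inj_on_def)
    then have S2: "(\<lambda>\<beta>. ?g \<beta> * x i ^ j) summable_on ?B"
      by (simp add: o_def monom_at_add mult.assoc)
    have e: "mps_eval (mps_slice i j f) x = infsum ?g ?B"
      unfolding mps_eval_def by (rule infsum_cong_neutral) (auto simp: mps_slice_def)
    \<comment> \<open>Dividing by \<open>x i ^ j\<close> shows that the slice itself is summable at
      \<open>x\<close>. If this power is 0, the slice may diverge, but then it contributes 0
      whatever its sum is.\<close>
    have "((\<lambda>\<beta>. ?g \<beta> * x i ^ j) has_sum (mps_eval (mps_slice i j f) x * x i ^ j)) ?B"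
    proof (cases "x i ^ j = 0")
      case False
      then have "?g summable_on ?B" using summable_on_cmult_left[OF S2, of "1 / x i ^ j"] by simp
      then show ?thesis unfolding e by (intro has_sum_cmult_left has_sum_infsum)
    next
      case True
      then show ?thesis by (simp only: mult_zero_right has_sum_0_simp)
    qed
    then show "((\<lambda>\<beta>. case (j, \<beta>) of (j, \<beta>) \<Rightarrow> ?h (\<beta> + single i j)) has_sum
        mps_eval (mps_slice i j f) x * x i ^ j) ?B"
      by (simp add: monom_at_add mult.assoc)
  qed
  then show ?thesis by (rule has_sum_imp_sums)
qed

lemma powser_zero_imp:
  fixes a :: "nat \<Rightarrow> real"
  assumes "r > 0" "\<And>t. \<bar>t\<bar> \<le> r \<Longrightarrow> (\<lambda>j. a j * t ^ j) sums 0"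
  shows "a j = 0"
proof (rule ccontr)
  assume j: "a j \<noteq> 0"
  have "a 0 = 0" using sums_unique2[OF assms(2)[of 0] powser_sums_zero[of a]] assms(1) by simp
  then have "j > 0" using j by (cases j) auto
  show False
  \<comment> \<open>Zeros of a nontrivial power series are isolated. Applied to the constant
    function 0, this produces a punctured disc on which 0 differs from 0.\<close>
  proof (rule powser_0_nonzero[of r 0 a "\<lambda>_. 0" j])
    fix s :: real assume s: "0 < s" "\<And>z::real. z \<in> cball 0 s - {0} \<Longrightarrow> (0::real) \<noteq> 0"
    show False using s(2)[of s] s(1) by auto
  qed (use assms j \<open>j > 0\<close> in auto)
qed

text \<open>Induction on the number of variables: with the first \<open>n\<close> arguments fixed,
  the values of the slices are the coefficients of a power series in the last variable that vanishes
  near 0, so every slice vanishes as a function and, by induction, as a series.\<close>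

lemma mps_eval_zero_imp:
  assumes "vars_below n f" "r > 0" "abs_conv_at f (\<lambda>_. r)"
    and "\<And>x :: nat \<Rightarrow> real. \<forall>i<n. \<bar>x i\<bar> \<le> r \<Longrightarrow> mps_eval f x = 0"
  shows "f = 0"
  using assms
proof (induction n arbitrary: f)
  case 0
  have sb: "mcoeff f \<alpha> = 0" if "\<alpha> \<noteq> 0" for \<alpha>
    using 0(1) that by (auto simp: vars_below_def)
  have "((\<lambda>\<alpha>. mcoeff f \<alpha> * monom_at (\<lambda>_. 0) \<alpha>) has_sum (mcoeff f 0)) UNIV"
    by (rule has_sum_finite_neutralI[of "{0}"]) (auto simp: sb)
  then have "mcoeff f 0 = 0" using 0(4)[of "\<lambda>_. 0"] by (simp add: mps_eval_def infsumI)
  then show ?case using sb by (intro mps_eqI) (metis mps.sel zero_mps_def)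
next
  case (Suc n)
  have "mps_slice n j f = 0" for j
  proof (rule Suc.IH)
    show "vars_below n (mps_slice n j f)" by (rule vars_below_slice[OF Suc.prems(1)])
    show "abs_conv_at (mps_slice n j f) (\<lambda>_. r)" by (rule abs_conv_at_slice) (use Suc.prems in auto)
    fix x :: "nat \<Rightarrow> real" assume x: "\<forall>i<n. \<bar>x i\<bar> \<le> r"
    show "mps_eval (mps_slice n j f) x = 0"
    proof (rule powser_zero_imp[OF \<open>r > 0\<close>])
      fix t assume t: "\<bar>t\<bar> \<le> r"
      let ?y = "x(n := t)"
      have "abs_conv_at f (\<lambda>i. norm (?y i))"
        by (rule abs_conv_at_mono[OF Suc.prems(1,3)]) (use x t in \<open>auto simp: less_Suc_eq\<close>)
      from slice_sums[of f ?y n, OF this]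
      show "(\<lambda>j. mps_eval (mps_slice n j f) x * t ^ j) sums 0"
        using Suc.prems(4)[of ?y] x t by (simp add: less_Suc_eq del: fun_upd_apply) (simp add: less_Suc_eq)
    qed
  qed fact
  then have z: "mcoeff (mps_slice n j f) \<beta> = 0" for j \<beta> by (simp add: zero_mps_def)
  show ?case
  proof (rule mps_eqI)
    fix \<alpha> :: "multi_index"
    let ?j = "lookup \<alpha> n"
    have "\<alpha> - single n ?j + single n ?j = \<alpha>"
      by (auto simp: lookup_add lookup_minus lookup_single when_def intro!: poly_mapping_eqI)
    then show "mcoeff f \<alpha> = mcoeff 0 \<alpha>" using z[of ?j "\<alpha> - single n ?j"]
      by (simp add: mps_slice_def lookup_minus zero_mps_def)
  qed
qed

section \<open>Evaluation respects the ring operations\<close>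

lemma mcoeff_0 [simp]: "mcoeff 0 \<alpha> = 0" by (simp add: zero_mps_def)
lemma mcoeff_1: "mcoeff 1 \<alpha> = (if \<alpha> = 0 then 1 else 0)" by (simp add: one_mps_def)
lemma mcoeff_add [simp]: "mcoeff (f + g) \<alpha> = mcoeff f \<alpha> + mcoeff g \<alpha>" by (simp add: plus_mps_def)
lemma mcoeff_diff [simp]: "mcoeff (f - g) \<alpha> = mcoeff f \<alpha> - mcoeff g \<alpha>" by (simp add: minus_mps_def)
lemma mcoeff_uminus [simp]: "mcoeff (- f) \<alpha> = - mcoeff f \<alpha>" by (simp add: uminus_mps_def)
lemma mcoeff_mult: "mcoeff (f * g) \<gamma> = (\<Sum>(\<alpha>, \<beta>)\<in>splits \<gamma>. mcoeff f \<alpha> * mcoeff g \<beta>)" by (simp add: times_mps_def)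

lemma mcoeff_mult_0 [simp]: "mcoeff (f * g) 0 = mcoeff f 0 * mcoeff g 0"
proof -
  have "\<alpha> = 0 \<and> \<beta> = 0" if "\<alpha> + \<beta> = 0" for \<alpha> \<beta> :: "multi_index"
  proof -
    have "lookup \<alpha> i + lookup \<beta> i = 0" for i
      using arg_cong[OF that, of "\<lambda>\<gamma>. lookup \<gamma> i"] by (simp add: lookup_add)
    then have "lookup \<alpha> i = 0 \<and> lookup \<beta> i = 0" for i by simp
    then show ?thesis by (metis lookup_zero poly_mapping_eqI)
  qed
  then have "p \<in> splits 0 \<longleftrightarrow> p = (0, 0)" for p
    unfolding splits_def by (metis (mono_tags, lifting) add.right_neutral case_prod_conv mem_Collect_eq surj_pair)
  then have "splits 0 = {(0, 0)}" by blast
  then show ?thesis by (simp add: mcoeff_mult)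
qed

lemma mcoeff_power_0 [simp]: "mcoeff (f ^ k) 0 = mcoeff f 0 ^ k"
  by (induction k) (simp_all add: mcoeff_1)

definition mps_const :: "real \<Rightarrow> mps" where "mps_const a = MPS (\<lambda>\<alpha>. if \<alpha> = 0 then a else 0)"
definition mps_var :: "nat \<Rightarrow> mps" where "mps_var i = MPS (\<lambda>\<alpha>. if \<alpha> = single i 1 then 1 else 0)"

lemma one_eq_const: "1 = mps_const 1" by (simp add: one_mps_def mps_const_def)
lemma zero_eq_const: "0 = mps_const 0" by (simp add: zero_mps_def mps_const_def)

lemma mps_eval_const [simp]: "mps_eval (mps_const a) x = of_real a"
  unfolding mps_eval_def by (rule infsumI, rule has_sum_finite_neutralI[of "{0}"]) (auto simp: mps_const_def)
lemma mps_eval_var [simp]: "mps_eval (mps_var i) x = x i"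
  unfolding mps_eval_def by (rule infsumI, rule has_sum_finite_neutralI[of "{single i 1}"]) (auto simp: mps_var_def)
lemma mps_eval_1 [simp]: "mps_eval 1 x = 1" by (simp add: one_eq_const)
lemma mps_eval_0 [simp]: "mps_eval 0 x = 0" by (simp add: zero_eq_const)

lemma abs_conv_const [simp]: "abs_conv_at (mps_const a) x"
  unfolding abs_conv_at_def
  by (rule finite_nonzero_values_imp_summable_on, rule finite_subset[of _ "{0}"]) (auto simp: mps_const_def)
lemma abs_conv_var [simp]: "abs_conv_at (mps_var a) x"
  unfolding abs_conv_at_def
  by (rule finite_nonzero_values_imp_summable_on, rule finite_subset[of _ "{single a 1}"]) (auto simp: mps_var_def)
lemma abs_conv_1 [simp]: "abs_conv_at 1 x" and abs_conv_0 [simp]: "abs_conv_at 0 x"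
  by (simp_all add: one_eq_const zero_eq_const)

lemma abs_conv_at_abs: "abs_conv_at f (\<lambda>i. \<bar>x i\<bar>) = abs_conv_at f x"
  using abs_conv_at_iff[of f x] by (simp add: abs_conv_at_def)

lemma abs_conv_add: "abs_conv_at f x \<Longrightarrow> abs_conv_at g x \<Longrightarrow> abs_conv_at (f + g) x"
  unfolding abs_conv_at_def
  by (rule summable_on_comparison_test[OF summable_on_add[where f = "\<lambda>\<alpha>. \<bar>mcoeff f \<alpha> * monom_at x \<alpha>\<bar>"
        and g = "\<lambda>\<alpha>. \<bar>mcoeff g \<alpha> * monom_at x \<alpha>\<bar>"]])
    (auto simp: distrib_right)

lemma abs_conv_uminus: "abs_conv_at f x \<Longrightarrow> abs_conv_at (- f) x"
  unfolding abs_conv_at_def by simp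

lemma abs_conv_diff: "abs_conv_at f x \<Longrightarrow> abs_conv_at g x \<Longrightarrow> abs_conv_at (f - g) x"
  using abs_conv_add[of f x "- g"] abs_conv_uminus by simp

lemma abs_conv_mult: "abs_conv_at f x \<Longrightarrow> abs_conv_at g x \<Longrightarrow> abs_conv_at (f * g) x"
  using has_sum_cauchy_product(2)[of "mcoeff f" x "mcoeff g"]
  by (simp add: abs_conv_at_def mcoeff_mult)

lemma abs_conv_summable:
  fixes x :: "nat \<Rightarrow> 'a::{real_normed_field,banach}"
  shows "abs_conv_at f (\<lambda>i. norm (x i)) \<Longrightarrow> (\<lambda>\<alpha>. of_real (mcoeff f \<alpha>) * monom_at x \<alpha>) summable_on UNIV"
  by (rule abs_summable_summable) (simp add: abs_conv_at_iff)

context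
  fixes x :: "nat \<Rightarrow> 'a::{real_normed_field,banach}" and f g :: mps
  assumes fg: "abs_conv_at f (\<lambda>i. norm (x i))" "abs_conv_at g (\<lambda>i. norm (x i))"
begin

lemma mps_eval_add: "mps_eval (f + g) x = mps_eval f x + mps_eval g x"
  unfolding mps_eval_def using fg[THEN abs_conv_summable] by (simp add: distrib_right infsum_add)

lemma mps_eval_diff: "mps_eval (f - g) x = mps_eval f x - mps_eval g x"
proof -
  have "(\<lambda>\<alpha>. - (of_real (mcoeff g \<alpha>) * monom_at x \<alpha>)) summable_on UNIV"
    using fg[THEN abs_conv_summable] by (simp add: summable_on_uminus)
  then have "infsum (\<lambda>\<alpha>. of_real (mcoeff f \<alpha>) * monom_at x \<alpha> + - (of_real (mcoeff g \<alpha>) * monom_at x \<alpha>)) UNIV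
      = mps_eval f x + infsum (\<lambda>\<alpha>. - (of_real (mcoeff g \<alpha>) * monom_at x \<alpha>)) UNIV"
    unfolding mps_eval_def using fg[THEN abs_conv_summable] by (intro infsum_add)
  then show ?thesis by (simp add: mps_eval_def left_diff_distrib infsum_uminus)
qed

lemma mps_eval_mult: "mps_eval (f * g) x = mps_eval f x * mps_eval g x"
proof -
  have "((\<lambda>\<gamma>. (\<Sum>(\<alpha>, \<beta>)\<in>splits \<gamma>. of_real (mcoeff f \<alpha>) * of_real (mcoeff g \<beta>)) * monom_at x \<gamma>) has_sum
     (mps_eval f x * mps_eval g x)) UNIV"
    unfolding mps_eval_def
    by (rule has_sum_cauchy_product) (use fg in \<open>simp_all add: abs_conv_at_iff\<close>)
  from infsumI[OF this] show ?thesis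
    by (simp add: mps_eval_def[of "f * g"] mcoeff_mult case_prod_unfold)
qed

end

lemma vars_below_const [simp]: "vars_below n (mps_const a)" by (auto simp: vars_below_def mps_const_def)
lemma vars_below_var: "i < n \<Longrightarrow> vars_below n (mps_var i)" by (auto simp: vars_below_def mps_var_def split: if_splits)
lemma vars_below_add: "vars_below n f \<Longrightarrow> vars_below n g \<Longrightarrow> vars_below n (f + g)"
  unfolding vars_below_def by (metis add_0 mcoeff_add)
lemma vars_below_diff: "vars_below n f \<Longrightarrow> vars_below n g \<Longrightarrow> vars_below n (f - g)"
  unfolding vars_below_def by (metis diff_0_right mcoeff_diff)
lemma vars_below_mult: "vars_below n (f * g)" if "vars_below n f" "vars_below n g"
  unfolding vars_below_def
proof safe
  fix \<gamma> i assume "mcoeff (f * g) \<gamma> \<noteq> 0" and i: "i \<in> keys \<gamma>"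
  then obtain p where "p \<in> splits \<gamma>" "(\<lambda>(\<alpha>, \<beta>). mcoeff f \<alpha> * mcoeff g \<beta>) p \<noteq> 0" unfolding mcoeff_mult
    using sum.not_neutral_contains_not_neutral by blast
  then obtain \<alpha> \<beta> where "\<gamma> = \<alpha> + \<beta>" "mcoeff f \<alpha> \<noteq> 0" "mcoeff g \<beta> \<noteq> 0" by (auto simp: splits_def)
  then show "i < n" using i keys_add[of \<alpha> \<beta>] that by (blast dest: vars_belowD)
qed

lemma conv_series_common:
  assumes "f \<in> conv_series n" "g \<in> conv_series n"
  obtains r where "r > 0" "abs_conv_at f (\<lambda>_. r)" "abs_conv_at g (\<lambda>_. r)"
proof -
  obtain r s where rs: "r > 0" "abs_conv_at f (\<lambda>_. r)" "s > 0" "abs_conv_at g (\<lambda>_. s)"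
    using assms by (auto simp: conv_series_iff)
  then have "abs_conv_at f (\<lambda>_. min r s)" "abs_conv_at g (\<lambda>_. min r s)"
    using assms by (auto simp: conv_series_iff elim!: abs_conv_at_mono)
  then show ?thesis using rs that[of "min r s"] by simp
qed

lemma conv_series_subring: "is_subring (conv_series n)"
  unfolding is_subring_def
proof (intro conjI ballI)
  show "1 \<in> conv_series n" by (auto simp: conv_series_iff one_eq_const intro: exI[of _ 1])
  fix f g assume fg: "f \<in> conv_series n" "g \<in> conv_series n"
  obtain r where "r > 0" "abs_conv_at f (\<lambda>_. r)" "abs_conv_at g (\<lambda>_. r)" using conv_series_common[OF fg] .
  then show "f - g \<in> conv_series n" "f * g \<in> conv_series n" using fg
    by (auto simp: conv_series_iff intro: vars_below_diff vars_below_mult abs_conv_diff abs_conv_mult)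
qed

text \<open>The neighbourhood filter of 0 inside n-space. The point 0 itself is not removed, so an
  eventual identity may be evaluated at 0, which yields constant coefficients.\<close>

definition near_zero :: "nat \<Rightarrow> (nat \<Rightarrow> real) filter" where
  "near_zero n = (INF r\<in>{0<..}. principal {x \<in> space_n n. \<forall>i<n. \<bar>x i\<bar> < r})"

lemma eventually_near_zero: "eventually P (near_zero n) \<longleftrightarrow> (\<exists>r>0. \<forall>x\<in>space_n n. (\<forall>i<n. \<bar>x i\<bar> < r) \<longrightarrow> P x)"
  unfolding near_zero_def
  by (subst eventually_INF_base) (auto simp: eventually_principal intro!: bexI[of _ "min a b" for a b])

lemma eventually_near_zero_zero: "eventually P (near_zero n) \<Longrightarrow> P (\<lambda>_. 0)"
  by (auto simp: eventually_near_zero space_n_def)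

lemma eventually_near_zero_bound: "r > 0 \<Longrightarrow> eventually (\<lambda>x. x \<in> space_n n \<and> (\<forall>i. \<bar>x i\<bar> < r)) (near_zero n)"
  unfolding eventually_near_zero space_n_def by (rule exI[of _ r]) (auto, metis abs_zero not_less)

lemma represents_iff: "represents n g F \<longleftrightarrow> g \<in> conv_series n \<and> eventually (\<lambda>x. F x = mps_eval g x) (near_zero n)"
  by (simp add: represents_def eventually_near_zero)

lemma conv_series_eventually:
  "f \<in> conv_series n \<Longrightarrow> eventually (\<lambda>x. abs_conv_at f (\<lambda>i. norm (x i))) (near_zero n)"
  by (auto simp: conv_series_def eventually_near_zero abs_conv_at_abs)

text \<open>The identity theorem in the form used throughout: formal identities between series are
  obtained by comparing their values at real points near 0.\<close>

lemma conv_series_eqI: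
  assumes "f \<in> conv_series n" "g \<in> conv_series n" "eventually (\<lambda>x. mps_eval f x = mps_eval g x) (near_zero n)"
  shows "f = g"
proof -
  have "f - g \<in> conv_series n" using conv_series_subring assms by (auto simp: is_subring_def)
  then obtain r where r: "vars_below n (f - g)" "r > 0" "abs_conv_at (f - g) (\<lambda>_. r)" by (auto simp: conv_series_iff)
  have "eventually (\<lambda>x. mps_eval (f - g) x = 0) (near_zero n)"
    using assms(3) conv_series_eventually[OF assms(1)] conv_series_eventually[OF assms(2)]
    by eventually_elim (simp add: mps_eval_diff)
  then obtain s where s: "s > 0" "\<And>x. x \<in> space_n n \<Longrightarrow> \<forall>i<n. \<bar>x i\<bar> < s \<Longrightarrow> mps_eval (f - g) x = 0"
    by (auto simp: eventually_near_zero)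
  let ?t = "min r (s / 2)"
  have "f - g = 0"
  proof (rule mps_eval_zero_imp[OF r(1), of ?t])
    show "abs_conv_at (f - g) (\<lambda>_. ?t)" by (rule abs_conv_at_mono[OF r(1,3)]) (use r s in auto)
    fix x :: "nat \<Rightarrow> real" assume x: "\<forall>i<n. \<bar>x i\<bar> \<le> ?t"
    have "mps_eval (f - g) x = mps_eval (f - g) (\<lambda>i. if i < n then x i else 0)"
      by (rule mps_eval_cong[OF r(1)]) auto
    also have "\<dots> = 0" by (rule s(2)) (use x s(1) in \<open>auto simp: space_n_def\<close>)
    finally show "mps_eval (f - g) x = 0" .
  qed (use r s in auto)
  then show ?thesis by simp
qed

lemma represents_unique: "represents n f F \<Longrightarrow> represents n g F \<Longrightarrow> f = g"
  unfolding represents_iff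
  by (rule conv_series_eqI[of _ n]) (auto elim: eventually_elim2)

lemma expansion_eqI: "represents n g F \<Longrightarrow> expansion n F = g"
  unfolding expansion_def using represents_unique by blast

section \<open>Composition, inversion and translation\<close>

lemma exp_bounded_zero: "0 \<le> M \<Longrightarrow> exp_bounded n \<rho> M (\<lambda>_. 0)"
  using exp_bounded_mono[OF exp_bounded_const[of n \<rho> 0]] by simp

text \<open>The bounds of the inner functions form a polyradius for \<open>f\<close>: a monomial in
  the \<open>h i\<close> has norm at most the same monomial in the \<open>R i\<close>, so absolute
  convergence of \<open>f\<close> at \<open>R\<close> dominates the sum of the norms.\<close>

lemma exp_bounded_compose:
  assumes f: "vars_below m f" "abs_conv_at f R" and R: "\<forall>i<m. 0 \<le> R i" and \<rho>: "\<forall>i<n. 0 < \<rho> i"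
    and h: "\<And>i. i < m \<Longrightarrow> exp_bounded n \<rho> (R i) (h i)"
  obtains M where "exp_bounded n \<rho> M (\<lambda>z. mps_eval f (\<lambda>i. h i z))"
proof -
  have \<rho>0: "\<forall>i<n. 0 \<le> \<rho> i" using \<rho> by (simp add: less_imp_le)
  have "exp_bounded n \<rho> \<bar>mcoeff f \<alpha> * monom_at R \<alpha>\<bar> (\<lambda>z. of_real (mcoeff f \<alpha>) * monom_at (\<lambda>i. h i z) \<alpha>)" for \<alpha>
  proof (cases "mcoeff f \<alpha> = 0")
    case True
    then show ?thesis by (simp add: exp_bounded_zero)
  next
    case False
    note k = vars_belowD[OF f(1) False]
    have "exp_bounded n \<rho> (monom_at R \<alpha>) (\<lambda>z. monom_at (\<lambda>i. h i z) \<alpha>)"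
      unfolding monom_at_def by (intro exp_bounded_prod exp_bounded_power h \<rho>0 k) auto
    from exp_bounded_cmult[OF this \<rho>0, of "of_real (mcoeff f \<alpha>)"]
    show ?thesis using monom_at_nonneg[of \<alpha> R] k R by (simp add: abs_mult)
  qed
  from exp_bounded_infinite_sum[where M = "\<lambda>\<alpha>. \<bar>mcoeff f \<alpha> * monom_at R \<alpha>\<bar>", OF this _ \<rho>] f(2) show ?thesis
    using that by (simp add: mps_eval_def abs_conv_at_def)
qed

text \<open>Neumann series in \<open>F / a\<close>. The bound \<open>M\<close> is smaller than the
  norm of \<open>a\<close> and controls both the norms of the powers and, pointwise, the convergence
  to the quotient.\<close>

lemma exp_bounded_inverse:
  assumes F: "exp_bounded n \<rho> M F" and a: "M < norm a" and \<rho>: "\<forall>i<n. 0 < \<rho> i"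
  obtains M' where "exp_bounded n \<rho> M' (\<lambda>z. 1 / (a - F z))"
proof -
  have \<rho>0: "\<forall>i<n. 0 \<le> \<rho> i" using \<rho> by (simp add: less_imp_le)
  have M: "0 \<le> M" using exp_bounded_nonneg[OF F \<rho>0] .
  have a0: "a \<noteq> 0" using a M by auto
  have 1: "exp_bounded n \<rho> (norm (1 / a) * (norm (1 / a) * M) ^ k) (\<lambda>z. 1 / a * (1 / a * F z) ^ k)" for k
    by (intro exp_bounded_cmult exp_bounded_power F \<rho>0)
  have lt: "norm (1 / a) * M < 1" using a M a0 by (simp add: norm_divide field_simps)
  have "summable (\<lambda>k. norm (1 / a) * (norm (1 / a) * M) ^ k)"
    by (intro summable_mult summable_geometric) (use lt M in \<open>auto simp: abs_mult norm_divide\<close>)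
  then have "(\<lambda>k. norm (1 / a) * (norm (1 / a) * M) ^ k) summable_on UNIV"
    using M by (subst summable_on_UNIV_nonneg_real_iff) auto
  from exp_bounded_infinite_sum[OF 1 this \<rho>]
  have "exp_bounded n \<rho> (infsum (\<lambda>k. norm (1 / a) * (norm (1 / a) * M) ^ k) UNIV) (\<lambda>z. \<Sum>\<^sub>\<infinity>k. 1 / a * (1 / a * F z) ^ k)" .
  then have "exp_bounded n \<rho> (infsum (\<lambda>k. norm (1 / a) * (norm (1 / a) * M) ^ k) UNIV) (\<lambda>z. 1 / (a - F z))"
  proof (rule exp_bounded_cong)
    fix z :: "nat \<Rightarrow> complex" assume z: "\<forall>i<n. norm (z i) \<le> \<rho> i"
    have "norm (F z) < norm a" using exp_bounded_norm_le[OF F z] a by simp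
    then have q: "norm (1 / a * F z) < 1" using a0 by (simp add: norm_divide norm_mult field_simps)
    have "((\<lambda>k. (1 / a * F z) ^ k) has_sum (1 / (1 - 1 / a * F z))) UNIV"
      by (rule norm_summable_imp_has_sum)
        (use q in \<open>auto simp: norm_power intro!: geometric_sums summable_geometric\<close>)
    from has_sum_cmult_right[OF this, of "1 / a"]
    have "((\<lambda>k. 1 / a * (1 / a * F z) ^ k) has_sum (1 / (a - F z))) UNIV"
      using a0 by (simp add: field_simps)
    then show "(\<Sum>\<^sub>\<infinity>k. 1 / a * (1 / a * F z) ^ k) = 1 / (a - F z)" by (rule infsumI)
  qed
  then show ?thesis using that by blast
qed

section \<open>Total degree and shrinking of polydiscs\<close>

definition mdeg :: "multi_index \<Rightarrow> nat" where
  "mdeg \<alpha> = (\<Sum>i\<in>keys \<alpha>. lookup \<alpha> i)"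

lemma mdeg_superset: "finite A \<Longrightarrow> keys \<alpha> \<subseteq> A \<Longrightarrow> mdeg \<alpha> = (\<Sum>i\<in>A. lookup \<alpha> i)"
  unfolding mdeg_def by (rule sum.mono_neutral_left) (auto simp: in_keys_iff)

lemma mdeg_add: "mdeg (\<alpha> + \<beta>) = mdeg \<alpha> + mdeg \<beta>"
proof -
  let ?A = "keys \<alpha> \<union> keys \<beta>"
  have "keys (\<alpha> + \<beta>) \<subseteq> ?A" by (rule keys_add)
  then show ?thesis by (simp add: mdeg_superset[of ?A] lookup_add sum.distrib)
qed

lemma mdeg_0 [simp]: "mdeg 0 = 0" by (simp add: mdeg_def)

lemma mdeg_eq_0_iff: "mdeg \<alpha> = 0 \<longleftrightarrow> \<alpha> = 0"
  by (auto simp: mdeg_def in_keys_iff simp flip: keys_eq_empty)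

lemma lookup_le_mdeg: "lookup \<alpha> i \<le> mdeg \<alpha>"
  by (cases "i \<in> keys \<alpha>") (auto simp: mdeg_def in_keys_iff intro: member_le_sum)

lemma finite_mdeg_le: "finite {\<alpha>. keys \<alpha> \<subseteq> {..<n} \<and> mdeg \<alpha> \<le> d}"
proof -
  let ?F = "{u. \<forall>i. (i \<in> {..<n} \<longrightarrow> u i \<in> {..d}) \<and> (i \<notin> {..<n} \<longrightarrow> u i = (0::nat))}"
  have F: "finite ?F" by (rule finite_set_of_finite_funs) auto
  have "finite (lookup -` ?F)"
    by (rule finite_vimageI[OF F]) (simp add: inj_on_def lookup_inject)
  then show ?thesis
    by (rule finite_subset[rotated]) (auto simp: in_keys_iff intro: order_trans[OF lookup_le_mdeg])
qed

lemma monom_at_scale: "monom_at (\<lambda>i. t * x i) \<alpha> = t ^ mdeg \<alpha> * monom_at x \<alpha>"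
  by (simp add: monom_at_def mdeg_def power_mult_distrib prod.distrib power_sum)

lemma monom_at_zero: "\<alpha> \<noteq> 0 \<Longrightarrow> monom_at (\<lambda>_. 0) \<alpha> = 0"
  using monom_at_scale[of 0 "\<lambda>_. 0" \<alpha>] mdeg_eq_0_iff[of \<alpha>] by (simp add: power_0_left)

text \<open>Vanishing at 0 means that every term has degree at least 1, so multiplying the
  polyradius by \<open>t\<close> not exceeding 1 multiplies the norm by at most
  \<open>t\<close>.\<close>

lemma exp_bounded_small:
  assumes F: "exp_bounded n \<rho> M F" and F0: "F (\<lambda>_. 0) = 0" and e: "e > 0" and \<rho>: "\<forall>i<n. 0 < \<rho> i"
  obtains t where "0 < t" "t \<le> 1" "exp_bounded n (\<lambda>i. t * \<rho> i) e F"
proof -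
  have \<rho>0: "\<forall>i<n. 0 \<le> \<rho> i" using \<rho> by (simp add: less_imp_le)
  obtain c where c: "has_expansion n \<rho> c F" using F by (auto simp: exp_bounded_def)
  have sb: "supp_below n c" using c by (simp add: has_expansion_def)
  have "((\<lambda>\<alpha>. c \<alpha> * monom_at (\<lambda>_. 0) \<alpha>) has_sum 0) UNIV"
    using c \<rho>0 unfolding has_expansion_def by (metis F0 norm_zero)
  moreover have "((\<lambda>\<alpha>. c \<alpha> * monom_at (\<lambda>_. 0) \<alpha>) has_sum c 0) UNIV"
    by (rule has_sum_finite_neutralI[of "{0}"]) (auto simp: monom_at_zero)
  ultimately have c0: "c 0 = 0" using has_sum_unique by blast
  define w where "w = weighted_norm \<rho> c"
  have w: "w \<ge> 0" unfolding w_def by (rule weighted_norm_nonneg[OF sb \<rho>0])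
  \<comment> \<open>The summand 1 in the denominator covers the case \<open>w = 0\<close>.\<close>
  define t where "t = min 1 (e / (w + 1))"
  have t: "0 < t" "t \<le> 1" "t * w \<le> e" using e w
    by (auto simp: t_def min_def field_simps)
  have \<rho>t: "\<forall>i<n. 0 \<le> t * \<rho> i" using \<rho>0 t by simp
  have S: "(\<lambda>\<alpha>. norm (c \<alpha>) * monom_at \<rho> \<alpha>) summable_on UNIV" using c by (simp add: has_expansion_def)
  have le: "norm (c \<alpha>) * monom_at (\<lambda>i. t * \<rho> i) \<alpha> \<le> t * (norm (c \<alpha>) * monom_at \<rho> \<alpha>)" for \<alpha>
  proof (cases "\<alpha> = 0")
    case False
    then have "t ^ mdeg \<alpha> \<le> t ^ 1" using t mdeg_eq_0_iff[of \<alpha>] by (intro power_decreasing) auto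
    then have "t ^ mdeg \<alpha> * (norm (c \<alpha>) * monom_at \<rho> \<alpha>) \<le> t * (norm (c \<alpha>) * monom_at \<rho> \<alpha>)"
      using wterm_nonneg[OF sb \<rho>0, of \<alpha>] by (intro mult_right_mono) auto
    then show ?thesis by (simp add: monom_at_scale mult_ac)
  qed (simp add: c0)
  have S': "(\<lambda>\<alpha>. norm (c \<alpha>) * monom_at (\<lambda>i. t * \<rho> i) \<alpha>) summable_on UNIV"
    by (rule summable_on_comparison_test[OF summable_on_cmult_right[OF S] le]) (rule wterm_nonneg[OF sb \<rho>t])
  have "weighted_norm (\<lambda>i. t * \<rho> i) c \<le> infsum (\<lambda>\<alpha>. t * (norm (c \<alpha>) * monom_at \<rho> \<alpha>)) UNIV"
    unfolding weighted_norm_def by (rule infsum_mono[OF S' summable_on_cmult_right[OF S] le])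
  also have "\<dots> = t * w" using S by (simp add: infsum_cmult_right w_def weighted_norm_def)
  also have "\<dots> \<le> e" by fact
  finally have we: "weighted_norm (\<lambda>i. t * \<rho> i) c \<le> e" .
  have "has_expansion n (\<lambda>i. t * \<rho> i) c F"
    unfolding has_expansion_def
  proof (intro conjI allI impI sb S')
    fix z :: "nat \<Rightarrow> complex" assume z: "\<forall>i<n. norm (z i) \<le> t * \<rho> i"
    have "t * \<rho> i \<le> \<rho> i" if "i < n" for i
      using t \<rho>0 that mult_right_mono[of t 1 "\<rho> i"] by simp
    then have "\<forall>i<n. norm (z i) \<le> \<rho> i" using z by (meson order_trans)
    then show "((\<lambda>\<alpha>. c \<alpha> * monom_at z \<alpha>) has_sum F z) UNIV" using c by (simp add: has_expansion_def)
  qed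
  then show ?thesis using that t we by (auto simp: exp_bounded_def)
qed

lemma conv_seriesI:
  assumes "vars_below n f" "abs_conv_at f \<rho>" "\<forall>i<n. 0 < \<rho> i"
  shows "f \<in> conv_series n"
proof -
  \<comment> \<open>The inserted 1 only keeps the minimum defined when \<open>n = 0\<close>.\<close>
  define r where "r = Min (insert 1 (\<rho> ` {..<n}))"
  have "r > 0" using assms(3) by (auto simp: r_def)
  moreover have "r \<le> \<rho> i" if "i < n" for i unfolding r_def using that by (intro Min_le) auto
  ultimately have "abs_conv_at f (\<lambda>_. r)" using assms(3)
    by (intro abs_conv_at_mono[OF assms(1,2)]) (fastforce simp: less_imp_le)
  then show ?thesis using assms(1) \<open>r > 0\<close> by (auto simp: conv_series_iff)
qed

lemma exp_bounded_Re_mps: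
  assumes "exp_bounded n \<rho> M F" "\<forall>i<n. 0 < \<rho> i"
  obtains f where "f \<in> conv_series n" "abs_conv_at f \<rho>"
    "\<And>x. \<forall>i<n. \<bar>x i\<bar> \<le> \<rho> i \<Longrightarrow> mps_eval f x = Re (F (\<lambda>i. of_real (x i)))"
proof -
  obtain c where c: "has_expansion n \<rho> c F" using assms by (auto simp: exp_bounded_def)
  have "\<forall>i<n. 0 \<le> \<rho> i" using assms by (simp add: less_imp_le)
  from expansion_Re_mps[OF c this] show ?thesis using that conv_seriesI assms(2) by blast
qed

lemma exp_bounded_Im_mps:
  assumes "exp_bounded n \<rho> M F" "\<forall>i<n. 0 < \<rho> i"
  obtains f where "f \<in> conv_series n" "abs_conv_at f \<rho>"
    "\<And>x. \<forall>i<n. \<bar>x i\<bar> \<le> \<rho> i \<Longrightarrow> mps_eval f x = Im (F (\<lambda>i. of_real (x i)))"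
proof -
  obtain c where c: "has_expansion n \<rho> c F" using assms by (auto simp: exp_bounded_def)
  have "\<forall>i<n. 0 \<le> \<rho> i" using assms by (simp add: less_imp_le)
  from expansion_Im_mps[OF c this] show ?thesis using that conv_seriesI assms(2) by blast
qed

lemma eventually_near_zero_box:
  assumes "\<forall>i<n. 0 < \<rho> i"
  shows "eventually (\<lambda>x. x \<in> space_n n \<and> (\<forall>i<n. \<bar>x i\<bar> < \<rho> i)) (near_zero n)"
proof -
  define r where "r = Min (insert 1 (\<rho> ` {..<n}))"
  have "r > 0" using assms by (auto simp: r_def)
  moreover have "r \<le> \<rho> i" if "i < n" for i unfolding r_def using that by (intro Min_le) auto
  ultimately show ?thesis unfolding eventually_near_zero by (intro exI[of _ r]) fastforce
qed

text \<open>A holomorphic function that is real on real points has real coefficients, so the identity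
  with its series persists at complex points.\<close>

lemma exp_bounded_real_mps:
  assumes F: "exp_bounded n \<rho> M F" and \<rho>: "\<forall>i<n. 0 < \<rho> i"
    and re: "\<And>x. \<forall>i<n. \<bar>x i\<bar> \<le> \<rho> i \<Longrightarrow> Im (F (\<lambda>i. of_real (x i))) = 0"
  obtains f where "f \<in> conv_series n" "abs_conv_at f \<rho>"
    "\<And>z. \<forall>i<n. cmod (z i) \<le> \<rho> i \<Longrightarrow> mps_eval f z = F z"
proof -
  have \<rho>0: "\<forall>i<n. 0 \<le> \<rho> i" using \<rho> by (simp add: less_imp_le)
  obtain c where c: "has_expansion n \<rho> c F" using F by (auto simp: exp_bounded_def)
  note R = expansion_Re_mps[OF c \<rho>0] and I = expansion_Im_mps[OF c \<rho>0]
  have "MPS (Im \<circ> c) = 0"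
  proof (rule conv_series_eqI[of _ n])
    show "MPS (Im \<circ> c) \<in> conv_series n" using conv_seriesI[OF I(1,2) \<rho>] .
    show "0 \<in> conv_series n" by (auto simp: conv_series_iff zero_eq_const intro: exI[of _ 1])
    show "eventually (\<lambda>x. mps_eval (MPS (Im \<circ> c)) x = mps_eval 0 x) (near_zero n)"
      using eventually_near_zero_box[OF \<rho>] by eventually_elim (use I(3) re in \<open>auto simp: less_imp_le\<close>)
  qed
  then have "Im (c \<alpha>) = 0" for \<alpha> by (metis comp_apply mcoeff_0 mps.sel)
  then have cR: "c \<alpha> = of_real (Re (c \<alpha>))" for \<alpha> by (simp add: complex_eq_iff)
  show ?thesis
  proof (rule that)
    show "MPS (Re \<circ> c) \<in> conv_series n" using conv_seriesI[OF R(1,2) \<rho>] .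
    show "abs_conv_at (MPS (Re \<circ> c)) \<rho>" by (rule R(2))
    fix z assume "\<forall>i<n. cmod (z i) \<le> \<rho> i"
    from has_expansion_infsum[OF c this] show "mps_eval (MPS (Re \<circ> c)) z = F z"
      using cR by (simp add: mps_eval_def)
  qed
qed

text \<open>The sides of the boxes may be infinite. Choosing real numbers strictly between the
  coordinates of the point and the sides gives a finite polyradius at which \<open>f\<close> still
  converges absolutely; this is the form needed for estimates.\<close>

lemma conv_domain_iff:
  "a \<in> conv_domain n f \<longleftrightarrow> a \<in> space_n n \<and> vars_below n f \<and> (\<exists>\<rho>. (\<forall>i<n. \<bar>a i\<bar> < \<rho> i) \<and> abs_conv_at f \<rho>)"
  if f: "vars_below n f"
proof
  assume "a \<in> conv_domain n f"
  then obtain R where R: "\<And>i. i < n \<Longrightarrow> 0 < R i" "\<And>x. x \<in> open_box n R \<Longrightarrow> abs_conv_at f x" "a \<in> open_box n R"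
    by (auto simp: conv_domain_def)
  then have a: "a \<in> space_n n" "\<And>i. i < n \<Longrightarrow> ereal \<bar>a i\<bar> < R i" by (auto simp: open_box_def)
  have "\<exists>s. \<bar>a i\<bar> < s \<and> ereal s < R i" if "i < n" for i
    using ereal_dense2[OF a(2)[OF that]] by auto
  then obtain s where s: "\<And>i. i < n \<Longrightarrow> \<bar>a i\<bar> < s i \<and> ereal (s i) < R i" by metis
  define \<rho> where "\<rho> = (\<lambda>i. if i < n then s i else 0)"
  have "\<bar>s i\<bar> = s i" if "i < n" for i using s[OF that] by linarith
  then have "\<rho> \<in> open_box n R" using s by (auto simp: open_box_def \<rho>_def space_n_def)
  from R(2)[OF this] show "a \<in> space_n n \<and> vars_below n f \<and> (\<exists>\<rho>. (\<forall>i<n. \<bar>a i\<bar> < \<rho> i) \<and> abs_conv_at f \<rho>)"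
    using a(1) s f by (auto simp: \<rho>_def intro!: exI[of _ \<rho>])
next
  assume "a \<in> space_n n \<and> vars_below n f \<and> (\<exists>\<rho>. (\<forall>i<n. \<bar>a i\<bar> < \<rho> i) \<and> abs_conv_at f \<rho>)"
  then obtain \<rho> where a: "a \<in> space_n n" and r: "\<And>i. i < n \<Longrightarrow> \<bar>a i\<bar> < \<rho> i" "abs_conv_at f \<rho>" by auto
  have pos: "0 < \<rho> i" if "i < n" for i using r(1)[OF that] by simp
  have "\<forall>x\<in>open_box n (\<lambda>i. ereal (\<rho> i)). abs_conv_at f x"
  proof
    fix x assume "x \<in> open_box n (\<lambda>i. ereal (\<rho> i))"
    then have "\<And>i. i < n \<Longrightarrow> \<bar>x i\<bar> \<le> \<bar>\<rho> i\<bar>" using pos by (force simp: open_box_def)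
    then show "abs_conv_at f x" by (rule abs_conv_at_mono[OF f r(2)])
  qed
  moreover have "a \<in> open_box n (\<lambda>i. ereal (\<rho> i))" using a r(1) by (simp add: open_box_def)
  ultimately show "a \<in> conv_domain n f" unfolding conv_domain_def using pos by (intro UnionI CollectI exI conjI) auto
qed

text \<open>The function \<open>a i + z i\<close> has norm at most the absolute value of
  \<open>a i\<close> plus its radius, which explains the radius of the translate. The identity is
  stated at complex points because translation has to commute with complexification later
  on.\<close>

lemma mps_translate_conv:
  assumes f: "vars_below n f" and a: "a \<in> space_n n" and \<rho>: "\<forall>i<n. \<bar>a i\<bar> < \<rho> i" "abs_conv_at f \<rho>"
  shows "mps_translate n f a \<in> conv_series n" "abs_conv_at (mps_translate n f a) (\<lambda>i. \<rho> i - \<bar>a i\<bar>)"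
    "\<And>z. \<forall>i<n. cmod (z i) \<le> \<rho> i - \<bar>a i\<bar> \<Longrightarrow>
       mps_eval (mps_translate n f a) z = mps_eval f (\<lambda>i. of_real (a i) + z i)"
proof -
  define \<rho>' where "\<rho>' = (\<lambda>i. \<rho> i - \<bar>a i\<bar>)"
  have \<rho>': "\<forall>i<n. 0 < \<rho>' i" using \<rho> by (simp add: \<rho>'_def)
  have \<rho>'0: "\<forall>i<n. 0 \<le> \<rho>' i" using \<rho>' by (simp add: less_imp_le)
  have "exp_bounded n \<rho>' (\<rho> i) (\<lambda>z. of_real (a i) + z i)" if "i < n" for i
    using exp_bounded_add[OF exp_bounded_const[of n \<rho>' "of_real (a i)"] exp_bounded_var[OF that] \<rho>'0] by (simp add: \<rho>'_def)
  moreover have "\<forall>i<n. 0 \<le> \<rho> i" using \<rho>(1) by force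
  ultimately obtain M where M: "exp_bounded n \<rho>' M (\<lambda>z. mps_eval f (\<lambda>i. of_real (a i) + z i))"
    using exp_bounded_compose[OF f \<rho>(2) _ \<rho>', of "\<lambda>i z. of_real (a i) + z i"] by blast
  have re: "mps_eval f (\<lambda>i. of_real (a i) + complex_of_real (x i)) = of_real (mps_eval f (\<lambda>i. a i + x i))" for x
    using mps_eval_of_real[of f "\<lambda>i. a i + x i"] by simp
  obtain g where g: "g \<in> conv_series n" "abs_conv_at g \<rho>'"
    "\<And>z. \<forall>i<n. cmod (z i) \<le> \<rho>' i \<Longrightarrow> mps_eval g z = mps_eval f (\<lambda>i. of_real (a i) + z i)"
    using exp_bounded_real_mps[OF M \<rho>'] re by (metis Im_complex_of_real)
  have "mps_translate n f a = g" unfolding mps_translate_def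
  proof (rule expansion_eqI, unfold represents_iff, safe)
    show "eventually (\<lambda>x. mps_eval f (\<lambda>i. a i + x i) = mps_eval g x) (near_zero n)"
      using eventually_near_zero_box[OF \<rho>']
    proof eventually_elim
      case (elim x)
      then have "mps_eval g (\<lambda>i. complex_of_real (x i)) = mps_eval f (\<lambda>i. of_real (a i) + complex_of_real (x i))"
        by (intro g(3)) (auto simp: less_imp_le)
      then show ?case unfolding re mps_eval_of_real by simp
    qed
  qed fact
  then show "mps_translate n f a \<in> conv_series n" "abs_conv_at (mps_translate n f a) (\<lambda>i. \<rho> i - \<bar>a i\<bar>)"
    "\<And>z. \<forall>i<n. cmod (z i) \<le> \<rho> i - \<bar>a i\<bar> \<Longrightarrow>
       mps_eval (mps_translate n f a) z = mps_eval f (\<lambda>i. of_real (a i) + z i)"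
    using g by (simp_all add: \<rho>'_def)
qed

lemma conv_series_exp_bounded:
  assumes "f \<in> conv_series n"
  obtains r M where "0 < r" "abs_conv_at f (\<lambda>_. r)" "exp_bounded n (\<lambda>_. r) M (mps_eval f)"
proof -
  obtain r where "r > 0" "vars_below n f" "abs_conv_at f (\<lambda>_. r)" using assms by (auto simp: conv_series_iff)
  then show ?thesis using mps_exp_bounded[of n f "\<lambda>_. r"] that by (metis less_imp_le)
qed

lemma mps_eval_at_0: "mps_eval f (\<lambda>_. 0) = of_real (mcoeff f 0)"
  unfolding mps_eval_def by (rule infsumI, rule has_sum_finite_neutralI[of "{0}"]) (auto simp: monom_at_zero)

lemma mps_inverse_conv:
  assumes f: "f \<in> conv_series n" "mcoeff f 0 \<noteq> 0"
  shows "mps_inverse f \<in> conv_series n" "f * mps_inverse f = 1"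
proof -
  obtain r M where r: "0 < r" "abs_conv_at f (\<lambda>_. r)" "exp_bounded n (\<lambda>_. r) M (mps_eval f)"
    using conv_series_exp_bounded[OF f(1)] .
  define a where "a = complex_of_real (mcoeff f 0)"
  have a: "cmod a > 0" using f(2) by (simp add: a_def)
  have "exp_bounded n (\<lambda>_. r) (cmod a + M) (\<lambda>z. a - mps_eval f z)"
    by (rule exp_bounded_diff[OF exp_bounded_const r(3)]) (use r in auto)
  \<comment> \<open>On this polydisc \<open>f\<close> deviates from its constant term
    \<open>a\<close> by at most half of its size, so the geometric series for
    \<open>f = a - (a - f)\<close> applies.\<close>
  then obtain t where t: "0 < t" "t \<le> 1" "exp_bounded n (\<lambda>i. t * r) (cmod a / 2) (\<lambda>z. a - mps_eval f z)"
    by (rule exp_bounded_small[where e = "cmod a / 2"]) (use r a in \<open>auto simp: mps_eval_at_0 a_def\<close>)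
  have tr: "\<forall>i<n. 0 < t * r" using t r by simp
  obtain M' where M': "exp_bounded n (\<lambda>i. t * r) M' (\<lambda>z. 1 / (a - (a - mps_eval f z)))"
  proof (rule exp_bounded_inverse[OF t(3) _ tr])
    show "cmod a / 2 < cmod a" using a by simp
  qed
  obtain g where g: "g \<in> conv_series n" "abs_conv_at g (\<lambda>_. t * r)"
    "\<And>x. \<forall>i<n. \<bar>x i\<bar> \<le> t * r \<Longrightarrow> mps_eval g x = Re (1 / (a - (a - mps_eval f (\<lambda>i. of_real (x i)))))"
    using exp_bounded_Re_mps[OF M' tr] by blast
  have bnd: "exp_bounded n (\<lambda>i. t * r) (cmod a / 2) (\<lambda>z. a - mps_eval f z)" by fact
  have "f * g = 1"
  proof (rule conv_series_eqI[of _ n])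
    show "f * g \<in> conv_series n" "1 \<in> conv_series n" using conv_series_subring f(1) g(1) by (auto simp: is_subring_def)
    show "eventually (\<lambda>x. mps_eval (f * g) x = mps_eval 1 x) (near_zero n)"
      using eventually_near_zero_box[OF tr] conv_series_eventually[OF f(1)] conv_series_eventually[OF g(1)]
    proof eventually_elim
      case (elim x)
      then have x: "\<forall>i<n. \<bar>x i\<bar> \<le> t * r" by (auto simp: less_imp_le)
      have "cmod (a - mps_eval f (\<lambda>i. of_real (x i))) \<le> cmod a / 2"
        using exp_bounded_norm_le[OF bnd, of "\<lambda>i. of_real (x i)"] x by simp
      then have "mps_eval f (\<lambda>i. complex_of_real (x i)) \<noteq> 0" using a by auto
      then have nz: "mps_eval f x \<noteq> 0" by (simp add: mps_eval_of_real)
      have "mps_eval g x = 1 / mps_eval f x" using g(3)[OF x] by (simp add: mps_eval_of_real)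
      then show ?case using elim nz by (simp add: mps_eval_mult)
    qed
  qed
  moreover from this have "h = g" if "f * h = 1" for h
    using that by (metis mult.assoc mult.commute mult.right_neutral)
  ultimately have "mps_inverse f = g" unfolding mps_inverse_def by (intro the_equality)
  then show "mps_inverse f \<in> conv_series n" "f * mps_inverse f = 1" using g \<open>f * g = 1\<close> by auto
qed

lemma mps_permute_simps:
  assumes "\<sigma> permutes {..<n}"
  shows "vars_below n f \<Longrightarrow> vars_below n (mps_permute \<sigma> f)"
    "mps_eval (mps_permute \<sigma> f) x = mps_eval f (\<lambda>i. x (\<sigma> i))"
    "abs_conv_at (mps_permute \<sigma> f) y \<longleftrightarrow> abs_conv_at f (\<lambda>i. y (\<sigma> i))"
proof -
  have bij: "bij \<sigma>" and inj: "inj \<sigma>" and surj: "surj \<sigma>"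
    using permutes_bij[OF assms] by (auto simp: bij_def)
  have inj': "inj (inv \<sigma>)" using bij by (simp add: bij_imp_bij_inv bij_is_inj)
  note lk = map_key.rep_eq[OF inj] map_key.rep_eq[OF inj']
  have bb: "bij_betw (Poly_Mapping.map_key \<sigma>) UNIV (UNIV :: multi_index set)"
    by (rule bij_betwI[where g = "Poly_Mapping.map_key (inv \<sigma>)"])
      (auto intro!: poly_mapping_eqI simp: lk inj surj surj_f_inv_f[OF surj])
  have mon: "monom_at x \<alpha> = monom_at (\<lambda>i. x (\<sigma> i)) (Poly_Mapping.map_key \<sigma> \<alpha>)" for x :: "nat \<Rightarrow> 'b::real_normed_field" and \<alpha>
  proof -
    have "keys (Poly_Mapping.map_key \<sigma> \<alpha>) = \<sigma> -` keys \<alpha>"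
      by (auto simp: in_keys_iff lk)
    then have k: "\<sigma> ` keys (Poly_Mapping.map_key \<sigma> \<alpha>) = keys \<alpha>"
      using surj by (simp add: surj_image_vimage_eq)
    show ?thesis unfolding monom_at_def k[symmetric]
      by (subst prod.reindex) (auto simp: lk inj_on_subset[OF inj])
  qed
  show "mps_eval (mps_permute \<sigma> f) x = mps_eval f (\<lambda>i. x (\<sigma> i))"
    unfolding mps_eval_def mps_permute_def mps.sel
    by (subst infsum_reindex_bij_betw[OF bb, of "\<lambda>\<alpha>. of_real (mcoeff f \<alpha>) * monom_at (\<lambda>i. x (\<sigma> i)) \<alpha>", symmetric])
      (simp add: mon[symmetric])
  show "abs_conv_at (mps_permute \<sigma> f) y \<longleftrightarrow> abs_conv_at f (\<lambda>i. y (\<sigma> i))"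
    unfolding abs_conv_at_def mps_permute_def mps.sel
    by (subst summable_on_reindex_bij_betw[OF bb, of "\<lambda>\<alpha>. \<bar>mcoeff f \<alpha> * monom_at (\<lambda>i. y (\<sigma> i)) \<alpha>\<bar>", symmetric])
      (simp add: mon[symmetric])
  assume f: "vars_below n f"
  show "vars_below n (mps_permute \<sigma> f)"
    unfolding vars_below_def
  proof safe
    fix \<alpha> i assume a: "mcoeff (mps_permute \<sigma> f) \<alpha> \<noteq> 0" and i: "i \<in> keys \<alpha>"
    obtain j where j: "i = \<sigma> j" using surj by (metis surjD)
    then have "j \<in> keys (Poly_Mapping.map_key \<sigma> \<alpha>)" using i by (simp add: in_keys_iff lk)
    then have "j < n" using vars_belowD[OF f, of "Poly_Mapping.map_key \<sigma> \<alpha>"] a by (simp add: mps_permute_def)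
    then show "i < n" using j permutes_in_image[OF assms, of j] by simp
  qed
qed

lemma mps_permute_conv:
  assumes "\<sigma> permutes {..<n}" "f \<in> conv_series n"
  shows "mps_permute \<sigma> f \<in> conv_series n"
  using assms mps_permute_simps[OF assms(1), of f] by (auto simp: conv_series_iff)

lemma monom_at_upd_0:
  "monom_at (x(i := 0)) \<alpha> = (if lookup \<alpha> i = 0 then monom_at x \<alpha> else 0)"
proof (cases "lookup \<alpha> i = 0")
  case True
  then show ?thesis using monom_at_fun_upd[of \<alpha> i x 0 0] by simp
next
  case False
  then show ?thesis by (auto simp: monom_at_def in_keys_iff intro!: prod_zero bexI[of _ i])
qed

lemma mps_eval_set_zero: "mps_eval (mps_set_zero i f) x = mps_eval f (x(i := 0))"
  unfolding mps_eval_def by (rule infsum_cong) (auto simp: mps_set_zero_def monom_at_upd_0)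

lemma abs_conv_set_zero: "abs_conv_at f x \<Longrightarrow> abs_conv_at (mps_set_zero i f) x"
  unfolding abs_conv_at_def
  by (rule summable_on_comparison_test[of "\<lambda>\<alpha>. \<bar>mcoeff f \<alpha> * monom_at x \<alpha>\<bar>"]) (auto simp: mps_set_zero_def)

lemma set_zero_conv:
  assumes "f \<in> conv_series (Suc n)"
  shows "mps_set_zero n f \<in> conv_series n"
proof -
  have "vars_below n (mps_set_zero n f)"
    unfolding vars_below_def
  proof safe
    fix \<alpha> i assume a: "mcoeff (mps_set_zero n f) \<alpha> \<noteq> 0" and i: "i \<in> keys \<alpha>"
    then have "lookup \<alpha> n = 0" "mcoeff f \<alpha> \<noteq> 0" by (auto simp: mps_set_zero_def split: if_splits)
    then have "i \<noteq> n" "i < Suc n" using i assms vars_belowD[of "Suc n" f \<alpha> i] by (auto simp: in_keys_iff conv_series_iff)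
    then show "i < n" by simp
  qed
  then show ?thesis using assms abs_conv_set_zero by (auto simp: conv_series_iff)
qed

section \<open>Differentiation and integration\<close>

lemma vars_below_deriv:
  assumes "vars_below n f"
  shows "vars_below n (mps_deriv i f)"
  unfolding vars_below_def
proof safe
  fix \<alpha> k assume "mcoeff (mps_deriv i f) \<alpha> \<noteq> 0" and k: "k \<in> keys \<alpha>"
  then have "mcoeff f (\<alpha> + single i 1) \<noteq> 0" by (simp add: mps_deriv_def)
  moreover have "k \<in> keys (\<alpha> + single i 1)" using k by (simp add: in_keys_iff lookup_add)
  ultimately show "k < n" using vars_belowD[OF assms] by blast
qed

text \<open>The factor \<open>j + 1\<close> from differentiation is absorbed by a strictly smaller
  radius in the one variable concerned, since \<open>(j + 1) * q ^ j\<close> is bounded for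
  \<open>q = s / \<rho> i < 1\<close>.\<close>

lemma abs_conv_deriv:
  assumes f: "abs_conv_at f \<rho>" and \<rho>: "\<forall>j. 0 \<le> \<rho> j" and s: "0 \<le> s" "s < \<rho> i"
  shows "abs_conv_at (mps_deriv i f) (\<rho>(i := s))"
proof -
  define q where "q = s / \<rho> i"
  have q: "0 \<le> q" "q < 1" "s = q * \<rho> i" using s by (auto simp: q_def)
  have "(\<lambda>j. real (Suc j) * q ^ j) \<longlonglongrightarrow> 0"
  proof -
    have "summable (\<lambda>j. diffs (\<lambda>_. 1) j * q ^ j)"
      by (rule termdiff_converges[of q 1]) (use q in \<open>auto intro: summable_geometric\<close>)
    then have "summable (\<lambda>j. real (Suc j) * q ^ j)" by (simp add: diffs_def)
    then show ?thesis by (rule summable_LIMSEQ_zero)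
  qed
  then have "Bseq (\<lambda>j. real (Suc j) * q ^ j)" by (intro convergent_imp_Bseq) (auto simp: convergent_def)
  then obtain K where K0: "K > 0" "\<forall>j. norm (real (Suc j) * q ^ j) \<le> K" by (rule BseqE)
  have K: "real (Suc j) * q ^ j \<le> K" for j using K0(2) by (metis abs_le_D1 real_norm_def)
  let ?e = "single i (1::nat)"
  have "(\<lambda>\<alpha>. \<bar>mcoeff f \<alpha> * monom_at \<rho> \<alpha>\<bar>) summable_on (\<lambda>\<alpha>. \<alpha> + ?e) ` UNIV"
    using f unfolding abs_conv_at_def by (rule summable_on_subset_banach) auto
  then have "(\<lambda>\<alpha>. \<bar>mcoeff f (\<alpha> + ?e) * monom_at \<rho> (\<alpha> + ?e)\<bar>) summable_on UNIV"
    by (subst (asm) summable_on_reindex) (auto simp: o_def)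
  then have S: "(\<lambda>\<alpha>. K / \<rho> i * \<bar>mcoeff f (\<alpha> + ?e) * monom_at \<rho> (\<alpha> + ?e)\<bar>) summable_on UNIV"
    by (rule summable_on_cmult_right)
  show ?thesis unfolding abs_conv_at_def
  proof (rule summable_on_comparison_test[OF S])
    fix \<alpha> :: "multi_index"
    let ?k = "lookup \<alpha> i"
    have d: "\<alpha> - single i ?k + single i ?k = \<alpha>"
      by (auto simp: lookup_add lookup_minus lookup_single when_def intro!: poly_mapping_eqI)
    have l0: "lookup (\<alpha> - single i ?k) i = 0" by (simp add: lookup_minus)
    have m1: "monom_at (\<rho>(i := s)) \<alpha> = monom_at \<rho> (\<alpha> - single i ?k) * s ^ ?k"
      using monom_at_fun_upd[OF l0, of \<rho> s ?k] d by simp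
    have m2: "monom_at \<rho> (\<alpha> + ?e) = monom_at \<rho> (\<alpha> - single i ?k) * \<rho> i ^ ?k * \<rho> i"
      using monom_at_fun_upd[OF l0, of \<rho> "\<rho> i" ?k] d by (simp add: monom_at_add)
    let ?A = "monom_at \<rho> (\<alpha> - single i ?k)"
    have A: "0 \<le> ?A" using \<rho> by (simp add: monom_at_nonneg)
    have "\<bar>mcoeff (mps_deriv i f) \<alpha> * monom_at (\<rho>(i := s)) \<alpha>\<bar> =
        (real (Suc ?k) * q ^ ?k) * (\<bar>mcoeff f (\<alpha> + ?e)\<bar> * ?A * \<rho> i ^ ?k)"
      unfolding m1 using q(1,3) A \<rho> by (simp add: mps_deriv_def abs_mult power_mult_distrib mult_ac del: of_nat_Suc)
    also have "\<dots> \<le> K * (\<bar>mcoeff f (\<alpha> + ?e)\<bar> * ?A * \<rho> i ^ ?k)"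
      using K[of ?k] A \<rho> by (intro mult_right_mono) auto
    also have "\<dots> = K / \<rho> i * \<bar>mcoeff f (\<alpha> + ?e) * monom_at \<rho> (\<alpha> + ?e)\<bar>"
      unfolding m2 using s A \<rho> by (simp add: abs_mult)
    finally show "\<bar>mcoeff (mps_deriv i f) \<alpha> * monom_at (\<rho>(i := s)) \<alpha>\<bar> \<le> K / \<rho> i * \<bar>mcoeff f (\<alpha> + ?e) * monom_at \<rho> (\<alpha> + ?e)\<bar>" .
  qed auto
qed

lemma deriv_conv_series:
  assumes "f \<in> conv_series n"
  shows "mps_deriv i f \<in> conv_series n"
proof -
  obtain r where r: "r > 0" "vars_below n f" "abs_conv_at f (\<lambda>_. r)" using assms by (auto simp: conv_series_iff)
  have "abs_conv_at (mps_deriv i f) ((\<lambda>_. r)(i := r / 2))" by (rule abs_conv_deriv) (use r in auto)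
  then show ?thesis by (rule conv_seriesI[OF vars_below_deriv[OF r(2)]]) (use r in auto)
qed

text \<open>With the other arguments frozen, \<open>f\<close> is an ordinary power series in
  \<open>z\<close> whose coefficients are the values of the slices, and such a series is
  differentiated term by term.\<close>

lemma mps_eval_has_deriv:
  fixes x :: "nat \<Rightarrow> 'a::{real_normed_field,banach}"
  assumes f: "vars_below n f" "abs_conv_at f \<rho>" and \<rho>: "\<forall>j. 0 \<le> \<rho> j"
    and x: "\<And>j. j < n \<Longrightarrow> j \<noteq> i \<Longrightarrow> norm (x j) \<le> \<rho> j" and z: "norm z < \<rho> i"
  shows "((\<lambda>z. mps_eval f (x(i := z))) has_field_derivative mps_eval (mps_deriv i f) (x(i := z))) (at z)"
proof -
  define c where "c = (\<lambda>j. mps_eval (mps_slice i j f) x)"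
  have sums: "(\<lambda>j. c j * w ^ j) sums mps_eval f (x(i := w))" if "norm w \<le> \<rho> i" for w
  proof -
    have "abs_conv_at f (\<lambda>j. norm ((x(i := w)) j))"
      by (rule abs_conv_at_mono[OF f]) (use x that \<rho> in auto)
    from slice_sums[of f "x(i := w)" i, OF this] show ?thesis by (simp add: c_def)
  qed
  have sums': "(\<lambda>j. diffs c j * z ^ j) sums mps_eval (mps_deriv i f) (x(i := z))"
  proof -
    have "abs_conv_at (mps_deriv i f) (\<rho>(i := norm z))" by (rule abs_conv_deriv[OF f(2) \<rho>]) (use z in auto)
    then have "abs_conv_at (mps_deriv i f) (\<lambda>j. norm ((x(i := z)) j))"
      by (rule abs_conv_at_mono[OF vars_below_deriv[OF f(1)]]) (use x \<rho> in auto)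
    from slice_sums[of "mps_deriv i f" "x(i := z)" i, OF this]
    have 1: "(\<lambda>j. mps_eval (mps_slice i j (mps_deriv i f)) x * z ^ j) sums mps_eval (mps_deriv i f) (x(i := z))"
      by simp
    have "mps_eval (mps_slice i j (mps_deriv i f)) x = of_nat (Suc j) * c (Suc j)" for j
    proof -
      have "mcoeff (mps_slice i j (mps_deriv i f)) \<alpha> = real (Suc j) * mcoeff (mps_slice i (Suc j) f) \<alpha>" for \<alpha>
        by (auto simp: mps_slice_def mps_deriv_def lookup_add lookup_single add.assoc single_add[symmetric])
      then show ?thesis unfolding c_def mps_eval_def
        by (simp add: mult.assoc infsum_cmult_right' del: of_nat_Suc)
    qed
    with 1 show ?thesis by (simp add: diffs_def)
  qed
  \<comment> \<open>A point halfway between the norm of \<open>z\<close> and the radius: the series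
    converges at \<open>K\<close>, and \<open>z\<close> lies strictly inside the disc through
    \<open>K\<close>.\<close>
  define K :: 'a where "K = of_real ((norm z + \<rho> i) / 2)"
  have K: "norm K = (norm z + \<rho> i) / 2" using z norm_ge_zero[of z] unfolding K_def by (metis abs_of_nonneg add_nonneg_nonneg half_gt_zero_iff less_eq_real_def norm_of_real order_trans divide_nonneg_nonneg zero_le_numeral)
  have "summable (\<lambda>j. c j * K ^ j)" using sums[of K] K z by (auto simp: sums_iff)
  then have "((\<lambda>w. suminf (\<lambda>j. c j * w ^ j)) has_field_derivative suminf (\<lambda>j. diffs c j * z ^ j)) (at z)"
    by (rule termdiffs_strong) (use K z in auto)
  then have "((\<lambda>w. suminf (\<lambda>j. c j * w ^ j)) has_field_derivative mps_eval (mps_deriv i f) (x(i := z))) (at z)"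
    using sums' by (simp add: sums_iff)
  then show ?thesis
  proof (rule has_field_derivative_transform_within_open[where S = "ball 0 (\<rho> i)"])
    fix w :: 'a assume "w \<in> ball 0 (\<rho> i)"
    then show "suminf (\<lambda>j. c j * w ^ j) = mps_eval f (x(i := w))" using sums[of w] by (simp add: sums_iff)
  qed (use z in auto)
qed

lemma single_Suc_diff: "lookup \<beta> i \<noteq> (0::nat) \<Longrightarrow> \<beta> - single i 1 + single i 1 = \<beta>"
  by (auto simp: lookup_add lookup_minus lookup_single when_def intro!: poly_mapping_eqI)

lemma mps_deriv_integral: "mps_deriv i (mps_integral i f) = f"
  by (rule mps_eqI) (auto simp: mps_deriv_def mps_integral_def lookup_add)

lemma vars_below_integral:
  assumes "vars_below n f" "i < n"
  shows "vars_below n (mps_integral i f)"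
  unfolding vars_below_def
proof safe
  fix \<beta> k assume a: "mcoeff (mps_integral i f) \<beta> \<noteq> 0" and k: "k \<in> keys \<beta>"
  then have 1: "lookup \<beta> i \<noteq> 0" "mcoeff f (\<beta> - single i 1) \<noteq> 0"
    by (auto simp: mps_integral_def split: if_splits)
  show "k < n"
  proof (cases "k = i")
    case False
    then have "k \<in> keys (\<beta> - single i 1)"
      using k by (simp add: in_keys_iff lookup_minus lookup_single when_def)
    then show ?thesis using vars_belowD[OF assms(1) 1(2)] by simp
  qed (use assms in simp)
qed

text \<open>Division by the exponent makes terms smaller and the shift of the exponent costs only a
  factor \<open>\<rho> i\<close>, so no radius is lost.\<close>

lemma abs_conv_integral:
  assumes f: "abs_conv_at f \<rho>" and \<rho>: "\<forall>j. 0 \<le> \<rho> j"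
  shows "abs_conv_at (mps_integral i f) \<rho>"
proof -
  let ?e = "single i (1::nat)"
  let ?B = "{\<beta>. lookup \<beta> i \<noteq> (0::nat)}"
  let ?g = "\<lambda>\<beta>. \<rho> i * \<bar>mcoeff f (\<beta> - ?e) * monom_at \<rho> (\<beta> - ?e)\<bar>"
  have inj: "inj_on (\<lambda>\<beta>. \<beta> - ?e) ?B"
    by (rule inj_onI) (metis (mono_tags, lifting) mem_Collect_eq single_Suc_diff)
  have "(\<lambda>\<alpha>. \<bar>mcoeff f \<alpha> * monom_at \<rho> \<alpha>\<bar>) summable_on (\<lambda>\<beta>. \<beta> - ?e) ` ?B"
    using f unfolding abs_conv_at_def by (rule summable_on_subset_banach) auto
  then have "(\<lambda>\<beta>. \<bar>mcoeff f (\<beta> - ?e) * monom_at \<rho> (\<beta> - ?e)\<bar>) summable_on ?B"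
    by (subst (asm) summable_on_reindex[OF inj]) (auto simp: o_def)
  then have "?g summable_on ?B" by (rule summable_on_cmult_right)
  then have "(\<lambda>\<beta>. \<bar>mcoeff (mps_integral i f) \<beta> * monom_at \<rho> \<beta>\<bar>) summable_on ?B"
  proof (rule summable_on_comparison_test)
    fix \<beta> assume "\<beta> \<in> ?B"
    then have b: "lookup \<beta> i \<noteq> 0" by simp
    have "monom_at \<rho> \<beta> = monom_at \<rho> (\<beta> - ?e) * \<rho> i"
      using monom_at_add[of \<rho> "\<beta> - ?e" ?e] single_Suc_diff[OF b] by simp
    moreover have "\<bar>mcoeff f (\<beta> - ?e) / real (lookup \<beta> i)\<bar> \<le> \<bar>mcoeff f (\<beta> - ?e)\<bar> / 1"
      unfolding abs_divide using b by (intro divide_left_mono) auto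
    moreover from this have "\<bar>mcoeff f (\<beta> - ?e) / real (lookup \<beta> i)\<bar> * (\<rho> i * \<bar>monom_at \<rho> (\<beta> - ?e)\<bar>)
        \<le> \<bar>mcoeff f (\<beta> - ?e)\<bar> / 1 * (\<rho> i * \<bar>monom_at \<rho> (\<beta> - ?e)\<bar>)"
      by (rule mult_right_mono) (use \<rho> in auto)
    ultimately show "\<bar>mcoeff (mps_integral i f) \<beta> * monom_at \<rho> \<beta>\<bar> \<le> ?g \<beta>"
      using b \<rho> by (simp add: mps_integral_def abs_mult mult_ac)
  qed auto
  then show ?thesis unfolding abs_conv_at_def
    by (subst (asm) summable_on_cong_neutral[where T = UNIV and g = "\<lambda>\<beta>. \<bar>mcoeff (mps_integral i f) \<beta> * monom_at \<rho> \<beta>\<bar>"])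
      (auto simp: mps_integral_def)
qed

lemma integral_conv_series: "f \<in> conv_series n \<Longrightarrow> i < n \<Longrightarrow> mps_integral i f \<in> conv_series n"
  unfolding conv_series_iff
  by (auto intro: vars_below_integral intro!: exI[of _ r for r] abs_conv_integral)

lemma mps_eval_integral_0 [simp]: "mps_eval (mps_integral i f) (x(i := 0)) = 0"
  unfolding mps_eval_def by (rule infsum_0) (auto simp: monom_at_upd_0 mps_integral_def)

lemma mps_eval_integral_deriv:
  fixes x :: "nat \<Rightarrow> 'a::{real_normed_field,banach}"
  assumes "vars_below n f" "i < n" "abs_conv_at f \<rho>" "\<forall>j. 0 \<le> \<rho> j"
    "\<And>j. j < n \<Longrightarrow> j \<noteq> i \<Longrightarrow> norm (x j) \<le> \<rho> j" "norm z < \<rho> i"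
  shows "((\<lambda>z. mps_eval (mps_integral i f) (x(i := z))) has_field_derivative mps_eval f (x(i := z))) (at z)"
  using mps_eval_has_deriv[OF vars_below_integral[OF assms(1,2)] abs_conv_integral[OF assms(3,4)] assms(4) assms(5,6)]
  by (simp add: mps_deriv_integral)


section \<open>Substitution\<close>

lemma has_expansion_unique:
  assumes "has_expansion n \<rho> c F" "has_expansion n \<rho> d F" "\<forall>i<n. 0 < \<rho> i"
  shows "c = d"
proof -
  have \<rho>0: "\<forall>i<n. 0 \<le> \<rho> i" using assms(3) by (simp add: less_imp_le)
  note R = expansion_Re_mps[OF assms(1) \<rho>0] expansion_Re_mps[OF assms(2) \<rho>0]
  note I = expansion_Im_mps[OF assms(1) \<rho>0] expansion_Im_mps[OF assms(2) \<rho>0]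
  have "MPS (Re \<circ> c) = MPS (Re \<circ> d)"
  proof (rule conv_series_eqI[of _ n])
    show "eventually (\<lambda>x. mps_eval (MPS (Re \<circ> c)) x = mps_eval (MPS (Re \<circ> d)) x) (near_zero n)"
      using eventually_near_zero_box[OF assms(3)] by eventually_elim (use R(3,6) in \<open>auto simp: less_imp_le\<close>)
  qed (use conv_seriesI R assms(3) in blast)+
  moreover have "MPS (Im \<circ> c) = MPS (Im \<circ> d)"
  proof (rule conv_series_eqI[of _ n])
    show "eventually (\<lambda>x. mps_eval (MPS (Im \<circ> c)) x = mps_eval (MPS (Im \<circ> d)) x) (near_zero n)"
      using eventually_near_zero_box[OF assms(3)] by eventually_elim (use I(3,6) in \<open>auto simp: less_imp_le\<close>)
  qed (use conv_seriesI I assms(3) in blast)+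
  ultimately show ?thesis by (auto simp: fun_eq_iff complex_eq_iff)
qed

lemma mcoeff_mult_low:
  assumes "\<And>\<alpha>. mcoeff f \<alpha> \<noteq> 0 \<Longrightarrow> d \<le> mdeg \<alpha>" "\<And>\<alpha>. mcoeff g \<alpha> \<noteq> 0 \<Longrightarrow> e \<le> mdeg \<alpha>" "mcoeff (f * g) \<gamma> \<noteq> 0"
  shows "d + e \<le> mdeg \<gamma>"
proof -
  obtain p where "p \<in> splits \<gamma>" "(\<lambda>(\<alpha>, \<beta>). mcoeff f \<alpha> * mcoeff g \<beta>) p \<noteq> 0"
    using assms(3) sum.not_neutral_contains_not_neutral unfolding mcoeff_mult by blast
  then show ?thesis using assms(1,2) by (fastforce simp: splits_def mdeg_add intro: add_mono)
qed

lemma mcoeff_power_low: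
  assumes "mcoeff f 0 = 0" "mcoeff (f ^ k) \<gamma> \<noteq> 0"
  shows "k \<le> mdeg \<gamma>"
  using assms(2)
proof (induction k arbitrary: \<gamma>)
  case (Suc k)
  have 1: "1 \<le> mdeg \<alpha>" if "mcoeff f \<alpha> \<noteq> 0" for \<alpha>
    using assms(1) that mdeg_eq_0_iff[of \<alpha>] by (cases "mdeg \<alpha>") auto
  from mcoeff_mult_low[where f = f and g = "f ^ k" and \<gamma> = \<gamma>, OF 1 Suc.IH] Suc.prems show ?case by simp
qed simp

lemma mcoeff_prod_low:
  assumes "finite A" "\<And>i. i \<in> A \<Longrightarrow> mcoeff (h i) 0 = 0" "mcoeff (\<Prod>i\<in>A. h i ^ k i) \<gamma> \<noteq> 0"
  shows "(\<Sum>i\<in>A. k i) \<le> mdeg \<gamma>"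
  using assms
proof (induction A arbitrary: \<gamma> rule: finite_induct)
  case (insert x A)
  have 1: "k x \<le> mdeg \<alpha>" if "mcoeff (h x ^ k x) \<alpha> \<noteq> 0" for \<alpha>
    using mcoeff_power_low[of "h x"] insert.prems(1) that by simp
  have 2: "(\<Sum>i\<in>A. k i) \<le> mdeg \<alpha>" if "mcoeff (\<Prod>i\<in>A. h i ^ k i) \<alpha> \<noteq> 0" for \<alpha>
    using insert.IH insert.prems(1) that by simp
  from mcoeff_mult_low[where \<gamma> = \<gamma>, OF 1 2] insert.prems(2) insert.hyps show ?case by simp
qed simp

lemma mps_power_eval:
  fixes z :: "nat \<Rightarrow> 'a::{real_normed_field,banach}"
  assumes "vars_below m h" "abs_conv_at h x"
  shows "vars_below m (h ^ k)" "abs_conv_at (h ^ k) x"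
    "abs_conv_at h (\<lambda>i. norm (z i)) \<Longrightarrow> mps_eval (h ^ k) z = mps_eval h z ^ k"
proof -
  have *: "abs_conv_at (h ^ k) y" if "abs_conv_at h y" for k y
    using that by (induction k) (auto intro: abs_conv_mult)
  show "vars_below m (h ^ k)" using assms(1)
    by (induction k) (auto intro: vars_below_mult simp: one_eq_const)
  show "abs_conv_at (h ^ k) x" using * assms(2) .
  show "abs_conv_at h (\<lambda>i. norm (z i)) \<Longrightarrow> mps_eval (h ^ k) z = mps_eval h z ^ k"
    using * by (induction k) (auto simp: mps_eval_mult)
qed

lemma mps_prod_eval:
  fixes z :: "nat \<Rightarrow> 'a::{real_normed_field,banach}"
  assumes "finite A" "\<And>i. i \<in> A \<Longrightarrow> vars_below m (h i)" "\<And>i. i \<in> A \<Longrightarrow> abs_conv_at (h i) x"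
  shows "vars_below m (\<Prod>i\<in>A. h i ^ k i)" "abs_conv_at (\<Prod>i\<in>A. h i ^ k i) x"
    "(\<And>i. i \<in> A \<Longrightarrow> abs_conv_at (h i) (\<lambda>j. norm (z j))) \<Longrightarrow>
      mps_eval (\<Prod>i\<in>A. h i ^ k i) z = (\<Prod>i\<in>A. mps_eval (h i) z ^ k i)"
proof -
  have *: "abs_conv_at (\<Prod>i\<in>A. h i ^ k i) y" if "\<And>i. i \<in> A \<Longrightarrow> abs_conv_at (h i) y" "finite A" "\<And>i. i \<in> A \<Longrightarrow> vars_below m (h i)" for A y
    using that(2,1,3) by (induction A rule: finite_induct) (auto intro!: abs_conv_mult mps_power_eval(2))
  show "vars_below m (\<Prod>i\<in>A. h i ^ k i)" using assms
    by (induction A rule: finite_induct) (auto intro!: vars_below_mult mps_power_eval(1) simp: one_eq_const)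
  show "abs_conv_at (\<Prod>i\<in>A. h i ^ k i) x" using * assms by blast
  assume z: "\<And>i. i \<in> A \<Longrightarrow> abs_conv_at (h i) (\<lambda>j. norm (z j))"
  show "mps_eval (\<Prod>i\<in>A. h i ^ k i) z = (\<Prod>i\<in>A. mps_eval (h i) z ^ k i)"
    using assms(1,2) z
  proof (induction A rule: finite_induct)
    case (insert i A)
    then show ?case using *[of A "\<lambda>j. norm (z j)"] mps_power_eval(2)[where m = m and h = "h i" and x = "\<lambda>j. norm (z j)"]
        mps_power_eval(3)[where m = m and h = "h i" and x = "\<lambda>j. norm (z j)" and z = z]
      by (simp add: mps_eval_mult)
  qed simp
qed

lemma mcoeff_const_mult [simp]: "mcoeff (mps_const a * g) \<gamma> = a * mcoeff g \<gamma>"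
proof -
  have "(\<Sum>(\<alpha>, \<beta>)\<in>splits \<gamma>. mcoeff (mps_const a) \<alpha> * mcoeff g \<beta>) = (\<Sum>p\<in>splits \<gamma>. if p = (0, \<gamma>) then a * mcoeff g \<gamma> else 0)"
    by (rule sum.cong) (auto simp: mps_const_def splits_def split: if_splits)
  also have "\<dots> = a * mcoeff g \<gamma>" by (simp add: sum.delta) (simp add: splits_def)
  finally show ?thesis by (simp add: mcoeff_mult)
qed

text \<open>Formal substitution is given coefficientwise by finite sums, composition by an infinite
  sum of expansions. Both are built from the same summands \<open>P \<alpha>\<close>, so it suffices
  that infinite summation of expansions agrees with the finite sums in each coefficient.\<close>

lemma mps_subst_conv:
  assumes f: "f \<in> conv_series n" and h: "\<And>i. i < n \<Longrightarrow> h i \<in> conv_series m \<and> mcoeff (h i) 0 = 0"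
  obtains r where "r > 0" "mps_subst f h \<in> conv_series m" "abs_conv_at (mps_subst f h) (\<lambda>_. r)"
    "\<And>z :: nat \<Rightarrow> complex. \<forall>i<m. cmod (z i) \<le> r \<Longrightarrow> mps_eval (mps_subst f h) z = mps_eval f (\<lambda>i. mps_eval (h i) z)"
proof -
  obtain s where s: "s > 0" "vars_below n f" "abs_conv_at f (\<lambda>_. s)" using f by (auto simp: conv_series_iff)
  have "\<exists>t>0. abs_conv_at (h i) (\<lambda>_. t) \<and> exp_bounded m (\<lambda>_. t) s (mps_eval (h i))" if i: "i < n" for i
  proof -
    obtain r M where r: "0 < r" "abs_conv_at (h i) (\<lambda>_. r)" "exp_bounded m (\<lambda>_. r) M (mps_eval (h i))"
      using conv_series_exp_bounded h i by blast
    obtain t where t: "0 < t" "t \<le> 1" "exp_bounded m (\<lambda>i. t * r) s (mps_eval (h i))"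
      by (rule exp_bounded_small[OF r(3) _ s(1)]) (use r h i in \<open>auto simp: mps_eval_at_0\<close>)
    have "t * r \<le> r" using t r mult_right_mono[of t 1 r] by simp
    with t r have le: "\<bar>t * r\<bar> \<le> \<bar>r\<bar>" by simp
    have "abs_conv_at (h i) (\<lambda>_. t * r)"
      by (rule abs_conv_at_mono[of m "h i" "\<lambda>_. r"]) (use le r h i in \<open>auto simp: conv_series_iff\<close>)
    then show ?thesis using t r by (intro exI[of _ "t * r"]) auto
  qed
  then obtain t where t: "\<And>i. i < n \<Longrightarrow> t i > 0 \<and> abs_conv_at (h i) (\<lambda>_. t i) \<and> exp_bounded m (\<lambda>_. t i) s (mps_eval (h i))"
    by metis
  define r where "r = Min (insert 1 (t ` {..<n}))"
  have r: "r > 0" using t by (auto simp: r_def)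
  have rt: "r \<le> t i" if "i < n" for i unfolding r_def using that by (intro Min_le) auto
  have vh: "vars_below m (h i)" if "i < n" for i using h that by (auto simp: conv_series_iff)
  have ah: "abs_conv_at (h i) (\<lambda>_. r)" if "i < n" for i
    by (rule abs_conv_at_mono[OF vh[OF that], of "\<lambda>_. t i"]) (use t[OF that] rt[OF that] r in auto)
  have nh: "exp_bounded m (\<lambda>_. r) s (mps_eval (h i))" if "i < n" for i
    using t[OF that] rt[OF that] r by (auto intro: exp_bounded_shrink)
  have r0: "\<forall>i<m. 0 \<le> r" using r by simp
  have rr: "\<forall>i<m. 0 < r" using r by simp
  define g where "g = (\<lambda>\<alpha>. \<Prod>i\<in>keys \<alpha>. h i ^ lookup \<alpha> i)"
  define P where "P = (\<lambda>\<alpha>. mps_const (mcoeff f \<alpha>) * g \<alpha>)"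
  have hz: "abs_conv_at (h i) (\<lambda>j. norm (z j))" if "i < n" "\<forall>i<m. cmod (z i) \<le> r" for i and z :: "nat \<Rightarrow> complex"
    by (rule abs_conv_at_mono[OF vh ah]) (use that r in auto)
  have P: "has_expansion m (\<lambda>_. r) (\<lambda>\<beta>. of_real (mcoeff (P \<alpha>) \<beta>)) (\<lambda>z. of_real (mcoeff f \<alpha>) * monom_at (\<lambda>i. mps_eval (h i) z) \<alpha>)
      \<and> weighted_norm (\<lambda>_. r) (\<lambda>\<beta>. of_real (mcoeff (P \<alpha>) \<beta>)) \<le> \<bar>mcoeff f \<alpha> * monom_at (\<lambda>_. s) \<alpha>\<bar>" for \<alpha>
  proof (cases "mcoeff f \<alpha> = 0")
    case True
    then have "P \<alpha> = 0" by (simp add: P_def zero_eq_const[symmetric])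
    then show ?thesis using True by (simp add: has_expansion_def supp_below_def weighted_norm_def)
  next
    case False
    note k = vars_belowD[OF s(2) False]
    have v: "vars_below m (P \<alpha>)" unfolding P_def g_def
      by (intro vars_below_mult mps_prod_eval(1)) (use k vh ah in auto)
    have a: "abs_conv_at (P \<alpha>) (\<lambda>_. r)" unfolding P_def g_def
      by (intro abs_conv_mult mps_prod_eval(2)) (use k vh ah in auto)
    have ag: "abs_conv_at (g \<alpha>) (\<lambda>j. norm (z j))" if "\<forall>i<m. cmod (z i) \<le> r" for z :: "nat \<Rightarrow> complex"
      unfolding g_def by (rule mps_prod_eval(2)) (use k vh hz[OF _ that] in auto)
    have ev: "mps_eval (P \<alpha>) z = of_real (mcoeff f \<alpha>) * monom_at (\<lambda>i. mps_eval (h i) z) \<alpha>"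
      if z: "\<forall>i<m. cmod (z i) \<le> r" for z
    proof -
      have "mps_eval (g \<alpha>) z = monom_at (\<lambda>i. mps_eval (h i) z) \<alpha>"
        unfolding g_def monom_at_def by (rule mps_prod_eval(3)) (use k vh ah hz[OF _ z] in auto)
      then show ?thesis unfolding P_def using ag[OF z] by (simp add: mps_eval_mult)
    qed
    have H: "has_expansion m (\<lambda>_. r) (\<lambda>\<beta>. of_real (mcoeff (P \<alpha>) \<beta>)) (\<lambda>z. of_real (mcoeff f \<alpha>) * monom_at (\<lambda>i. mps_eval (h i) z) \<alpha>)"
      using mps_has_exp[OF v a r0] ev unfolding has_expansion_def by simp
    have "exp_bounded m (\<lambda>_. r) (monom_at (\<lambda>_. s) \<alpha>) (\<lambda>z. monom_at (\<lambda>i. mps_eval (h i) z) \<alpha>)"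
      unfolding monom_at_def by (intro exp_bounded_prod exp_bounded_power nh r0 k) auto
    from exp_bounded_cmult[OF this r0, of "of_real (mcoeff f \<alpha>)"]
    obtain c where c: "has_expansion m (\<lambda>_. r) c (\<lambda>z. of_real (mcoeff f \<alpha>) * monom_at (\<lambda>i. mps_eval (h i) z) \<alpha>)"
      "weighted_norm (\<lambda>_. r) c \<le> \<bar>mcoeff f \<alpha>\<bar> * monom_at (\<lambda>_. s) \<alpha>" by (auto simp: exp_bounded_def)
    \<comment> \<open>The norm estimate is known for some expansion \<open>c\<close>, the
      coefficients are known for \<open>P \<alpha>\<close>; uniqueness of expansions lets them share
      both.\<close>
    have "c = (\<lambda>\<beta>. of_real (mcoeff (P \<alpha>) \<beta>))" by (rule has_expansion_unique[OF c(1) H rr])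
    then show ?thesis using c(2) H s(1) by (simp add: abs_mult monom_at_nonneg)
  qed
  \<comment> \<open>As the \<open>h i\<close> have no constant term, \<open>P \<alpha>\<close>
    starts in degree \<open>mdeg \<alpha>\<close>, so only finitely many \<open>\<alpha>\<close>
    reach a given coefficient.\<close>
  have fin: "finite {\<alpha>. mcoeff (P \<alpha>) \<beta> \<noteq> 0}" for \<beta>
  proof (rule finite_subset[OF _ finite_mdeg_le[of n "mdeg \<beta>"]], safe)
    fix \<alpha> assume a: "mcoeff (P \<alpha>) \<beta> \<noteq> 0"
    then have 1: "mcoeff f \<alpha> \<noteq> 0" "mcoeff (g \<alpha>) \<beta> \<noteq> 0" by (auto simp: P_def)
    show "mdeg \<alpha> \<le> mdeg \<beta>" unfolding mdeg_def[of \<alpha>]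
      by (rule mcoeff_prod_low[where h = h]) (use 1 vars_belowD[OF s(2)] h in \<open>auto simp: g_def\<close>)
    fix i assume "i \<in> keys \<alpha>"
    then show "i < n" using vars_belowD[OF s(2) 1(1)] by simp
  qed
  have co: "mcoeff (mps_subst f h) \<beta> = (\<Sum>\<^sub>\<infinity>\<alpha>. mcoeff (P \<alpha>) \<beta>)" for \<beta>
  proof -
    have "mcoeff (mps_subst f h) \<beta> = Sum_any (\<lambda>\<alpha>. mcoeff (P \<alpha>) \<beta>)" by (simp add: mps_subst_def P_def g_def)
    also have "\<dots> = (\<Sum>\<alpha> | mcoeff (P \<alpha>) \<beta> \<noteq> 0. mcoeff (P \<alpha>) \<beta>)" by (rule Sum_any.expand_set)
    also have "\<dots> = (\<Sum>\<^sub>\<infinity>\<alpha>\<in>{\<alpha>. mcoeff (P \<alpha>) \<beta> \<noteq> 0}. mcoeff (P \<alpha>) \<beta>)" using fin by simp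
    also have "\<dots> = (\<Sum>\<^sub>\<infinity>\<alpha>. mcoeff (P \<alpha>) \<beta>)" by (rule infsum_cong_neutral) auto
    finally show ?thesis .
  qed
  have co': "(\<Sum>\<^sub>\<infinity>\<alpha>. complex_of_real (mcoeff (P \<alpha>) \<beta>)) = of_real (mcoeff (mps_subst f h) \<beta>)" for \<beta>
  proof -
    have "((\<lambda>\<alpha>. mcoeff (P \<alpha>) \<beta>) has_sum mcoeff (mps_subst f h) \<beta>) UNIV"
      unfolding co by (intro has_sum_infsum finite_nonzero_values_imp_summable_on) (use fin in simp)
    from has_sum_of_real[OF this, where 'a = complex] show ?thesis by (rule infsumI)
  qed
  have "has_expansion m (\<lambda>_. r) (\<lambda>\<beta>. \<Sum>\<^sub>\<infinity>\<alpha>. complex_of_real (mcoeff (P \<alpha>) \<beta>))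
      (\<lambda>z. \<Sum>\<^sub>\<infinity>\<alpha>. of_real (mcoeff f \<alpha>) * monom_at (\<lambda>i. mps_eval (h i) z) \<alpha>)"
    by (rule has_expansion_infinite_sum(1)[where M = "\<lambda>\<alpha>. \<bar>mcoeff f \<alpha> * monom_at (\<lambda>_. s) \<alpha>\<bar>"])
      (use P s(3) r in \<open>auto simp: abs_conv_at_def\<close>)
  then have E: "has_expansion m (\<lambda>_. r) (\<lambda>\<beta>. of_real (mcoeff (mps_subst f h) \<beta>)) (\<lambda>z. mps_eval f (\<lambda>i. mps_eval (h i) z))"
    by (simp add: co' mps_eval_def[of f])
  have "MPS (Re \<circ> (\<lambda>\<beta>. complex_of_real (mcoeff (mps_subst f h) \<beta>))) = mps_subst f h" by (simp add: o_def)
  with expansion_Re_mps(1,2)[OF E r0] have va: "vars_below m (mps_subst f h)" "abs_conv_at (mps_subst f h) (\<lambda>_. r)" by simp_all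
  show ?thesis
  proof (rule that[OF r conv_seriesI[OF va rr] va(2)])
    fix z :: "nat \<Rightarrow> complex" assume "\<forall>i<m. cmod (z i) \<le> r"
    from has_expansion_infsum[OF E this] show "mps_eval (mps_subst f h) z = mps_eval f (\<lambda>i. mps_eval (h i) z)"
      by (simp add: mps_eval_def[of "mps_subst f h"])
  qed
qed

text \<open>The inner point is set to 0 from index \<open>n\<close> on so that it lies in
  \<open>space_n n\<close>, where identities between germs in \<open>n\<close> variables are
  available.\<close>

lemma subst_conv_real:
  assumes f: "f \<in> conv_series n" and h: "\<And>i. i < n \<Longrightarrow> h i \<in> conv_series m \<and> mcoeff (h i) 0 = 0"
  shows "mps_subst f h \<in> conv_series m"
    "eventually (\<lambda>x. mps_eval (mps_subst f h) x = mps_eval f (\<lambda>i. if i < n then mps_eval (h i) x else 0)) (near_zero m)"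
proof -
  have vf: "vars_below n f" using f by (simp add: conv_series_iff)
  obtain r where r: "r > 0" "mps_subst f h \<in> conv_series m"
    "\<And>z :: nat \<Rightarrow> complex. \<forall>i<m. cmod (z i) \<le> r \<Longrightarrow> mps_eval (mps_subst f h) z = mps_eval f (\<lambda>i. mps_eval (h i) z)"
    by (rule mps_subst_conv[OF f h]) blast+
  show "mps_subst f h \<in> conv_series m" by (rule r(2))
  show "eventually (\<lambda>x. mps_eval (mps_subst f h) x = mps_eval f (\<lambda>i. if i < n then mps_eval (h i) x else 0)) (near_zero m)"
    using eventually_near_zero_bound[OF r(1)]
  proof eventually_elim
    case (elim x)
    have "mps_eval (mps_subst f h) (\<lambda>i. complex_of_real (x i)) = mps_eval f (\<lambda>i. mps_eval (h i) (\<lambda>i. complex_of_real (x i)))"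
      by (rule r(3)) (use elim in \<open>auto simp: less_imp_le\<close>)
    then have "mps_eval (mps_subst f h) x = mps_eval f (\<lambda>i. mps_eval (h i) x)"
      by (simp add: mps_eval_of_real mps_eval_of_real[of f "\<lambda>i. mps_eval (h i) x"])
    also have "\<dots> = mps_eval f (\<lambda>i. if i < n then mps_eval (h i) x else 0)" by (rule mps_eval_cong[OF vf]) simp
    finally show ?case .
  qed
qed

section \<open>Germs represented by a system\<close>

text \<open>Describes elements of \<open>S n\<close> by arbitrary functions near 0, so that closure
  properties become rules for expressions and need no name for the series involved.\<close>

definition germ :: "(nat \<Rightarrow> mps set) \<Rightarrow> nat \<Rightarrow> ((nat \<Rightarrow> real) \<Rightarrow> real) \<Rightarrow> bool" where
  "germ S n F \<longleftrightarrow> (\<exists>f\<in>S n. eventually (\<lambda>x. F x = mps_eval f x) (near_zero n))"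

text \<open>Arguments stay real and only values are complex. This is the setting in which contour
  integrals depending on real parameters take place.\<close>

definition cgerm :: "(nat \<Rightarrow> mps set) \<Rightarrow> nat \<Rightarrow> ((nat \<Rightarrow> real) \<Rightarrow> complex) \<Rightarrow> bool" where
  "cgerm S n F \<longleftrightarrow> germ S n (\<lambda>x. Re (F x)) \<and> germ S n (\<lambda>x. Im (F x))"

lemma germ_cong: "germ S n F \<Longrightarrow> eventually (\<lambda>x. F x = G x) (near_zero n) \<Longrightarrow> germ S n G"
  unfolding germ_def by (erule bexE, rule bexI, erule (1) eventually_elim2) auto

lemma cgerm_cong: "cgerm S n F \<Longrightarrow> eventually (\<lambda>x. F x = G x) (near_zero n) \<Longrightarrow> cgerm S n G"
  unfolding cgerm_def
  by (elim conjE, intro conjI; erule germ_cong, erule eventually_mono) simp_all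

lemma germI: "f \<in> S n \<Longrightarrow> germ S n (mps_eval f)"
  unfolding germ_def by (rule bexI[of _ f]) auto

lemma var_in_polynomials: "i < n \<Longrightarrow> 0 \<in> k \<Longrightarrow> 1 \<in> k \<Longrightarrow> mps_var i \<in> polynomials k n"
  by (auto simp: polynomials_def vars_below_var) (auto simp: mps_var_def)

lemma const_in_polynomials: "0 \<in> k \<Longrightarrow> a \<in> k \<Longrightarrow> mps_const a \<in> polynomials k n"
  by (auto simp: polynomials_def) (auto simp: mps_const_def)

lemma eventually_near_zero_Suc_upd:
  assumes "eventually P (near_zero n)"
  shows "eventually (\<lambda>x. P (x(n := 0))) (near_zero (Suc n))"
proof -
  obtain r where r: "r > 0" "\<And>x. x \<in> space_n n \<Longrightarrow> \<forall>i<n. \<bar>x i\<bar> < r \<Longrightarrow> P x"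
    using assms by (auto simp: eventually_near_zero)
  show ?thesis unfolding eventually_near_zero
    by (intro exI[of _ r] conjI ballI impI r) (use r(1) in \<open>auto simp: space_n_def\<close>)
qed

lemma eventually_near_zero_restrict:
  assumes "eventually P (near_zero (Suc n))"
  shows "eventually P (near_zero n)"
proof -
  obtain r where r: "r > 0" "\<And>x. x \<in> space_n (Suc n) \<Longrightarrow> \<forall>i<Suc n. \<bar>x i\<bar> < r \<Longrightarrow> P x"
    using assms by (auto simp: eventually_near_zero)
  show ?thesis unfolding eventually_near_zero
    by (intro exI[of _ r] conjI ballI impI r) (use r(1) in \<open>auto simp: space_n_def less_Suc_eq\<close>)
qed

text \<open>Closure under permutations is all that a system offers for renaming; an injective
  renaming is obtained from it by completing the injection on a larger index set.\<close>

lemma extend_to_permutation: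
  fixes s :: "nat \<Rightarrow> nat"
  assumes s: "inj_on s {..<n}" "s ` {..<n} \<subseteq> {..<N}" and n: "n \<le> N"
  obtains \<sigma> where "\<sigma> permutes {..<N}" "\<And>i. i < n \<Longrightarrow> \<sigma> i = s i"
proof -
  have "card ({..<N} - {..<n}) = card ({..<N} - s ` {..<n})"
    using s n by (simp add: card_Diff_subset card_image)
  then obtain g where g: "bij_betw g ({..<N} - {..<n}) ({..<N} - s ` {..<n})"
    using finite_same_card_bij by (metis finite_Diff finite_lessThan)
  define \<sigma> where "\<sigma> = (\<lambda>i. if i < n then s i else if i < N then g i else i)"
  have "bij_betw \<sigma> ({..<n} \<union> ({..<N} - {..<n})) (s ` {..<n} \<union> ({..<N} - s ` {..<n}))"
  proof (rule bij_betw_combine)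
    show "bij_betw \<sigma> {..<n} (s ` {..<n})"
      by (subst bij_betw_cong[of _ _ s]) (use s in \<open>auto simp: \<sigma>_def bij_betw_def\<close>)
    show "bij_betw \<sigma> ({..<N} - {..<n}) ({..<N} - s ` {..<n})"
      by (subst bij_betw_cong[of _ _ g]) (use g in \<open>auto simp: \<sigma>_def\<close>)
  qed auto
  moreover have "{..<n} \<union> ({..<N} - {..<n}) = {..<N}" "s ` {..<n} \<union> ({..<N} - s ` {..<n}) = {..<N}"
    using s n by auto
  ultimately have "bij_betw \<sigma> {..<N} {..<N}" by simp
  then have "\<sigma> permutes {..<N}" by (rule bij_imp_permutes) (use n in \<open>auto simp: \<sigma>_def\<close>)
  then show ?thesis using that by (simp add: \<sigma>_def)
qed

text \<open>Closure properties shared by \<open>IA\<close> and by every convergent Analysis system containing the algebraic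
  series. Translation is only required at rational points.\<close>

locale rational_sys =
  fixes S :: "nat \<Rightarrow> mps set"
  assumes sub: "S n \<subseteq> conv_series n"
    and ring: "is_subring (S n)"
    and restr: "S n = S (n + 1) \<inter> conv_series n"
    and perm: "perm_closed S"
    and rat: "polynomials \<rat> n \<subseteq> S n"
    and inv: "f \<in> S n \<Longrightarrow> mcoeff f 0 \<noteq> 0 \<Longrightarrow> mps_inverse f \<in> S n"
    and zero: "f \<in> S (Suc n) \<Longrightarrow> mps_set_zero n f \<in> S n"
    and trans: "f \<in> S n \<Longrightarrow> a \<in> conv_domain n f \<inter> points_over \<rat> n \<Longrightarrow> mps_translate n f a \<in> S n"
    and int: "f \<in> S (Suc n) \<Longrightarrow> mps_integral n f \<in> S (Suc n)"
begin

lemma conv: "f \<in> S n \<Longrightarrow> f \<in> conv_series n"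
  using sub by blast

lemma mono: "n \<le> m \<Longrightarrow> S n \<subseteq> S m"
proof (induction m rule: dec_induct)
  case (step m)
  then show ?case using restr[of m] by (metis Int_lower1 Suc_eq_plus1 order_trans)
qed simp

lemma restr_le: "n \<le> m \<Longrightarrow> f \<in> S m \<Longrightarrow> f \<in> conv_series n \<Longrightarrow> f \<in> S n"
proof (induction m rule: dec_induct)
  case (step m)
  then have "f \<in> conv_series m" using conv_series_mono by blast
  moreover have "f \<in> S (m + 1)" using step by simp
  ultimately have "f \<in> S m" using restr[of m] by blast
  then show ?case using step by blast
qed

text \<open>The final step of most membership proofs: the series is known to converge by an
  estimate, its germ is known to come from \<open>S n\<close>, and the identity theorem identifies
  the two.\<close>

lemma mem_if_germ:
  assumes "f \<in> conv_series n" "germ S n F" "eventually (\<lambda>x. F x = mps_eval f x) (near_zero n)"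
  shows "f \<in> S n"
proof -
  obtain g where g: "g \<in> S n" "eventually (\<lambda>x. F x = mps_eval g x) (near_zero n)"
    using assms(2) by (auto simp: germ_def)
  have "f = g"
    by (rule conv_series_eqI[OF assms(1) conv[OF g(1)]]) (use assms(3) g(2) in \<open>auto elim: eventually_elim2\<close>)
  then show ?thesis using g by simp
qed

lemma germ_mult:
  assumes "germ S n F" "germ S n G"
  shows "germ S n (\<lambda>x. F x * G x)"
proof -
  obtain f g where f: "f \<in> S n" "eventually (\<lambda>x. F x = mps_eval f x) (near_zero n)"
    and g: "g \<in> S n" "eventually (\<lambda>x. G x = mps_eval g x) (near_zero n)"
    using assms by (auto simp: germ_def)
  have "f * g \<in> S n" using f g ring by (auto simp: is_subring_def)
  moreover have "eventually (\<lambda>x. F x * G x = mps_eval (f * g) x) (near_zero n)"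
    using f(2) g(2) conv_series_eventually[OF conv[OF f(1)]] conv_series_eventually[OF conv[OF g(1)]]
    by eventually_elim (simp add: mps_eval_mult)
  ultimately show ?thesis by (auto simp: germ_def)
qed

lemma germ_diff:
  assumes "germ S n F" "germ S n G"
  shows "germ S n (\<lambda>x. F x - G x)"
proof -
  obtain f g where f: "f \<in> S n" "eventually (\<lambda>x. F x = mps_eval f x) (near_zero n)"
    and g: "g \<in> S n" "eventually (\<lambda>x. G x = mps_eval g x) (near_zero n)"
    using assms by (auto simp: germ_def)
  have "f - g \<in> S n" using f g ring by (auto simp: is_subring_def)
  moreover have "eventually (\<lambda>x. F x - G x = mps_eval (f - g) x) (near_zero n)"
    using f(2) g(2) conv_series_eventually[OF conv[OF f(1)]] conv_series_eventually[OF conv[OF g(1)]]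
    by eventually_elim (simp add: mps_eval_diff)
  ultimately show ?thesis by (auto simp: germ_def)
qed

lemma germ_const: "a \<in> \<rat> \<Longrightarrow> germ S n (\<lambda>_. a)"
  using const_in_polynomials[of \<rat> a n] rat[of n] unfolding germ_def by (auto intro!: bexI[of _ "mps_const a"])

lemma germ_var: "i < n \<Longrightarrow> germ S n (\<lambda>x. x i)"
  using var_in_polynomials[of i n \<rat>] rat[of n] unfolding germ_def by (auto intro!: bexI[of _ "mps_var i"])

lemma germ_add:
  assumes "germ S n F" "germ S n G"
  shows "germ S n (\<lambda>x. F x + G x)"
  using germ_diff[OF assms(1) germ_diff[OF germ_const[of 0] assms(2)]] by simp

lemma germ_inverse:
  assumes "germ S n F" "F (\<lambda>_. 0) \<noteq> 0"
  shows "germ S n (\<lambda>x. 1 / F x)"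
proof -
  obtain f where f: "f \<in> S n" "eventually (\<lambda>x. F x = mps_eval f x) (near_zero n)"
    using assms by (auto simp: germ_def)
  have nz: "mcoeff f 0 \<noteq> 0" using eventually_near_zero_zero[OF f(2)] assms(2) by (simp add: mps_eval_at_0)
  note I = mps_inverse_conv[OF conv[OF f(1)] nz]
  have "eventually (\<lambda>x. 1 / F x = mps_eval (mps_inverse f) x) (near_zero n)"
    using f(2) conv_series_eventually[OF conv[OF f(1)]] conv_series_eventually[OF I(1)]
  proof eventually_elim
    case (elim x)
    then have "F x * mps_eval (mps_inverse f) x = 1" using I(2) by (metis mps_eval_1 mps_eval_mult)
    then show ?case by (metis mult_zero_left nonzero_mult_div_cancel_left zero_neq_one)
  qed
  then show ?thesis using inv[OF f(1) nz] by (auto simp: germ_def)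
qed

lemma germ_restrict:
  assumes "germ S (Suc n) F"
  shows "germ S n F"
proof -
  obtain f where f: "f \<in> S (Suc n)" "eventually (\<lambda>x. F x = mps_eval f x) (near_zero (Suc n))"
    using assms by (auto simp: germ_def)
  have "eventually (\<lambda>x. F x = mps_eval (mps_set_zero n f) x) (near_zero n)"
    using eventually_near_zero_restrict[OF f(2)] eventually_near_zero_bound[OF zero_less_one]
  proof eventually_elim
    case (elim x)
    then have "x(n := 0) = x" by (auto simp: space_n_def)
    then show ?case using elim by (simp add: mps_eval_set_zero)
  qed
  then show ?thesis using zero[OF f(1)] by (auto simp: germ_def)
qed

lemma germ_restrict_le: "n \<le> m \<Longrightarrow> germ S m F \<Longrightarrow> germ S n F"
  by (induction m rule: dec_induct) (auto dest: germ_restrict)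

lemma germ_Suc:
  assumes "germ S n F"
  shows "germ S (Suc n) (\<lambda>x. F (x(n := 0)))"
proof -
  obtain f where f: "f \<in> S n" "eventually (\<lambda>x. F x = mps_eval f x) (near_zero n)"
    using assms by (auto simp: germ_def)
  have "vars_below n f" using conv[OF f(1)] by (simp add: conv_series_iff)
  then have "mps_eval f (x(n := 0)) = mps_eval f x" for x :: "nat \<Rightarrow> real" by (rule mps_eval_cong) auto
  then have "eventually (\<lambda>x. F (x(n := 0)) = mps_eval f x) (near_zero (Suc n))"
    using eventually_near_zero_Suc_upd[OF f(2)] by simp
  moreover have "f \<in> S (Suc n)" using mono[of n "Suc n"] f by auto
  ultimately show ?thesis by (auto simp: germ_def)
qed

lemma germ_extend:
  assumes "germ S n F" "n \<le> m"
  shows "germ S m (\<lambda>x. F (\<lambda>i. if i < n then x i else 0))"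
  using assms(2)
proof (induction m rule: dec_induct)
  case base
  show ?case
    by (rule germ_cong[OF assms(1)], rule eventually_mono[OF eventually_near_zero_bound[OF zero_less_one]])
      (auto simp: space_n_def not_less intro!: arg_cong[where f = F])
next
  case (step m)
  from germ_Suc[OF step.IH] show ?case
    by (rule germ_cong) (use step(1) in \<open>auto intro!: always_eventually arg_cong[where f = F]\<close>)
qed

lemma germ_permute:
  assumes "germ S n F" and \<sigma>: "\<sigma> permutes {..<n}"
  shows "germ S n (\<lambda>x. F (\<lambda>i. x (\<sigma> i)))"
proof -
  obtain f where f: "f \<in> S n" "eventually (\<lambda>x. F x = mps_eval f x) (near_zero n)"
    using assms by (auto simp: germ_def)
  obtain r where r: "r > 0" "\<And>x. x \<in> space_n n \<Longrightarrow> \<forall>i<n. \<bar>x i\<bar> < r \<Longrightarrow> F x = mps_eval f x"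
    using f(2) by (auto simp: eventually_near_zero)
  have "eventually (\<lambda>x. F (\<lambda>i. x (\<sigma> i)) = mps_eval (mps_permute \<sigma> f) x) (near_zero n)"
    unfolding eventually_near_zero
  proof (intro exI[of _ r] conjI ballI impI r(1))
    fix x assume x: "x \<in> space_n n" "\<forall>i<n. \<bar>x i\<bar> < r"
    have "(\<lambda>i. x (\<sigma> i)) \<in> space_n n" using x(1) \<sigma> by (auto simp: space_n_def permutes_def)
    moreover have "\<forall>i<n. \<bar>x (\<sigma> i)\<bar> < r" using x(2) permutes_in_image[OF \<sigma>] by auto
    ultimately show "F (\<lambda>i. x (\<sigma> i)) = mps_eval (mps_permute \<sigma> f) x"
      using r(2) by (simp add: mps_permute_simps(2)[OF \<sigma>])
  qed
  moreover have "mps_permute \<sigma> f \<in> S n" using perm f(1) \<sigma> by (auto simp: perm_closed_def)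
  ultimately show ?thesis by (auto simp: germ_def)
qed

text \<open>Variables in \<open>D\<close> are renamed by \<open>s\<close>, the others are to become
  0. The latter are moved to fresh indices beyond \<open>m\<close>; forgetting these indices
  afterwards sets them to 0.\<close>

lemma germ_reindex:
  assumes F: "germ S n F" and D: "D \<subseteq> {..<n}" and s: "inj_on s D" "s ` D \<subseteq> {..<m}"
  shows "germ S m (\<lambda>x. F (\<lambda>i. if i \<in> D then x (s i) else 0))"
proof -
  \<comment> \<open>The values \<open>m + i\<close> avoid the range of \<open>s\<close> and are
    pairwise distinct, so \<open>s'\<close> remains injective.\<close>
  define s' where "s' = (\<lambda>i. if i \<in> D then s i else m + i)"
  have sD: "s i < m" if "i \<in> D" for i using s(2) that by auto
  have "inj_on s' {..<n}"
  proof (rule inj_onI)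
    fix i j assume "s' i = s' j"
    then show "i = j" using sD[of i] sD[of j] inj_onD[OF s(1), of i j]
      by (cases "i \<in> D"; cases "j \<in> D") (auto simp: s'_def)
  qed
  moreover have "s' ` {..<n} \<subseteq> {..<n + m}" using sD by (auto simp: s'_def trans_less_add2)
  ultimately obtain \<sigma> where \<sigma>: "\<sigma> permutes {..<n + m}" "\<And>i. i < n \<Longrightarrow> \<sigma> i = s' i"
    by (rule extend_to_permutation) auto
  have "germ S (n + m) (\<lambda>x. F (\<lambda>i. if i < n then x (\<sigma> i) else 0))"
    using germ_permute[OF germ_extend[OF F] \<sigma>(1)] by simp
  then have "germ S m (\<lambda>x. F (\<lambda>i. if i < n then x (\<sigma> i) else 0))" by (rule germ_restrict_le[rotated]) simp
  then show ?thesis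
  proof (rule germ_cong, intro eventually_mono[OF eventually_near_zero_bound[OF zero_less_one]] arg_cong[where f = F] ext)
    fix x and i :: nat assume x: "x \<in> space_n m \<and> (\<forall>i. \<bar>x i\<bar> < 1)"
    show "(if i < n then x (\<sigma> i) else 0) = (if i \<in> D then x (s i) else 0)"
      using x D \<sigma>(2)[of i] by (auto simp: s'_def space_n_def)
  qed
qed

lemma cgerm_reindex:
  "cgerm S n F \<Longrightarrow> D \<subseteq> {..<n} \<Longrightarrow> inj_on s D \<Longrightarrow> s ` D \<subseteq> {..<m} \<Longrightarrow>
   cgerm S m (\<lambda>x. F (\<lambda>i. if i \<in> D then x (s i) else 0))"
  unfolding cgerm_def
  by (elim conjE, intro conjI; rule germ_reindex[where F = "\<lambda>x. Re (F x)"] germ_reindex[where F = "\<lambda>x. Im (F x)"])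

lemma cgerm_add: "cgerm S n F \<Longrightarrow> cgerm S n G \<Longrightarrow> cgerm S n (\<lambda>x. F x + G x)"
  and cgerm_diff: "cgerm S n F \<Longrightarrow> cgerm S n G \<Longrightarrow> cgerm S n (\<lambda>x. F x - G x)"
  and cgerm_mult: "cgerm S n F \<Longrightarrow> cgerm S n G \<Longrightarrow> cgerm S n (\<lambda>x. F x * G x)"
  by (auto simp: cgerm_def intro: germ_add germ_diff germ_mult)

lemma cgerm_const: "Re a \<in> \<rat> \<Longrightarrow> Im a \<in> \<rat> \<Longrightarrow> cgerm S n (\<lambda>_. a)"
  by (auto simp: cgerm_def intro: germ_const)

lemma cgerm_of_real: "germ S n F \<Longrightarrow> cgerm S n (\<lambda>x. of_real (F x))"
  by (auto simp: cgerm_def intro: germ_const)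

lemma cgerm_inverse:
  assumes F: "cgerm S n F" and nz: "F (\<lambda>_. 0) \<noteq> 0"
  shows "cgerm S n (\<lambda>x. 1 / F x)"
proof -
  let ?N = "\<lambda>x. Re (F x) * Re (F x) + Im (F x) * Im (F x)"
  have R: "germ S n (\<lambda>x. Re (F x))" and I: "germ S n (\<lambda>x. Im (F x))" using F by (auto simp: cgerm_def)
  have "?N (\<lambda>_. 0) \<noteq> 0" using nz by (simp add: complex_eq_iff sum_squares_eq_zero_iff)
  then have N: "germ S n (\<lambda>x. 1 / ?N x)" by (intro germ_inverse germ_add germ_mult R I)
  have "germ S n (\<lambda>x. Re (F x) * (1 / ?N x))" "germ S n (\<lambda>x. (0 - Im (F x)) * (1 / ?N x))"
    by (rule germ_mult[OF R N]) (rule germ_mult[OF germ_diff[OF germ_const[OF Rats_0] I] N])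
  then show ?thesis by (simp add: cgerm_def Re_divide Im_divide power2_eq_square)
qed

section \<open>Translation and definite integrals within a system\<close>

lemma rep_translate:
  assumes f: "f \<in> S n" "abs_conv_at f \<rho>" and a: "\<And>i. i < n \<Longrightarrow> a i \<in> \<rat>" "\<And>i. n \<le> i \<Longrightarrow> a i = 0"
    "\<And>i. i < n \<Longrightarrow> \<bar>a i\<bar> < \<rho> i"
  shows "mps_translate n f a \<in> S n"
    "eventually (\<lambda>x. mps_eval (mps_translate n f a) x = mps_eval f (\<lambda>i. a i + x i)) (near_zero n)"
proof -
  have v: "vars_below n f" using conv[OF f(1)] by (simp add: conv_series_iff)
  have as: "a \<in> space_n n" using a by (auto simp: space_n_def)
  have ar: "\<forall>i<n. \<bar>a i\<bar> < \<rho> i" using a by simp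
  have "a \<in> conv_domain n f" using conv_domain_iff[OF v] v as ar f(2) by blast
  then show "mps_translate n f a \<in> S n" using trans[OF f(1)] as a by (auto simp: points_over_def)
  have "\<forall>i<n. 0 < \<rho> i - \<bar>a i\<bar>" using ar by simp
  from eventually_near_zero_box[OF this]
  show "eventually (\<lambda>x. mps_eval (mps_translate n f a) x = mps_eval f (\<lambda>i. a i + x i)) (near_zero n)"
  proof eventually_elim
    case (elim x)
    have "mps_eval (mps_translate n f a) (\<lambda>i. complex_of_real (x i)) = mps_eval f (\<lambda>i. complex_of_real (a i) + of_real (x i))"
      by (rule mps_translate_conv(3)[OF v as ar f(2)]) (use elim in \<open>auto simp: less_imp_le\<close>)
    then show ?case using mps_eval_of_real[of f "\<lambda>i. a i + x i"] by (simp add: mps_eval_of_real)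
  qed
qed

text \<open>The germ describes the series only near 0, whereas translation needs absolute
  convergence up to the given polyradius. By uniqueness, the element of \<open>S n\<close> is the
  series read off from the expansion of \<open>F\<close> and inherits its full radius.\<close>

lemma rep_Re:
  assumes F: "exp_bounded n \<rho> M F" "\<forall>i<n. 0 < \<rho> i" and g: "germ S n (\<lambda>x. Re (F (\<lambda>i. of_real (x i))))"
  obtains f where "f \<in> S n" "abs_conv_at f \<rho>"
    "\<And>x. \<forall>i<n. \<bar>x i\<bar> \<le> \<rho> i \<Longrightarrow> mps_eval f x = Re (F (\<lambda>i. of_real (x i)))"
proof (rule exp_bounded_Re_mps[OF F])
  fix f assume f: "f \<in> conv_series n" "abs_conv_at f \<rho>"
    and e: "\<And>x. \<forall>i<n. \<bar>x i\<bar> \<le> \<rho> i \<Longrightarrow> mps_eval f x = Re (F (\<lambda>i. of_real (x i)))"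
  have "f \<in> S n" by (rule mem_if_germ[OF f(1) g], rule eventually_mono[OF eventually_near_zero_box[OF F(2)]])
      (use e in \<open>auto simp: less_imp_le\<close>)
  then show thesis using that f(2) e by blast
qed

lemma rep_Im:
  assumes F: "exp_bounded n \<rho> M F" "\<forall>i<n. 0 < \<rho> i" and g: "germ S n (\<lambda>x. Im (F (\<lambda>i. of_real (x i))))"
  obtains f where "f \<in> S n" "abs_conv_at f \<rho>"
    "\<And>x. \<forall>i<n. \<bar>x i\<bar> \<le> \<rho> i \<Longrightarrow> mps_eval f x = Im (F (\<lambda>i. of_real (x i)))"
proof (rule exp_bounded_Im_mps[OF F])
  fix f assume f: "f \<in> conv_series n" "abs_conv_at f \<rho>"
    and e: "\<And>x. \<forall>i<n. \<bar>x i\<bar> \<le> \<rho> i \<Longrightarrow> mps_eval f x = Im (F (\<lambda>i. of_real (x i)))"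
  have "f \<in> S n" by (rule mem_if_germ[OF f(1) g], rule eventually_mono[OF eventually_near_zero_box[OF F(2)]])
      (use e in \<open>auto simp: less_imp_le\<close>)
  then show thesis using that f(2) e by blast
qed

lemma eventually_translate_box:
  assumes "\<And>i. i < n \<Longrightarrow> \<bar>a i\<bar> < \<rho> i"
  shows "eventually (\<lambda>x. \<forall>i<n. \<bar>a i + x i\<bar> \<le> \<rho> i) (near_zero n)"
proof -
  have "\<forall>i<n. 0 < \<rho> i - \<bar>a i\<bar>" using assms by simp
  from eventually_near_zero_box[OF this] show ?thesis by eventually_elim force
qed

lemma cgerm_translate:
  assumes F: "exp_bounded n \<rho> M F" "\<forall>i<n. 0 < \<rho> i" and g: "cgerm S n (\<lambda>x. F (\<lambda>i. of_real (x i)))"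
    and a: "\<And>i. i < n \<Longrightarrow> a i \<in> \<rat>" "\<And>i. n \<le> i \<Longrightarrow> a i = 0" "\<And>i. i < n \<Longrightarrow> \<bar>a i\<bar> < \<rho> i"
  shows "cgerm S n (\<lambda>x. F (\<lambda>i. of_real (a i + x i)))"
  unfolding cgerm_def
proof
  have R: "germ S n (\<lambda>x. Re (F (\<lambda>i. of_real (x i))))" and I: "germ S n (\<lambda>x. Im (F (\<lambda>i. of_real (x i))))"
    using g by (auto simp: cgerm_def)
  obtain f where f: "f \<in> S n" "abs_conv_at f \<rho>"
    "\<And>x. \<forall>i<n. \<bar>x i\<bar> \<le> \<rho> i \<Longrightarrow> mps_eval f x = Re (F (\<lambda>i. of_real (x i)))"
    using rep_Re[OF F R] by blast
  note T = rep_translate[OF f(1,2) a]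
  show "germ S n (\<lambda>x. Re (F (\<lambda>i. of_real (a i + x i))))" unfolding germ_def
    by (rule bexI[OF _ T(1)], rule eventually_elim2[OF T(2) eventually_translate_box[OF a(3)]]) (use f(3) in auto)
  obtain f where f: "f \<in> S n" "abs_conv_at f \<rho>"
    "\<And>x. \<forall>i<n. \<bar>x i\<bar> \<le> \<rho> i \<Longrightarrow> mps_eval f x = Im (F (\<lambda>i. of_real (x i)))"
    using rep_Im[OF F I] by blast
  note T = rep_translate[OF f(1,2) a]
  show "germ S n (\<lambda>x. Im (F (\<lambda>i. of_real (a i + x i))))" unfolding germ_def
    by (rule bexI[OF _ T(1)], rule eventually_elim2[OF T(2) eventually_translate_box[OF a(3)]]) (use f(3) in auto)
qed

text \<open>The primitive vanishes where the last variable is 0, so the definite integral from 0 to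
  \<open>b\<close> is its value at last variable \<open>b\<close>. That value is a translation
  followed by setting the last variable to 0. The parameter interval from 0 to 1 matches the
  parametrization of line paths.\<close>

lemma rep_integral:
  assumes f: "f \<in> S (Suc n)" "abs_conv_at f \<rho>" and \<rho>: "\<forall>i. 0 < \<rho> i" and b: "b \<in> \<rat>" "\<bar>b\<bar> < \<rho> n"
  obtains \<Psi> where "germ S n \<Psi>"
    "eventually (\<lambda>x. ((\<lambda>t. mps_eval f (x(n := t * b)) * b) has_integral \<Psi> x) {0..1}) (near_zero n)"
proof -
  define G where "G = mps_integral n f"
  have vf: "vars_below (Suc n) f" using conv[OF f(1)] by (simp add: conv_series_iff)
  have \<rho>0: "\<forall>j. 0 \<le> \<rho> j" using \<rho> by (simp add: less_imp_le)
  have G: "G \<in> S (Suc n)" "abs_conv_at G \<rho>" using int[OF f(1)] abs_conv_integral[OF f(2) \<rho>0] by (auto simp: G_def)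
  define a where "a = (\<lambda>i. if i = n then b else 0)"
  have T: "mps_translate (Suc n) G a \<in> S (Suc n)"
    "eventually (\<lambda>x. mps_eval (mps_translate (Suc n) G a) x = mps_eval G (\<lambda>i. a i + x i)) (near_zero (Suc n))"
    by (rule rep_translate[OF G]; use b \<rho> in \<open>auto simp: a_def\<close>)+
  have "germ S (Suc n) (\<lambda>x. mps_eval G (\<lambda>i. a i + x i))" unfolding germ_def
    by (rule bexI[OF _ T(1)], rule eventually_mono[OF T(2)]) simp
  \<comment> \<open>Passing from \<open>Suc n\<close> to \<open>n\<close> variables sets the last
    displacement to 0 and leaves the value at \<open>b\<close>.\<close>
  then have g: "germ S n (\<lambda>x. mps_eval G (\<lambda>i. a i + x i))" by (rule germ_restrict)
  have "eventually (\<lambda>x. ((\<lambda>t. mps_eval f (x(n := t * b)) * b) has_integral mps_eval G (\<lambda>i. a i + x i)) {0..1}) (near_zero n)"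
  proof -
    have "\<forall>i<n. 0 < \<rho> i" using \<rho> by simp
    from eventually_near_zero_box[OF this] show ?thesis
    proof eventually_elim
      case (elim x)
      have "((\<lambda>t. mps_eval f (x(n := t * b)) * b) has_integral
          (mps_eval G (x(n := 1 * b)) - mps_eval G (x(n := 0 * b)))) {0..1}"
      proof (rule fundamental_theorem_of_calculus)
        fix t :: real assume t: "t \<in> {0..1}"
        have "\<bar>t * b\<bar> \<le> 1 * \<bar>b\<bar>" unfolding abs_mult using t by (intro mult_right_mono) auto
        then have tb: "norm (t * b) < \<rho> n" using b by simp
        have "((\<lambda>z. mps_eval G (x(n := z))) has_field_derivative mps_eval f (x(n := t * b))) (at (t * b))"
          unfolding G_def
          by (rule mps_eval_integral_deriv[OF vf _ f(2) \<rho>0 _ tb]) (use elim in \<open>auto simp: less_imp_le\<close>)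
        from DERIV_chain2[where f = "\<lambda>z. mps_eval G (x(n := z))" and g = "\<lambda>t. t * b" and Db = b and x = t and s = UNIV, OF this]
        have "((\<lambda>t. mps_eval G (x(n := t * b))) has_real_derivative mps_eval f (x(n := t * b)) * b) (at t)"
          using DERIV_cmult_right[OF DERIV_ident, where c = b] by simp
        then show "((\<lambda>t. mps_eval G (x(n := t * b))) has_vector_derivative mps_eval f (x(n := t * b)) * b) (at t within {0..1})"
          by (auto simp: has_real_derivative_iff_has_vector_derivative intro: has_vector_derivative_at_within)
      qed simp
      moreover have "x(n := 1 * b) = (\<lambda>i. a i + x i)" using elim by (auto simp: a_def space_n_def)
      ultimately show ?case by (simp add: G_def)
    qed
  qed
  then show ?thesis using that g by blast
qed

lemma cgerm_integral:
  assumes F: "exp_bounded (Suc n) \<rho> M F" "\<forall>i. 0 < \<rho> i" and g: "cgerm S (Suc n) (\<lambda>x. F (\<lambda>i. of_real (x i)))"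
    and b: "b \<in> \<rat>" "\<bar>b\<bar> < \<rho> n"
  obtains \<Psi> where "cgerm S n \<Psi>"
    "eventually (\<lambda>x. ((\<lambda>t. F (\<lambda>i. of_real ((x(n := t * b)) i)) * of_real b) has_integral \<Psi> x) {0..1}) (near_zero n)"
proof -
  have \<rho>': "\<forall>i<Suc n. 0 < \<rho> i" "\<forall>i<n. 0 < \<rho> i" using F(2) by auto
  have R: "germ S (Suc n) (\<lambda>x. Re (F (\<lambda>i. of_real (x i))))" and I: "germ S (Suc n) (\<lambda>x. Im (F (\<lambda>i. of_real (x i))))"
    using g by (auto simp: cgerm_def)
  obtain f where f: "f \<in> S (Suc n)" "abs_conv_at f \<rho>"
    "\<And>x. \<forall>i<Suc n. \<bar>x i\<bar> \<le> \<rho> i \<Longrightarrow> mps_eval f x = Re (F (\<lambda>i. of_real (x i)))"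
    using rep_Re[OF F(1) \<rho>'(1) R] by blast
  obtain h where h: "h \<in> S (Suc n)" "abs_conv_at h \<rho>"
    "\<And>x. \<forall>i<Suc n. \<bar>x i\<bar> \<le> \<rho> i \<Longrightarrow> mps_eval h x = Im (F (\<lambda>i. of_real (x i)))"
    using rep_Im[OF F(1) \<rho>'(1) I] by blast
  obtain U where U: "germ S n U"
    "eventually (\<lambda>x. ((\<lambda>t. mps_eval f (x(n := t * b)) * b) has_integral U x) {0..1}) (near_zero n)"
    using rep_integral[OF f(1,2) F(2) b] .
  obtain V where V: "germ S n V"
    "eventually (\<lambda>x. ((\<lambda>t. mps_eval h (x(n := t * b)) * b) has_integral V x) {0..1}) (near_zero n)"
    using rep_integral[OF h(1,2) F(2) b] .
  have "cgerm S n (\<lambda>x. Complex (U x) (V x))" using U V by (simp add: cgerm_def)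
  moreover have "eventually (\<lambda>x. ((\<lambda>t. F (\<lambda>i. of_real ((x(n := t * b)) i)) * of_real b) has_integral Complex (U x) (V x)) {0..1}) (near_zero n)"
    using U(2) V(2) eventually_near_zero_box[OF \<rho>'(2)]
  proof eventually_elim
    case (elim x)
    have "((\<lambda>t. of_real (mps_eval f (x(n := t * b)) * b) + \<i> * of_real (mps_eval h (x(n := t * b)) * b)) has_integral
        of_real (U x) + \<i> * of_real (V x)) {0..1}"
      using elim by (intro has_integral_add has_integral_mult_right has_integral_of_real)
    then have "((\<lambda>t. F (\<lambda>i. of_real ((x(n := t * b)) i)) * of_real b) has_integral (of_real (U x) + \<i> * of_real (V x))) {0..1}"
    proof (rule has_integral_eq[rotated])
      fix t :: real assume t: "t \<in> {0..1}"
      have "\<bar>t * b\<bar> \<le> 1 * \<bar>b\<bar>" unfolding abs_mult using t by (intro mult_right_mono) auto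
      then have "\<forall>i<Suc n. \<bar>(x(n := t * b)) i\<bar> \<le> \<rho> i" using b elim by (auto simp: less_Suc_eq less_imp_le)
      from f(3)[OF this] h(3)[OF this]
      show "of_real (mps_eval f (x(n := t * b)) * b) + \<i> * of_real (mps_eval h (x(n := t * b)) * b) =
          F (\<lambda>i. of_real ((x(n := t * b)) i)) * of_real b"
        by (simp add: complex_eq_iff del: fun_upd_apply)
    qed
    then show ?case by (simp add: complex_eq_iff Complex_eq)
  qed
  ultimately show ?thesis using that by blast
qed

end

section \<open>Cauchy's formula on a square\<close>

text \<open>The second formula is the first one for the derivative of \<open>\<phi>\<close>: the two
  integrands differ by the derivative of \<open>\<phi> z / (z - w)\<close>, whose integral over a
  closed path vanishes. A corner has distance sqrt 2 r from 0, less than 2 r, so the square lies in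
  the disc of radius \<open>R\<close>.\<close>

lemma cauchy_square:
  assumes hol: "\<phi> holomorphic_on ball 0 R" and r: "0 < r" "2 * r \<le> R" and w: "cmod w < r"
  shows "((\<lambda>z. \<phi> z / (z - w)) has_contour_integral (2 * pi * \<i> * \<phi> w)) (rectpath (Complex (-r) (-r)) (Complex r r))"
    "((\<lambda>z. \<phi> z / (z - w) ^ 2) has_contour_integral (2 * pi * \<i> * deriv \<phi> w)) (rectpath (Complex (-r) (-r)) (Complex r r))"
proof -
  let ?\<gamma> = "rectpath (Complex (-r) (-r)) (Complex r r)"
  have wb: "w \<in> box (Complex (-r) (-r)) (Complex r r)"
    using w abs_Re_le_cmod[of w] abs_Im_le_cmod[of w] by (auto simp: in_box_complex_iff)
  have wR: "w \<in> ball 0 R" using w r by auto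
  have pi: "path_image ?\<gamma> \<subseteq> ball 0 R - {w}"
  proof
    fix z assume z: "z \<in> path_image ?\<gamma>"
    then have "z \<in> cbox (Complex (-r) (-r)) (Complex r r)"
      using path_image_rectpath_subset_cbox[of "Complex (-r) (-r)" "Complex r r"] r by auto
    then have "(Re z)\<^sup>2 \<le> r\<^sup>2" "(Im z)\<^sup>2 \<le> r\<^sup>2"
      using r by (auto simp: in_cbox_complex_iff abs_le_square_iff[symmetric])
    then have "(cmod z)\<^sup>2 \<le> 2 * r\<^sup>2" by (simp add: cmod_power2)
    also have "\<dots> < (2 * r)\<^sup>2" using r by (simp add: power_mult_distrib)
    finally have "cmod z < 2 * r" by (rule power_less_imp_less_base) (use r in simp)
    moreover have "z \<noteq> w"
      using path_image_rectpath_inter_box[of "Complex (-r) (-r)" "Complex r r"] r wb z by auto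
    ultimately show "z \<in> ball 0 R - {w}" using r by auto
  qed
  have F: "((\<lambda>z. f z / (z - w)) has_contour_integral (2 * pi * \<i> * f w)) ?\<gamma>" if "f holomorphic_on ball 0 R" for f
    using Cauchy_integral_formula_convex_simple[OF convex_ball that _ valid_path_rectpath pi] wR
      winding_number_rectpath[OF wb] by simp
  show "((\<lambda>z. \<phi> z / (z - w)) has_contour_integral (2 * pi * \<i> * \<phi> w)) ?\<gamma>" by (rule F[OF hol])
  have d: "((\<lambda>z. deriv \<phi> z / (z - w)) has_contour_integral (2 * pi * \<i> * deriv \<phi> w)) ?\<gamma>"
    by (rule F[OF holomorphic_deriv[OF hol open_ball]])
  have "((\<lambda>z. deriv \<phi> z / (z - w) - \<phi> z / (z - w) ^ 2) has_contour_integral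
      (\<phi> (pathfinish ?\<gamma>) / (pathfinish ?\<gamma> - w) - \<phi> (pathstart ?\<gamma>) / (pathstart ?\<gamma> - w))) ?\<gamma>"
  proof (rule contour_integral_primitive[OF _ valid_path_rectpath pi])
    fix z assume z: "z \<in> ball 0 R - {w}"
    have D: "(\<phi> has_field_derivative deriv \<phi> z) (at z)"
      using holomorphic_derivI[OF hol open_ball] z by blast
    have "((\<lambda>z. z - w) has_field_derivative 1 - 0) (at z)"
      by (rule DERIV_diff[OF DERIV_ident DERIV_const])
    from DERIV_divide[OF D this]
    have "((\<lambda>z. \<phi> z / (z - w)) has_field_derivative (deriv \<phi> z * (z - w) - \<phi> z * (1 - 0)) / ((z - w) * (z - w))) (at z)"
      using z by simp
    moreover have "(deriv \<phi> z * (z - w) - \<phi> z * (1 - 0)) / ((z - w) * (z - w)) = deriv \<phi> z / (z - w) - \<phi> z / (z - w) ^ 2"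
      using z by (simp add: diff_divide_distrib power2_eq_square)
    ultimately show "((\<lambda>z. \<phi> z / (z - w)) has_field_derivative deriv \<phi> z / (z - w) - \<phi> z / (z - w) ^ 2)
        (at z within ball 0 R - {w})"
      by (metis has_field_derivative_at_within)
  qed
  then have "((\<lambda>z. deriv \<phi> z / (z - w) - \<phi> z / (z - w) ^ 2) has_contour_integral 0) ?\<gamma>"
    by (simp add: rectpath_def Let_def)
  from has_contour_integral_diff[OF d this]
  show "((\<lambda>z. \<phi> z / (z - w) ^ 2) has_contour_integral (2 * pi * \<i> * deriv \<phi> w)) ?\<gamma>" by simp
qed

text \<open>Every half side is oriented away from its corner, because its integrand is expanded
  there. A full side is thus one half side followed by the reverse of another, which is the origin
  of the alternating signs.\<close>

lemma rectpath_from_halves: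
  fixes r :: real
  defines "C \<equiv> \<lambda>a b. Complex (a * r) (b * r)"
  assumes "\<And>a b d. \<bar>a\<bar> = 1 \<Longrightarrow> \<bar>b\<bar> = 1 \<Longrightarrow> (f has_contour_integral H a b) (linepath (C a b) (C 0 b)) \<and>
      (f has_contour_integral V a b) (linepath (C a b) (C a 0))"
  shows "(f has_contour_integral (H (-1) (-1) - H 1 (-1) + V 1 (-1) - V 1 1 + H 1 1 - H (-1) 1 + V (-1) 1 - V (-1) (-1)))
      (rectpath (Complex (-r) (-r)) (Complex r r))"
proof -
  have H: "(f has_contour_integral H a b) (linepath (C a b) (C 0 b))" if "\<bar>a\<bar> = 1" "\<bar>b\<bar> = 1" for a b using assms(2) that by blast
  have V: "(f has_contour_integral V a b) (linepath (C a b) (C a 0))" if "\<bar>a\<bar> = 1" "\<bar>b\<bar> = 1" for a b using assms(2) that by blast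
  have HH: "(f has_contour_integral (H a b + (- H (-a) b))) (linepath (C a b) (C (-a) b))" if "\<bar>a\<bar> = 1" "\<bar>b\<bar> = 1" for a b
  proof (rule has_contour_integral_split[where c = "C 0 b" and k = "1/2"])
    show "(f has_contour_integral - H (-a) b) (linepath (C 0 b) (C (-a) b))"
      using has_contour_integral_reverse_linepath[OF H[of "-a" b]] that by simp
  qed (use that H in \<open>auto simp: C_def complex_eq_iff\<close>)
  have VV: "(f has_contour_integral (V a b + (- V a (-b)))) (linepath (C a b) (C a (-b)))" if "\<bar>a\<bar> = 1" "\<bar>b\<bar> = 1" for a b
  proof (rule has_contour_integral_split[where c = "C a 0" and k = "1/2"])
    show "(f has_contour_integral - V a (-b)) (linepath (C a 0) (C a (-b)))"
      using has_contour_integral_reverse_linepath[OF V[of a "-b"]] that by simp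
  qed (use that V in \<open>auto simp: C_def complex_eq_iff\<close>)
  have "(f has_contour_integral ((H (-1) (-1) + (- H 1 (-1))) + ((V 1 (-1) + (- V 1 1)) + ((H 1 1 + (- H (-1) 1)) + (V (-1) 1 + (- V (-1) (-1)))))))
     (linepath (C (-1) (-1)) (C 1 (-1)) +++ linepath (C 1 (-1)) (C 1 1) +++ linepath (C 1 1) (C (-1) 1) +++ linepath (C (-1) 1) (C (-1) (-1)))"
    using HH[of "-1" "-1"] VV[of 1 "-1"] HH[of 1 1] VV[of "-1" 1]
    by (intro has_contour_integral_join) (auto intro!: valid_path_join)
  then show ?thesis by (simp add: rectpath_def Let_def C_def algebra_simps)
qed

section \<open>Complexification\<close>

lemma conv_abs_conv_cpoint:
  assumes "f \<in> conv_series n"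
  shows "eventually (\<lambda>w. abs_conv_at f (\<lambda>i. norm (cpoint w i))) (near_zero (2 * n))"
proof -
  obtain r where r: "r > 0" "vars_below n f" "abs_conv_at f (\<lambda>_. r)" using assms by (auto simp: conv_series_iff)
  have "eventually (\<lambda>w. w \<in> space_n (2 * n) \<and> (\<forall>i. \<bar>w i\<bar> < r / 2)) (near_zero (2 * n))"
    by (rule eventually_near_zero_bound) (use r in simp)
  then show ?thesis
  proof eventually_elim
    case (elim w)
    show ?case
    proof (rule abs_conv_at_mono[OF r(2,3)])
      fix i
      have "cmod (cpoint w i) \<le> \<bar>w (2 * i)\<bar> + \<bar>w (2 * i + 1)\<bar>"
        using cmod_le[of "cpoint w i"] by (simp add: cpoint_def)
      also have "\<dots> < r" using elim by (metis add_strict_mono field_sum_of_halves)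
      finally show "\<bar>cmod (cpoint w i)\<bar> \<le> \<bar>r\<bar>" using r by simp
    qed
  qed
qed

text \<open>The real and imaginary coordinates themselves become complex variables here: the
  function in question is the holomorphic extension of the complexified series to
  \<open>2 * n\<close> complex variables, and \<open>z (2 * j) + \<i> * z (2 * j + 1)\<close> has
  norm at most the sum of the two radii.\<close>

lemma cpoint_exp_bounded:
  assumes f: "vars_below n f" "abs_conv_at f R" and \<rho>: "\<forall>i<2 * n. 0 < \<rho> i"
    and le: "\<And>j. j < n \<Longrightarrow> \<rho> (2 * j) + \<rho> (2 * j + 1) \<le> R j"
  obtains M where "exp_bounded (2 * n) \<rho> M (\<lambda>z. mps_eval f (\<lambda>j. z (2 * j) + \<i> * z (2 * j + 1)))"
proof (rule exp_bounded_compose[OF f _ \<rho>, of "\<lambda>j z. z (2 * j) + \<i> * z (2 * j + 1)"])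
  have \<rho>0: "\<forall>i<2 * n. 0 \<le> \<rho> i" using \<rho> by (simp add: less_imp_le)
  show "exp_bounded (2 * n) \<rho> (R j) (\<lambda>z. z (2 * j) + \<i> * z (2 * j + 1))" if "j < n" for j
  proof -
    have "exp_bounded (2 * n) \<rho> (\<rho> (2 * j) + cmod \<i> * \<rho> (2 * j + 1)) (\<lambda>z. z (2 * j) + \<i> * z (2 * j + 1))"
      using that by (intro exp_bounded_add exp_bounded_cmult exp_bounded_var \<rho>0) auto
    then show ?thesis by (rule exp_bounded_mono) (use le[OF that] in simp)
  qed
  show "\<forall>i<n. 0 \<le> R i"
  proof (intro allI impI)
    fix i assume "i < n"
    then have "0 < \<rho> (2 * i)" "0 < \<rho> (2 * i + 1)" using \<rho> by auto
    then show "0 \<le> R i" using le[OF \<open>i < n\<close>] by simp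
  qed
qed (use that in blast)

lemma cpoint_of_real: "cpoint w = (\<lambda>j. of_real (w (2 * j)) + \<i> * of_real (w (2 * j + 1)))"
  by (auto simp: cpoint_def complex_eq_iff)

lemma mps_reim_conv:
  assumes "f \<in> conv_series n"
  shows "mps_Re n f \<in> conv_series (2 * n)" "mps_Im n f \<in> conv_series (2 * n)"
    "eventually (\<lambda>w. mps_eval (mps_Re n f) w = Re (mps_eval f (cpoint w))) (near_zero (2 * n))"
    "eventually (\<lambda>w. mps_eval (mps_Im n f) w = Im (mps_eval f (cpoint w))) (near_zero (2 * n))"
proof -
  obtain r where r: "r > 0" "vars_below n f" "abs_conv_at f (\<lambda>_. r)" using assms by (auto simp: conv_series_iff)
  have r2: "\<forall>i<2 * n. 0 < r / 2" using r by simp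
  obtain M where M: "exp_bounded (2 * n) (\<lambda>_. r / 2) M (\<lambda>z. mps_eval f (\<lambda>j. z (2 * j) + \<i> * z (2 * j + 1)))"
    using cpoint_exp_bounded[OF r(2,3) r2] by auto
  obtain g where g: "g \<in> conv_series (2 * n)" "\<And>x. \<forall>i<2 * n. \<bar>x i\<bar> \<le> r / 2 \<Longrightarrow> mps_eval g x = Re (mps_eval f (cpoint x))"
    using exp_bounded_Re_mps[OF M r2] unfolding cpoint_of_real by blast
  obtain h where h: "h \<in> conv_series (2 * n)" "\<And>x. \<forall>i<2 * n. \<bar>x i\<bar> \<le> r / 2 \<Longrightarrow> mps_eval h x = Im (mps_eval f (cpoint x))"
    using exp_bounded_Im_mps[OF M r2] unfolding cpoint_of_real by blast
  have eg: "eventually (\<lambda>w. mps_eval g w = Re (mps_eval f (cpoint w))) (near_zero (2 * n))"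
    using eventually_near_zero_box[OF r2] by eventually_elim (rule g(2), auto)
  have eh: "eventually (\<lambda>w. mps_eval h w = Im (mps_eval f (cpoint w))) (near_zero (2 * n))"
    using eventually_near_zero_box[OF r2] by eventually_elim (rule h(2), auto)
  have "mps_Re n f = g" unfolding mps_Re_def
    by (rule expansion_eqI) (use g(1) eg in \<open>auto simp: represents_iff elim: eventually_mono\<close>)
  moreover have "mps_Im n f = h" unfolding mps_Im_def
    by (rule expansion_eqI) (use h(1) eh in \<open>auto simp: represents_iff elim: eventually_mono\<close>)
  ultimately show "mps_Re n f \<in> conv_series (2 * n)" "mps_Im n f \<in> conv_series (2 * n)"
    "eventually (\<lambda>w. mps_eval (mps_Re n f) w = Re (mps_eval f (cpoint w))) (near_zero (2 * n))"
    "eventually (\<lambda>w. mps_eval (mps_Im n f) w = Im (mps_eval f (cpoint w))) (near_zero (2 * n))"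
    using g(1) h(1) eg eh by auto
qed

lemma exp_bounded_extend:
  assumes F: "exp_bounded n \<rho> M F" and \<rho>: "\<And>i. i < n \<Longrightarrow> \<rho>' i = \<rho> i" and le: "n \<le> m"
  shows "exp_bounded m \<rho>' M F"
proof -
  obtain c where c: "has_expansion n \<rho> c F" "weighted_norm \<rho> c \<le> M" using F by (auto simp: exp_bounded_def)
  have sb: "supp_below n c" using c by (simp add: has_expansion_def)
  have eq: "norm (c \<alpha>) * monom_at \<rho>' \<alpha> = norm (c \<alpha>) * monom_at \<rho> \<alpha>" for \<alpha>
    using monom_at_cong[of \<alpha> \<rho>' \<rho>] \<rho> supp_belowD[OF sb] by (cases "c \<alpha> = 0") auto
  have "supp_below m c" using sb le unfolding supp_below_def by (meson lessThan_subset_iff order_trans)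
  moreover have "\<forall>i<n. norm (z i) \<le> \<rho> i" if "\<forall>i<m. norm (z i) \<le> \<rho>' i" for z :: "nat \<Rightarrow> complex"
  proof (intro allI impI)
    fix i assume "i < n"
    then show "norm (z i) \<le> \<rho> i" using that \<rho>[of i] le by (metis order_less_le_trans)
  qed
  ultimately have "has_expansion m \<rho>' c F" using c(1) unfolding has_expansion_def eq by blast
  then show ?thesis using c(2) by (auto simp: exp_bounded_def weighted_norm_def eq)
qed

lemma eval_slice_holomorphic:
  fixes z :: complex
  assumes f: "vars_below (Suc n) f" "abs_conv_at f \<rho>" and \<rho>: "\<forall>j. 0 \<le> \<rho> j"
    and x: "\<And>j. j < n \<Longrightarrow> norm (x j) \<le> \<rho> j"
  shows "(\<lambda>z. mps_eval f (x(n := z))) holomorphic_on ball 0 (\<rho> n)"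
    "z \<in> ball 0 (\<rho> n) \<Longrightarrow> deriv (\<lambda>z. mps_eval f (x(n := z))) z = mps_eval (mps_deriv n f) (x(n := z))"
proof -
  have *: "((\<lambda>z. mps_eval f (x(n := z))) has_field_derivative mps_eval (mps_deriv n f) (x(n := z))) (at z)"
    if "z \<in> ball 0 (\<rho> n)" for z
    by (rule mps_eval_has_deriv[OF f \<rho>]) (use x that in auto)
  then show "(\<lambda>z. mps_eval f (x(n := z))) holomorphic_on ball 0 (\<rho> n)"
    using holomorphic_on_open[OF open_ball] by blast
  show "z \<in> ball 0 (\<rho> n) \<Longrightarrow> deriv (\<lambda>z. mps_eval f (x(n := z))) z = mps_eval (mps_deriv n f) (x(n := z))"
    using * DERIV_imp_deriv by blast
qed

text \<open>Differentiation, coefficients in the base field, composition and translation over the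
  base field are left out on purpose: they are consequences of real and imaginary parts together
  with the properties already assumed.\<close>

locale analysis_sys = rational_sys +
  assumes reim: "f \<in> S (Suc n) \<Longrightarrow> mps_Re (Suc n) f \<in> S (2 * Suc n) \<and> mps_Im (Suc n) f \<in> S (2 * Suc n)"
begin

section \<open>Composition through Cauchy integrals\<close>

lemma cgerm_cpoint:
  assumes "f \<in> S (Suc n)"
  shows "cgerm S (2 * Suc n) (\<lambda>w. mps_eval f (cpoint w))"
  unfolding cgerm_def germ_def
  by (intro conjI bexI[OF _ conjunct1[OF reim[OF assms]]] bexI[OF _ conjunct2[OF reim[OF assms]]])
    (rule eventually_mono[OF mps_reim_conv(3)[OF conv[OF assms]]] eventually_mono[OF mps_reim_conv(4)[OF conv[OF assms]]], simp)+

lemma cgerm_power: "cgerm S n F \<Longrightarrow> cgerm S n (\<lambda>x. F x ^ k)"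
proof (induction k)
  case 0
  then show ?case using cgerm_const[of 1] by simp
next
  case (Suc k)
  then show ?case by (simp add: cgerm_mult)
qed

text \<open>Half sides of the square, seen from a corner \<open>c\<close>: the integrand expands around the
  corner with a radius exceeding the length \<open>r\<close> of the half side.\<close>

lemma cgerm_half_side:
  assumes f: "f \<in> S (Suc n)" "abs_conv_at f (\<lambda>_. R)"
    and g: "g \<in> S n" "exp_bounded n (\<lambda>_. \<epsilon>) (r / 10) (mps_eval g)" and \<epsilon>: "0 < \<epsilon>" "\<epsilon> \<le> R"
    and r: "0 < r" "r \<in> \<rat>" "4 * r \<le> R"
    and a: "\<bar>a\<bar> = 1" "\<bar>b\<bar> = 1" and us: "(u, s) = (1, a) \<or> (u, s) = (\<i>, b)"
  obtains \<Psi> where "cgerm S n \<Psi>"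
    "eventually (\<lambda>x. ((\<lambda>z. mps_eval f ((\<lambda>i. complex_of_real (x i))(n := z)) / (z - of_real (mps_eval g x)) ^ k) has_contour_integral \<Psi> x)
        (linepath (Complex (a * r) (b * r)) (Complex (a * r) (b * r) - u * of_real (s * r)))) (near_zero n)"
proof -
  define c where "c = Complex (a * r) (b * r)"
  have R: "0 < R" using \<epsilon> by simp
  have ab: "a \<in> {1, -1}" "b \<in> {1, -1}" using a by (auto simp: abs_if split: if_splits)
  have vf: "vars_below (Suc n) f" using conv[OF f(1)] by (simp add: conv_series_iff)
  \<comment> \<open>The corner has distance sqrt 2 r from 0. The rational bounds 1.4 r and 2 r are
    all that is used of it.\<close>
  have c2: "(cmod c)\<^sup>2 = 2 * r\<^sup>2" using ab by (auto simp: c_def cmod_power2)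
  have "(14 / 10 * r)\<^sup>2 \<le> (cmod c)\<^sup>2" unfolding c2 by (simp add: power_mult_distrib power_divide)
  then have clo: "14 / 10 * r \<le> cmod c" by (rule power2_le_imp_le) simp
  have "(cmod c)\<^sup>2 \<le> (2 * r)\<^sup>2" unfolding c2 by (simp add: power_mult_distrib)
  then have cup: "cmod c \<le> 2 * r" by (rule power2_le_imp_le) (use r in simp)
  \<comment> \<open>\<open>f\<close> with its last argument made complex: two real variables
    \<open>n\<close> and \<open>Suc n\<close> hold its real and imaginary part, the first
    \<open>n\<close> arguments stay real.\<close>
  define A where "A = (\<lambda>z. mps_eval f (\<lambda>i. if i < n then z i else z n + \<i> * z (Suc n)))"
  \<comment> \<open>Two radii 2 r add up to 4 r, which is still within \<open>R\<close>, and the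
    coordinates of the corner, of absolute value r, are strictly inside.\<close>
  define \<rho>A where "\<rho>A = (\<lambda>i. if i < n then \<epsilon> else 2 * r)"
  have \<rho>A: "\<forall>i<Suc (Suc n). 0 < \<rho>A i" using \<epsilon> r by (simp add: \<rho>A_def)
  have A: "cgerm S (Suc (Suc n)) (\<lambda>x. A (\<lambda>i. of_real (x i)))"
  proof -
    \<comment> \<open>\<open>D\<close> keeps all real coordinates and the imaginary coordinate of
      the last variable; \<open>t\<close> closes the gaps, and the remaining imaginary coordinates
      become 0.\<close>
    define D where "D = {i. i < 2 * Suc n \<and> (even i \<or> i = 2 * n + 1)}"
    define t where "t = (\<lambda>i. if i = 2 * n + 1 then Suc n else i div 2)"
    have "cgerm S (Suc (Suc n)) (\<lambda>x. mps_eval f (cpoint (\<lambda>i. if i \<in> D then x (t i) else 0)))"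
    proof (rule cgerm_reindex[OF cgerm_cpoint[OF f(1)]])
      show "inj_on t D" by (auto simp: inj_on_def D_def t_def elim!: evenE split: if_splits)
    qed (auto simp: D_def t_def)
    moreover have "mps_eval f (cpoint (\<lambda>i. if i \<in> D then x (t i) else 0)) = A (\<lambda>i. of_real (x i))" for x
      unfolding A_def by (rule mps_eval_cong[OF vf]) (auto simp: cpoint_def D_def t_def complex_eq_iff less_Suc_eq)
    ultimately show ?thesis by simp
  qed
  obtain MA where MA: "exp_bounded (Suc (Suc n)) \<rho>A MA A"
  proof -
    have "exp_bounded (Suc (Suc n)) \<rho>A R (\<lambda>z. if i < n then z i else z n + \<i> * z (Suc n))" if "i < Suc n" for i
    proof (cases "i < n")
      case True
      have "exp_bounded (Suc (Suc n)) \<rho>A (\<rho>A i) (\<lambda>z. z i)" by (rule exp_bounded_var) (use that in simp)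
      then show ?thesis using True \<epsilon> by (auto simp: \<rho>A_def intro: exp_bounded_mono)
    next
      case False
      have "exp_bounded (Suc (Suc n)) \<rho>A (\<rho>A n + cmod \<i> * \<rho>A (Suc n)) (\<lambda>z. z n + \<i> * z (Suc n))"
        by (intro exp_bounded_add exp_bounded_cmult exp_bounded_var) (use \<rho>A in \<open>auto simp: less_imp_le\<close>)
      then show ?thesis using False r by (auto simp: \<rho>A_def intro: exp_bounded_mono)
    qed
    then show thesis
      using exp_bounded_compose[OF vf f(2) _ \<rho>A, of "\<lambda>i z. if i < n then z i else z n + \<i> * z (Suc n)"] R that
      unfolding A_def by auto
  qed
  \<comment> \<open>Moves the origin of the last, complex argument to the corner. This is where
    rationality of \<open>r\<close> enters.\<close>
  define \<tau> where "\<tau> = (\<lambda>i. if i = n then a * r else if i = Suc n then b * r else 0)"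
  have rat: "a * r \<in> \<rat>" "b * r \<in> \<rat>" using ab r by auto
  have A2: "cgerm S (Suc (Suc n)) (\<lambda>x. A (\<lambda>i. of_real (\<tau> i + x i)))"
    by (rule cgerm_translate[OF MA \<rho>A A]) (use rat r ab \<epsilon> in \<open>auto simp: \<tau>_def \<rho>A_def\<close>)
  \<comment> \<open>\<open>f\<close> along the line through the corner in direction
    \<open>u\<close>, with the position on that line as last variable.\<close>
  define B where "B = (\<lambda>z. mps_eval f (z(n := c + u * z n)))"
  have B: "cgerm S (Suc n) (\<lambda>x. B (\<lambda>i. of_real (x i)))"
  proof -
    \<comment> \<open>The real coordinate that varies along the side. The other one keeps its value
      at the corner, that is, displacement 0.\<close>
    define m where "m = (if u = 1 then n else Suc n)"
    define D where "D = {..<n} \<union> {m}"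
    define t where "t = (\<lambda>i. if i = m then n else i)"
    have "cgerm S (Suc n) (\<lambda>x. A (\<lambda>i. of_real (\<tau> i + (if i \<in> D then x (t i) else 0))))"
      by (rule cgerm_reindex[OF A2]) (auto simp: D_def t_def m_def inj_on_def split: if_splits)
    moreover have "A (\<lambda>i. of_real (\<tau> i + (if i \<in> D then x (t i) else 0))) = B (\<lambda>i. of_real (x i))" for x
      unfolding A_def B_def
      by (rule mps_eval_cong[OF vf]) (use us in \<open>auto simp: \<tau>_def D_def t_def m_def c_def less_Suc_eq complex_eq_iff\<close>)
    ultimately show ?thesis by simp
  qed
  \<comment> \<open>The radius 1.2 r along the side exceeds the length r of the half side. It is
    also small enough for the kernel, as 1.2 r plus the bound 0.1 r of \<open>g\<close> stays below
    1.4 r, and for \<open>f\<close>, as 2 r plus 1.2 r stays below \<open>R\<close>.\<close>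
  define \<rho> where "\<rho> = (\<lambda>i. if i < n then \<epsilon> else 12 / 10 * r)"
  have \<rho>: "\<forall>i. 0 < \<rho> i" using \<epsilon> r by (simp add: \<rho>_def)
  then have \<rho>': "\<forall>i<Suc n. 0 < \<rho> i" "\<forall>i<Suc n. 0 \<le> \<rho> i" by (auto simp: less_imp_le)
  have u1: "cmod u = 1" using us by auto
  obtain MB where MB: "exp_bounded (Suc n) \<rho> MB B"
  proof -
    have "exp_bounded (Suc n) \<rho> R (\<lambda>z. (z(n := c + u * z n)) i)" if "i < Suc n" for i
    proof (cases "i = n")
      case True
      have "exp_bounded (Suc n) \<rho> (cmod c + cmod u * \<rho> n) (\<lambda>z. c + u * z n)"
        by (intro exp_bounded_add exp_bounded_cmult exp_bounded_var exp_bounded_const \<rho>'(2)) auto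
      then have "exp_bounded (Suc n) \<rho> R (\<lambda>z. c + u * z n)"
        by (rule exp_bounded_mono) (use cup u1 r in \<open>simp add: \<rho>_def\<close>)
      then show ?thesis using True by simp
    next
      case False
      have "exp_bounded (Suc n) \<rho> (\<rho> i) (\<lambda>z. z i)" by (rule exp_bounded_var) (use that in simp)
      then show ?thesis using False that \<epsilon> by (auto simp: \<rho>_def intro: exp_bounded_mono)
    qed
    then show thesis
      using exp_bounded_compose[OF vf f(2) _ \<rho>'(1), of "\<lambda>i z. (z(n := c + u * z n)) i"] R that
      unfolding B_def by (auto simp: fun_upd_def)
  qed
  \<comment> \<open>The Cauchy kernel at \<open>c + u * z n\<close>, arranged as a constant minus a
    smaller function so that the geometric series applies.\<close>
  define K where "K = (\<lambda>z. 1 / (c - (mps_eval g z - u * z n)))"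
  have uc: "Re u \<in> \<rat>" "Im u \<in> \<rat>" "Re c \<in> \<rat>" "Im c \<in> \<rat>" using us rat by (auto simp: c_def)
  have vg: "vars_below n g" using conv[OF g(1)] by (simp add: conv_series_iff)
  have g0: "mps_eval g (\<lambda>_. 0::complex) \<noteq> c"
    using exp_bounded_norm_le[OF g(2), of "\<lambda>_. 0"] \<epsilon> clo r by auto
  have gS: "g \<in> S (Suc n)" using mono[of n "Suc n"] g(1) by auto
  have K: "cgerm S (Suc n) (\<lambda>x. K (\<lambda>i. of_real (x i)))"
  proof -
    have "cgerm S (Suc n) (\<lambda>x. c - (of_real (mps_eval g x) - u * of_real (x n)))"
      by (intro cgerm_diff cgerm_mult cgerm_const cgerm_of_real germ_var uc germI gS) auto
    then have "cgerm S (Suc n) (\<lambda>x. 1 / (c - (of_real (mps_eval g x) - u * of_real (x n))))"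
      by (rule cgerm_inverse) (use g0 mps_eval_of_real[of g "\<lambda>_. 0"] in auto)
    then show ?thesis by (simp add: K_def mps_eval_of_real)
  qed
  obtain MK where MK: "exp_bounded (Suc n) \<rho> MK K"
  proof -
    have "exp_bounded (Suc n) \<rho> (r / 10) (mps_eval g)"
      by (rule exp_bounded_extend[OF g(2)]) (auto simp: \<rho>_def)
    then have "exp_bounded (Suc n) \<rho> (r / 10 + cmod u * \<rho> n) (\<lambda>z. mps_eval g z - u * z n)"
      by (intro exp_bounded_diff exp_bounded_cmult exp_bounded_var \<rho>'(2)) auto
    from exp_bounded_inverse[OF this _ \<rho>'(1), of c] show thesis using that clo u1 r unfolding K_def
      by (auto simp: \<rho>_def)
  qed
  \<comment> \<open>The factor \<open>u\<close> comes from \<open>dz\<close> along the side.\<close>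
  define \<Phi> where "\<Phi> = (\<lambda>z. u * (B z * K z ^ k))"
  have \<Phi>: "cgerm S (Suc n) (\<lambda>x. \<Phi> (\<lambda>i. of_real (x i)))"
    unfolding \<Phi>_def by (intro cgerm_mult cgerm_const cgerm_power B K uc)
  have M\<Phi>: "exp_bounded (Suc n) \<rho> (cmod u * (MB * MK ^ k)) \<Phi>"
    unfolding \<Phi>_def by (intro exp_bounded_mult exp_bounded_cmult exp_bounded_power MB MK \<rho>')
  \<comment> \<open>The signed length leading from the corner to the midpoint of the side; its
    absolute value r is less than 1.2 r.\<close>
  have sr: "- (s * r) \<in> \<rat>" "\<bar>- (s * r)\<bar> < \<rho> n" using us ab r by (auto simp: \<rho>_def)
  obtain \<Psi> where \<Psi>: "cgerm S n \<Psi>"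
    "eventually (\<lambda>x. ((\<lambda>t. \<Phi> (\<lambda>i. of_real ((x(n := t * (- (s * r)))) i)) * of_real (- (s * r))) has_integral \<Psi> x) {0..1}) (near_zero n)"
    using cgerm_integral[OF M\<Phi> \<rho> \<Phi> sr] by blast
  show thesis
  proof (rule that[OF \<Psi>(1)], rule eventually_mono[OF \<Psi>(2)])
    fix x assume I: "((\<lambda>t. \<Phi> (\<lambda>i. of_real ((x(n := t * (- (s * r)))) i)) * of_real (- (s * r))) has_integral \<Psi> x) {0..1}"
    show "((\<lambda>z. mps_eval f ((\<lambda>i. complex_of_real (x i))(n := z)) / (z - of_real (mps_eval g x)) ^ k) has_contour_integral \<Psi> x)
        (linepath (Complex (a * r) (b * r)) (Complex (a * r) (b * r) - u * of_real (s * r)))"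
      unfolding has_contour_integral_linepath c_def[symmetric]
    proof (rule has_integral_eq[OF _ I])
      fix t :: real
      let ?z = "\<lambda>i. complex_of_real ((x(n := t * (- (s * r)))) i)"
      have e: "c + u * ?z n = linepath c (c - u * of_real (s * r)) t"
        by (simp add: linepath_def scaleR_conv_of_real algebra_simps)
      have "mps_eval g ?z = mps_eval g (\<lambda>i. of_real (x i))" by (rule mps_eval_cong[OF vg]) auto
      then have "K ?z = 1 / (linepath c (c - u * of_real (s * r)) t - of_real (mps_eval g x))"
        unfolding K_def e[symmetric] by (simp add: mps_eval_of_real algebra_simps)
      moreover have "B ?z = mps_eval f ((\<lambda>i. complex_of_real (x i))(n := linepath c (c - u * of_real (s * r)) t))"
        unfolding B_def e by (rule mps_eval_cong[OF vf]) auto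
      ultimately show "\<Phi> ?z * of_real (- (s * r)) =
          mps_eval f ((\<lambda>i. complex_of_real (x i))(n := linepath c (c - u * of_real (s * r)) t)) /
          (linepath c (c - u * of_real (s * r)) t - of_real (mps_eval g x)) ^ k * (c - u * of_real (s * r) - c)"
        by (simp add: \<Phi>_def power_one_over)
    qed
  qed
qed

text \<open>Exponent 1 will give the value and exponent 2 the derivative of \<open>f\<close> in its
  last argument at \<open>g\<close>. The radii are returned as well, because Cauchy's formula has to
  be applied to the same square afterwards.\<close>

lemma cgerm_square:
  assumes f: "f \<in> S (Suc n)" and g: "g \<in> S n" "mcoeff g 0 = 0"
  obtains r R \<Psi> where "0 < r" "4 * r \<le> R" "abs_conv_at f (\<lambda>_. R)" "cgerm S n \<Psi>"
    "eventually (\<lambda>x. cmod (mps_eval g (\<lambda>i. complex_of_real (x i))) < r \<and>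
      ((\<lambda>z. mps_eval f ((\<lambda>i. complex_of_real (x i))(n := z)) / (z - of_real (mps_eval g x)) ^ k) has_contour_integral \<Psi> x)
        (rectpath (Complex (-r) (-r)) (Complex r r))) (near_zero n)"
proof -
  obtain R where R: "R > 0" "abs_conv_at f (\<lambda>_. R)" using conv[OF f] by (auto simp: conv_series_iff)
  obtain r where r: "r \<in> \<rat>" "0 < r" "r < R / 4" using Rats_dense_in_real[of 0 "R / 4"] R by auto
  obtain r0 M where r0: "0 < r0" "exp_bounded n (\<lambda>_. r0) M (mps_eval g)" using conv_series_exp_bounded[OF conv[OF g(1)]] by blast
  obtain t where t: "0 < t" "t \<le> 1" "exp_bounded n (\<lambda>i. t * r0) (r / 10) (mps_eval g)"
    by (rule exp_bounded_small[OF r0(2), of "r / 10"]) (use r0 r g(2) in \<open>auto simp: mps_eval_at_0\<close>)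
  \<comment> \<open>Both requirements on the parameters at once: \<open>g\<close> must be bounded by
    a tenth of r, and \<open>f\<close> must converge for them.\<close>
  define \<epsilon> where "\<epsilon> = min R (t * r0)"
  have \<epsilon>: "0 < \<epsilon>" "\<epsilon> \<le> R" using R t r0 by (auto simp: \<epsilon>_def)
  have gn: "exp_bounded n (\<lambda>_. \<epsilon>) (r / 10) (mps_eval g)"
    by (rule exp_bounded_shrink[OF t(3)]) (use \<epsilon> in \<open>auto simp: \<epsilon>_def\<close>)
  have r4: "4 * r \<le> R" using r by simp
  let ?H = "\<lambda>x z. mps_eval f ((\<lambda>i. complex_of_real (x i))(n := z)) / (z - of_real (mps_eval g x)) ^ k"
  have exHH: "\<exists>\<Psi>. cgerm S n \<Psi> \<and> eventually (\<lambda>x. (?H x has_contour_integral \<Psi> x)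
      (linepath (Complex (a * r) (b * r)) (Complex (0 * r) (b * r)))) (near_zero n)" if ab: "\<bar>a\<bar> = 1" "\<bar>b\<bar> = 1" for a b
  proof -
    have eq: "Complex (a * r) (b * r) - 1 * of_real (a * r) = Complex (0 * r) (b * r)" by (simp add: complex_eq_iff)
    obtain \<Psi> where "cgerm S n \<Psi>" "eventually (\<lambda>x. (?H x has_contour_integral \<Psi> x)
        (linepath (Complex (a * r) (b * r)) (Complex (a * r) (b * r) - 1 * of_real (a * r)))) (near_zero n)"
      by (rule cgerm_half_side[OF f R(2) g(1) gn \<epsilon> r(2,1) r4 ab, of 1 a k]) (simp, blast)
    then show ?thesis unfolding eq by blast
  qed
  \<comment> \<open>The integrals over half sides exist separately for each corner; a choice makes
    them functions of the signs \<open>a\<close> and \<open>b\<close> of the corner.\<close>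
  define HH where "HH = (\<lambda>a b. SOME \<Psi>. cgerm S n \<Psi> \<and> eventually (\<lambda>x. (?H x has_contour_integral \<Psi> x)
      (linepath (Complex (a * r) (b * r)) (Complex (0 * r) (b * r)))) (near_zero n))"
  have HH: "cgerm S n (HH a b)" "eventually (\<lambda>x. (?H x has_contour_integral HH a b x)
      (linepath (Complex (a * r) (b * r)) (Complex (0 * r) (b * r)))) (near_zero n)" if "\<bar>a\<bar> = 1" "\<bar>b\<bar> = 1" for a b
    using someI_ex[OF exHH[OF that]] unfolding HH_def by blast+
  have exV: "\<exists>\<Psi>. cgerm S n \<Psi> \<and> eventually (\<lambda>x. (?H x has_contour_integral \<Psi> x)
      (linepath (Complex (a * r) (b * r)) (Complex (a * r) (0 * r)))) (near_zero n)" if ab: "\<bar>a\<bar> = 1" "\<bar>b\<bar> = 1" for a b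
  proof -
    have eq: "Complex (a * r) (b * r) - \<i> * of_real (b * r) = Complex (a * r) (0 * r)" by (simp add: complex_eq_iff)
    obtain \<Psi> where "cgerm S n \<Psi>" "eventually (\<lambda>x. (?H x has_contour_integral \<Psi> x)
        (linepath (Complex (a * r) (b * r)) (Complex (a * r) (b * r) - \<i> * of_real (b * r)))) (near_zero n)"
      by (rule cgerm_half_side[OF f R(2) g(1) gn \<epsilon> r(2,1) r4 ab, of \<i> b k]) (simp, blast)
    then show ?thesis unfolding eq by blast
  qed
  define V where "V = (\<lambda>a b. SOME \<Psi>. cgerm S n \<Psi> \<and> eventually (\<lambda>x. (?H x has_contour_integral \<Psi> x)
      (linepath (Complex (a * r) (b * r)) (Complex (a * r) (0 * r)))) (near_zero n))"
  have V: "cgerm S n (V a b)" "eventually (\<lambda>x. (?H x has_contour_integral V a b x)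
      (linepath (Complex (a * r) (b * r)) (Complex (a * r) (0 * r)))) (near_zero n)" if "\<bar>a\<bar> = 1" "\<bar>b\<bar> = 1" for a b
    using someI_ex[OF exV[OF that]] unfolding V_def by blast+
  define \<Psi> where "\<Psi> = (\<lambda>x. HH (-1) (-1) x - HH 1 (-1) x + V 1 (-1) x - V 1 1 x + HH 1 1 x - HH (-1) 1 x + V (-1) 1 x - V (-1) (-1) x)"
  have "cgerm S n \<Psi>" unfolding \<Psi>_def by (intro cgerm_add cgerm_diff HH V) auto
  moreover have "eventually (\<lambda>x. cmod (mps_eval g (\<lambda>i. complex_of_real (x i))) < r \<and> (?H x has_contour_integral \<Psi> x)
        (rectpath (Complex (-r) (-r)) (Complex r r))) (near_zero n)"
  proof -
    have e: "eventually (\<lambda>x. \<forall>a\<in>{1,-1}. \<forall>b\<in>{1,-1}. (?H x has_contour_integral HH a b x)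
      (linepath (Complex (a * r) (b * r)) (Complex (0 * r) (b * r))) \<and> (?H x has_contour_integral V a b x)
      (linepath (Complex (a * r) (b * r)) (Complex (a * r) (0 * r)))) (near_zero n)"
      by (intro eventually_ball_finite ballI eventually_conj HH(2) V(2)) auto
    have "\<forall>i<n. 0 < \<epsilon>" using \<epsilon> by simp
    from e eventually_near_zero_box[OF this] show ?thesis
    proof eventually_elim
      case (elim x)
      have "cmod (mps_eval g (\<lambda>i. complex_of_real (x i))) \<le> r / 10"
        by (rule exp_bounded_norm_le[OF gn]) (use elim in \<open>auto simp: less_imp_le\<close>)
      then have "cmod (mps_eval g (\<lambda>i. complex_of_real (x i))) < r" using r by simp
      moreover have "(?H x has_contour_integral \<Psi> x) (rectpath (Complex (-r) (-r)) (Complex r r))"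
        unfolding \<Psi>_def
      proof (rule rectpath_from_halves[where H = "\<lambda>a b. HH a b x" and V = "\<lambda>a b. V a b x"])
        fix a b :: real assume "\<bar>a\<bar> = 1" "\<bar>b\<bar> = 1"
        then have "a \<in> {1,-1}" "b \<in> {1,-1}" by (auto simp: abs_if split: if_splits)
        then show "(?H x has_contour_integral HH a b x) (linepath (Complex (a * r) (b * r)) (Complex (0 * r) (b * r))) \<and>
          (?H x has_contour_integral V a b x) (linepath (Complex (a * r) (b * r)) (Complex (a * r) (0 * r)))"
          using elim by blast
      qed
      ultimately show ?case by blast
    qed
  qed
  ultimately show ?thesis using that r(2) r4 R(2) by blast
qed

text \<open>The integral of \<open>1 / z\<close> around the square is \<open>2 * pi * \<i>\<close>,
  and it is a germ of the system by the case \<open>f = 1\<close>, \<open>g = 0\<close>. The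
  normalizing constant of Cauchy's formula is therefore supplied by the construction itself.\<close>

lemma germ_inverse_two_pi: "germ S n (\<lambda>_. 1 / (2 * pi))"
proof -
  have "(1::mps) - 1 \<in> S n" using ring[of n] unfolding is_subring_def by blast
  then have 1: "1 \<in> S (Suc n)" "0 \<in> S n" using ring[of "Suc n"] by (simp_all add: is_subring_def)
  obtain r R \<Psi> where H: "0 < r" "4 * r \<le> R" "abs_conv_at 1 (\<lambda>_. R)" "cgerm S n \<Psi>"
    "eventually (\<lambda>x. cmod (mps_eval 0 (\<lambda>i. complex_of_real (x i))) < r \<and>
      ((\<lambda>z. mps_eval 1 ((\<lambda>i. complex_of_real (x i))(n := z)) / (z - of_real (mps_eval 0 x)) ^ 1) has_contour_integral \<Psi> x)
        (rectpath (Complex (-r) (-r)) (Complex r r))) (near_zero n)"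
    using cgerm_square[OF 1, of 1] by auto
  have "((\<lambda>z. 1 / (z - 0)) has_contour_integral (2 * pi * \<i> * 1)) (rectpath (Complex (-r) (-r)) (Complex r r))"
    by (rule cauchy_square(1)[where \<phi> = "\<lambda>_. 1" and R = "2 * r"]) (use H in auto)
  then have "cgerm S n (\<lambda>_. 2 * pi * \<i>)"
    by (intro cgerm_cong[OF H(4)] eventually_mono[OF H(5)]) (auto dest: has_contour_integral_unique)
  then have "germ S n (\<lambda>_. 2 * pi)" by (simp add: cgerm_def)
  from germ_inverse[OF this] show ?thesis by simp
qed

lemma germ_compose_last:
  assumes f: "f \<in> S (Suc n)" and g: "g \<in> S n" "mcoeff g 0 = 0"
  shows "germ S n (\<lambda>x. mps_eval f (x(n := mps_eval g x)))"
    and "germ S n (\<lambda>x. mps_eval (mps_deriv n f) (x(n := mps_eval g x)))"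
proof -
  have vf: "vars_below (Suc n) f" using conv[OF f] by (simp add: conv_series_iff)
  \<comment> \<open>The value sought is real, so the contour integral is
    \<open>2 * pi * \<i>\<close> times a real number and its imaginary part contains
    everything.\<close>
  have I: "germ S n (\<lambda>x. Im (\<Psi> x) * (1 / (2 * pi)))" if "cgerm S n \<Psi>" for \<Psi>
    by (rule germ_mult[OF _ germ_inverse_two_pi]) (use that in \<open>simp add: cgerm_def\<close>)
  {
    fix r R k \<Psi> assume H: "0 < r" "4 * r \<le> R" "abs_conv_at f (\<lambda>_. R)" "cgerm S n \<Psi>"
    "eventually (\<lambda>x. cmod (mps_eval g (\<lambda>i. complex_of_real (x i))) < r \<and>
      ((\<lambda>z. mps_eval f ((\<lambda>i. complex_of_real (x i))(n := z)) / (z - of_real (mps_eval g x)) ^ k) has_contour_integral \<Psi> x)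
        (rectpath (Complex (-r) (-r)) (Complex r r))) (near_zero n)"
    and k: "k = 1 \<or> k = 2"
    have R: "0 < R" using H by simp
    have "eventually (\<lambda>x. Im (\<Psi> x) * (1 / (2 * pi)) = mps_eval (if k = 1 then f else mps_deriv n f) (x(n := mps_eval g x))) (near_zero n)"
      using H(5) eventually_near_zero_bound[OF R]
    proof eventually_elim
      case (elim x)
      let ?\<phi> = "\<lambda>z. mps_eval f ((\<lambda>i. complex_of_real (x i))(n := z))"
      let ?w = "complex_of_real (mps_eval g x)"
      have w: "cmod ?w < r" using elim by (simp add: mps_eval_of_real)
      have wR: "?w \<in> ball 0 R" using w H by auto
      have hol: "?\<phi> holomorphic_on ball 0 R"
        by (rule eval_slice_holomorphic(1)[OF vf H(3)]) (use R elim in \<open>auto simp: less_imp_le\<close>)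
      have d: "deriv ?\<phi> ?w = mps_eval (mps_deriv n f) ((\<lambda>i. complex_of_real (x i))(n := ?w))"
        by (rule eval_slice_holomorphic(2)[OF vf H(3)]) (use R elim wR in \<open>auto simp: less_imp_le\<close>)
      define y where "y = x(n := mps_eval g x)"
      have up: "(\<lambda>i. complex_of_real (x i))(n := ?w) = (\<lambda>i. of_real (y i))" by (auto simp: y_def)
      have "2 * r \<le> R" using H by simp
      note C = cauchy_square[OF hol H(1) this w]
      have "\<Psi> x = 2 * pi * \<i> * of_real (mps_eval (if k = 1 then f else mps_deriv n f) y)"
        using k
      proof
        assume k1: "k = 1"
        have "\<Psi> x = 2 * pi * \<i> * ?\<phi> ?w"
          using has_contour_integral_unique[OF _ C(1)] elim k1 by simp
        then show ?thesis using k1 unfolding up mps_eval_of_real by simp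
      next
        assume k2: "k = 2"
        have "\<Psi> x = 2 * pi * \<i> * deriv ?\<phi> ?w"
          using has_contour_integral_unique[OF _ C(2)] elim k2 by simp
        then show ?thesis using k2 unfolding d up mps_eval_of_real by simp
      qed
      then show ?case unfolding y_def[symmetric] by simp
    qed
    from germ_cong[OF I[OF H(4)] this]
    have "germ S n (\<lambda>x. mps_eval (if k = 1 then f else mps_deriv n f) (x(n := mps_eval g x)))" .
  } note * = this
  show "germ S n (\<lambda>x. mps_eval f (x(n := mps_eval g x)))"
    by (rule cgerm_square[OF f g, where k = 1]) (use *[OF _ _ _ _ _ disjI1[OF refl]] in simp)
  show "germ S n (\<lambda>x. mps_eval (mps_deriv n f) (x(n := mps_eval g x)))"
    by (rule cgerm_square[OF f g, where k = 2]) (use *[OF _ _ _ _ _ disjI2[OF refl]] in simp)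
qed

end

section \<open>Polynomials\<close>

definition mps_monom :: "real \<Rightarrow> multi_index \<Rightarrow> mps" where
  "mps_monom c \<alpha> = MPS (\<lambda>\<beta>. if \<beta> = \<alpha> then c else 0)"

lemma mps_monom_mult: "mps_monom c \<alpha> * mps_monom d \<beta> = mps_monom (c * d) (\<alpha> + \<beta>)"
proof (rule mps_eqI)
  fix \<gamma>
  have "(\<Sum>p\<in>splits \<gamma>. mcoeff (mps_monom c \<alpha>) (fst p) * mcoeff (mps_monom d \<beta>) (snd p)) =
      (\<Sum>p\<in>splits \<gamma>. if p = (\<alpha>, \<beta>) then c * d else 0)"
    by (rule sum.cong) (auto simp: mps_monom_def)
  also have "\<dots> = mcoeff (mps_monom (c * d) (\<alpha> + \<beta>)) \<gamma>"
    by (simp add: sum.delta) (auto simp: splits_def mps_monom_def)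
  finally show "mcoeff (mps_monom c \<alpha> * mps_monom d \<beta>) \<gamma> = mcoeff (mps_monom (c * d) (\<alpha> + \<beta>)) \<gamma>"
    by (simp add: mcoeff_mult case_prod_unfold)
qed

lemma mdeg_single [simp]: "mdeg (single i j) = j"
  by (cases "j = 0") (simp_all add: mdeg_def)

lemma mcoeff_var_0 [simp]: "mcoeff (mps_var i) 0 = 0"
  using mdeg_single[of i 1] by (auto simp: mps_var_def simp del: mdeg_single)

lemma is_subring_add:
  assumes "is_subring A" "x \<in> A" "y \<in> A"
  shows "x + y \<in> A"
proof -
  have "(x - x) - y \<in> A" using assms unfolding is_subring_def by blast
  then have "x - ((x - x) - y) \<in> A" using assms unfolding is_subring_def by blast
  then show ?thesis by simp
qed

lemma is_subring_0: "is_subring A \<Longrightarrow> 0 \<in> A"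
  unfolding is_subring_def by (metis diff_self)

text \<open>An induction principle for polynomials: a property that holds for constants and
  variables and is preserved by the ring operations holds for all of them.\<close>

lemma polynomials_subset:
  assumes T: "is_subring T" and c: "\<And>a. a \<in> k \<Longrightarrow> mps_const a \<in> T" and v: "\<And>i. i < n \<Longrightarrow> mps_var i \<in> T"
  shows "polynomials k n \<subseteq> T"
proof
  have mono: "mps_monom a \<alpha> \<in> T" if "a \<in> k" "keys \<alpha> \<subseteq> {..<n}" for a \<alpha>
    using that(2)
  proof (induction "mdeg \<alpha>" arbitrary: \<alpha>)
    case 0
    then have "mps_monom a \<alpha> = mps_const a" by (auto simp: mps_monom_def mps_const_def mdeg_eq_0_iff)
    then show ?case using c that by simp
  next
    case (Suc d)
    then obtain i where i: "i \<in> keys \<alpha>" by (metis keys_eq_empty ex_in_conv mdeg_eq_0_iff nat.distinct(1))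
    define \<beta> where "\<beta> = \<alpha> - single i 1"
    have \<alpha>: "\<alpha> = \<beta> + single i 1" unfolding \<beta>_def using i by (intro single_Suc_diff[symmetric]) (simp add: in_keys_iff)
    have "keys \<beta> \<subseteq> keys \<alpha>" by (auto simp: in_keys_iff \<alpha> lookup_add)
    moreover have "mdeg \<alpha> = mdeg \<beta> + 1" unfolding \<alpha> by (simp add: mdeg_add)
    ultimately have "mps_monom a \<beta> \<in> T" using Suc by (intro Suc.hyps(1)) auto
    moreover have "mps_monom a \<alpha> = mps_monom a \<beta> * mps_var i"
      using mps_monom_mult[of a \<beta> 1 "single i 1"] by (simp add: \<alpha> mps_var_def mps_monom_def)
    moreover have "mps_var i \<in> T" using v i Suc.prems by auto
    ultimately show ?case using T by (simp add: is_subring_def)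
  qed
  fix f assume f: "f \<in> polynomials k n"
  \<comment> \<open>\<open>f\<close> reduced to the exponents in \<open>A\<close>, which allows
    monomials to be added one at a time.\<close>
  define P where "P = (\<lambda>A. MPS (\<lambda>\<alpha>. if \<alpha> \<in> A then mcoeff f \<alpha> else 0))"
  have "P A \<in> T" if "finite A" "A \<subseteq> {\<alpha>. mcoeff f \<alpha> \<noteq> 0}" for A
    using that
  proof (induction A rule: finite_induct)
    case empty
    then show ?case using is_subring_0[OF T] by (simp add: P_def zero_mps_def)
  next
    case (insert \<alpha> A)
    have "P (insert \<alpha> A) = P A + mps_monom (mcoeff f \<alpha>) \<alpha>"
      using insert.hyps by (intro mps_eqI) (auto simp: P_def mps_monom_def)
    moreover have "mps_monom (mcoeff f \<alpha>) \<alpha> \<in> T" using f insert.prems by (intro mono) (auto simp: polynomials_def vars_below_def)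
    ultimately show ?case using insert is_subring_add[OF T] by simp
  qed
  moreover have "P {\<alpha>. mcoeff f \<alpha> \<noteq> 0} = f" by (rule mps_eqI) (simp add: P_def)
  moreover have "finite {\<alpha>. mcoeff f \<alpha> \<noteq> 0}" using f by (simp add: polynomials_def)
  ultimately show "f \<in> T" by (metis order_refl)
qed

section \<open>Permutation of variables against differentiation and integration\<close>

lemma map_key_add_single:
  assumes "bij \<sigma>"
  shows "Poly_Mapping.map_key \<sigma> (\<alpha> + single (\<sigma> i) 1) = Poly_Mapping.map_key \<sigma> \<alpha> + single i (1::nat)"
    "Poly_Mapping.map_key \<sigma> (\<alpha> - single (\<sigma> i) 1) = Poly_Mapping.map_key \<sigma> \<alpha> - single i (1::nat)"
    "lookup (Poly_Mapping.map_key \<sigma> \<alpha>) i = lookup \<alpha> (\<sigma> i)"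
proof -
  have inj: "inj \<sigma>" using assms by (rule bij_is_inj)
  note lk = map_key.rep_eq[OF inj]
  show "lookup (Poly_Mapping.map_key \<sigma> \<alpha>) i = lookup \<alpha> (\<sigma> i)" by (simp add: lk)
  show "Poly_Mapping.map_key \<sigma> (\<alpha> + single (\<sigma> i) 1) = Poly_Mapping.map_key \<sigma> \<alpha> + single i (1::nat)"
    by (rule poly_mapping_eqI) (auto simp: lk lookup_add lookup_single when_def inj_eq[OF inj])
  show "Poly_Mapping.map_key \<sigma> (\<alpha> - single (\<sigma> i) 1) = Poly_Mapping.map_key \<sigma> \<alpha> - single i (1::nat)"
    by (rule poly_mapping_eqI) (auto simp: lk lookup_minus lookup_single when_def inj_eq[OF inj])
qed

lemma deriv_permute: "bij \<sigma> \<Longrightarrow> mps_deriv (\<sigma> i) (mps_permute \<sigma> f) = mps_permute \<sigma> (mps_deriv i f)"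
  by (rule mps_eqI) (simp add: mps_deriv_def mps_permute_def map_key_add_single del: One_nat_def)

lemma integral_permute: "bij \<sigma> \<Longrightarrow> mps_integral (\<sigma> i) (mps_permute \<sigma> f) = mps_permute \<sigma> (mps_integral i f)"
  by (rule mps_eqI) (simp add: mps_integral_def mps_permute_def map_key_add_single del: One_nat_def)

lemma permute_involution:
  assumes "bij \<sigma>" "\<And>i. \<sigma> (\<sigma> i) = i"
  shows "mps_permute \<sigma> (mps_permute \<sigma> f) = f"
proof (rule mps_eqI)
  fix \<alpha> :: "multi_index"
  have "Poly_Mapping.map_key \<sigma> (Poly_Mapping.map_key \<sigma> \<alpha>) = \<alpha>"
    by (rule poly_mapping_eqI) (simp add: map_key_add_single(3)[OF assms(1)] assms(2))
  then show "mcoeff (mps_permute \<sigma> (mps_permute \<sigma> f)) \<alpha> = mcoeff f \<alpha>" by (simp add: mps_permute_def)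
qed

lemma eventually_small:
  assumes "g \<in> conv_series n" "mcoeff g 0 = 0" "\<delta> > 0"
  shows "eventually (\<lambda>x. \<bar>mps_eval g x\<bar> < \<delta>) (near_zero n)"
proof -
  obtain r0 M where r0: "0 < r0" "exp_bounded n (\<lambda>_. r0) M (mps_eval g)" using conv_series_exp_bounded[OF assms(1)] by blast
  obtain t where t: "0 < t" "t \<le> 1" "exp_bounded n (\<lambda>i. t * r0) (\<delta> / 2) (mps_eval g)"
    by (rule exp_bounded_small[OF r0(2), of "\<delta> / 2"]) (use r0 assms in \<open>auto simp: mps_eval_at_0\<close>)
  have "\<forall>i<n. 0 < t * r0" using t r0 by simp
  from eventually_near_zero_box[OF this] show ?thesis
  proof eventually_elim
    case (elim x)
    have "cmod (mps_eval g (\<lambda>i. of_real (x i))) \<le> \<delta> / 2"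
      by (rule exp_bounded_norm_le[OF t(3)]) (use elim in \<open>auto simp: less_imp_le\<close>)
    then show ?case using assms(3) by (simp add: mps_eval_of_real)
  qed
qed

context rational_sys
begin

lemma permute_mem: "f \<in> S n \<Longrightarrow> \<sigma> permutes {..<n} \<Longrightarrow> mps_permute \<sigma> f \<in> S n"
  using perm by (auto simp: perm_closed_def)

text \<open>The axiom integrates in the last variable only; conjugation with the transposition of
  \<open>i\<close> and the last index covers the others.\<close>

lemma integral_mem:
  assumes "f \<in> S n" "i < n"
  shows "mps_integral i f \<in> S n"
proof -
  obtain m where m: "n = Suc m" using assms(2) by (cases n) auto
  define \<tau> where "\<tau> = Transposition.transpose i m"
  have \<tau>: "\<tau> permutes {..<n}" unfolding \<tau>_def by (rule permutes_swap_id) (use assms m in auto)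
  have bij: "bij \<tau>" using \<tau> by (rule permutes_bij)
  have "mps_permute \<tau> (mps_integral m (mps_permute \<tau> f)) \<in> S n"
    using int permute_mem[OF _ \<tau>] assms m by simp
  also have "mps_permute \<tau> (mps_integral m (mps_permute \<tau> f)) = mps_integral (\<tau> m) f"
    using integral_permute[OF bij, of m "mps_permute \<tau> f"] permute_involution[OF bij] by (simp add: \<tau>_def)
  finally show ?thesis by (simp add: \<tau>_def)
qed

lemma mcoeff_0_in_base_field: "f \<in> S n \<Longrightarrow> mcoeff f 0 \<in> base_field S"
proof (induction n arbitrary: f)
  case 0
  then show ?case by (auto simp: base_field_def)
next
  case (Suc n)
  from Suc.IH[OF zero[OF Suc.prems]] show ?case by (simp add: mps_set_zero_def)
qed

lemma S0_const:
  assumes "f \<in> S 0"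
  shows "f = mps_const (mcoeff f 0)"
proof (rule mps_eqI)
  fix \<alpha>
  have "vars_below 0 f" using conv[OF assms] by (simp add: conv_series_iff)
  then show "mcoeff f \<alpha> = mcoeff (mps_const (mcoeff f 0)) \<alpha>"
    by (auto simp: vars_below_def mps_const_def)
qed

lemma const_mem: "a \<in> base_field S \<Longrightarrow> mps_const a \<in> S n"
  using S0_const mono[of 0 n] by (auto simp: base_field_def)

lemma base_field_iff: "a \<in> base_field S \<longleftrightarrow> mps_const a \<in> S 0"
  using const_mem[of a 0] mcoeff_0_in_base_field[of "mps_const a" 0] by (auto simp: mps_const_def)

lemma mps_const_arith: "mps_const a - mps_const b = mps_const (a - b)" "mps_const a * mps_const b = mps_const (a * b)"
  by (rule mps_eqI, simp add: mps_const_def, rule mps_eqI, simp) (simp add: mps_const_def)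

lemma base_field_subring: "is_subring (base_field S)"
  using ring[of 0] by (auto simp: is_subring_def base_field_iff one_eq_const mps_const_arith[symmetric])

lemma base_field_subfield: "is_subfield (base_field S)"
  unfolding is_subfield_def
proof (intro conjI base_field_subring ballI impI)
  fix a assume a: "a \<in> base_field S" "a \<noteq> 0"
  have "mcoeff (mps_const a) 0 \<noteq> 0" using a by (simp add: mps_const_def)
  moreover have cS: "mps_const a \<in> S 0" using a by (simp add: base_field_iff)
  ultimately have "mps_inverse (mps_const a) \<in> S 0" "mps_const a * mps_inverse (mps_const a) = 1"
    using inv mps_inverse_conv[OF conv] by blast+
  moreover from this have "mcoeff (mps_inverse (mps_const a)) 0 = inverse a"
    using a by (metis mcoeff_1 mcoeff_const_mult inverse_unique)
  ultimately show "inverse a \<in> base_field S" using mcoeff_0_in_base_field by metis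
qed

lemma Rats_base_field: "\<rat> \<subseteq> base_field S"
  unfolding subset_iff base_field_iff using const_in_polynomials[OF Rats_0] rat[of 0] by blast

lemma var_mem: "i < n \<Longrightarrow> mps_var i \<in> S n"
  using var_in_polynomials[of i n \<rat>] rat[of n] by auto

lemma polynomials_mem: "polynomials (base_field S) n \<subseteq> S n"
  by (rule polynomials_subset[OF ring const_mem var_mem])

end

context analysis_sys
begin

text \<open>The Cauchy argument yields the derivative only with its last variable replaced by a
  series. Hence the last variable of \<open>f\<close> is moved to a new index, differentiation takes
  place there, and the old variable is substituted for the new one; as a series without constant
  term it is admissible.\<close>

lemma deriv_mem_last:
  assumes "f \<in> S (Suc n)"
  shows "mps_deriv n f \<in> S (Suc n)"
proof -
  define \<tau> where "\<tau> = Transposition.transpose n (Suc n)"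
  have \<tau>: "\<tau> permutes {..<Suc (Suc n)}" unfolding \<tau>_def by (rule permutes_swap_id) auto
  have bij: "bij \<tau>" using \<tau> by (rule permutes_bij)
  have "f \<in> S (Suc (Suc n))" using mono[of "Suc n" "Suc (Suc n)"] assms by auto
  then have f': "mps_permute \<tau> f \<in> S (Suc (Suc n))" using permute_mem \<tau> by blast
  have "germ S (Suc n) (\<lambda>x. mps_eval (mps_deriv (Suc n) (mps_permute \<tau> f)) (x(Suc n := mps_eval (mps_var n) x)))"
    by (rule germ_compose_last(2)[OF f' var_mem]) auto
  moreover have "mps_deriv (Suc n) (mps_permute \<tau> f) = mps_permute \<tau> (mps_deriv n f)"
    using deriv_permute[OF bij, of n f] by (simp add: \<tau>_def)
  moreover have "vars_below (Suc n) (mps_deriv n f)"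
    using conv[OF assms] by (auto simp: conv_series_iff intro: vars_below_deriv)
  then have "mps_eval (mps_deriv n f) (\<lambda>i. (x(Suc n := x n)) (\<tau> i)) = mps_eval (mps_deriv n f) x" for x :: "nat \<Rightarrow> real"
    by (rule mps_eval_cong) (auto simp: \<tau>_def Transposition.transpose_def)
  ultimately have "germ S (Suc n) (mps_eval (mps_deriv n f))"
    by (simp add: mps_permute_simps(2)[OF \<tau>] del: fun_upd_apply)
  then show ?thesis by (rule mem_if_germ[OF deriv_conv_series[OF conv[OF assms]]]) simp
qed

lemma deriv_mem:
  assumes "f \<in> S n" "i < n"
  shows "mps_deriv i f \<in> S n"
proof -
  obtain m where m: "n = Suc m" using assms(2) by (cases n) auto
  define \<tau> where "\<tau> = Transposition.transpose i m"
  have \<tau>: "\<tau> permutes {..<n}" unfolding \<tau>_def by (rule permutes_swap_id) (use assms m in auto)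
  have bij: "bij \<tau>" using \<tau> by (rule permutes_bij)
  have "mps_permute \<tau> (mps_deriv m (mps_permute \<tau> f)) \<in> S n"
    using deriv_mem_last permute_mem[OF _ \<tau>] assms m by simp
  also have "mps_permute \<tau> (mps_deriv m (mps_permute \<tau> f)) = mps_deriv (\<tau> m) f"
    using deriv_permute[OF bij, of m "mps_permute \<tau> f"] permute_involution[OF bij] by (simp add: \<tau>_def)
  finally show ?thesis by (simp add: \<tau>_def)
qed

text \<open>Up to a nonzero natural factor, a coefficient of \<open>f\<close> is a coefficient of
  lower degree of a partial derivative, and finally a constant coefficient. The factor is invertible
  because the base field contains the rationals.\<close>

lemma coeff_in_base_field: "f \<in> S n \<Longrightarrow> mcoeff f \<alpha> \<in> base_field S"
proof (induction "mdeg \<alpha>" arbitrary: \<alpha> f)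
  case 0
  then show ?case using mcoeff_0_in_base_field mdeg_eq_0_iff[of \<alpha>] by simp
next
  case (Suc d)
  then obtain i where i: "i \<in> keys \<alpha>" by (metis keys_eq_empty ex_in_conv mdeg_eq_0_iff nat.distinct(1))
  show ?case
  proof (cases "i < n")
    case True
    define \<beta> where "\<beta> = \<alpha> - single i 1"
    have \<alpha>: "\<alpha> = \<beta> + single i 1" unfolding \<beta>_def using i by (intro single_Suc_diff[symmetric]) (simp add: in_keys_iff)
    have "mdeg \<alpha> = mdeg \<beta> + 1" unfolding \<alpha> by (simp add: mdeg_add)
    then have 1: "mcoeff (mps_deriv i f) \<beta> \<in> base_field S"
      using Suc.hyps deriv_mem[OF Suc.prems True] by simp
    define N where "N = real (lookup \<beta> i + 1)"
    have 2: "mcoeff (mps_deriv i f) \<beta> = N * mcoeff f \<alpha>" by (simp add: mps_deriv_def \<alpha> N_def)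
    have "N \<in> \<rat>" "N \<noteq> 0" by (auto simp: N_def)
    then have "inverse N \<in> base_field S" using Rats_base_field by auto
    then have "inverse N * (N * mcoeff f \<alpha>) \<in> base_field S" using 1 base_field_subring unfolding 2 is_subring_def by blast
    moreover have "inverse N * (N * mcoeff f \<alpha>) = mcoeff f \<alpha>" using \<open>N \<noteq> 0\<close> by simp
    ultimately show ?thesis by simp
  next
    case False
    then have "mcoeff f \<alpha> = 0" using vars_belowD[of n f \<alpha> i] i conv[OF Suc.prems] by (auto simp: conv_series_iff)
    then show ?thesis using is_subring_0[OF base_field_subring] by simp
  qed
qed

text \<open>Arguments are replaced one at a time, from the last to the first. They live on fresh
  indices from \<open>m\<close> on, so that the variables in which the \<open>h i\<close> are
  written are not confused with those still to be replaced.\<close>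

lemma germ_compose:
  assumes f: "f \<in> S n" and h: "\<And>i. i < n \<Longrightarrow> h i \<in> S m \<and> mcoeff (h i) 0 = 0"
  shows "germ S m (\<lambda>x. mps_eval f (\<lambda>i. if i < n then mps_eval (h i) x else 0))"
proof -
  \<comment> \<open>The first \<open>j\<close> arguments are still fresh variables, the others have
    already become \<open>h i\<close>. For \<open>j = n\<close> this is a renaming of
    \<open>f\<close>, for \<open>j = 0\<close> the composition.\<close>
  define F where "F = (\<lambda>j (x :: nat \<Rightarrow> real). mps_eval f (\<lambda>i. if i < j then x (m + i) else if i < n then mps_eval (h i) x else 0))"
  have "germ S (m + j) (F j)" if "j \<le> n" for j
    using that
  proof (induction j rule: inc_induct)
    case base
    have "germ S (m + n) (\<lambda>x. mps_eval f (\<lambda>i. if i \<in> {..<n} then x (m + i) else 0))"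
      by (rule germ_reindex[OF germI[of f S n, OF f]]) (auto simp: inj_on_def)
    then show ?case by (rule germ_cong) (auto simp: F_def intro!: always_eventually arg_cong[where f = "mps_eval f"])
  next
    case (step j)
    have hj: "h j \<in> S m" "mcoeff (h j) 0 = 0" using h step by auto
    obtain G where G: "G \<in> S (Suc (m + j))" "eventually (\<lambda>x. F (Suc j) x = mps_eval G x) (near_zero (Suc (m + j)))"
      using step.IH by (auto simp: germ_def)
    have hj': "h j \<in> S (m + j)" using hj mono[of m "m + j"] by auto
    have g: "germ S (m + j) (\<lambda>x. mps_eval G (x(m + j := mps_eval (h j) x)))"
      by (rule germ_compose_last(1)[OF G(1) hj' hj(2)])
    obtain \<delta> where \<delta>: "\<delta> > 0" "\<And>x. x \<in> space_n (Suc (m + j)) \<Longrightarrow> \<forall>i<Suc (m + j). \<bar>x i\<bar> < \<delta> \<Longrightarrow> F (Suc j) x = mps_eval G x"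
      using G(2) by (auto simp: eventually_near_zero)
    have "eventually (\<lambda>x. mps_eval G (x(m + j := mps_eval (h j) x)) = F j x) (near_zero (m + j))"
      using eventually_small[OF conv[OF hj'] hj(2) \<delta>(1)] eventually_near_zero_bound[OF \<delta>(1)]
    proof eventually_elim
      case (elim x)
      let ?y = "x(m + j := mps_eval (h j) x)"
      have "F (Suc j) ?y = mps_eval G ?y"
        by (rule \<delta>(2)) (use elim in \<open>auto simp: space_n_def\<close>)
      moreover have "mps_eval (h i) ?y = mps_eval (h i) x" if "i < n" for i
        by (rule mps_eval_cong[of m]) (use h[OF that] conv in \<open>auto simp: conv_series_iff\<close>)
      then have "F (Suc j) ?y = F j x"
        unfolding F_def by (intro arg_cong[where f = "mps_eval f"] ext) (use step(1,2) in \<open>auto simp: less_Suc_eq\<close>)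
      ultimately show ?case by simp
    qed
    from germ_cong[OF g this] show ?case .
  qed
  from this[of 0] show ?thesis by (simp add: F_def)
qed

lemma subst_mem:
  assumes f: "f \<in> S n" and h: "\<And>i. i < n \<Longrightarrow> h i \<in> S m \<and> mcoeff (h i) 0 = 0"
  shows "mps_subst f h \<in> S m"
proof -
  have hc: "h i \<in> conv_series m \<and> mcoeff (h i) 0 = 0" if "i < n" for i using h[OF that] conv by blast
  have c: "mps_subst f h \<in> conv_series m" by (rule subst_conv_real(1)[OF conv[OF f]]) (rule hc)
  have e: "eventually (\<lambda>x. mps_eval (mps_subst f h) x = mps_eval f (\<lambda>i. if i < n then mps_eval (h i) x else 0)) (near_zero m)"
    by (rule subst_conv_real(2)[OF conv[OF f]]) (rule hc)
  have "germ S m (\<lambda>x. mps_eval f (\<lambda>i. if i < n then mps_eval (h i) x else 0))" by (rule germ_compose[OF f]) (rule h)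
  then show ?thesis by (rule mem_if_germ[OF c]) (rule eventually_mono[OF e], simp)
qed

lemma translate_mem:
  assumes f: "f \<in> S n" and a: "a \<in> conv_domain n f \<inter> points_over (base_field S) n"
  shows "mps_translate n f a \<in> S n"
proof -
  have vf: "vars_below n f" using conv[OF f] by (simp add: conv_series_iff)
  obtain \<rho> where as: "a \<in> space_n n" and \<rho>: "\<forall>i<n. \<bar>a i\<bar> < \<rho> i" "abs_conv_at f \<rho>"
    using a conv_domain_iff[OF vf] by blast
  have ak: "a i \<in> base_field S" if "i < n" for i using a that by (auto simp: points_over_def)
  \<comment> \<open>The variable \<open>T\<close> has index \<open>n\<close> and needs a radius
    \<open>q\<close> beyond 1 with \<open>\<bar>a i\<bar> * q < \<rho> i\<close> for all
    \<open>i\<close>. This choice increases \<open>\<bar>a i\<bar>\<close> by at most half of its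
    distance to \<open>\<rho> i\<close>; the inserted 2 keeps the minimum defined when
    \<open>n = 0\<close>.\<close>
  define q' where "q' = (\<lambda>i. 1 + (\<rho> i - \<bar>a i\<bar>) / (2 * (\<bar>a i\<bar> + 1)))"
  define q where "q = Min (insert 2 (q' ` {..<n}))"
  have "1 < q' i" if "i < n" for i using \<rho>(1) that by (simp add: q'_def)
  then have q: "1 < q" by (simp add: q_def)
  have aq: "\<bar>a i\<bar> * q < \<rho> i" if i: "i < n" for i
  proof -
    have "q \<le> q' i" unfolding q_def using i by (intro Min_le) auto
    then have "\<bar>a i\<bar> * q \<le> \<bar>a i\<bar> * q' i" by (rule mult_left_mono) simp
    also have "\<dots> = \<bar>a i\<bar> + (\<bar>a i\<bar> / (\<bar>a i\<bar> + 1)) * ((\<rho> i - \<bar>a i\<bar>) / 2)"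
      by (simp add: q'_def field_simps)
    also have "\<dots> \<le> \<bar>a i\<bar> + 1 * ((\<rho> i - \<bar>a i\<bar>) / 2)"
      using \<rho>(1) i by (intro add_left_mono mult_right_mono) (auto simp: less_imp_le divide_le_eq_1)
    also have "\<dots> < \<rho> i" using \<rho>(1) i by (simp add: field_simps)
    finally show ?thesis .
  qed
  define F where "F = (\<lambda>z. mps_eval f (\<lambda>i. z i + complex_of_real (a i) * z n))"
  \<comment> \<open>Chosen so that the radius of variable \<open>i\<close> plus
    \<open>\<bar>a i\<bar>\<close> times the radius of \<open>T\<close> is exactly
    \<open>\<rho> i\<close>.\<close>
  define \<rho>' where "\<rho>' = (\<lambda>i. if i < n then \<rho> i - \<bar>a i\<bar> * q else q)"
  have \<rho>': "\<forall>i<Suc n. 0 < \<rho>' i" using aq q by (auto simp: \<rho>'_def)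
  then have \<rho>'0: "\<forall>i<Suc n. 0 \<le> \<rho>' i" by (simp add: less_imp_le)
  have "exp_bounded (Suc n) \<rho>' (\<rho> i) (\<lambda>z. z i + complex_of_real (a i) * z n)" if "i < n" for i
  proof -
    have "exp_bounded (Suc n) \<rho>' (\<rho>' i + cmod (complex_of_real (a i)) * \<rho>' n) (\<lambda>z. z i + complex_of_real (a i) * z n)"
      by (intro exp_bounded_add exp_bounded_cmult exp_bounded_var \<rho>'0) (use that in auto)
    then show ?thesis using that by (simp add: \<rho>'_def)
  qed
  moreover have "\<forall>i<n. 0 \<le> \<rho> i" using \<rho>(1) by force
  ultimately obtain M where M: "exp_bounded (Suc n) \<rho>' M F"
    using exp_bounded_compose[OF vf \<rho>(2) _ \<rho>', of "\<lambda>i z. z i + complex_of_real (a i) * z n"] unfolding F_def by blast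
  define h where "h = (\<lambda>i. mps_var i + mps_const (a i) * mps_var n)"
  have h: "h i \<in> S (Suc n) \<and> mcoeff (h i) 0 = 0" if "i < n" for i
    unfolding h_def using that ak ring[of "Suc n"] const_mem[of "a i" "Suc n"] var_mem[of i "Suc n"] var_mem[of n "Suc n"]
    by (auto intro!: is_subring_add simp: is_subring_def)
  have hev: "mps_eval (h i) x = x i + a i * x n" for i x
    unfolding h_def by (simp add: mps_eval_add mps_eval_mult abs_conv_mult)
  have Fr: "F (\<lambda>i. of_real (x i)) = of_real (mps_eval f (\<lambda>i. x i + a i * x n))" for x
    using mps_eval_of_real[of f "\<lambda>i. x i + a i * x n"] by (simp add: F_def)
  have "germ S (Suc n) (\<lambda>x. mps_eval f (\<lambda>i. if i < n then mps_eval (h i) x else 0))" by (rule germ_compose[OF f h])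
  moreover have "mps_eval f (\<lambda>i. if i < n then mps_eval (h i) x else 0) = mps_eval f (\<lambda>i. x i + a i * x n)" for x
    by (rule mps_eval_cong[OF vf]) (simp add: hev)
  ultimately have "cgerm S (Suc n) (\<lambda>x. F (\<lambda>i. of_real (x i)))" unfolding Fr by (intro cgerm_of_real) simp
  \<comment> \<open>The rational translation of \<open>T\<close> by 1, which is legitimate since
    \<open>q\<close> exceeds 1.\<close>
  then have "cgerm S (Suc n) (\<lambda>x. F (\<lambda>i. of_real ((if i = n then 1 else 0) + x i)))"
    by (rule cgerm_translate[OF M \<rho>']) (use q \<rho>' in \<open>auto simp: \<rho>'_def\<close>)
  then have "germ S (Suc n) (\<lambda>x. mps_eval f (\<lambda>i. (if i = n then 1 else 0) + x i + a i * (1 + x n)))"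
    unfolding cgerm_def Fr by simp
  \<comment> \<open>Setting the displacement of \<open>T\<close> to 0 leaves \<open>T = 1\<close>,
    hence the argument \<open>X + a\<close>.\<close>
  then have g: "germ S n (\<lambda>x. mps_eval f (\<lambda>i. (if i = n then 1 else 0) + x i + a i * (1 + x n)))" by (rule germ_restrict)
  show ?thesis
  proof (rule mem_if_germ[OF mps_translate_conv(1)[OF vf as \<rho>] g])
    have "\<forall>i<n. 0 < \<rho> i - \<bar>a i\<bar>" using \<rho> by simp
    from eventually_near_zero_box[OF this]
    show "eventually (\<lambda>x. mps_eval f (\<lambda>i. (if i = n then 1 else 0) + x i + a i * (1 + x n)) = mps_eval (mps_translate n f a) x) (near_zero n)"
    proof eventually_elim
      case (elim x)
      have "mps_eval (mps_translate n f a) (\<lambda>i. complex_of_real (x i)) = mps_eval f (\<lambda>i. complex_of_real (a i) + of_real (x i))"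
        by (rule mps_translate_conv(3)[OF vf as \<rho>]) (use elim in \<open>auto simp: less_imp_le\<close>)
      then have "mps_eval (mps_translate n f a) x = mps_eval f (\<lambda>i. a i + x i)"
        using mps_eval_of_real[of f "\<lambda>i. a i + x i"] by (simp add: mps_eval_of_real)
      also have "\<dots> = mps_eval f (\<lambda>i. (if i = n then 1 else 0) + x i + a i * (1 + x n))"
        by (rule mps_eval_cong[OF vf]) (use elim in \<open>auto simp: space_n_def\<close>)
      finally show ?case by simp
    qed
  qed
qed

end

section \<open>Algebraic elements over a domain\<close>

text \<open>Relative to a subset, since the polynomial rings of interest are subsets of one ambient
  commutative ring.\<close>

definition is_domain :: "'a::comm_ring_1 set \<Rightarrow> bool" where
  "is_domain R \<longleftrightarrow> is_subring R \<and> (\<forall>x\<in>R. \<forall>y\<in>R. x * y = 0 \<longrightarrow> x = 0 \<or> y = 0)"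

text \<open>The condition on \<open>a N\<close> makes the relation nontrivial and forces
  \<open>N\<close> to be positive. Keeping the leading coefficient explicit avoids fraction fields:
  powers of it serve as denominators.\<close>

definition alg_over :: "'a::comm_ring_1 set \<Rightarrow> 'a \<Rightarrow> bool" where
  "alg_over R x \<longleftrightarrow> (\<exists>N a. (\<forall>i. a i \<in> R) \<and> a N \<noteq> 0 \<and> (\<Sum>i\<le>N. a i * x ^ i) = 0)"

lemma is_domainD: "is_domain R \<Longrightarrow> x \<in> R \<Longrightarrow> y \<in> R \<Longrightarrow> x \<noteq> 0 \<Longrightarrow> y \<noteq> 0 \<Longrightarrow> x * y \<noteq> 0"
  unfolding is_domain_def by blast

lemma is_subring_mult: "is_subring R \<Longrightarrow> x \<in> R \<Longrightarrow> y \<in> R \<Longrightarrow> x * y \<in> R"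
  and is_subring_diff: "is_subring R \<Longrightarrow> x \<in> R \<Longrightarrow> y \<in> R \<Longrightarrow> x - y \<in> R"
  and is_subring_1: "is_subring R \<Longrightarrow> 1 \<in> R"
  unfolding is_subring_def by blast+

lemma is_subring_uminus: "is_subring R \<Longrightarrow> x \<in> R \<Longrightarrow> - x \<in> R"
  using is_subring_diff[of R 0 x] is_subring_0[of R] by simp

lemma is_subring_power: "is_subring R \<Longrightarrow> x \<in> R \<Longrightarrow> x ^ k \<in> R"
  by (induction k) (auto intro: is_subring_mult is_subring_1)

lemma is_subring_sum: "is_subring R \<Longrightarrow> (\<And>i. i \<in> A \<Longrightarrow> f i \<in> R) \<Longrightarrow> sum f A \<in> R"
  by (induction A rule: infinite_finite_induct) (auto intro: is_subring_add is_subring_0)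

lemma is_subring_of_nat: "is_subring R \<Longrightarrow> of_nat k \<in> R"
  by (induction k) (auto intro: is_subring_add is_subring_0 is_subring_1)

lemma is_domain_power: "is_domain R \<Longrightarrow> x \<in> R \<Longrightarrow> x \<noteq> 0 \<Longrightarrow> x ^ k \<noteq> 0"
proof (induction k)
  case (Suc k)
  then show ?case using is_domainD[of R x "x ^ k"] is_subring_power[of R x k] by (auto simp: is_domain_def)
qed simp

text \<open>Fraction-free Gaussian elimination.\<close>

lemma homogeneous_system_nontrivial:
  fixes R :: "'a::comm_ring_1 set"
  assumes R: "is_domain R" and "finite I" "finite J" "card I < card J" "\<And>i j. c i j \<in> R"
  shows "\<exists>x. (\<forall>j. x j \<in> R) \<and> (\<exists>j\<in>J. x j \<noteq> 0) \<and> (\<forall>i\<in>I. (\<Sum>j\<in>J. c i j * x j) = 0)"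
  using assms(2-5)
proof (induction I arbitrary: J c rule: finite_induct)
  case empty
  have "is_subring R" using R by (simp add: is_domain_def)
  then show ?case using empty by (intro exI[of _ "\<lambda>_. 1"]) (auto simp: is_subring_1 card_gt_0_iff)
next
  case (insert i0 I)
  have sr: "is_subring R" using R by (simp add: is_domain_def)
  show ?case
  proof (cases "\<forall>j\<in>J. c i0 j = 0")
    case True
    then show ?thesis using insert.IH[of J c] insert.prems insert.hyps by auto
  next
    case False
    then obtain p where p: "p \<in> J" "c i0 p \<noteq> 0" by auto
    let ?J = "J - {p}"
    \<comment> \<open>Elimination of the unknown \<open>p\<close> by means of the row
      \<open>i0\<close>, cross-multiplied instead of divided by the pivot.\<close>
    define c' where "c' = (\<lambda>i j. c i0 p * c i j - c i p * c i0 j)"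
    have "c' i j \<in> R" for i j unfolding c'_def by (intro is_subring_diff is_subring_mult sr insert.prems)
    moreover have "card I < card ?J" using insert p by simp
    moreover have "finite ?J" using insert.prems by simp
    ultimately have "\<exists>x. (\<forall>j. x j \<in> R) \<and> (\<exists>j\<in>?J. x j \<noteq> 0) \<and> (\<forall>i\<in>I. (\<Sum>j\<in>?J. c' i j * x j) = 0)"
      by (intro insert.IH)
    then obtain x where x: "\<And>j. x j \<in> R" "\<exists>j\<in>?J. x j \<noteq> 0" "\<And>i. i \<in> I \<Longrightarrow> (\<Sum>j\<in>?J. c' i j * x j) = 0"
      by blast
    \<comment> \<open>Back substitution, with the whole solution multiplied by the pivot. It stays
      nontrivial because \<open>R\<close> is a domain.\<close>
    define y where "y = (\<lambda>j. if j = p then - (\<Sum>j\<in>?J. c i0 j * x j) else c i0 p * x j)"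
    have sum: "(\<Sum>j\<in>J. c i j * y j) = (\<Sum>j\<in>?J. c' i j * x j)" for i
    proof -
      have "(\<Sum>j\<in>J. c i j * y j) = c i p * y p + (\<Sum>j\<in>?J. c i j * y j)"
        using insert.prems p by (simp add: sum.remove)
      also have "(\<Sum>j\<in>?J. c i j * y j) = (\<Sum>j\<in>?J. c i j * (c i0 p * x j))"
        by (rule sum.cong) (auto simp: y_def)
      also have "c i p * y p + \<dots> = (\<Sum>j\<in>?J. c' i j * x j)"
        by (simp add: y_def c'_def sum_distrib_left sum_subtractf algebra_simps)
      finally show ?thesis .
    qed
    have "(\<Sum>j\<in>?J. c' i0 j * x j) = 0" by (simp add: c'_def mult.commute)
    then have "\<forall>i\<in>insert i0 I. (\<Sum>j\<in>J. c i j * y j) = 0" using x(3) by (simp add: sum)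
    moreover have "\<exists>j\<in>J. y j \<noteq> 0"
    proof -
      obtain j where j: "j \<in> ?J" "x j \<noteq> 0" using x(2) by blast
      then have "y j \<noteq> 0" using is_domainD[OF R insert.prems(3) x(1) p(2)] by (simp add: y_def)
      then show ?thesis using j by blast
    qed
    moreover have "\<forall>j. y j \<in> R" unfolding y_def
      by (auto intro!: is_subring_uminus is_subring_sum is_subring_mult sr insert.prems x)
    ultimately show ?thesis by blast
  qed
qed

lemma alg_overI:
  assumes R: "is_subring R" and "finite J" "\<And>j. y j \<in> R" "\<exists>j\<in>J. y j \<noteq> 0" "(\<Sum>j\<in>J. y j * x ^ j) = 0"
  shows "alg_over R x"
proof -
  define N where "N = Max {j \<in> J. y j \<noteq> 0}"
  have "N \<in> {j \<in> J. y j \<noteq> 0}" unfolding N_def by (rule Max_in) (use assms in auto)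
  have le: "j \<le> N" if "j \<in> J" "y j \<noteq> 0" for j unfolding N_def using assms(2) that by (intro Max_ge) auto
  define a where "a = (\<lambda>j. if j \<in> J then y j else 0)"
  have "(\<Sum>i\<le>N. a i * x ^ i) = (\<Sum>j\<in>J. y j * x ^ j)"
  proof (rule sum.mono_neutral_cong)
    show "y i * x ^ i = 0" if "i \<in> J - {..N}" for i using le[of i] that by fastforce
  qed (use assms(2) in \<open>auto simp: a_def\<close>)
  moreover have "a j \<in> R" for j using assms(3) is_subring_0[OF R] by (simp add: a_def)
  ultimately show ?thesis unfolding alg_over_def
    using assms(5) \<open>N \<in> _\<close> by (intro exI[of _ N] exI[of _ a]) (auto simp: a_def)
qed

lemma alg_over_scale:
  assumes R: "is_domain R" and s: "s \<in> R" "s \<noteq> 0" and x: "alg_over R (s * x)"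
  shows "alg_over R x"
proof -
  have sr: "is_subring R" using R by (simp add: is_domain_def)
  obtain N a where a: "\<forall>i. a i \<in> R" "a N \<noteq> 0" "(\<Sum>i\<le>N. a i * (s * x) ^ i) = 0"
    using x by (auto simp: alg_over_def)
  show ?thesis
  proof (rule alg_overI[OF sr, of "{..N}" "\<lambda>i. a i * s ^ i"])
    show "\<And>j. a j * s ^ j \<in> R" using a s by (auto intro: is_subring_mult is_subring_power sr)
    show "\<exists>j\<in>{..N}. a j * s ^ j \<noteq> 0"
      using is_domainD[OF R _ is_subring_power[OF sr s(1)] a(2) is_domain_power[OF R s]] a(1) by blast
    show "(\<Sum>j\<le>N. a j * s ^ j * x ^ j) = 0" using a(3) by (simp add: power_mult_distrib mult.assoc)
  qed simp
qed

text \<open>\<open>x\<close> need not be integral over \<open>R\<close>, but its leading coefficient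
  times \<open>x\<close> is; one factor of the leading coefficient pays for each reduction of a
  power to exponents below \<open>N\<close>.\<close>

lemma alg_over_power_span:
  assumes sr: "is_subring R" and a: "\<forall>i. a i \<in> R" "(\<Sum>i\<le>N. a i * x ^ i) = 0" and N: "N > 0"
  shows "\<exists>r. (\<forall>k. r k \<in> R) \<and> (a N) ^ i * x ^ i = (\<Sum>k<N. r k * x ^ k)"
proof (induction i)
  case 0
  have "(\<Sum>k<N. (if k = 0 then 1 else 0) * x ^ k) = 1"
    using N by (simp add: if_distrib[where f = "\<lambda>r. r * _"] sum.delta cong: if_cong)
  then show ?case by (intro exI[of _ "\<lambda>k. if k = 0 then 1 else 0"]) (auto simp: is_subring_0 is_subring_1 sr)
next
  case (Suc i)
  then obtain r where r: "\<And>k. r k \<in> R" "(a N) ^ i * x ^ i = (\<Sum>k<N. r k * x ^ k)" by blast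
  obtain M where M: "N = Suc M" using N by (cases N) auto
  have top: "a N * x ^ N = - (\<Sum>k<N. a k * x ^ k)"
    using a(2) by (simp add: lessThan_Suc_atMost[symmetric] eq_neg_iff_add_eq_0 add.commute)
  \<comment> \<open>Multiplication by \<open>a N * x\<close> shifts the coefficients, and the one
    term of exponent \<open>N\<close> that arises is replaced by the relation for
    \<open>x\<close>.\<close>
  define r' where "r' = (\<lambda>k. (if k = 0 then 0 else a N * r (k - 1)) - r M * a k)"
  have "(a N) ^ Suc i * x ^ Suc i = a N * x * (\<Sum>k<N. r k * x ^ k)"
    using r(2) by (simp add: mult_ac)
  also have "\<dots> = (\<Sum>k<N. a N * r k * x ^ Suc k)" by (simp add: sum_distrib_left mult_ac)
  also have "\<dots> = (\<Sum>k<M. a N * r k * x ^ Suc k) + r M * (a N * x ^ N)" by (simp add: M mult_ac)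
  also have "(\<Sum>k<M. a N * r k * x ^ Suc k) = (\<Sum>k<N. (if k = 0 then 0 else a N * r (k - 1)) * x ^ k)"
    unfolding M by (simp only: sum.lessThan_Suc_shift) simp
  also have "\<dots> + r M * (a N * x ^ N) = (\<Sum>k<N. r' k * x ^ k)"
    unfolding top by (simp add: r'_def left_diff_distrib sum_subtractf sum_distrib_left mult.assoc)
  finally have "(a N) ^ Suc i * x ^ Suc i = (\<Sum>k<N. r' k * x ^ k)" .
  moreover have "r' k \<in> R" for k unfolding r'_def using r(1) a(1)
    by (auto intro!: is_subring_diff is_subring_mult is_subring_0 is_subring_uminus sr)
  ultimately show ?case by blast
qed

text \<open>A dimension count: after clearing denominators, all powers of \<open>x + y\<close> lie
  in the span of the \<open>d * e\<close> products of low powers of \<open>x\<close> and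
  \<open>y\<close>, so \<open>d * e + 1\<close> of these powers are linearly dependent.\<close>

lemma alg_over_add:
  assumes R: "is_domain R" and x: "alg_over R x" and y: "alg_over R y"
  shows "alg_over R (x + y)"
proof -
  have sr: "is_subring R" using R by (simp add: is_domain_def)
  obtain d a where a: "\<forall>i. a i \<in> R" "a d \<noteq> 0" "(\<Sum>i\<le>d. a i * x ^ i) = 0" using x by (auto simp: alg_over_def)
  obtain e b where b: "\<forall>i. b i \<in> R" "b e \<noteq> 0" "(\<Sum>i\<le>e. b i * y ^ i) = 0" using y by (auto simp: alg_over_def)
  have d: "d > 0" using a by (cases d) auto
  have e: "e > 0" using b by (cases e) auto
  obtain r where r: "\<And>i k. r i k \<in> R" "\<And>i. (a d) ^ i * x ^ i = (\<Sum>k<d. r i k * x ^ k)"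
    using alg_over_power_span[OF sr a(1,3) d] by metis
  obtain s where s: "\<And>i k. s i k \<in> R" "\<And>i. (b e) ^ i * y ^ i = (\<Sum>k<e. s i k * y ^ k)"
    using alg_over_power_span[OF sr b(1,3) e] by metis
  define c where "c = a d * b e"
  have cR: "c \<in> R" "c \<noteq> 0" unfolding c_def using a b is_domainD[OF R] by (auto intro: is_subring_mult sr)
  \<comment> \<open>Coordinates of \<open>c ^ m * (x + y) ^ m\<close> with respect to these
    products, from the binomial theorem. The powers of \<open>a d\<close> and \<open>b e\<close>
    written out here are those that reducing \<open>x ^ i\<close> and \<open>y ^ (m - i)\<close>
    does not use up.\<close>
  define M where "M = (\<lambda>(k, l) m. \<Sum>i\<le>m. of_nat (m choose i) * (a d) ^ (m - i) * (b e) ^ i * (r i k * s (m - i) l))"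
  have MR: "M p m \<in> R" for p m unfolding M_def case_prod_unfold
    by (intro is_subring_sum is_subring_mult is_subring_of_nat is_subring_power sr r s) (use a b in auto)
  let ?I = "{..<d} \<times> {..<e}"
  have pow: "c ^ m * (x + y) ^ m = (\<Sum>p\<in>?I. M p m * (x ^ fst p * y ^ snd p))" for m
  proof -
    have "c ^ m * (x + y) ^ m = (\<Sum>i\<le>m. of_nat (m choose i) * (a d) ^ (m - i) * (b e) ^ i * (((a d) ^ i * x ^ i) * ((b e) ^ (m - i) * y ^ (m - i))))"
    proof -
      have "c ^ m * (of_nat (m choose i) * x ^ i * y ^ (m - i)) =
          of_nat (m choose i) * (a d) ^ (m - i) * (b e) ^ i * (((a d) ^ i * x ^ i) * ((b e) ^ (m - i) * y ^ (m - i)))"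
        if "i \<le> m" for i
      proof -
        have "c ^ m = (a d) ^ (m - i) * (a d) ^ i * ((b e) ^ i * (b e) ^ (m - i))"
          unfolding c_def power_mult_distrib using that by (simp flip: power_add)
        then show ?thesis by (simp add: mult_ac)
      qed
      then show ?thesis unfolding binomial_ring sum_distrib_left by (intro sum.cong) auto
    qed
    also have "\<dots> = (\<Sum>i\<le>m. of_nat (m choose i) * (a d) ^ (m - i) * (b e) ^ i *
        (\<Sum>p\<in>?I. (r i (fst p) * s (m - i) (snd p)) * (x ^ fst p * y ^ snd p)))"
      unfolding r(2) s(2) sum_product sum.cartesian_product by (simp add: case_prod_unfold mult_ac)
    also have "\<dots> = (\<Sum>p\<in>?I. M p m * (x ^ fst p * y ^ snd p))"
      unfolding M_def case_prod_unfold sum_distrib_left sum_distrib_right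
      by (subst sum.swap) (simp add: mult.assoc)
    finally show ?thesis .
  qed
  \<comment> \<open>There are \<open>d * e + 1\<close> unknowns, indexed from 0 to
    \<open>d * e\<close>, and \<open>d * e\<close> equations.\<close>
  have "\<exists>w. (\<forall>m. w m \<in> R) \<and> (\<exists>m\<in>{..d * e}. w m \<noteq> 0) \<and> (\<forall>p\<in>?I. (\<Sum>m\<le>d * e. M p m * w m) = 0)"
    by (rule homogeneous_system_nontrivial[OF R]) (use MR in auto)
  then obtain w where w: "\<And>m. w m \<in> R" "\<exists>m\<in>{..d * e}. w m \<noteq> 0" "\<And>p. p \<in> ?I \<Longrightarrow> (\<Sum>m\<le>d * e. M p m * w m) = 0"
    by blast
  show ?thesis
  proof (rule alg_overI[OF sr, of "{..d * e}" "\<lambda>m. w m * c ^ m"])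
    show "\<And>j. w j * c ^ j \<in> R" by (intro is_subring_mult is_subring_power sr w cR)
    show "\<exists>j\<in>{..d * e}. w j * c ^ j \<noteq> 0"
      using w(2) is_domainD[OF R w(1) is_subring_power[OF sr cR(1)] _ is_domain_power[OF R cR]] by blast
    have "(\<Sum>m\<le>d * e. w m * c ^ m * (x + y) ^ m) = (\<Sum>m\<le>d * e. \<Sum>p\<in>?I. M p m * w m * (x ^ fst p * y ^ snd p))"
      unfolding mult.assoc[of "w _"] pow sum_distrib_left by (simp add: mult_ac)
    also have "\<dots> = (\<Sum>p\<in>?I. (\<Sum>m\<le>d * e. M p m * w m) * (x ^ fst p * y ^ snd p))"
      by (subst sum.swap) (simp add: sum_distrib_right)
    also have "\<dots> = 0" by (rule sum.neutral) (use w(3) in auto)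
    finally show "(\<Sum>m\<le>d * e. w m * c ^ m * (x + y) ^ m) = 0" .
  qed simp
qed

section \<open>Complexification of a commutative ring\<close>

text \<open>The ring obtained by adjoining a square root of -1. For power series \<open>U\<close>
  and \<open>V\<close>, \<open>Cx U V\<close> plays the part of \<open>U + iV\<close>, so that
  algebraicity can be discussed without complex coefficients.\<close>

datatype 'a cplx = Cx (cre: 'a) (cim: 'a)

lemma cplx_eq_iff: "x = y \<longleftrightarrow> cre x = cre y \<and> cim x = cim y"
  by (cases x; cases y) auto

instantiation cplx :: (comm_ring_1) comm_ring_1
begin
definition "0 = Cx 0 0"
definition "1 = Cx 1 0"
definition "x + y = Cx (cre x + cre y) (cim x + cim y)"
definition "x - y = Cx (cre x - cre y) (cim x - cim y)"
definition "- x = Cx (- cre x) (- cim x)"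
definition "x * y = Cx (cre x * cre y - cim x * cim y) (cre x * cim y + cim x * cre y)"
instance
  by standard (auto simp: zero_cplx_def one_cplx_def plus_cplx_def minus_cplx_def uminus_cplx_def times_cplx_def
      cplx_eq_iff algebra_simps)
end

lemma cplx_sel [simp]: "cre 0 = 0" "cim 0 = 0" "cre 1 = 1" "cim 1 = 0"
  "cre (x + y) = cre x + cre y" "cim (x + y) = cim x + cim y"
  "cre (x - y) = cre x - cre y" "cim (x - y) = cim x - cim y" "cre (- x) = - cre x" "cim (- x) = - cim x"
  "cre (x * y) = cre x * cre y - cim x * cim y" "cim (x * y) = cre x * cim y + cim x * cre y"
  by (simp_all add: zero_cplx_def one_cplx_def plus_cplx_def minus_cplx_def uminus_cplx_def times_cplx_def)

lemma cplx_sum_sel [simp]: "cre (sum f A) = (\<Sum>i\<in>A. cre (f i))" "cim (sum f A) = (\<Sum>i\<in>A. cim (f i))"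
  by (induction A rule: infinite_finite_induct) auto

lemma Cx_real_power: "Cx x 0 ^ k = Cx (x ^ k) 0"
  by (induction k) (auto simp: cplx_eq_iff)

definition cconj :: "'a::comm_ring_1 cplx \<Rightarrow> 'a cplx" where "cconj x = Cx (cre x) (- cim x)"

lemma cconj_hom: "cconj 0 = 0" "cconj 1 = 1" "cconj (x * y) = cconj x * cconj y" "cconj (x + y) = cconj x + cconj y"
  by (auto simp: cconj_def cplx_eq_iff)

lemma cconj_power: "cconj (x ^ k) = cconj x ^ k"
  by (induction k) (auto simp: cconj_hom)

lemma cconj_sum: "cconj (sum f A) = (\<Sum>i\<in>A. cconj (f i))"
  by (induction A rule: infinite_finite_induct) (auto simp: cconj_hom)

definition cplx_set :: "'a set \<Rightarrow> 'a cplx set" where "cplx_set R = {x. cre x \<in> R \<and> cim x \<in> R}"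

lemma cplx_set_subring:
  assumes R: "is_subring R"
  shows "is_subring (cplx_set R)"
  unfolding is_subring_def cplx_set_def
  by (auto intro!: is_subring_add[OF R] is_subring_diff[OF R] is_subring_mult[OF R] is_subring_1[OF R] is_subring_0[OF R])

text \<open>The norm, a sum of two squares, is multiplicative and by assumption vanishes only at 0,
  so a zero divisor would produce one in \<open>R\<close>.\<close>

lemma cplx_set_domain:
  assumes R: "is_domain R" and sq: "\<And>a b. a \<in> R \<Longrightarrow> b \<in> R \<Longrightarrow> a * a + b * b = 0 \<Longrightarrow> a = 0 \<and> b = 0"
  shows "is_domain (cplx_set R)"
  unfolding is_domain_def
proof (intro conjI ballI impI)
  have sr: "is_subring R" using R by (simp add: is_domain_def)
  then show "is_subring (cplx_set R)" by (rule cplx_set_subring)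
  fix x y :: "'a cplx" assume x: "x \<in> cplx_set R" and y: "y \<in> cplx_set R" and xy: "x * y = 0"
  let ?nx = "cre x * cre x + cim x * cim x" and ?ny = "cre y * cre y + cim y * cim y"
  have 1: "cre x * cre y - cim x * cim y = 0" "cre x * cim y + cim x * cre y = 0"
    using arg_cong[OF xy, of cre] arg_cong[OF xy, of cim] by simp_all
  have "?nx * ?ny = (cre x * cre y - cim x * cim y) * (cre x * cre y - cim x * cim y) +
      (cre x * cim y + cim x * cre y) * (cre x * cim y + cim x * cre y)" by (simp add: algebra_simps)
  also have "\<dots> = 0" unfolding 1 by simp
  finally have "?nx * ?ny = 0" .
  moreover have "?nx \<in> R" "?ny \<in> R" using x y by (auto simp: cplx_set_def intro!: is_subring_add is_subring_mult sr)
  ultimately have "?nx = 0 \<or> ?ny = 0" using R unfolding is_domain_def by blast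
  then show "x = 0 \<or> y = 0" using sq x y by (auto simp: cplx_set_def cplx_eq_iff)
qed

lemma alg_over_cconj:
  assumes sr: "is_subring R" and x: "alg_over (cplx_set R) x"
  shows "alg_over (cplx_set R) (cconj x)" "alg_over (cplx_set R) (- cconj x)"
proof -
  have "alg_over (cplx_set R) (u * cconj x)" if u: "u = 1 \<or> u = -1" for u
  proof -
    obtain N a where a: "\<forall>i. a i \<in> cplx_set R" "a N \<noteq> 0" "(\<Sum>i\<le>N. a i * x ^ i) = 0"
      using x by (auto simp: alg_over_def)
    define b where "b = (\<lambda>i. cconj (a i) * u ^ i)"
    have uu: "u ^ i * u ^ i = 1" for i using u by (auto simp flip: power_mult_distrib)
    have "b i \<in> cplx_set R" for i unfolding b_def
    proof (rule is_subring_mult[OF cplx_set_subring[OF sr]])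
      show "cconj (a i) \<in> cplx_set R" using a(1) sr by (auto simp: cplx_set_def cconj_def intro: is_subring_uminus)
      show "u ^ i \<in> cplx_set R" using u
        by (intro is_subring_power cplx_set_subring sr) (auto intro: is_subring_1 is_subring_uminus cplx_set_subring sr)
    qed
    moreover have "b N \<noteq> 0"
    proof
      assume "b N = 0"
      then have "cconj (a N) * (u ^ N * u ^ N) = 0" unfolding b_def by (metis mult.assoc mult_zero_left)
      then have "cconj (a N) = 0" by (simp add: uu)
      then show False using a(2) by (simp add: cconj_def cplx_eq_iff)
    qed
    moreover have "(\<Sum>i\<le>N. b i * (u * cconj x) ^ i) = 0"
    proof -
      have "b i * (u * cconj x) ^ i = cconj (a i * x ^ i)" for i
      proof -
        have "b i * (u * cconj x) ^ i = cconj (a i) * (u ^ i * u ^ i) * cconj x ^ i"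
          by (simp add: b_def power_mult_distrib mult_ac)
        then show ?thesis by (simp add: uu cconj_hom cconj_power)
      qed
      then show ?thesis using arg_cong[OF a(3), of cconj] by (simp add: cconj_sum cconj_hom)
    qed
    ultimately show ?thesis unfolding alg_over_def by blast
  qed
  from this[of 1] this[of "-1"] show "alg_over (cplx_set R) (cconj x)" "alg_over (cplx_set R) (- cconj x)" by simp_all
qed

text \<open>Powers of a real element are real, so the relation splits into its real and its
  imaginary part, and at least one of them keeps a nonzero leading coefficient.\<close>

lemma alg_over_real:
  assumes "is_subring R" "alg_over (cplx_set R) (Cx x 0)"
  shows "alg_over R x"
proof -
  obtain N a where a: "\<forall>i. a i \<in> cplx_set R" "a N \<noteq> 0" "(\<Sum>i\<le>N. a i * Cx x 0 ^ i) = 0"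
    using assms by (auto simp: alg_over_def)
  have "(\<Sum>i\<le>N. cre (a i) * x ^ i) = 0" "(\<Sum>i\<le>N. cim (a i) * x ^ i) = 0"
    using arg_cong[OF a(3), of cre] arg_cong[OF a(3), of cim] by (simp_all add: Cx_real_power)
  moreover have "cre (a N) \<noteq> 0 \<or> cim (a N) \<noteq> 0" using a(2) by (simp add: cplx_eq_iff)
  moreover have "\<forall>i. cre (a i) \<in> R" "\<forall>i. cim (a i) \<in> R" using a(1) by (simp_all add: cplx_set_def)
  ultimately show ?thesis unfolding alg_over_def
    by (elim disjE) (rule exI[of _ N], rule exI[of _ "\<lambda>i. cre (a i)"], simp, rule exI[of _ N], rule exI[of _ "\<lambda>i. cim (a i)"], simp)
qed

text \<open>The sum of \<open>x\<close> and its conjugate is twice the real part, the difference is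
  \<open>Cx 0 2\<close> times the imaginary part; conjugation preserves algebraicity, and the
  factors are cancelled since 2 is not 0.\<close>

lemma alg_over_cplx_parts:
  assumes R: "is_domain R" and sq: "\<And>a b. a \<in> R \<Longrightarrow> b \<in> R \<Longrightarrow> a * a + b * b = 0 \<Longrightarrow> a = 0 \<and> b = 0"
    and two: "(2::'a::comm_ring_1) \<noteq> 0" and x: "alg_over (cplx_set R) (x :: 'a cplx)"
  shows "alg_over R (cre x)" "alg_over R (cim x)"
proof -
  have sr: "is_subring R" using R by (simp add: is_domain_def)
  note D = cplx_set_domain[OF R sq]
  have 2: "2 \<in> R" using is_subring_of_nat[OF sr, of 2] by simp
  have "x + cconj x = Cx 2 0 * Cx (cre x) 0" "x + - cconj x = Cx 0 2 * Cx (cim x) 0"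
    by (simp_all add: cplx_eq_iff cconj_def)
  moreover have "alg_over (cplx_set R) (x + cconj x)" "alg_over (cplx_set R) (x + - cconj x)"
    using alg_over_add[OF D x alg_over_cconj(1)[OF sr x]] alg_over_add[OF D x alg_over_cconj(2)[OF sr x]] by blast+
  ultimately have 1: "alg_over (cplx_set R) (Cx 2 0 * Cx (cre x) 0)" "alg_over (cplx_set R) (Cx 0 2 * Cx (cim x) 0)"
    by simp_all
  have C: "Cx 2 0 \<in> cplx_set R" "Cx 0 2 \<in> cplx_set R" using 2 is_subring_0[OF sr] by (simp_all add: cplx_set_def)
  have "Cx 2 0 \<noteq> (0 :: 'a cplx)" "Cx 0 2 \<noteq> (0 :: 'a cplx)" using two by (simp_all add: cplx_eq_iff)
  then have "alg_over (cplx_set R) (Cx (cre x) 0)" "alg_over (cplx_set R) (Cx (cim x) 0)"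
    using alg_over_scale[OF D C(1) _ 1(1)] alg_over_scale[OF D C(2) _ 1(2)] by blast+
  then show "alg_over R (cre x)" "alg_over R (cim x)" using alg_over_real[OF sr] by blast+
qed

section \<open>Real and imaginary parts of algebraic power series\<close>

text \<open>The lowest terms of the factors cannot cancel in the product. Lowest means of least
  degree and, among these, least in the linear order of multi-indices, which is compatible with
  addition; the bound on the variables leaves finitely many multi-indices of that degree, so a
  minimum exists.\<close>

lemma mps_no_zero_divisors:
  assumes f: "f \<noteq> 0" "vars_below n f" and g: "g \<noteq> 0" "vars_below n g"
  shows "f * g \<noteq> 0"
proof -
  have low: "\<exists>\<alpha>. mcoeff f \<alpha> \<noteq> 0 \<and> (\<forall>\<beta>. mcoeff f \<beta> \<noteq> 0 \<longrightarrow> mdeg \<alpha> \<le> mdeg \<beta>) \<and>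
      (\<forall>\<beta>. mcoeff f \<beta> \<noteq> 0 \<longrightarrow> mdeg \<beta> = mdeg \<alpha> \<longrightarrow> \<alpha> \<le> \<beta>)" if f: "f \<noteq> 0" "vars_below n f" for f
  proof -
    have "\<exists>\<alpha>. mcoeff f \<alpha> \<noteq> 0"
    proof (rule ccontr)
      assume "\<nexists>\<alpha>. mcoeff f \<alpha> \<noteq> 0"
      then have "f = 0" by (intro mps_eqI) simp
      then show False using f by simp
    qed
    then obtain \<alpha>0 where a0: "mcoeff f \<alpha>0 \<noteq> 0" "\<And>\<beta>. mcoeff f \<beta> \<noteq> 0 \<Longrightarrow> mdeg \<alpha>0 \<le> mdeg \<beta>"
      using ex_has_least_nat[of "\<lambda>\<alpha>. mcoeff f \<alpha> \<noteq> 0" _ mdeg] by blast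
    define A where "A = {\<alpha>. mcoeff f \<alpha> \<noteq> 0 \<and> mdeg \<alpha> = mdeg \<alpha>0}"
    have fin: "finite A"
      by (rule finite_subset[OF _ finite_mdeg_le[of n "mdeg \<alpha>0"]]) (use f in \<open>auto simp: A_def vars_below_def\<close>)
    have "\<alpha>0 \<in> A" using a0 by (simp add: A_def)
    then have "Min A \<in> A" "\<And>\<beta>. \<beta> \<in> A \<Longrightarrow> Min A \<le> \<beta>" using fin by (auto intro: Min_in)
    then show ?thesis using a0(2) by (intro exI[of _ "Min A"]) (auto simp: A_def)
  qed
  obtain \<alpha> where \<alpha>: "mcoeff f \<alpha> \<noteq> 0" "\<And>\<beta>. mcoeff f \<beta> \<noteq> 0 \<Longrightarrow> mdeg \<alpha> \<le> mdeg \<beta>"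
    "\<And>\<beta>. mcoeff f \<beta> \<noteq> 0 \<Longrightarrow> mdeg \<beta> = mdeg \<alpha> \<Longrightarrow> \<alpha> \<le> \<beta>" using low[OF f] by blast
  obtain \<beta> where \<beta>: "mcoeff g \<beta> \<noteq> 0" "\<And>\<gamma>. mcoeff g \<gamma> \<noteq> 0 \<Longrightarrow> mdeg \<beta> \<le> mdeg \<gamma>"
    "\<And>\<gamma>. mcoeff g \<gamma> \<noteq> 0 \<Longrightarrow> mdeg \<gamma> = mdeg \<beta> \<Longrightarrow> \<beta> \<le> \<gamma>" using low[OF g] by blast
  have "(\<Sum>p\<in>splits (\<alpha> + \<beta>). mcoeff f (fst p) * mcoeff g (snd p)) =
      (\<Sum>p\<in>splits (\<alpha> + \<beta>). if p = (\<alpha>, \<beta>) then mcoeff f \<alpha> * mcoeff g \<beta> else 0)"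
  proof (rule sum.cong, rule refl)
    fix p assume "p \<in> splits (\<alpha> + \<beta>)"
    then obtain \<alpha>' \<beta>' where p: "p = (\<alpha>', \<beta>')" "\<alpha>' + \<beta>' = \<alpha> + \<beta>" by (auto simp: splits_def)
    have "\<alpha>' = \<alpha> \<and> \<beta>' = \<beta>" if nz: "mcoeff f \<alpha>' \<noteq> 0" "mcoeff g \<beta>' \<noteq> 0"
    proof -
      have "mdeg \<alpha>' + mdeg \<beta>' = mdeg \<alpha> + mdeg \<beta>" using p(2) by (metis mdeg_add)
      then have "mdeg \<alpha>' = mdeg \<alpha>" "mdeg \<beta>' = mdeg \<beta>" using \<alpha>(2)[OF nz(1)] \<beta>(2)[OF nz(2)] by auto
      then have le: "\<alpha> \<le> \<alpha>'" "\<beta> \<le> \<beta>'" using \<alpha>(3)[OF nz(1)] \<beta>(3)[OF nz(2)] by auto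
      have "\<alpha>' = \<alpha>"
      proof (rule ccontr)
        assume "\<alpha>' \<noteq> \<alpha>"
        then have "\<alpha> < \<alpha>'" using le by simp
        then have "\<alpha> + \<beta> < \<alpha>' + \<beta>" by (rule add_strict_right_mono)
        also have "\<dots> \<le> \<alpha>' + \<beta>'" using le(2) by (rule add_left_mono)
        finally show False using p(2) by simp
      qed
      then show ?thesis using p(2) by simp
    qed
    then show "mcoeff f (fst p) * mcoeff g (snd p) = (if p = (\<alpha>, \<beta>) then mcoeff f \<alpha> * mcoeff g \<beta> else 0)"
      using p(1) by auto
  qed
  also have "\<dots> = mcoeff f \<alpha> * mcoeff g \<beta>" by (simp add: sum.delta) (simp add: splits_def)
  finally have "mcoeff (f * g) (\<alpha> + \<beta>) \<noteq> 0" using \<alpha>(1) \<beta>(1) by (simp add: mcoeff_mult case_prod_unfold)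
  then show ?thesis by auto
qed

lemma Rats_subring: "is_subring (\<rat> :: real set)"
  by (auto simp: is_subring_def)

lemma polynomials_subring:
  assumes k: "is_subring k"
  shows "is_subring (polynomials k n)"
  unfolding is_subring_def
proof (intro conjI ballI)
  show "1 \<in> polynomials k n"
    unfolding one_eq_const by (rule const_in_polynomials) (use k in \<open>auto intro: is_subring_0 is_subring_1\<close>)
  fix f g assume f: "f \<in> polynomials k n" and g: "g \<in> polynomials k n"
  have ff: "finite {\<alpha>. mcoeff f \<alpha> \<noteq> 0}" "finite {\<alpha>. mcoeff g \<alpha> \<noteq> 0}" and
    co: "\<And>\<alpha>. mcoeff f \<alpha> \<in> k" "\<And>\<alpha>. mcoeff g \<alpha> \<in> k" using f g by (auto simp: polynomials_def)
  have "{\<alpha>. mcoeff (f - g) \<alpha> \<noteq> 0} \<subseteq> {\<alpha>. mcoeff f \<alpha> \<noteq> 0} \<union> {\<alpha>. mcoeff g \<alpha> \<noteq> 0}" by auto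
  then have "finite {\<alpha>. mcoeff (f - g) \<alpha> \<noteq> 0}" using ff by (meson finite_UnI finite_subset)
  then show "f - g \<in> polynomials k n" using f g co k
    by (auto simp: polynomials_def intro: vars_below_diff is_subring_diff)
  have "{\<alpha>. mcoeff (f * g) \<alpha> \<noteq> 0} \<subseteq> (\<lambda>(\<alpha>, \<beta>). \<alpha> + \<beta>) ` ({\<alpha>. mcoeff f \<alpha> \<noteq> 0} \<times> {\<alpha>. mcoeff g \<alpha> \<noteq> 0})"
  proof
    fix \<gamma> assume "\<gamma> \<in> {\<alpha>. mcoeff (f * g) \<alpha> \<noteq> 0}"
    then obtain p where "p \<in> splits \<gamma>" "(\<lambda>(\<alpha>, \<beta>). mcoeff f \<alpha> * mcoeff g \<beta>) p \<noteq> 0" unfolding mcoeff_mult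
      using sum.not_neutral_contains_not_neutral by blast
    then show "\<gamma> \<in> (\<lambda>(\<alpha>, \<beta>). \<alpha> + \<beta>) ` ({\<alpha>. mcoeff f \<alpha> \<noteq> 0} \<times> {\<alpha>. mcoeff g \<alpha> \<noteq> 0})"
      by (force simp: splits_def)
  qed
  then have "finite {\<alpha>. mcoeff (f * g) \<alpha> \<noteq> 0}" by (rule finite_subset) (use ff in simp)
  moreover have "mcoeff (f * g) \<gamma> \<in> k" for \<gamma>
    unfolding mcoeff_mult case_prod_unfold using co k by (intro is_subring_sum is_subring_mult)
  ultimately show "f * g \<in> polynomials k n" using f g by (auto simp: polynomials_def intro: vars_below_mult)
qed

lemma const_conv: "mps_const a \<in> conv_series n"
  by (auto simp: conv_series_iff intro: exI[of _ 1])

lemma var_conv: "i < n \<Longrightarrow> mps_var i \<in> conv_series n"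
  by (auto simp: conv_series_iff vars_below_var intro: exI[of _ 1])

lemma polynomials_conv: "polynomials k n \<subseteq> conv_series n"
  by (rule polynomials_subset[OF conv_series_subring const_conv var_conv])

lemma reim_eqI:
  assumes "f \<in> conv_series n" "g \<in> conv_series (2 * n)" "h \<in> conv_series (2 * n)"
    "eventually (\<lambda>w. mps_eval f (cpoint w) = Complex (mps_eval g w) (mps_eval h w)) (near_zero (2 * n))"
  shows "mps_Re n f = g" "mps_Im n f = h"
proof -
  note R = mps_reim_conv[OF assms(1)]
  show "mps_Re n f = g"
    by (rule conv_series_eqI[OF R(1) assms(2)], rule eventually_elim2[OF R(3) assms(4)]) simp
  show "mps_Im n f = h"
    by (rule conv_series_eqI[OF R(2) assms(3)], rule eventually_elim2[OF R(4) assms(4)]) simp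
qed

lemma reim_const: "mps_Re n (mps_const a) = mps_const a" "mps_Im n (mps_const a) = 0"
proof -
  have "0 \<in> conv_series (2 * n)" by (rule is_subring_0[OF conv_series_subring])
  from reim_eqI[OF const_conv[of a] const_conv[of a] this]
  show "mps_Re n (mps_const a) = mps_const a" "mps_Im n (mps_const a) = 0"
    by (auto simp: complex_eq_iff)
qed

lemma reim_var:
  assumes "i < n"
  shows "mps_Re n (mps_var i) = mps_var (2 * i)" "mps_Im n (mps_var i) = mps_var (2 * i + 1)"
proof -
  have "mps_var i \<in> conv_series n" "mps_var (2 * i) \<in> conv_series (2 * n)" "mps_var (2 * i + 1) \<in> conv_series (2 * n)"
    using assms by (auto intro!: var_conv)
  then show "mps_Re n (mps_var i) = mps_var (2 * i)" "mps_Im n (mps_var i) = mps_var (2 * i + 1)"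
    by (rule reim_eqI; simp add: cpoint_def)+
qed

lemma reim_arith:
  assumes f: "f \<in> conv_series n" and g: "g \<in> conv_series n"
  shows "mps_Re n (f - g) = mps_Re n f - mps_Re n g" "mps_Im n (f - g) = mps_Im n f - mps_Im n g"
    "mps_Re n (f * g) = mps_Re n f * mps_Re n g - mps_Im n f * mps_Im n g"
    "mps_Im n (f * g) = mps_Re n f * mps_Im n g + mps_Im n f * mps_Re n g"
proof -
  note F = mps_reim_conv[OF f] and G = mps_reim_conv[OF g]
  note sr = conv_series_subring
  have e: "eventually (\<lambda>w. abs_conv_at f (\<lambda>i. norm (cpoint w i)) \<and> abs_conv_at g (\<lambda>i. norm (cpoint w i)) \<and>
      abs_conv_at (mps_Re n f) (\<lambda>i. norm (w i)) \<and> abs_conv_at (mps_Im n f) (\<lambda>i. norm (w i)) \<and>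
      abs_conv_at (mps_Re n g) (\<lambda>i. norm (w i)) \<and> abs_conv_at (mps_Im n g) (\<lambda>i. norm (w i)) \<and>
      mps_eval f (cpoint w) = Complex (mps_eval (mps_Re n f) w) (mps_eval (mps_Im n f) w) \<and>
      mps_eval g (cpoint w) = Complex (mps_eval (mps_Re n g) w) (mps_eval (mps_Im n g) w)) (near_zero (2 * n))"
    using conv_abs_conv_cpoint[OF f] conv_abs_conv_cpoint[OF g] F(3,4) G(3,4)
      F(1)[THEN conv_series_eventually] F(2)[THEN conv_series_eventually]
      G(1)[THEN conv_series_eventually] G(2)[THEN conv_series_eventually]
    by eventually_elim simp
  have "eventually (\<lambda>w. mps_eval (f - g) (cpoint w) = Complex (mps_eval (mps_Re n f - mps_Re n g) w) (mps_eval (mps_Im n f - mps_Im n g) w)) (near_zero (2 * n))"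
    using e by eventually_elim (simp add: mps_eval_diff complex_eq_iff)
  then show "mps_Re n (f - g) = mps_Re n f - mps_Re n g" "mps_Im n (f - g) = mps_Im n f - mps_Im n g"
    by (rule reim_eqI[rotated 3]; intro is_subring_diff sr f g F G)+
  have "eventually (\<lambda>w. mps_eval (f * g) (cpoint w) = Complex (mps_eval (mps_Re n f * mps_Re n g - mps_Im n f * mps_Im n g) w)
      (mps_eval (mps_Re n f * mps_Im n g + mps_Im n f * mps_Re n g) w)) (near_zero (2 * n))"
    using e by eventually_elim (simp add: mps_eval_diff mps_eval_add mps_eval_mult abs_conv_mult complex_eq_iff)
  then show "mps_Re n (f * g) = mps_Re n f * mps_Re n g - mps_Im n f * mps_Im n g"
    "mps_Im n (f * g) = mps_Re n f * mps_Im n g + mps_Im n f * mps_Re n g"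
    by (rule reim_eqI[rotated 3]; intro is_subring_diff is_subring_add is_subring_mult sr f g F G)+
qed

lemma reim_polynomials:
  assumes "q \<in> polynomials \<rat> n"
  shows "mps_Re n q \<in> polynomials \<rat> (2 * n)" "mps_Im n q \<in> polynomials \<rat> (2 * n)"
proof -
  let ?P = "polynomials \<rat> (2 * n)"
  have sP: "is_subring ?P" by (rule polynomials_subring[OF Rats_subring])
  let ?T = "{q \<in> conv_series n. mps_Re n q \<in> ?P \<and> mps_Im n q \<in> ?P}"
  have "polynomials \<rat> n \<subseteq> ?T"
  proof (rule polynomials_subset)
    show "is_subring ?T" unfolding is_subring_def
      using is_subring_1[OF sP] is_subring_0[OF sP]
      by (auto simp: reim_arith reim_const one_eq_const const_conv
          intro!: is_subring_diff[OF sP] is_subring_add[OF sP] is_subring_mult[OF sP]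
            is_subring_diff[OF conv_series_subring] is_subring_mult[OF conv_series_subring])
    show "mps_const a \<in> ?T" if "a \<in> \<rat>" for a
      using that is_subring_0[OF sP] by (auto simp: reim_const const_conv intro!: const_in_polynomials)
    show "mps_var i \<in> ?T" if "i < n" for i
      using that by (auto simp: reim_var var_conv intro!: var_in_polynomials)
  qed
  then show "mps_Re n q \<in> ?P" "mps_Im n q \<in> ?P" using assms by auto
qed

text \<open>At points with vanishing imaginary coordinates the complexified series has the values of
  the series itself.\<close>

lemma reim_zero_imp:
  assumes q: "q \<in> conv_series n" and z: "mps_Re n q = 0" "mps_Im n q = 0"
  shows "q = 0"
proof (rule conv_series_eqI[OF q])
  show "0 \<in> conv_series n" by (rule is_subring_0[OF conv_series_subring])
  have vq: "vars_below n q" using q by (simp add: conv_series_iff)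
  have "eventually (\<lambda>w. mps_eval q (cpoint w) = 0) (near_zero (2 * n))"
    using mps_reim_conv(3,4)[OF q] by eventually_elim (simp add: z complex_eq_iff)
  then obtain r where r: "r > 0" "\<And>w. w \<in> space_n (2 * n) \<Longrightarrow> \<forall>i<2 * n. \<bar>w i\<bar> < r \<Longrightarrow> mps_eval q (cpoint w) = 0"
    by (auto simp: eventually_near_zero)
  show "eventually (\<lambda>x. mps_eval q x = mps_eval 0 x) (near_zero n)"
    using eventually_near_zero_bound[OF r(1)]
  proof eventually_elim
    case (elim x)
    \<comment> \<open>The real point \<open>x\<close> seen in the coordinates of the
      complexification, with all imaginary coordinates 0.\<close>
    define w where "w = (\<lambda>i. if even i then x (i div 2) else 0)"
    have "mps_eval q (cpoint w) = 0" by (rule r(2)) (use elim r(1) in \<open>auto simp: w_def space_n_def\<close>)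
    moreover have "cpoint w = (\<lambda>i. of_real (x i))" by (auto simp: cpoint_def w_def complex_eq_iff)
    ultimately show ?case by (simp add: mps_eval_of_real)
  qed
qed

lemma sum_squares_zero:
  assumes "a \<in> conv_series n" "b \<in> conv_series n" "a * a + b * b = 0"
  shows "a = 0 \<and> b = 0"
proof -
  have e: "eventually (\<lambda>x. mps_eval a x = 0 \<and> mps_eval b x = 0) (near_zero n)"
    using assms(1,2)[THEN conv_series_eventually]
  proof eventually_elim
    case (elim x)
    then have "mps_eval (a * a + b * b) x = mps_eval a x * mps_eval a x + mps_eval b x * mps_eval b x"
      by (simp add: mps_eval_add mps_eval_mult abs_conv_mult)
    then show ?case using assms(3) by (simp add: sum_squares_eq_zero_iff)
  qed
  have z: "0 \<in> conv_series n" by (rule is_subring_0[OF conv_series_subring])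
  show ?thesis
    by (intro conjI; rule conv_series_eqI[OF assms(1) z] conv_series_eqI[OF assms(2) z]; rule eventually_mono[OF e]; simp)
qed

lemma alg_over_algebraic_series:
  assumes "f \<in> conv_series n" "alg_over (polynomials \<rat> n) f"
  shows "f \<in> algebraic_series n"
proof -
  obtain N a where a: "\<forall>i. a i \<in> polynomials \<rat> n" "a N \<noteq> 0" "(\<Sum>i\<le>N. a i * f ^ i) = 0"
    using assms by (auto simp: alg_over_def)
  define p where "p = (\<Sum>i\<le>N. Polynomial.monom (a i) i)"
  have co: "coeff p i = (if i \<le> N then a i else 0)" for i
    by (simp add: p_def coeff_sum if_distrib cong: if_cong)
  have "p \<noteq> 0" using co[of N] a(2) by auto
  moreover have "coeff p i \<in> polynomials \<rat> n" for i
    unfolding co using a(1) is_subring_0[OF polynomials_subring[OF Rats_subring]] by simp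
  moreover have "poly p f = 0" using a(3) by (simp add: p_def poly_sum poly_monom)
  ultimately show ?thesis using assms(1) by (auto simp: algebraic_series_def)
qed

text \<open>Sending a series to its complexification is an injective ring homomorphism that maps
  rational polynomials to pairs of rational polynomials. It transports the algebraic equation of
  \<open>f\<close>, and injectivity keeps the leading coefficient nonzero.\<close>

lemma algebraic_series_reim:
  assumes f: "f \<in> algebraic_series n"
  shows "mps_Re n f \<in> algebraic_series (2 * n)" "mps_Im n f \<in> algebraic_series (2 * n)"
proof -
  have fc: "f \<in> conv_series n" using f by (simp add: algebraic_series_def)
  obtain p where p: "p \<noteq> 0" "\<forall>i. coeff p i \<in> polynomials \<rat> n" "poly p f = 0"
    using f by (auto simp: algebraic_series_def)
  let ?R = "polynomials \<rat> (2 * n)"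
  define \<kappa> where "\<kappa> = (\<lambda>g. Cx (mps_Re n g) (mps_Im n g))"
  have sc: "is_subring (conv_series n)" by (rule conv_series_subring)
  have k0: "\<kappa> 0 = 0" using reim_const[of n 0] by (simp add: \<kappa>_def cplx_eq_iff zero_eq_const[symmetric])
  have k1: "\<kappa> 1 = 1" using reim_const[of n 1] by (simp add: \<kappa>_def cplx_eq_iff one_eq_const[symmetric])
  have km: "\<kappa> (g * h) = \<kappa> g * \<kappa> h" if "g \<in> conv_series n" "h \<in> conv_series n" for g h
    using reim_arith[OF that] by (simp add: \<kappa>_def cplx_eq_iff)
  have kd: "\<kappa> (g - h) = \<kappa> g - \<kappa> h" if "g \<in> conv_series n" "h \<in> conv_series n" for g h
    using reim_arith[OF that] by (simp add: \<kappa>_def cplx_eq_iff)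
  have ka: "\<kappa> (g + h) = \<kappa> g + \<kappa> h" if "g \<in> conv_series n" "h \<in> conv_series n" for g h
    using kd[of "g + h" h] that is_subring_add[OF sc] by simp
  have kp: "\<kappa> (g ^ i) = \<kappa> g ^ i" if "g \<in> conv_series n" for g i
    using that by (induction i) (auto simp: k1 km is_subring_power[OF sc])
  have ks: "\<kappa> (sum g A) = (\<Sum>i\<in>A. \<kappa> (g i))" if "\<And>i. i \<in> A \<Longrightarrow> g i \<in> conv_series n" for g and A :: "nat set"
    using that by (induction A rule: infinite_finite_induct) (auto simp: k0 ka is_subring_sum[OF sc])
  have pc: "coeff p i \<in> conv_series n" for i using p(2) polynomials_conv by blast
  have "(\<Sum>i\<le>degree p. \<kappa> (coeff p i) * \<kappa> f ^ i) = \<kappa> (\<Sum>i\<le>degree p. coeff p i * f ^ i)"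
    by (subst ks) (auto simp: km kp pc fc is_subring_mult[OF sc] is_subring_power[OF sc])
  also have "\<dots> = 0" using p(3) k0 by (simp add: poly_altdef)
  finally have "(\<Sum>i\<le>degree p. \<kappa> (coeff p i) * \<kappa> f ^ i) = 0" .
  moreover have "\<kappa> (coeff p i) \<in> cplx_set ?R" for i using p(2) reim_polynomials by (simp add: \<kappa>_def cplx_set_def)
  moreover have "\<kappa> (coeff p (degree p)) \<noteq> 0"
    using reim_zero_imp[OF pc, of "degree p"] p(1) by (auto simp: \<kappa>_def cplx_eq_iff)
  ultimately have alg: "alg_over (cplx_set ?R) (\<kappa> f)"
    unfolding alg_over_def by (intro exI[of _ "degree p"] exI[of _ "\<lambda>i. \<kappa> (coeff p i)"]) simp
  have dom: "is_domain ?R" unfolding is_domain_def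
    using polynomials_subring[OF Rats_subring] mps_no_zero_divisors by (auto simp: polynomials_def)
  have sq: "a * a + b * b = 0 \<Longrightarrow> a = 0 \<and> b = 0" if "a \<in> ?R" "b \<in> ?R" for a b
    using sum_squares_zero polynomials_conv that by blast
  have "mcoeff (2::mps) 0 = 2" using mcoeff_add[of 1 1 0] by (simp add: mcoeff_1)
  then have two: "(2::mps) \<noteq> 0" by auto
  have "alg_over ?R (cre (\<kappa> f))" by (rule alg_over_cplx_parts(1)[OF dom _ two alg]) (rule sq)
  moreover have "alg_over ?R (cim (\<kappa> f))" by (rule alg_over_cplx_parts(2)[OF dom _ two alg]) (rule sq)
  moreover have "cre (\<kappa> f) = mps_Re n f" "cim (\<kappa> f) = mps_Im n f" by (simp_all only: \<kappa>_def cplx.sel)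
  ultimately show "mps_Re n f \<in> algebraic_series (2 * n)" "mps_Im n f \<in> algebraic_series (2 * n)"
    using alg_over_algebraic_series mps_reim_conv(1,2)[OF fc] by simp_all
qed

section \<open>Integrated algebraic power series\<close>

lemma polynomials_algebraic: "polynomials \<rat> n \<subseteq> algebraic_series n"
proof
  fix f assume f: "f \<in> polynomials \<rat> n"
  have sr: "is_subring (polynomials \<rat> n)" by (rule polynomials_subring[OF Rats_subring])
  have "coeff [:- f, 1:] i \<in> polynomials \<rat> n" for i
    using f is_subring_uminus[OF sr] is_subring_1[OF sr] is_subring_0[OF sr]
    by (auto simp: coeff_pCons split: nat.split)
  moreover have "poly [:- f, 1:] f = 0" "[:- f, 1:] \<noteq> 0" by simp_all
  moreover have "f \<in> conv_series n" using f polynomials_conv by blast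
  ultimately show "f \<in> algebraic_series n" unfolding algebraic_series_def by blast
qed

text \<open>The intersection defining \<open>IA\<close> runs over a nonempty family, and
  \<open>IA\<close> consists of convergent series.\<close>

lemma ia_closed_conv_series: "ia_closed conv_series"
  unfolding ia_closed_def
proof (intro conjI allI ballI impI)
  show "conv_series n = conv_series (n + 1) \<inter> conv_series n" for n using conv_series_mono[of n "n + 1"] by auto
  show "perm_closed conv_series" unfolding perm_closed_def using mps_permute_conv by blast
  show "algebraic_series n \<subseteq> conv_series n" for n by (auto simp: algebraic_series_def)
  fix n f assume f: "f \<in> conv_series n"
  show "mps_inverse f \<in> conv_series n" if "mcoeff f 0 \<noteq> 0" using mps_inverse_conv(1)[OF f that] .
  show "mps_subst f h \<in> conv_series n" if "\<forall>i<n. h i \<in> polynomials \<rat> n \<and> mcoeff (h i) 0 = 0" for h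
    by (rule subst_conv_real(1)[OF f]) (use that polynomials_conv in blast)
  have v: "vars_below n f" using f by (simp add: conv_series_iff)
  show "mps_translate n f a \<in> conv_series n" if "a \<in> conv_domain n f \<inter> points_over \<rat> n" for a
    using that conv_domain_iff[OF v] mps_translate_conv(1)[OF v] by blast
  show "mps_integral (n - 1) f \<in> conv_series n" if "1 \<le> n" using integral_conv_series[OF f, of "n - 1"] that by simp
qed (auto simp: conv_series_subring)

lemma ia_closedD:
  assumes "ia_closed S"
  shows "S n \<subseteq> conv_series n" "is_subring (S n)" "S n = S (n + 1) \<inter> conv_series n" "perm_closed S"
    "algebraic_series n \<subseteq> S n" "f \<in> S n \<Longrightarrow> mcoeff f 0 \<noteq> 0 \<Longrightarrow> mps_inverse f \<in> S n"
    "f \<in> S n \<Longrightarrow> (\<And>i. i < n \<Longrightarrow> h i \<in> polynomials \<rat> n \<and> mcoeff (h i) 0 = 0) \<Longrightarrow> mps_subst f h \<in> S n"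
    "f \<in> S n \<Longrightarrow> a \<in> conv_domain n f \<inter> points_over \<rat> n \<Longrightarrow> mps_translate n f a \<in> S n"
    "f \<in> S (Suc m) \<Longrightarrow> mps_integral m f \<in> S (Suc m)"
proof -
  have A: "\<forall>n. S n \<subseteq> conv_series n \<and> is_subring (S n)" "\<forall>n. S n = S (n + 1) \<inter> conv_series n" "perm_closed S"
    "\<forall>n. algebraic_series n \<subseteq> S n"
    "\<forall>n. \<forall>f\<in>S n.
        (mcoeff f 0 \<noteq> 0 \<longrightarrow> mps_inverse f \<in> S n) \<and>
        (\<forall>h. (\<forall>i<n. h i \<in> polynomials \<rat> n \<and> mcoeff (h i) 0 = 0) \<longrightarrow> mps_subst f h \<in> S n) \<and>
        (\<forall>a\<in>conv_domain n f \<inter> points_over \<rat> n. mps_translate n f a \<in> S n) \<and>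
        (n \<ge> 1 \<longrightarrow> mps_integral (n - 1) f \<in> S n)"
    using assms unfolding ia_closed_def by - (elim conjE, assumption)+
  show "S n \<subseteq> conv_series n" "is_subring (S n)" "perm_closed S" "algebraic_series n \<subseteq> S n" using A(1,3,4) by blast+
  show "S n = S (n + 1) \<inter> conv_series n" by (rule spec[OF A(2)])
  note B = A(5)[THEN spec, THEN bspec]
  show "f \<in> S n \<Longrightarrow> mcoeff f 0 \<noteq> 0 \<Longrightarrow> mps_inverse f \<in> S n"
    "f \<in> S n \<Longrightarrow> (\<And>i. i < n \<Longrightarrow> h i \<in> polynomials \<rat> n \<and> mcoeff (h i) 0 = 0) \<Longrightarrow> mps_subst f h \<in> S n"
    "f \<in> S n \<Longrightarrow> a \<in> conv_domain n f \<inter> points_over \<rat> n \<Longrightarrow> mps_translate n f a \<in> S n"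
    using B[of f n] by blast+
  show "f \<in> S (Suc m) \<Longrightarrow> mps_integral m f \<in> S (Suc m)" using B[of f "Suc m"] by simp
qed

lemma IA_iff: "f \<in> IA n \<longleftrightarrow> (\<forall>S. ia_closed S \<longrightarrow> f \<in> S n)"
  by (auto simp: IA_def)

lemma IA_subset: "ia_closed S \<Longrightarrow> IA n \<subseteq> S n"
  by (auto simp: IA_iff)

lemma ia_closed_IA: "ia_closed IA"
  unfolding ia_closed_def
proof (intro conjI allI ballI impI)
  show "IA n \<subseteq> conv_series n" for n by (rule IA_subset[OF ia_closed_conv_series])
  show "is_subring (IA n)" for n
    unfolding is_subring_def using is_subring_1[OF ia_closedD(2)] is_subring_diff[OF ia_closedD(2)] is_subring_mult[OF ia_closedD(2)]
    by (auto simp: IA_iff)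
  show "IA n = IA (n + 1) \<inter> conv_series n" for n
  proof (intro set_eqI iffI)
    fix f assume f: "f \<in> IA n"
    have "f \<in> S (n + 1)" if S: "ia_closed S" for S
    proof -
      have "S n = S (n + 1) \<inter> conv_series n" by (rule ia_closedD(3)[OF S])
      moreover have "f \<in> S n" using f S by (simp add: IA_iff)
      ultimately show ?thesis by blast
    qed
    moreover have "f \<in> conv_series n" using f IA_subset[OF ia_closed_conv_series] by blast
    ultimately show "f \<in> IA (n + 1) \<inter> conv_series n" by (simp add: IA_iff)
  next
    fix f assume f: "f \<in> IA (n + 1) \<inter> conv_series n"
    have "f \<in> S n" if S: "ia_closed S" for S
    proof -
      have "S n = S (n + 1) \<inter> conv_series n" by (rule ia_closedD(3)[OF S])
      moreover have "f \<in> S (n + 1)" using f S by (simp add: IA_iff)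
      ultimately show ?thesis using f by blast
    qed
    then show "f \<in> IA n" by (simp add: IA_iff)
  qed
  show "perm_closed IA" unfolding perm_closed_def
  proof (intro allI ballI impI)
    fix n f \<sigma> assume "f \<in> IA n" "\<sigma> permutes {..<n}"
    then show "mps_permute \<sigma> f \<in> IA n"
      using ia_closedD(4) unfolding perm_closed_def by (simp add: IA_iff)
  qed
  show "algebraic_series n \<subseteq> IA n" for n using ia_closedD(5) unfolding IA_def by blast
  fix n f assume "f \<in> IA n"
  then have f: "\<And>S. ia_closed S \<Longrightarrow> f \<in> S n" by (simp add: IA_iff)
  show "mps_inverse f \<in> IA n" if "mcoeff f 0 \<noteq> 0" unfolding IA_iff
    using ia_closedD(6) f that by blast
  show "mps_subst f h \<in> IA n" if "\<forall>i<n. h i \<in> polynomials \<rat> n \<and> mcoeff (h i) 0 = 0" for h unfolding IA_iff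
    using ia_closedD(7) f that by blast
  show "mps_translate n f a \<in> IA n" if "a \<in> conv_domain n f \<inter> points_over \<rat> n" for a unfolding IA_iff
    using ia_closedD(8) f that by blast
  show "mps_integral (n - 1) f \<in> IA n" if "1 \<le> n" unfolding IA_iff
    using ia_closedD(9)[of _ f "n - 1"] f that by simp
qed

lemma ia_closed_rational_sys:
  assumes S: "ia_closed S"
  shows "rational_sys S"
proof
  note D = ia_closedD[OF S]
  show "S n \<subseteq> conv_series n" "is_subring (S n)" "S n = S (n + 1) \<inter> conv_series n" "perm_closed S" for n
    using D by blast+
  show "polynomials \<rat> n \<subseteq> S n" for n using polynomials_algebraic D(5) by blast
  show "f \<in> S n \<Longrightarrow> mcoeff f 0 \<noteq> 0 \<Longrightarrow> mps_inverse f \<in> S n" for f n by (rule D)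
  show "f \<in> S n \<Longrightarrow> a \<in> conv_domain n f \<inter> points_over \<rat> n \<Longrightarrow> mps_translate n f a \<in> S n" for f n a by (rule D)
  show "f \<in> S (Suc n) \<Longrightarrow> mps_integral n f \<in> S (Suc n)" for f n by (rule D)
  fix f n assume f: "f \<in> S (Suc n)"
  \<comment> \<open>Setting the last variable to 0 is a rational polynomial substitution within
    \<open>Suc n\<close> variables; compatibility of the levels then moves the result to level
    \<open>n\<close>.\<close>
  define h where "h = (\<lambda>i. if i < n then mps_var i else 0)"
  have h: "h i \<in> polynomials \<rat> (Suc n) \<and> mcoeff (h i) 0 = 0" for i
    using is_subring_0[OF polynomials_subring[OF Rats_subring]] by (auto simp: h_def intro: var_in_polynomials)
  have fc: "f \<in> conv_series (Suc n)" using f D(1) by blast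
  have vf: "vars_below (Suc n) f" using fc by (simp add: conv_series_iff)
  have hc: "h i \<in> conv_series (Suc n) \<and> mcoeff (h i) 0 = 0" for i using h polynomials_conv by blast
  note C = subst_conv_real[where h = h, OF fc hc]
  have "mps_subst f h = mps_set_zero n f"
  proof (rule conv_series_eqI[OF C(1)])
    show "mps_set_zero n f \<in> conv_series (Suc n)" using set_zero_conv[OF fc] conv_series_mono[of n "Suc n"] by auto
    show "eventually (\<lambda>x. mps_eval (mps_subst f h) x = mps_eval (mps_set_zero n f) x) (near_zero (Suc n))"
      using C(2)
    proof eventually_elim
      case (elim x)
      then have "mps_eval (mps_subst f h) x = mps_eval f (\<lambda>i. if i < Suc n then mps_eval (h i) x else 0)" .
      also have "\<dots> = mps_eval f (x(n := 0))" by (rule mps_eval_cong[OF vf]) (auto simp: h_def less_Suc_eq)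
      finally show ?case by (simp add: mps_eval_set_zero)
    qed
  qed
  then have "mps_set_zero n f \<in> S (Suc n)" using D(7)[where h = h, OF f h] by simp
  then show "mps_set_zero n f \<in> S n" using set_zero_conv[OF fc] D(3)[of n] by simp
qed

lemma cpoint_0 [simp]: "cpoint (\<lambda>_. 0) = (\<lambda>_. 0)"
  by (auto simp: cpoint_def complex_eq_iff)

lemma eventually_cpoint_small:
  assumes "r > 0"
  shows "eventually (\<lambda>w. \<forall>i. cmod (cpoint w i) < r) (near_zero n)"
proof -
  have "r / 2 > 0" using assms by simp
  from eventually_near_zero_bound[OF this] show ?thesis
  proof eventually_elim
    case (elim w)
    show ?case
    proof
      fix i
      have "cmod (cpoint w i) \<le> \<bar>w (2 * i)\<bar> + \<bar>w (2 * i + 1)\<bar>"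
        using cmod_le[of "cpoint w i"] by (simp add: cpoint_def)
      also have "\<dots> < r" using elim by (metis add_strict_mono field_sum_of_halves)
      finally show "cmod (cpoint w i) < r" .
    qed
  qed
qed

lemma zero_derivative_segment:
  fixes D :: "real \<Rightarrow> complex"
  assumes "\<And>t. \<bar>t\<bar> < \<delta> \<Longrightarrow> (D has_vector_derivative 0) (at t)" "\<bar>t\<bar> < \<delta>"
  shows "D t = D 0"
proof -
  obtain c where "\<And>x. x \<in> {-\<delta><..<\<delta>} \<Longrightarrow> D x = c"
  proof (rule has_vector_derivative_zero_constant)
    fix x assume "x \<in> {-\<delta><..<\<delta>}"
    then have "\<bar>x\<bar> < \<delta>" by auto
    then show "(D has_vector_derivative 0) (at x within {-\<delta><..<\<delta>})"
      by (rule has_vector_derivative_at_within[OF assms(1)])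
  qed auto
  moreover have "t \<in> {-\<delta><..<\<delta>}" "0 \<in> {-\<delta><..<\<delta>}" using assms(2) by auto
  ultimately show ?thesis by simp
qed

text \<open>Integrate \<open>f dz\<close> along a horizontal segment followed by a vertical one.\<close>

lemma complex_integral_parts:
  assumes f: "f \<in> conv_series (Suc m)"
  defines "U \<equiv> mps_Re (Suc m) f" and "V \<equiv> mps_Im (Suc m) f"
  defines "a \<equiv> 2 * m" and "b \<equiv> Suc (2 * m)"
  shows "eventually (\<lambda>w. mps_eval (mps_integral m f) (cpoint w) =
     Complex (mps_eval (mps_set_zero b (mps_integral a U)) w - mps_eval (mps_integral b V) w)
       (mps_eval (mps_set_zero b (mps_integral a V)) w + mps_eval (mps_integral b U) w)) (near_zero (2 * Suc m))"
proof -
  note C = mps_reim_conv[OF f, folded U_def V_def]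
  have vf: "vars_below (Suc m) f" using f by (simp add: conv_series_iff)
  have vU: "vars_below (2 * Suc m) U" and vV: "vars_below (2 * Suc m) V" using C(1,2) by (simp_all add: conv_series_iff)
  obtain r where r: "r > 0" "abs_conv_at f (\<lambda>_. r)" using f by (auto simp: conv_series_iff)
  obtain s where s: "s > 0" "abs_conv_at U (\<lambda>_. s)" "abs_conv_at V (\<lambda>_. s)" using conv_series_common[OF C(1,2)] .
  obtain e where e: "e > 0" "\<And>w. w \<in> space_n (2 * Suc m) \<Longrightarrow> \<forall>i<2 * Suc m. \<bar>w i\<bar> < e \<Longrightarrow>
      mps_eval f (cpoint w) = Complex (mps_eval U w) (mps_eval V w)"
  proof -
    have "eventually (\<lambda>w. mps_eval f (cpoint w) = Complex (mps_eval U w) (mps_eval V w)) (near_zero (2 * Suc m))"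
      using C(3,4) by eventually_elim (simp add: complex_eq_iff)
    then show thesis using that by (auto simp: eventually_near_zero)
  qed
  \<comment> \<open>Half of \<open>r\<close>, because a complex coordinate is bounded by the sum of
    the absolute values of its two real coordinates.\<close>
  define \<delta> where "\<delta> = min (r / 2) (min s e)"
  have \<delta>: "\<delta> > 0" "\<delta> \<le> r / 2" "\<delta> \<le> s" "\<delta> \<le> e" using r s e by (auto simp: \<delta>_def)
  have ab: "a < 2 * Suc m" "b < 2 * Suc m" "a \<noteq> b" by (auto simp: a_def b_def)
  have dU: "((\<lambda>t. complex_of_real (mps_eval (mps_integral i W) (w(i := t)))) has_vector_derivative complex_of_real (mps_eval W (w(i := t)))) (at t)"
    if "i < 2 * Suc m" "\<forall>i. \<bar>w i\<bar> < \<delta>" "\<bar>t\<bar> < \<delta>" "vars_below (2 * Suc m) W" "abs_conv_at W (\<lambda>_. s)" for i w t W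
  proof -
    have "((\<lambda>t. mps_eval (mps_integral i W) (w(i := t))) has_field_derivative mps_eval W (w(i := t))) (at t)"
      by (rule mps_eval_integral_deriv[OF that(4,1,5)]) (use that \<delta> s in \<open>auto simp: less_imp_le intro: order_trans[OF less_imp_le]\<close>)
    then show ?thesis
      by (intro has_vector_derivative_of_real) (simp add: has_real_derivative_iff_has_vector_derivative)
  qed
  have dG: "((\<lambda>t. mps_eval (mps_integral m f) (cpoint (w(i := t)))) has_vector_derivative
      u * Complex (mps_eval U (w(i := t))) (mps_eval V (w(i := t)))) (at t)"
    if iu: "(i, u) = (a, 1) \<or> (i, u) = (b, \<i>)" and w: "w \<in> space_n (2 * Suc m)" "\<forall>i. \<bar>w i\<bar> < \<delta>" and t: "\<bar>t\<bar> < \<delta>" for i u w t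
  proof -
    \<comment> \<open>The complex coordinate of index \<open>m\<close> as a function of the one real
      coordinate that moves. Its velocity \<open>u\<close> is 1 for the real coordinate
      \<open>a\<close> and \<open>\<i>\<close> for the imaginary coordinate
      \<open>b\<close>.\<close>
    define p where "p = (\<lambda>t. if i = a then Complex t (w b) else Complex (w a) t)"
    have cp: "cpoint (w(i := t)) = (cpoint w)(m := p t)" for t
      using iu by (auto simp: cpoint_def p_def a_def b_def fun_eq_iff)
    have dp: "(p has_vector_derivative u) (at t)"
    proof (cases "i = a")
      case True
      then have "p = (\<lambda>t. of_real t + \<i> * of_real (w b))" "u = 1" using iu ab by (auto simp: p_def complex_eq_iff fun_eq_iff)
      then show ?thesis by (auto intro!: derivative_eq_intros has_vector_derivative_of_real)
    next
      case False
      then have "p = (\<lambda>t. of_real (w a) + \<i> * of_real t)" "u = \<i>" using iu by (auto simp: p_def complex_eq_iff fun_eq_iff)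
      then show ?thesis by (auto intro!: derivative_eq_intros has_vector_derivative_of_real)
    qed
    have cb: "cmod (cpoint w j) \<le> r" for j
    proof -
      have "cmod (cpoint w j) \<le> \<bar>w (2 * j)\<bar> + \<bar>w (2 * j + 1)\<bar>"
        using cmod_le[of "cpoint w j"] by (simp add: cpoint_def)
      also have "\<dots> \<le> r" using w(2)[rule_format, of "2 * j"] w(2)[rule_format, of "2 * j + 1"] \<delta>(2) by linarith
      finally show ?thesis .
    qed
    have pb: "cmod (p t) < r"
    proof -
      have "cmod (p t) \<le> \<bar>Re (p t)\<bar> + \<bar>Im (p t)\<bar>" by (rule cmod_le)
      also have "\<dots> < \<delta> + \<delta>" using w(2)[rule_format, of a] w(2)[rule_format, of b] t by (auto simp: p_def)
      also have "\<dots> \<le> r" using \<delta>(2) by simp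
      finally show ?thesis .
    qed
    have "((\<lambda>z. mps_eval (mps_integral m f) ((cpoint w)(m := z))) has_field_derivative mps_eval f ((cpoint w)(m := p t))) (at (p t))"
      by (rule mps_eval_integral_deriv[OF vf _ r(2)]) (use r cb pb in \<open>auto simp: less_imp_le\<close>)
    from field_vector_diff_chain_at[OF dp this]
    have "((\<lambda>t. mps_eval (mps_integral m f) (cpoint (w(i := t)))) has_vector_derivative
        u * mps_eval f (cpoint (w(i := t)))) (at t)" by (simp add: o_def cp)
    moreover have "mps_eval f (cpoint (w(i := t))) = Complex (mps_eval U (w(i := t))) (mps_eval V (w(i := t)))"
      by (rule e(2)) (use w t iu \<delta> ab in \<open>auto simp: space_n_def intro: less_le_trans\<close>)
    ultimately show ?thesis by simp
  qed
  show ?thesis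
    using eventually_near_zero_bound[OF \<delta>(1)]
  proof eventually_elim
    case (elim w)
    then have w: "w \<in> space_n (2 * Suc m)" "\<forall>i. \<bar>w i\<bar> < \<delta>" by auto
    \<comment> \<open>The corner of the path, where the horizontal segment ends. Integrals along
      that segment therefore appear with the coordinate \<open>b\<close> set to 0.\<close>
    define w0 where "w0 = w(b := 0)"
    have w0: "w0 \<in> space_n (2 * Suc m)" "\<forall>i. \<bar>w0 i\<bar> < \<delta>" using w \<delta>(1) by (auto simp: w0_def space_n_def)
    let ?G = "\<lambda>w. mps_eval (mps_integral m f) (cpoint w)"
    \<comment> \<open>Both sides of the claimed identity have the same derivative along the
      horizontal segment and vanish at its start.\<close>
    define D1 where "D1 = (\<lambda>t. ?G (w0(a := t)) - (of_real (mps_eval (mps_integral a U) (w0(a := t))) +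
        \<i> * of_real (mps_eval (mps_integral a V) (w0(a := t)))))"
    have "D1 (w a) = D1 0"
    proof (rule zero_derivative_segment)
      fix t assume t: "\<bar>t\<bar> < \<delta>"
      have "(D1 has_vector_derivative (1 * Complex (mps_eval U (w0(a := t))) (mps_eval V (w0(a := t))) -
          (of_real (mps_eval U (w0(a := t))) + \<i> * of_real (mps_eval V (w0(a := t)))))) (at t)"
        unfolding D1_def
        by (intro has_vector_derivative_diff has_vector_derivative_add has_vector_derivative_mult_right dG dU w0 t vU vV s ab disjI1 refl)
      then show "(D1 has_vector_derivative 0) (at t)" by (simp add: Complex_eq)
    qed (use w in simp)
    moreover have "w0(a := w a) = w0" using ab by (auto simp: w0_def)
    moreover have "?G (w0(a := 0)) = 0"
    proof -
      have "cpoint (w0(a := 0)) = (cpoint w0)(m := 0)" by (auto simp: cpoint_def w0_def a_def b_def fun_eq_iff complex_eq_iff)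
      then show ?thesis by simp
    qed
    ultimately have 1: "?G w0 = Complex (mps_eval (mps_integral a U) w0) (mps_eval (mps_integral a V) w0)"
      by (simp add: D1_def complex_eq_iff)
    \<comment> \<open>The same along the vertical segment, where \<open>dz\<close> contributes the
      factor \<open>\<i>\<close>; this time the start is the end of the horizontal segment.\<close>
    define D2 where "D2 = (\<lambda>t. ?G (w(b := t)) - (\<i> * of_real (mps_eval (mps_integral b U) (w(b := t))) -
        of_real (mps_eval (mps_integral b V) (w(b := t)))))"
    have "D2 (w b) = D2 0"
    proof (rule zero_derivative_segment)
      fix t assume t: "\<bar>t\<bar> < \<delta>"
      have "(D2 has_vector_derivative (\<i> * Complex (mps_eval U (w(b := t))) (mps_eval V (w(b := t))) -
          (\<i> * of_real (mps_eval U (w(b := t))) - of_real (mps_eval V (w(b := t)))))) (at t)"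
        unfolding D2_def
        by (intro has_vector_derivative_diff has_vector_derivative_add has_vector_derivative_mult_right dG dU w t vU vV s ab disjI2 refl)
      moreover have "\<i> * Complex x y - (\<i> * of_real x - of_real y) = 0" for x y by (simp add: complex_eq_iff)
      ultimately show "(D2 has_vector_derivative 0) (at t)" by simp
    qed (use w in simp)
    then have "?G w = ?G w0 + (\<i> * of_real (mps_eval (mps_integral b U) w) - of_real (mps_eval (mps_integral b V) w))"
      by (simp add: D2_def w0_def algebra_simps)
    then show ?case unfolding 1 by (simp add: mps_eval_set_zero w0_def complex_eq_iff)
  qed
qed

lemma (in rational_sys) cgerm_reim_iff:
  assumes f: "f \<in> conv_series n"
  shows "cgerm S (2 * n) (\<lambda>w. mps_eval f (cpoint w)) \<longleftrightarrow> mps_Re n f \<in> S (2 * n) \<and> mps_Im n f \<in> S (2 * n)"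
proof -
  note C = mps_reim_conv[OF f]
  have e: "eventually (\<lambda>w. Re (mps_eval f (cpoint w)) = mps_eval (mps_Re n f) w) (near_zero (2 * n))"
    "eventually (\<lambda>w. Im (mps_eval f (cpoint w)) = mps_eval (mps_Im n f) w) (near_zero (2 * n))"
    using C(3,4) by (auto elim: eventually_mono)
  show ?thesis
    using mem_if_germ[OF C(1) _ e(1)] mem_if_germ[OF C(2) _ e(2)] e unfolding cgerm_def germ_def by blast
qed

text \<open>Meant for the complexification of a substitution: the parts of \<open>f(h)\<close> arise
  from the parts of \<open>f\<close> by substituting the real and imaginary parts of the
  \<open>h i\<close>, which are again rational polynomials without constant term.\<close>

lemma ia_closed_germ_subst:
  assumes S: "ia_closed S" and F: "germ S n F" and h: "\<And>i. i < n \<Longrightarrow> h i \<in> polynomials \<rat> n \<and> mcoeff (h i) 0 = 0"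
  shows "germ S n (\<lambda>x. F (\<lambda>i. if i < n then mps_eval (h i) x else 0))"
proof -
  obtain f where f: "f \<in> S n" "eventually (\<lambda>x. F x = mps_eval f x) (near_zero n)" using F by (auto simp: germ_def)
  have fc: "f \<in> conv_series n" using f ia_closedD(1)[OF S] by blast
  have hc: "h i \<in> conv_series n \<and> mcoeff (h i) 0 = 0" if "i < n" for i using h[OF that] polynomials_conv by blast
  obtain r where r: "r > 0" "\<And>x. x \<in> space_n n \<Longrightarrow> \<forall>i<n. \<bar>x i\<bar> < r \<Longrightarrow> F x = mps_eval f x"
    using f(2) by (auto simp: eventually_near_zero)
  have "eventually (\<lambda>x. \<forall>i\<in>{..<n}. \<bar>mps_eval (h i) x\<bar> < r) (near_zero n)"
    by (intro eventually_ball_finite ballI) (use eventually_small hc r(1) in auto)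
  moreover have "eventually (\<lambda>x. mps_eval (mps_subst f h) x = mps_eval f (\<lambda>i. if i < n then mps_eval (h i) x else 0)) (near_zero n)"
    by (rule subst_conv_real(2)[OF fc]) (rule hc)
  ultimately have "eventually (\<lambda>x. F (\<lambda>i. if i < n then mps_eval (h i) x else 0) = mps_eval (mps_subst f h) x) (near_zero n)"
  proof eventually_elim
    case (elim x)
    have "F (\<lambda>i. if i < n then mps_eval (h i) x else 0) = mps_eval f (\<lambda>i. if i < n then mps_eval (h i) x else 0)"
      by (rule r(2)) (use elim in \<open>auto simp: space_n_def\<close>)
    then show ?case using elim by simp
  qed
  then show ?thesis using ia_closedD(7)[where h = h, OF S f(1) h] unfolding germ_def by blast
qed

lemma mps_eval_inverse_cpoint:
  assumes f: "f \<in> conv_series n" "mcoeff f 0 \<noteq> 0"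
  shows "eventually (\<lambda>w. 1 / mps_eval f (cpoint w) = mps_eval (mps_inverse f) (cpoint w)) (near_zero (2 * n))"
proof -
  note I = mps_inverse_conv[OF f]
  show ?thesis
    using conv_abs_conv_cpoint[OF f(1)] conv_abs_conv_cpoint[OF I(1)]
  proof eventually_elim
    case (elim w)
    then have "mps_eval f (cpoint w) * mps_eval (mps_inverse f) (cpoint w) = 1"
      using mps_eval_mult[of f "cpoint w" "mps_inverse f"] I(2) by simp
    then show ?case by (metis mult_zero_left nonzero_mult_div_cancel_left zero_neq_one)
  qed
qed

text \<open>By minimality of \<open>IA\<close> it suffices that the elements of \<open>IA\<close> whose real and imaginary parts lie
  in \<open>IA\<close> form a sequence with the same closure properties.\<close>

lemma ia_closed_reim: "ia_closed (\<lambda>n. {f \<in> IA n. cgerm IA (2 * n) (\<lambda>w. mps_eval f (cpoint w))})"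
proof -
  interpret rational_sys IA by (rule ia_closed_rational_sys[OF ia_closed_IA])
  let ?S = "\<lambda>n. {f \<in> IA n. cgerm IA (2 * n) (\<lambda>w. mps_eval f (cpoint w))}"
  note D = ia_closedD[OF ia_closed_IA]
  have vb: "vars_below n f" if "f \<in> IA n" for n f using conv[OF that] by (simp add: conv_series_iff)
  show ?thesis
    unfolding ia_closed_def
  proof (intro conjI allI)
    fix n
    show "?S n \<subseteq> conv_series n" using sub by blast
    show "is_subring (?S n)"
      unfolding is_subring_def
    proof (intro conjI ballI)
      show "1 \<in> ?S n" using is_subring_1[OF ring] by (simp add: cgerm_const)
      fix f g assume "f \<in> ?S n" "g \<in> ?S n"
      then have f: "f \<in> IA n" "cgerm IA (2 * n) (\<lambda>w. mps_eval f (cpoint w))"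
        and g: "g \<in> IA n" "cgerm IA (2 * n) (\<lambda>w. mps_eval g (cpoint w))" by auto
      note e = conv_abs_conv_cpoint[OF conv[OF f(1)]] conv_abs_conv_cpoint[OF conv[OF g(1)]]
      have "cgerm IA (2 * n) (\<lambda>w. mps_eval (f - g) (cpoint w))"
        by (rule cgerm_cong[OF cgerm_diff[OF f(2) g(2)]], rule eventually_elim2[OF e]) (simp add: mps_eval_diff)
      then show "f - g \<in> ?S n" using is_subring_diff[OF ring f(1) g(1)] by simp
      have "cgerm IA (2 * n) (\<lambda>w. mps_eval (f * g) (cpoint w))"
        by (rule cgerm_cong[OF cgerm_mult[OF f(2) g(2)]], rule eventually_elim2[OF e]) (simp add: mps_eval_mult)
      then show "f * g \<in> ?S n" using is_subring_mult[OF ring f(1) g(1)] by simp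
    qed
    show "algebraic_series n \<subseteq> ?S n"
    proof
      fix f assume f: "f \<in> algebraic_series n"
      then have "mps_Re n f \<in> IA (2 * n)" "mps_Im n f \<in> IA (2 * n)" using algebraic_series_reim[OF f] D(5) by blast+
      moreover have "f \<in> IA n" using f D(5) by blast
      ultimately show "f \<in> ?S n" using cgerm_reim_iff[OF conv] by blast
    qed
    show "?S n = ?S (n + 1) \<inter> conv_series n"
    proof (intro set_eqI iffI)
      fix f assume f: "f \<in> ?S n"
      have "cgerm IA (2 * (n + 1)) (\<lambda>w. mps_eval f (cpoint (\<lambda>i. if i \<in> {..<2 * n} then w (id i) else 0)))"
        by (rule cgerm_reindex) (use f in auto)
      moreover have "mps_eval f (cpoint (\<lambda>i. if i \<in> {..<2 * n} then w (id i) else 0)) = mps_eval f (cpoint w)" for w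
        by (rule mps_eval_cong[OF vb[of f n]]) (use f in \<open>auto simp: cpoint_def\<close>)
      moreover have "f \<in> IA (n + 1)" using mono[of n "n + 1"] f by auto
      ultimately show "f \<in> ?S (n + 1) \<inter> conv_series n" using f conv by simp
    next
      fix f assume f: "f \<in> ?S (n + 1) \<inter> conv_series n"
      have "cgerm IA (2 * n) (\<lambda>w. mps_eval f (cpoint (\<lambda>i. if i \<in> {..<2 * n} then w (id i) else 0)))"
        by (rule cgerm_reindex[where n = "2 * (n + 1)"]) (use f in auto)
      moreover have "mps_eval f (cpoint (\<lambda>i. if i \<in> {..<2 * n} then w (id i) else 0)) = mps_eval f (cpoint w)" for w
        by (rule mps_eval_cong[of n]) (use f in \<open>auto simp: cpoint_def conv_series_iff\<close>)
      moreover have "f \<in> IA n" using restr_le[of n "n + 1" f] f by simp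
      ultimately show "f \<in> ?S n" by simp
    qed
  next
    show "perm_closed ?S"
      unfolding perm_closed_def
    proof (intro allI ballI impI)
      fix n f \<sigma> assume f: "f \<in> ?S n" and \<sigma>: "\<sigma> permutes {..<n}"
      \<comment> \<open>\<open>\<sigma>\<close> acting on pairs of coordinates: real and imaginary
        coordinate of a variable move together.\<close>
      define s where "s = (\<lambda>i. 2 * \<sigma> (i div 2) + i mod 2)"
      have inj: "inj_on s {..<2 * n}"
      proof (rule inj_onI)
        fix i j assume e: "s i = s j"
        then have m: "i mod 2 = j mod 2" unfolding s_def by presburger
        then have "\<sigma> (i div 2) = \<sigma> (j div 2)" using e by (simp add: s_def)
        then have "i div 2 = j div 2" using permutes_inj[OF \<sigma>] by (simp add: inj_eq)
        then show "i = j" using m by (metis div_mult_mod_eq)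
      qed
      have "s i < 2 * n" if "i < 2 * n" for i
      proof -
        have "\<sigma> (i div 2) < n" using permutes_in_image[OF \<sigma>, of "i div 2"] that by simp
        then show ?thesis unfolding s_def by presburger
      qed
      then have "cgerm IA (2 * n) (\<lambda>w. mps_eval f (cpoint (\<lambda>i. if i \<in> {..<2 * n} then w (s i) else 0)))"
        by (intro cgerm_reindex inj) (use f in auto)
      moreover have "mps_eval f (cpoint (\<lambda>i. if i \<in> {..<2 * n} then w (s i) else 0)) = mps_eval (mps_permute \<sigma> f) (cpoint w)" for w
        unfolding mps_permute_simps(2)[OF \<sigma>]
        by (rule mps_eval_cong[OF vb[of f n]]) (use f in \<open>auto simp: cpoint_def s_def\<close>)
      ultimately show "mps_permute \<sigma> f \<in> ?S n" using permute_mem[OF _ \<sigma>] f by simp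
    qed
  next
    fix n
    show "\<forall>f\<in>?S n.
        (mcoeff f 0 \<noteq> 0 \<longrightarrow> mps_inverse f \<in> ?S n) \<and>
        (\<forall>h. (\<forall>i<n. h i \<in> polynomials \<rat> n \<and> mcoeff (h i) 0 = 0) \<longrightarrow> mps_subst f h \<in> ?S n) \<and>
        (\<forall>a\<in>conv_domain n f \<inter> points_over \<rat> n. mps_translate n f a \<in> ?S n) \<and>
        (n \<ge> 1 \<longrightarrow> mps_integral (n - 1) f \<in> ?S n)"
    proof (intro ballI conjI allI impI)
      fix f assume "f \<in> ?S n"
      then have f: "f \<in> IA n" "cgerm IA (2 * n) (\<lambda>w. mps_eval f (cpoint w))" by auto
      note fc = conv[OF f(1)]
      {
        assume nz: "mcoeff f 0 \<noteq> 0"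
        have "cgerm IA (2 * n) (\<lambda>w. 1 / mps_eval f (cpoint w))"
          by (rule cgerm_inverse[OF f(2)]) (use nz in \<open>simp add: mps_eval_at_0\<close>)
        from cgerm_cong[OF this mps_eval_inverse_cpoint[OF fc nz]]
        show "mps_inverse f \<in> ?S n" using inv[OF f(1) nz] by simp
      }
      {
        fix h :: "nat \<Rightarrow> mps" assume h: "\<forall>i<n. h i \<in> polynomials \<rat> n \<and> mcoeff (h i) 0 = 0"
        have hc: "h i \<in> conv_series n \<and> mcoeff (h i) 0 = 0" if "i < n" for i using h that polynomials_conv by blast
        obtain r where r: "r > 0"
          "\<And>z :: nat \<Rightarrow> complex. \<forall>i<n. cmod (z i) \<le> r \<Longrightarrow> mps_eval (mps_subst f h) z = mps_eval f (\<lambda>i. mps_eval (h i) z)"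
          by (rule mps_subst_conv[where h = h, OF fc hc]) blast+
        \<comment> \<open>Even indices carry the real parts and odd indices the imaginary parts, in
          accordance with the coordinates of \<open>cpoint\<close>.\<close>
        define h' where "h' = (\<lambda>i. if even i then mps_Re n (h (i div 2)) else mps_Im n (h (i div 2)))"
        have h': "h' i \<in> polynomials \<rat> (2 * n) \<and> mcoeff (h' i) 0 = 0" if i: "i < 2 * n" for i
        proof -
          have i2: "i div 2 < n" using i by simp
          note C = mps_reim_conv(3,4)[OF conjunct1[OF hc[OF i2]]]
          have "h (i div 2) \<in> polynomials \<rat> n" "mcoeff (h (i div 2)) 0 = 0" using h i2 by auto
          then show ?thesis using eventually_near_zero_zero[OF C(1)] eventually_near_zero_zero[OF C(2)]
            by (simp add: h'_def reim_polynomials mps_eval_at_0)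
        qed
        have "cgerm IA (2 * n) (\<lambda>w. mps_eval f (cpoint (\<lambda>i. if i < 2 * n then mps_eval (h' i) w else 0)))"
          unfolding cgerm_def
          using ia_closed_germ_subst[OF ia_closed_IA, where F = "\<lambda>w. Re (mps_eval f (cpoint w))" and h = h', OF _ h']
            ia_closed_germ_subst[OF ia_closed_IA, where F = "\<lambda>w. Im (mps_eval f (cpoint w))" and h = h', OF _ h'] f(2)
          by (simp add: cgerm_def)
        moreover have "eventually (\<lambda>w. mps_eval f (cpoint (\<lambda>i. if i < 2 * n then mps_eval (h' i) w else 0)) =
            mps_eval (mps_subst f h) (cpoint w)) (near_zero (2 * n))"
        proof -
          have "eventually (\<lambda>w. \<forall>i\<in>{..<n}. mps_eval (h i) (cpoint w) =
              Complex (mps_eval (mps_Re n (h i)) w) (mps_eval (mps_Im n (h i)) w)) (near_zero (2 * n))"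
          proof (intro eventually_ball_finite ballI)
            fix i assume "i \<in> {..<n}"
            then have "h i \<in> conv_series n" using hc by blast
            from mps_reim_conv(3,4)[OF this]
            show "eventually (\<lambda>w. mps_eval (h i) (cpoint w) = Complex (mps_eval (mps_Re n (h i)) w) (mps_eval (mps_Im n (h i)) w)) (near_zero (2 * n))"
              by eventually_elim (simp add: complex_eq_iff)
          qed simp
          with eventually_cpoint_small[OF r(1)] show ?thesis
          proof eventually_elim
            case (elim w)
            have "mps_eval (mps_subst f h) (cpoint w) = mps_eval f (\<lambda>i. mps_eval (h i) (cpoint w))"
              by (rule r(2)) (use elim in \<open>auto simp: less_imp_le\<close>)
            also have "\<dots> = mps_eval f (cpoint (\<lambda>i. if i < 2 * n then mps_eval (h' i) w else 0))"
              by (rule mps_eval_cong[OF vb[OF f(1)]]) (use elim in \<open>auto simp: cpoint_def h'_def\<close>)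
            finally show ?case by simp
          qed
        qed
        ultimately have "cgerm IA (2 * n) (\<lambda>w. mps_eval (mps_subst f h) (cpoint w))" by (rule cgerm_cong)
        moreover have "mps_subst f h \<in> IA n" by (rule D(7)[OF f(1)]) (use h in blast)
        ultimately show "mps_subst f h \<in> ?S n" by simp
      }
      {
        fix a assume a: "a \<in> conv_domain n f \<inter> points_over \<rat> n"
        then obtain \<rho> where as: "a \<in> space_n n" and \<rho>: "\<forall>i<n. \<bar>a i\<bar> < \<rho> i" "abs_conv_at f \<rho>"
          using conv_domain_iff[OF vb[OF f(1)]] by blast
        have aQ: "a i \<in> \<rat>" if "i < n" for i using a that by (auto simp: points_over_def)
        \<comment> \<open>A real translation shifts only the real coordinates.\<close>
        define a' where "a' = (\<lambda>i. if even i then a (i div 2) else 0)"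
        \<comment> \<open>Each \<open>\<rho> j\<close> is divided between two coordinates: the real
          part gets half of \<open>\<rho> j + \<bar>a j\<bar>\<close>, which exceeds
          \<open>\<bar>a j\<bar>\<close>, and the imaginary part gets half of
          \<open>\<rho> j - \<bar>a j\<bar>\<close>, which is positive. Together they are exactly
          \<open>\<rho> j\<close>.\<close>
        define \<rho>' where "\<rho>' = (\<lambda>i. (\<rho> (i div 2) + (if even i then 1 else -1) * \<bar>a (i div 2)\<bar>) / 2)"
        have \<rho>': "\<forall>i<2 * n. 0 < \<rho>' i"
        proof (intro allI impI)
          fix i assume "i < 2 * n"
          then have "i div 2 < n" by simp
          then have "\<bar>a (i div 2)\<bar> < \<rho> (i div 2)" using \<rho> by blast
          then show "0 < \<rho>' i" by (auto simp: \<rho>'_def)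
        qed
        obtain M where M: "exp_bounded (2 * n) \<rho>' M (\<lambda>z. mps_eval f (\<lambda>j. z (2 * j) + \<i> * z (2 * j + 1)))"
          by (rule cpoint_exp_bounded[OF vb[OF f(1)] \<rho>(2) \<rho>']) (auto simp: \<rho>'_def add_divide_distrib diff_divide_distrib)
        have "cgerm IA (2 * n) (\<lambda>w. mps_eval f (\<lambda>j. of_real (a' (2 * j) + w (2 * j)) + \<i> * of_real (a' (2 * j + 1) + w (2 * j + 1))))"
        proof (rule cgerm_translate[OF M \<rho>'])
          show "cgerm IA (2 * n) (\<lambda>x. mps_eval f (\<lambda>j. of_real (x (2 * j)) + \<i> * of_real (x (2 * j + 1))))"
            using f(2) by (simp add: cpoint_of_real)
          show "a' i \<in> \<rat>" if "i < 2 * n" for i using aQ that by (simp add: a'_def)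
          show "a' i = 0" if "2 * n \<le> i" for i using as that by (auto simp: a'_def space_n_def)
          show "\<bar>a' i\<bar> < \<rho>' i" if "i < 2 * n" for i
          proof -
            have "i div 2 < n" using that by simp
            then have "\<bar>a (i div 2)\<bar> < \<rho> (i div 2)" using \<rho> by blast
            then show ?thesis by (auto simp: a'_def \<rho>'_def)
          qed
        qed
        moreover have "mps_eval f (\<lambda>j. of_real (a' (2 * j) + w (2 * j)) + \<i> * of_real (a' (2 * j + 1) + w (2 * j + 1))) =
            mps_eval f (\<lambda>j. of_real (a j) + cpoint w j)" for w
          by (rule arg_cong[where f = "mps_eval f"]) (auto simp: a'_def cpoint_of_real fun_eq_iff)
        ultimately have g: "cgerm IA (2 * n) (\<lambda>w. mps_eval f (\<lambda>j. of_real (a j) + cpoint w j))" by simp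
        define r where "r = Min (insert 1 ((\<lambda>i. \<rho> i - \<bar>a i\<bar>) ` {..<n}))"
        have r: "r > 0" using \<rho>(1) by (auto simp: r_def)
        have rle: "r \<le> \<rho> i - \<bar>a i\<bar>" if "i < n" for i unfolding r_def using that by (intro Min_le) auto
        have "eventually (\<lambda>w. mps_eval f (\<lambda>j. of_real (a j) + cpoint w j) = mps_eval (mps_translate n f a) (cpoint w)) (near_zero (2 * n))"
          using eventually_cpoint_small[OF r]
        proof eventually_elim
          case (elim w)
          have "\<forall>i<n. cmod (cpoint w i) \<le> \<rho> i - \<bar>a i\<bar>" using elim rle by (meson less_imp_le less_le_trans)
          from mps_translate_conv(3)[OF vb[OF f(1)] as \<rho> this] show ?case by simp
        qed
        from cgerm_cong[OF g this] show "mps_translate n f a \<in> ?S n" using trans[OF f(1) a] by simp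
      }
      {
        assume "n \<ge> 1"
        then obtain m where m: "n = Suc m" by (cases n) auto
        note P = complex_integral_parts[OF fc[unfolded m]]
        have UV: "mps_Re n f \<in> IA (2 * n)" "mps_Im n f \<in> IA (2 * n)" using cgerm_reim_iff[OF fc] f(2) by auto
        have z: "mps_set_zero (Suc (2 * m)) g \<in> IA (2 * n)" if "g \<in> IA (2 * n)" for g
        proof -
          have "mps_set_zero (Suc (2 * m)) g \<in> IA (Suc (2 * m))" using zero[of g "Suc (2 * m)"] that by (simp add: m)
          then show ?thesis using mono[of "Suc (2 * m)" "2 * n"] m by auto
        qed
        have "germ IA (2 * n) (\<lambda>w. mps_eval (mps_set_zero (Suc (2 * m)) (mps_integral (2 * m) (mps_Re n f))) w -
            mps_eval (mps_integral (Suc (2 * m)) (mps_Im n f)) w)"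
          "germ IA (2 * n) (\<lambda>w. mps_eval (mps_set_zero (Suc (2 * m)) (mps_integral (2 * m) (mps_Im n f))) w +
            mps_eval (mps_integral (Suc (2 * m)) (mps_Re n f)) w)"
          by (intro germ_diff germ_add germI z integral_mem UV; simp add: m)+
        then have "cgerm IA (2 * n) (\<lambda>w. Complex (mps_eval (mps_set_zero (Suc (2 * m)) (mps_integral (2 * m) (mps_Re n f))) w -
            mps_eval (mps_integral (Suc (2 * m)) (mps_Im n f)) w) (mps_eval (mps_set_zero (Suc (2 * m)) (mps_integral (2 * m) (mps_Im n f))) w +
            mps_eval (mps_integral (Suc (2 * m)) (mps_Re n f)) w))" by (simp add: cgerm_def)
        then have "cgerm IA (2 * n) (\<lambda>w. mps_eval (mps_integral m f) (cpoint w))"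
          by (rule cgerm_cong) (use P in \<open>auto simp: m elim: eventually_mono\<close>)
        then show "mps_integral (n - 1) f \<in> ?S n" using int[of f m] f(1) m by simp
      }
    qed
  qed
qed

lemma analysis_sys_IA: "analysis_sys IA"
proof -
  interpret rational_sys IA by (rule ia_closed_rational_sys[OF ia_closed_IA])
  show ?thesis
  proof
    fix f n assume f: "f \<in> IA (Suc n)"
    \<comment> \<open>Minimality: \<open>IA\<close> is contained in the sequence of those of its
      elements that have the desired property.\<close>
    then have "cgerm IA (2 * Suc n) (\<lambda>w. mps_eval f (cpoint w))" using IA_subset[OF ia_closed_reim] by blast
    then show "mps_Re (Suc n) f \<in> IA (2 * Suc n) \<and> mps_Im (Suc n) f \<in> IA (2 * Suc n)"
      using cgerm_reim_iff[OF conv[OF f]] by blast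
  qed
qed

lemma (in analysis_sys) convergent_analysis_system: "convergent_analysis_system S"
proof -
  have "is_system S"
    unfolding is_system_def
  proof (intro conjI allI impI)
    show "S n = S (n + 1) \<inter> conv_series n" for n by (rule restr)
    show "S n \<subseteq> series_over (base_field S) n" for n
      using coeff_in_base_field conv by (auto simp: series_over_def)
  qed (rule sub ring perm base_field_subfield polynomials_mem)+
  then have "convergent_system S" unfolding convergent_system_def using translate_mem by blast
  moreover have "\<forall>n\<ge>1. \<forall>f\<in>S n.
        (mcoeff f 0 \<noteq> 0 \<longrightarrow> mps_inverse f \<in> S n) \<and> mps_set_zero (n - 1) f \<in> S (n - 1) \<and>
        mps_deriv (n - 1) f \<in> S n \<and> mps_Re n f \<in> S (2 * n) \<and> mps_Im n f \<in> S (2 * n) \<and> mps_integral (n - 1) f \<in> S n"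
  proof (intro allI impI ballI)
    fix n :: nat and f assume "1 \<le> n" "f \<in> S n"
    then obtain m where "n = Suc m" "f \<in> S (Suc m)" by (cases n) auto
    then show "(mcoeff f 0 \<noteq> 0 \<longrightarrow> mps_inverse f \<in> S n) \<and> mps_set_zero (n - 1) f \<in> S (n - 1) \<and>
        mps_deriv (n - 1) f \<in> S n \<and> mps_Re n f \<in> S (2 * n) \<and> mps_Im n f \<in> S (2 * n) \<and> mps_integral (n - 1) f \<in> S n"
      using inv zero deriv_mem_last reim int by simp
  qed
  ultimately show ?thesis by (simp add: convergent_analysis_system_def)
qed

text \<open>Puts the system among the sequences that \<open>IA\<close> intersects. Polynomial
  substitution, which is no axiom of Analysis systems, is an instance of composition.\<close>

lemma (in analysis_sys) ia_closed:
  assumes "\<And>n. algebraic_series n \<subseteq> S n"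
  shows "ia_closed S"
  unfolding ia_closed_def
proof (intro conjI allI ballI impI)
  show "S n = S (n + 1) \<inter> conv_series n" for n by (rule restr)
  fix n f assume f: "f \<in> S n"
  show "mps_subst f h \<in> S n" if "\<forall>i<n. h i \<in> polynomials \<rat> n \<and> mcoeff (h i) 0 = 0" for h
    by (rule subst_mem[OF f]) (use that rat in blast)
  show "mps_integral (n - 1) f \<in> S n" if "n \<ge> 1" using int[of f "n - 1"] f that by simp
qed (use assms in \<open>auto intro: ring perm inv trans conv\<close>)

text \<open>Rational constants are algebraic, so the base field contains the rationals and
  translation over it includes rational translation. The operations of an Analysis system concern
  positive \<open>n\<close>; inversion for \<open>n = 0\<close> comes from the base field being a
  field.\<close>

lemma convergent_analysis_system_imp_analysis_sys:
  assumes A: "convergent_analysis_system S" and alg: "\<And>n. algebraic_series n \<subseteq> S n"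
  shows "analysis_sys S"
proof -
  have sys: "is_system S" and
    tr: "\<And>n f a. f \<in> S n \<Longrightarrow> a \<in> conv_domain n f \<inter> points_over (base_field S) n \<Longrightarrow> mps_translate n f a \<in> S n" and
    op: "\<And>n f. n \<ge> 1 \<Longrightarrow> f \<in> S n \<Longrightarrow> (mcoeff f 0 \<noteq> 0 \<longrightarrow> mps_inverse f \<in> S n) \<and>
        mps_set_zero (n - 1) f \<in> S (n - 1) \<and> mps_deriv (n - 1) f \<in> S n \<and>
        mps_Re n f \<in> S (2 * n) \<and> mps_Im n f \<in> S (2 * n) \<and> mps_integral (n - 1) f \<in> S n"
    using A unfolding convergent_analysis_system_def convergent_system_def by blast+
  have sub: "S n \<subseteq> conv_series n" and ring: "is_subring (S n)" and restr: "S n = S (n + 1) \<inter> conv_series n"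
    and perm: "perm_closed S" and fld: "is_subfield (base_field S)" for n
    using sys unfolding is_system_def by - (elim conjE, erule allE, blast, elim conjE, erule allE, blast, elim conjE, erule allE, erule allE, assumption, (elim conjE, assumption)+)
  have rat: "polynomials \<rat> n \<subseteq> S n" for n using polynomials_algebraic alg by blast
  have Q: "a \<in> base_field S" if "a \<in> \<rat>" for a
    using const_in_polynomials[OF Rats_0 that, of 0] rat[of 0]
    by (auto simp: base_field_def mps_const_def intro!: image_eqI[where x = "mps_const a"])
  show ?thesis
  proof
    show "S n \<subseteq> conv_series n" "is_subring (S n)" "S n = S (n + 1) \<inter> conv_series n" "perm_closed S" "polynomials \<rat> n \<subseteq> S n" for n
      by (rule sub ring restr perm rat)+
    show "mps_translate n f a \<in> S n" if "f \<in> S n" "a \<in> conv_domain n f \<inter> points_over \<rat> n" for f n a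
      by (rule tr[OF that(1)]) (use that(2) Q in \<open>auto simp: points_over_def\<close>)
    show "mps_set_zero n f \<in> S n" "mps_integral n f \<in> S (Suc n)"
      "mps_Re (Suc n) f \<in> S (2 * Suc n) \<and> mps_Im (Suc n) f \<in> S (2 * Suc n)" if "f \<in> S (Suc n)" for f n
      using op[of "Suc n" f] that by simp_all
    show "mps_inverse f \<in> S n" if f: "f \<in> S n" "mcoeff f 0 \<noteq> 0" for f n
    proof (cases n)
      case 0
      have fc: "f \<in> conv_series n" using f sub by blast
      have c: "\<exists>b. g = mps_const b" if "g \<in> S 0" for g
      proof -
        have "vars_below 0 g" using that sub[of 0] by (auto simp: conv_series_iff)
        then have "g = mps_const (mcoeff g 0)" by (intro mps_eqI) (auto simp: vars_below_def mps_const_def)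
        then show ?thesis by blast
      qed
      have "mcoeff f 0 \<in> base_field S" using f 0 by (auto simp: base_field_def)
      then have "inverse (mcoeff f 0) \<in> base_field S" using fld f(2) by (auto simp: is_subfield_def)
      then obtain g where g: "g \<in> S 0" "mcoeff g 0 = inverse (mcoeff f 0)" by (auto simp: base_field_def)
      obtain b d where bd: "f = mps_const b" "g = mps_const d" using c f(1) g(1) 0 by metis
      have "f * g = 1"
      proof (rule mps_eqI)
        fix \<alpha>
        have "b \<noteq> 0" "d = inverse b" using f(2) g(2) by (simp_all add: bd mps_const_def)
        then show "mcoeff (f * g) \<alpha> = mcoeff 1 \<alpha>" unfolding bd mcoeff_const_mult by (simp add: mps_const_def mcoeff_1)
      qed
      then have "mps_inverse f = g"
        using mps_inverse_conv(2)[OF fc f(2)] by (metis mult.assoc mult.commute mult.right_neutral)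
      then show ?thesis using g 0 by simp
    next
      case (Suc m)
      then show ?thesis using op[of n f] f by simp
    qed
  qed
qed

theorem theorem2p2:
  shows "convergent_analysis_system IA \<and>
    (\<forall>n. algebraic_series n \<subseteq> IA n) \<and>
    (\<forall>S. convergent_analysis_system S \<and> (\<forall>n. algebraic_series n \<subseteq> S n) \<longrightarrow> (\<forall>n. IA n \<subseteq> S n))"
  using analysis_sys.convergent_analysis_system[OF analysis_sys_IA] ia_closedD(5)[OF ia_closed_IA]
    IA_subset[OF analysis_sys.ia_closed[OF convergent_analysis_system_imp_analysis_sys]] by blast

end
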